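(* Let $\ell\ge k\ge r\ge 2$ be integers and $Q$ be an $r$-graph with $\partial_{r-2}Q$ being complete $k$-partite. Suppose that $F$ is an edge-critical graph with $\chi(F)=\ell+1$. Then there exist $\varepsilon>0$ and $N_0>0$ such that for all $n\ge N_0$: (i) every $n$-vertex $H_F^r$-free $r$-graph $\mathcal{H}$ with $\delta_Q(\mathcal{H})\ge(1-\varepsilon)\frac{v(Q)\cdot\mathrm{inj}(n,Q,H_F^r)}{n}$ is $\ell$-partite; (ii) $\mathrm{inj}(n,Q,H_F^r)=\mathrm{inj}(Q,\mathcal{G})$ for some complete $\ell$-partite $r$-graph $\mathcal{G}$ on $n$ vertices.
   Context: An $r$-graph is a set of $r$-subsets of a finite vertex set. For $r$-graphs $Q,\mathcal{H}$, a homomorphism is a map $\phi\colon V(Q)\to V(\mathcal{H})$ with $\phi(e)\in\mathcal{H}$ for all $e\in Q$; $\mathrm{inj}(Q,\mathcal{H})$ is the number of injective homomorphisms. $d_{Q,\mathcal{H}}(v)$ is the number of injective homomorphisms $\phi$ with $v\in\phi(V(Q))$, and $\delta_Q(\mathcal{H})$ its minimum over $v$. $\mathrm{inj}(n,Q,\mathcal{F})=\max\{\mathrm{inj}(Q,\mathcal{H}): v(\mathcal{H})=n,\ \mathcal{H}\text{ contains no member of }\mathcal{F}\text{ as a subgraph}\}$. $\partial_{r-2}Q$ is the graph of all pairs contained in some edge of $Q$ (for $r=2$, $\partial_0Q=Q$). The expansion $H_F^r$ of a graph $F$ is obtained by adding $r-2$ new vertices to each edge, these $(r-2)$-sets pairwise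 disjoint; $H_F^2=F$. $F$ is edge-critical if some edge $e$ has $\chi(F\setminus\{e\})<\chi(F)$. An $r$-graph is $\ell$-partite if its vertex set has a partition into $\ell$ (possibly empty) parts such that every edge meets each part in at most one vertex, and complete $\ell$-partite if it contains all such $r$-sets.
   Formalization: Q is assumed to have at least one edge: with possibly empty parts an edgeless Q has a complete k-partite shadow, and (i) fails (e.g. r=ℓ=2, F=K_3, H=C_5 plus isolated vertices). The finite r-graphs H and G have natural numbers as vertices, which covers every isomorphism class. *)

theory Defs
  imports Complex_Main "HOL-Library.FuncSet" "HOL-Library.Disjoint_Sets"
begin

datatype 'a hypergraph = Hypergraph (verts: "'a set") (edges: "'a set set")

definition r_graph :: "nat \<Rightarrow> 'a hypergraph \<Rightarrow> bool" where
  "r_graph r H \<longleftrightarrow> finite (verts H) \<and> (\<forall>e\<in>edges H. e \<subseteq> verts H \<and> card e = r)"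

text \<open>Maps are extensional (\<^term>\<open>undefined\<close> outside the vertex set), so that the cardinality of
  the following set is the number of injective homomorphisms.\<close>

definition inj_homs :: "'q hypergraph \<Rightarrow> 'a hypergraph \<Rightarrow> ('q \<Rightarrow> 'a) set" where
  "inj_homs Q H =
     {\<phi> \<in> verts Q \<rightarrow>\<^sub>E verts H. inj_on \<phi> (verts Q) \<and> (\<forall>e\<in>edges Q. \<phi> ` e \<in> edges H)}"

definition inj_num :: "'q hypergraph \<Rightarrow> 'a hypergraph \<Rightarrow> nat" where
  "inj_num Q H = card (inj_homs Q H)"

definition Q_degree :: "'q hypergraph \<Rightarrow> 'a hypergraph \<Rightarrow> 'a \<Rightarrow> nat" where
  "Q_degree Q H v = card {\<phi> \<in> inj_homs Q H. v \<in> \<phi> ` verts Q}"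

definition min_Q_degree :: "'q hypergraph \<Rightarrow> 'a hypergraph \<Rightarrow> nat" where
  "min_Q_degree Q H = Min (Q_degree Q H ` verts H)"

text \<open>Containment is up to isomorphism: a (not necessarily induced) copy of \<open>F\<close> in \<open>H\<close> is the image
  of an injective homomorphism.\<close>

definition contains :: "'a hypergraph \<Rightarrow> 'f hypergraph \<Rightarrow> bool" where
  "contains H F \<longleftrightarrow> inj_homs F H \<noteq> {}"

definition free_of :: "'f hypergraph set \<Rightarrow> 'a hypergraph \<Rightarrow> bool" where
  "free_of \<F> H \<longleftrightarrow> (\<forall>F\<in>\<F>. \<not> contains H F)"

text \<open>Host hypergraphs have vertices in \<^typ>\<open>nat\<close>, which represents every isomorphism class of
  finite hypergraphs.\<close>

definition max_inj :: "nat \<Rightarrow> nat \<Rightarrow> 'q hypergraph \<Rightarrow> 'f hypergraph set \<Rightarrow> nat" where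
  "max_inj r n Q \<F> =
     Max {inj_num Q H |H :: nat hypergraph. r_graph r H \<and> card (verts H) = n \<and> free_of \<F> H}"

definition pair_shadow :: "'a hypergraph \<Rightarrow> 'a hypergraph" where
  "pair_shadow Q = Hypergraph (verts Q) {p. card p = 2 \<and> (\<exists>e\<in>edges Q. p \<subseteq> e)}"

definition expansion :: "nat \<Rightarrow> 'f hypergraph \<Rightarrow> ('f + 'f set \<times> nat) hypergraph" where
  "expansion r F = Hypergraph
     (Inl ` verts F \<union> Inr ` (edges F \<times> {..<r - 2}))
     ((\<lambda>e. Inl ` e \<union> Inr ` ({e} \<times> {..<r - 2})) ` edges F)"

definition colorable :: "'f hypergraph \<Rightarrow> nat \<Rightarrow> bool" where
  "colorable F k \<longleftrightarrow>
     (\<exists>c. c \<in> verts F \<rightarrow> {..<k} \<and> (\<forall>u v. {u, v} \<in> edges F \<longrightarrow> c u \<noteq> c v))"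

definition chromatic_number :: "'f hypergraph \<Rightarrow> nat" where
  "chromatic_number F = (LEAST k. colorable F k)"

definition delete_edge :: "'f hypergraph \<Rightarrow> 'f set \<Rightarrow> 'f hypergraph" where
  "delete_edge F e = Hypergraph (verts F) (edges F - {e})"

definition edge_critical :: "'f hypergraph \<Rightarrow> bool" where
  "edge_critical F \<longleftrightarrow>
     (\<exists>e\<in>edges F. chromatic_number (delete_edge F e) < chromatic_number F)"

text \<open>Partitions are indexed by \<open>{..<l}\<close>, so parts may be empty. In particular an edgeless graph is
  complete \<open>l\<close>-partite for every \<open>l \<ge> 1\<close>; where the usual convention of nonempty parts matters,
  edges have to be required separately.\<close>

definition parts_of :: "nat \<Rightarrow> (nat \<Rightarrow> 'a set) \<Rightarrow> 'a set \<Rightarrow> bool" where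
  "parts_of l V X \<longleftrightarrow> disjoint_family_on V {..<l} \<and> (\<Union>i<l. V i) = X"

definition partite :: "nat \<Rightarrow> 'a hypergraph \<Rightarrow> bool" where
  "partite l H \<longleftrightarrow>
     (\<exists>V. parts_of l V (verts H) \<and> (\<forall>e\<in>edges H. \<forall>i<l. card (e \<inter> V i) \<le> 1))"

definition complete_partite :: "nat \<Rightarrow> nat \<Rightarrow> 'a hypergraph \<Rightarrow> bool" where
  "complete_partite r l H \<longleftrightarrow>
     (\<exists>V. parts_of l V (verts H) \<and>
          edges H = {e. e \<subseteq> verts H \<and> card e = r \<and> (\<forall>i<l. card (e \<inter> V i) \<le> 1)})"

end

theory Submission
  imports Defs
begin

text \<open>
The shadow of \<open>Q\<close> is a complete multipartite graph \<open>P\<close>, so injective homomorphisms from \<open>Q\<close> to a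
complete \<open>l\<close>-partite hypergraph are just injective proper maps of \<open>P\<close>. Call a pair of vertices of \<open>H\<close>
thick if it survives in some edge after deleting any few other vertices. Copies of \<open>Q\<close> using a thin
pair are negligible, and an \<open>H\<^sub>F\<close>-free \<open>H\<close> has an \<open>F\<close>-free thick graph, hence (Erdos) one with few copies of
\<open>K\<^sub>l\<^sub>+\<^sub>1\<close>.

Instead of a removal lemma, Zykov symmetrization is applied to the number of copies of \<open>P\<close> minus a large
multiple of the number of copies of \<open>K\<^sub>l\<^sub>+\<^sub>1\<close>. This penalized density never decreases, so along the
whole process the graph has almost optimally many copies of \<open>P\<close> and few of \<open>K\<^sub>l\<^sub>+\<^sub>1\<close>. The final complete
multipartite graph is close to an optimal \<open>l\<close>-partite one; undoing the process one vertex at a time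
preserves closeness because a weak form of closeness improves itself to a strong one.

Finally, a vertex with many thick neighbours in every part, or an edge of \<open>H\<close> with two typical vertices
in one part, yields an expansion of the edge-critical \<open>F\<close>. Large \<open>Q\<close>-degree forces every vertex to be
typical for some part. Part (ii) follows by deleting vertices of low \<open>Q\<close>-degree from an extremal
hypergraph.
\<close>

section \<open>Counting maps into a finite set\<close>

text \<open>The best proportions of the parts are never computed. Only the supremum
  \<open>opt\<close> of the densities enters, through two facts about near-optimal colourings: all
  parts are linear, and no vertex lies in noticeably more than \<open>opt * v * n^(v-1)\<close>
  copies, since cloning it would beat the supremum. A vertex with many thin pairs to the other parts
  then falls short of the required degree.

  Homomorphisms are counted instead of injections as long as possible, because they lift to blow-ups
  and are easy to follow under cloning; injectivity costs only \<open>O(n^(v-1))\<close> maps. The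
  set \<open>homs\<close> covers both quantities of the symmetrization: maps of the multipartite
  pattern, with the parts of the shadow as colours \<open>p\<close>, and ordered cliques, with
  \<open>p = id\<close>. A clique never uses two nonadjacent vertices, so cloning changes the number
  of cliques by an exact amount, and this is why it can enter with a negative sign.\<close>

definition homs :: "'i set \<Rightarrow> ('i \<Rightarrow> 'b) \<Rightarrow> 'a set \<Rightarrow> ('a \<Rightarrow> 'a \<Rightarrow> bool) \<Rightarrow> ('i \<Rightarrow> 'a) set" where
  "homs I p V E = {\<phi> \<in> I \<rightarrow>\<^sub>E V. \<forall>a\<in>I. \<forall>b\<in>I. p a \<noteq> p b \<longrightarrow> E (\<phi> a) (\<phi> b)}"

lemma finite_homs [simp]: "finite I \<Longrightarrow> finite V \<Longrightarrow> finite (homs I p V E)"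
  unfolding homs_def by (rule finite_subset[of _ "I \<rightarrow>\<^sub>E V"]) (auto intro: finite_PiE)

lemma card_PiE_const: "finite I \<Longrightarrow> card (I \<rightarrow>\<^sub>E V) = card V ^ card I"
  by (simp add: card_PiE)

lemma card_homs_le:
  assumes "finite I" "finite V"
  shows "card (homs I p V E) \<le> card V ^ card I"
proof -
  have "card (homs I p V E) \<le> card (I \<rightarrow>\<^sub>E V)"
    by (rule card_mono) (use assms in \<open>auto simp: homs_def intro: finite_PiE\<close>)
  then show ?thesis using assms(1) by (simp only: card_PiE_const)
qed

lemma card_pair_fixed_le:
  assumes "finite I" "finite V" "a \<in> I" "b \<in> I" "a \<noteq> b" "finite R"
  shows "card {\<phi> \<in> I \<rightarrow>\<^sub>E V. (\<phi> a, \<phi> b) \<in> R} \<le> card R * card V ^ (card I - 2)"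
proof -
  let ?J = "I - {a, b}"
  let ?f = "\<lambda>\<phi>. ((\<phi> a, \<phi> b), restrict \<phi> ?J)"
  have cJ: "card ?J = card I - 2" using assms by (simp add: card_Diff_subset)
  have "inj_on ?f {\<phi> \<in> I \<rightarrow>\<^sub>E V. (\<phi> a, \<phi> b) \<in> R}"
  proof (rule inj_onI)
    fix x y assume x: "x \<in> {\<phi> \<in> I \<rightarrow>\<^sub>E V. (\<phi> a, \<phi> b) \<in> R}" and y: "y \<in> {\<phi> \<in> I \<rightarrow>\<^sub>E V. (\<phi> a, \<phi> b) \<in> R}"
      and e: "?f x = ?f y"
    have "x i = y i" if "i \<in> I" for i
      using e that by (cases "i \<in> ?J") (auto dest: fun_cong[of _ _ i])
    then show "x = y" using x y by (intro PiE_ext[of x I "\<lambda>_. V" y]) auto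
  qed
  moreover have "?f ` {\<phi> \<in> I \<rightarrow>\<^sub>E V. (\<phi> a, \<phi> b) \<in> R} \<subseteq> R \<times> (?J \<rightarrow>\<^sub>E V)"
    by (auto simp: PiE_def Pi_def)
  ultimately have "card {\<phi> \<in> I \<rightarrow>\<^sub>E V. (\<phi> a, \<phi> b) \<in> R} \<le> card (R \<times> (?J \<rightarrow>\<^sub>E V))"
    using assms by (intro card_inj_on_le) (auto intro: finite_PiE)
  then show ?thesis using cJ assms by (simp add: card_cartesian_product card_PiE_const)
qed

text \<open>The set allowed for coordinate \<open>d\<close> may depend on the other coordinates.
  This is the shape of a thin pair: the images of two pattern vertices determine a small set which
  the image of a third one has to meet.\<close>

lemma card_coord_choice_le:
  assumes "finite I" "finite V" "d \<in> I" "\<And>g. finite (W g)" "\<And>g. card (W g) \<le> q"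
  shows "card {\<phi> \<in> I \<rightarrow>\<^sub>E V. \<phi> d \<in> W (restrict \<phi> (I - {d}))} \<le> q * card V ^ (card I - 1)"
proof -
  let ?J = "I - {d}"
  let ?f = "\<lambda>\<phi>. (restrict \<phi> ?J, \<phi> d)"
  have "inj_on ?f {\<phi> \<in> I \<rightarrow>\<^sub>E V. \<phi> d \<in> W (restrict \<phi> ?J)}"
  proof (rule inj_onI)
    fix x y assume x: "x \<in> {\<phi> \<in> I \<rightarrow>\<^sub>E V. \<phi> d \<in> W (restrict \<phi> ?J)}" and y: "y \<in> {\<phi> \<in> I \<rightarrow>\<^sub>E V. \<phi> d \<in> W (restrict \<phi> ?J)}"
      and e: "?f x = ?f y"
    have "x i = y i" if "i \<in> I" for i
      using e that by (cases "i \<in> ?J") (auto dest: fun_cong[of _ _ i])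
    then show "x = y" using x y by (intro PiE_ext[of x I "\<lambda>_. V" y]) auto
  qed
  moreover have "?f ` {\<phi> \<in> I \<rightarrow>\<^sub>E V. \<phi> d \<in> W (restrict \<phi> ?J)} \<subseteq> (SIGMA g:(?J \<rightarrow>\<^sub>E V). W g)"
    by (auto simp: PiE_def Pi_def)
  ultimately have "card {\<phi> \<in> I \<rightarrow>\<^sub>E V. \<phi> d \<in> W (restrict \<phi> ?J)} \<le> card (SIGMA g:(?J \<rightarrow>\<^sub>E V). W g)"
    using assms by (intro card_inj_on_le) (auto intro!: finite_PiE finite_SigmaI)
  also have "\<dots> = (\<Sum>g\<in>(?J \<rightarrow>\<^sub>E V). card (W g))"
    using assms by (intro card_SigmaI) (auto intro: finite_PiE)
  also have "\<dots> \<le> (\<Sum>g\<in>(?J \<rightarrow>\<^sub>E V). q)" by (intro sum_mono assms)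
  also have "\<dots> = q * card V ^ (card I - 1)" using assms by (simp add: card_PiE_const)
  finally show ?thesis .
qed

lemma card_coord_choice_fixed_le:
  assumes "finite I" "finite V" "d \<in> I" "a \<in> I" "a \<noteq> d" "\<And>g. finite (W g)" "\<And>g. card (W g) \<le> q"
  shows "card {\<phi> \<in> I \<rightarrow>\<^sub>E V. \<phi> a = x \<and> \<phi> d \<in> W (restrict \<phi> (I - {d}))} \<le> q * card V ^ (card I - 2)"
proof -
  let ?J = "I - {a}"
  \<comment> \<open>After coordinate \<open>a\<close> is forgotten, its fixed value \<open>x\<close>
    is put back before \<open>W\<close> is evaluated; this reduces the claim to the preceding bound
    on a smaller index set.\<close>
  let ?W = "\<lambda>g. W (restrict (g(a := x)) (I - {d}))"
  let ?f = "\<lambda>\<phi>. restrict \<phi> ?J"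
  let ?A = "{\<phi> \<in> I \<rightarrow>\<^sub>E V. \<phi> a = x \<and> \<phi> d \<in> W (restrict \<phi> (I - {d}))}"
  have "inj_on ?f ?A"
  proof (rule inj_onI)
    fix y z assume y: "y \<in> ?A" and z: "z \<in> ?A" and e: "?f y = ?f z"
    have "y i = z i" if "i \<in> I" for i
      using e that y z by (cases "i \<in> ?J") (auto dest: fun_cong[of _ _ i])
    then show "y = z" using y z by (intro PiE_ext[of y I "\<lambda>_. V" z]) auto
  qed
  moreover have "?f ` ?A \<subseteq> {g \<in> ?J \<rightarrow>\<^sub>E V. g d \<in> ?W (restrict g (?J - {d}))}"
  proof
    fix g assume "g \<in> ?f ` ?A"
    then obtain \<phi> where \<phi>: "\<phi> \<in> ?A" "g = ?f \<phi>" by auto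
    have r: "restrict ((restrict g (?J - {d}))(a := x)) (I - {d}) = restrict \<phi> (I - {d})"
    proof
      fix z show "restrict ((restrict g (?J - {d}))(a := x)) (I - {d}) z = restrict \<phi> (I - {d}) z"
        using \<phi> by (cases "z = a") (auto simp: restrict_def)
    qed
    have "g d = \<phi> d" "g \<in> ?J \<rightarrow>\<^sub>E V" using \<phi> assms by (auto simp: PiE_def Pi_def)
    then show "g \<in> {g \<in> ?J \<rightarrow>\<^sub>E V. g d \<in> ?W (restrict g (?J - {d}))}"
      using \<phi>(1) unfolding mem_Collect_eq r by simp
  qed
  ultimately have "card ?A \<le> card {g \<in> ?J \<rightarrow>\<^sub>E V. g d \<in> ?W (restrict g (?J - {d}))}"
    by (rule card_inj_on_le) (rule finite_subset[of _ "?J \<rightarrow>\<^sub>E V"], use assms in \<open>auto intro: finite_PiE\<close>)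
  also have "\<dots> \<le> q * card V ^ (card ?J - 1)"
    by (rule card_coord_choice_le) (use assms in auto)
  also have "card ?J - 1 = card I - 2" using assms by simp
  finally show ?thesis .
qed

lemma card_UN_le_real:
  assumes "finite X" "\<And>x. x \<in> X \<Longrightarrow> real (card (A x)) \<le> q"
  shows "real (card (\<Union>x\<in>X. A x)) \<le> real (card X) * q"
proof -
  have "real (card (\<Union>x\<in>X. A x)) \<le> real (\<Sum>x\<in>X. card (A x))" using card_UN_le[OF assms(1)] of_nat_mono by blast
  also have "\<dots> = (\<Sum>x\<in>X. real (card (A x)))" by simp
  also have "\<dots> \<le> real (card X) * q" by (rule sum_bounded_above) (use assms in auto)
  finally show ?thesis .
qed

lemma card_SIGMA_ge_real:
  assumes "finite X" "\<And>x. x \<in> X \<Longrightarrow> finite (A x)" "\<And>x. x \<in> X \<Longrightarrow> real (card (A x)) \<ge> q"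
  shows "real (card (SIGMA x:X. A x)) \<ge> real (card X) * q"
proof -
  have "real (card (SIGMA x:X. A x)) = (\<Sum>x\<in>X. real (card (A x)))" using assms by simp
  also have "\<dots> \<ge> real (card X) * q" by (rule sum_bounded_below) (use assms in auto)
  finally show ?thesis .
qed

section \<open>Missing and inside pairs, transversal cliques, dense sets of tuples\<close>

definition missing :: "'a set \<Rightarrow> ('a \<Rightarrow> 'b) \<Rightarrow> ('a \<Rightarrow> 'a \<Rightarrow> bool) \<Rightarrow> ('a \<times> 'a) set" where
  "missing V c E = {(x, y) \<in> V \<times> V. c x \<noteq> c y \<and> \<not> E x y}"

definition inside :: "'a set \<Rightarrow> ('a \<Rightarrow> 'b) \<Rightarrow> ('a \<Rightarrow> 'a \<Rightarrow> bool) \<Rightarrow> ('a \<times> 'a) set" where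
  "inside V c E = {(x, y) \<in> V \<times> V. c x = c y \<and> E x y}"

lemma finite_missing [simp]: "finite V \<Longrightarrow> finite (missing V c E)"
  unfolding missing_def by (rule finite_subset[of _ "V \<times> V"]) auto

lemma finite_inside [simp]: "finite V \<Longrightarrow> finite (inside V c E)"
  unfolding inside_def by (rule finite_subset[of _ "V \<times> V"]) auto

lemma pair_power_bound:
  assumes "real N \<le> \<eta> * real n ^ 2" "2 \<le> m"
  shows "real (N * n ^ (m - 2)) \<le> \<eta> * real n ^ m"
proof -
  have "real (N * n ^ (m - 2)) \<le> \<eta> * real n ^ 2 * real n ^ (m - 2)"
    using assms(1) by (simp add: mult_right_mono)
  also have "\<dots> = \<eta> * (real n ^ (2 + (m - 2)))" by (simp only: power_add mult.assoc)
  also have "2 + (m - 2) = m" using assms(2) by simp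
  finally show ?thesis .
qed

text \<open>Union bound: there are at least \<open>(\<alpha> * n)^|J|\<close> choices from the sets
  \<open>A j\<close>. Since these lie in different colour classes, a choice that is not a clique
  shows a missing pair in two of its coordinates, and each of the fewer than \<open>|J|^2\<close>
  ordered pairs of coordinates spoils at most \<open>\<eta> * n^|J|\<close> choices.\<close>

lemma card_transversal_cliques:
  assumes J: "finite J" and V: "finite V" and A: "\<And>j. j \<in> J \<Longrightarrow> A j \<subseteq> {x\<in>V. c x = j}"
    and cA: "\<And>j. j \<in> J \<Longrightarrow> real (card (A j)) \<ge> \<alpha> * real (card V)" and \<alpha>: "0 \<le> \<alpha>"
    and m: "real (card (missing V c E)) \<le> \<eta> * real (card V) ^ 2"
  shows "real (card {f \<in> Pi\<^sub>E J A. \<forall>i\<in>J. \<forall>j\<in>J. i \<noteq> j \<longrightarrow> E (f i) (f j)})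
    \<ge> (\<alpha> ^ card J - real (card J) ^ 2 * \<eta>) * real (card V) ^ card J"
proof -
  let ?n = "real (card V)"
  let ?G = "{f \<in> Pi\<^sub>E J A. \<forall>i\<in>J. \<forall>j\<in>J. i \<noteq> j \<longrightarrow> E (f i) (f j)}"
  let ?P = "{(i, j) \<in> J \<times> J. i \<noteq> j}"
  let ?B = "\<Union>ij\<in>?P. {f \<in> J \<rightarrow>\<^sub>E V. (f (fst ij), f (snd ij)) \<in> missing V c E}"
  have finA: "finite (A j)" if "j \<in> J" for j using A[OF that] V by (auto intro: finite_subset[of _ V])
  have finG: "finite ?G" by (rule finite_subset[of _ "Pi\<^sub>E J A"]) (auto intro!: finite_PiE J finA)
  have fP: "finite ?P" by (rule finite_subset[of _ "J \<times> J"]) (use J in auto)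
  have finB: "finite ?B" using fP by (intro finite_UN_I) (auto intro!: finite_PiE J V)
  have sub: "f \<in> ?G \<union> ?B" if f: "f \<in> Pi\<^sub>E J A" for f
  proof (cases "\<forall>i\<in>J. \<forall>j\<in>J. i \<noteq> j \<longrightarrow> E (f i) (f j)")
    case False
    then obtain i j where ij: "i \<in> J" "j \<in> J" "i \<noteq> j" "\<not> E (f i) (f j)" by auto
    have "f i \<in> A i" "f j \<in> A j" using f ij by auto
    then have mi: "(f i, f j) \<in> missing V c E"
      using subsetD[OF A[OF ij(1)], of "f i"] subsetD[OF A[OF ij(2)], of "f j"] ij(3,4) by (simp add: missing_def)
    have fV: "f \<in> J \<rightarrow>\<^sub>E V"
    proof (rule PiE_I)
      show "f x \<in> V" if "x \<in> J" for x using PiE_mem[OF f that] A[OF that] by blast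
      show "f x = undefined" if "x \<notin> J" for x using PiE_arb[OF f that] .
    qed
    have P: "(i, j) \<in> ?P" using ij(1-3) by blast
    have "f \<in> {f \<in> J \<rightarrow>\<^sub>E V. (f (fst (i, j)), f (snd (i, j))) \<in> missing V c E}"
      unfolding fst_conv snd_conv using mi fV by blast
    then show ?thesis by (intro UnI2 UN_I[OF P])
  next
    case True
    then have "f \<in> ?G" using f by blast
    then show ?thesis by (rule UnI1)
  qed
  \<comment> \<open>The sign of \<open>\<eta>\<close> is read off from the bound on the missing
    pairs. For empty \<open>V\<close> that bound says nothing, but then the power vanishes as soon
    as \<open>J\<close> is nonempty.\<close>
  have "0 \<le> \<eta> * ?n ^ 2" using m by (rule order_trans[rotated]) simp
  then have e0: "0 \<le> \<eta> * ?n ^ card J" if "card J \<ge> 1"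
    using that by (cases "card V = 0") (auto simp: zero_le_mult_iff power_0_left)
  have "real (card ?B) \<le> real (card ?P) * (\<eta> * ?n ^ card J)"
  proof (rule card_UN_le_real[OF fP])
    fix x assume "x \<in> ?P"
    then have x: "fst x \<in> J" "snd x \<in> J" "fst x \<noteq> snd x" by (simp_all add: case_prod_unfold)
    have c2: "2 \<le> card J" using card_mono[OF J, of "{fst x, snd x}"] x by simp
    show "real (card {f \<in> J \<rightarrow>\<^sub>E V. (f (fst x), f (snd x)) \<in> missing V c E}) \<le> \<eta> * ?n ^ card J"
      using of_nat_mono[OF card_pair_fixed_le[OF J V x finite_missing[OF V]]] pair_power_bound[OF m c2]
      by (rule order_trans)
  qed
  also have "\<dots> \<le> real (card J) ^ 2 * (\<eta> * ?n ^ card J)"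
  proof (cases "card J \<ge> 1")
    case True
    have "card ?P \<le> card J ^ 2"
      using card_mono[of "J \<times> J" ?P] J by (auto simp: power2_eq_square card_cartesian_product)
    then have "real (card ?P) \<le> real (card J ^ 2)" by (rule of_nat_mono)
    then have "real (card ?P) \<le> real (card J) ^ 2" by (simp only: of_nat_power)
    then show ?thesis using e0[OF True] by (rule mult_right_mono)
  next
    case False
    then have "J = {}" using J by (simp add: card_gt_0_iff Suc_le_eq)
    then show ?thesis by simp
  qed
  finally have B: "real (card ?B) \<le> real (card J) ^ 2 * (\<eta> * ?n ^ card J)" .
  have "(\<alpha> * ?n) ^ card J \<le> (\<Prod>j\<in>J. real (card (A j)))"
    using prod_mono[of J "\<lambda>_. \<alpha> * ?n" "\<lambda>j. real (card (A j))"] cA \<alpha> by simp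
  also have "\<dots> = real (card (Pi\<^sub>E J A))" using J by (simp add: card_PiE)
  also have "\<dots> \<le> real (card ?G) + real (card ?B)"
    proof -
    have "card (Pi\<^sub>E J A) \<le> card (?G \<union> ?B)"
      by (rule card_mono[OF finite_UnI[OF finG finB] subsetI]) (rule sub)
    also have "\<dots> \<le> card ?G + card ?B" by (rule card_Un_le)
    finally show ?thesis by (simp only: of_nat_add[symmetric] of_nat_le_iff)
  qed
  finally have "(\<alpha> * ?n) ^ card J \<le> real (card ?G) + real (card ?B)" .
  then show ?thesis using B unfolding power_mult_distrib left_diff_distrib mult.assoc by linarith
qed

text \<open>Double counting pairs of a tuple with \<open>m\<close> entries and a \<open>t\<close>-tuple of candidates for the next
  entry; using tuples instead of \<open>t\<close>-sets avoids binomial coefficients.\<close>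

lemma dense_tuples_contain_box:
  "\<xi> > 0 \<Longrightarrow> \<exists>N. \<forall>V R. finite (V::'a set) \<longrightarrow> card V \<ge> N \<longrightarrow> R \<subseteq> {..<m} \<rightarrow>\<^sub>E V \<longrightarrow>
     real (card R) \<ge> \<xi> * real (card V) ^ m \<longrightarrow>
     (\<exists>A. (\<forall>i<m. A i \<subseteq> V \<and> card (A i) = t) \<and> Pi\<^sub>E {..<m} A \<subseteq> R)"
proof (induction m arbitrary: \<xi>)
  case 0
  show ?case
  proof (intro exI[of _ 0] allI impI)
    fix V :: "'a set" and R :: "(nat \<Rightarrow> 'a) set" assume "R \<subseteq> {..<0} \<rightarrow>\<^sub>E V" "real (card R) \<ge> \<xi> * real (card V) ^ 0"
    then have "card R \<noteq> 0" using 0 by auto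
    then have "R \<noteq> {}" by auto
    then have "R = {\<lambda>x. undefined}" using \<open>R \<subseteq> {..<0} \<rightarrow>\<^sub>E V\<close> subset_singletonD[of R] by simp
    then show "\<exists>A. (\<forall>i<0. A i \<subseteq> V \<and> card (A i) = t) \<and> Pi\<^sub>E {..<0} A \<subseteq> R" by auto
  qed
next
  case (Suc m)
  \<comment> \<open>At least \<open>\<xi>/2 * n^m\<close> tuples (the set \<open>L\<close> below)
    have \<open>\<xi>/2 * n\<close> extensions, and each of them admits
    \<open>(\<xi>/2 * n)^t\<close> choices of \<open>t\<close> extensions; \<open>\<zeta>\<close> is
    the resulting density of pairs.\<close>
  define \<zeta> where "\<zeta> = (\<xi>/2) * (\<xi>/2) ^ t"
  have \<zeta>: "\<zeta> > 0" using Suc.prems by (simp add: \<zeta>_def)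
  obtain N where N: "\<And>V R. finite (V::'a set) \<Longrightarrow> card V \<ge> N \<Longrightarrow> R \<subseteq> {..<m} \<rightarrow>\<^sub>E V \<Longrightarrow>
     real (card R) \<ge> (\<zeta>/2) * real (card V) ^ m \<Longrightarrow>
     (\<exists>A. (\<forall>i<m. A i \<subseteq> V \<and> card (A i) = t) \<and> Pi\<^sub>E {..<m} A \<subseteq> R)"
    using Suc.IH[of "\<zeta>/2"] \<zeta> by (meson half_gt_zero)
  obtain N1 :: nat where N1: "real N1 > real t ^ 2 * 2 / \<zeta>" using reals_Archimedean2 by blast
  show ?case
  proof (intro exI[of _ "max N (max N1 1)"] allI impI)
    fix V :: "'a set" and R assume V: "finite V" and nN: "card V \<ge> max N (max N1 1)"
      and R: "R \<subseteq> {..<Suc m} \<rightarrow>\<^sub>E V" and dens: "real (card R) \<ge> \<xi> * real (card V) ^ Suc m"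
    let ?n = "real (card V)"
    have n0: "?n > 0" using nN by simp
    let ?G = "{..<m} \<rightarrow>\<^sub>E V"
    let ?T = "{..<t} \<rightarrow>\<^sub>E V"
    define N' where "N' g = {y\<in>V. g(m := y) \<in> R}" for g
    define L where "L = {g \<in> ?G. real (card (N' g)) \<ge> \<xi>/2 * ?n}"
    have fG: "finite ?G" and fT: "finite ?T" using V by (auto intro: finite_PiE)
    have cG: "card ?G = card V ^ m" and cT: "card ?T = card V ^ t" by (simp_all add: card_PiE)
    have fL: "finite L" using fG by (auto simp: L_def)
    have fN: "finite (N' g)" for g using V by (auto simp: N'_def)
    have cN: "card (N' g) \<le> card V" for g using V by (auto simp: N'_def intro: card_mono)
    have "card R \<le> card (SIGMA g:?G. N' g)"
    proof (rule card_inj_on_le)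
      let ?f = "\<lambda>\<phi>. (restrict \<phi> {..<m}, \<phi> m)"
      have rec: "(restrict \<phi> {..<m})(m := \<phi> m) = \<phi>" if "\<phi> \<in> R" for \<phi>
      proof
        fix x show "((restrict \<phi> {..<m})(m := \<phi> m)) x = \<phi> x"
          using that R by (cases "x < Suc m") (auto simp: restrict_def PiE_def extensional_def)
      qed
      show "inj_on ?f R" proof (rule inj_onI)
        fix x y assume "x \<in> R" "y \<in> R" "?f x = ?f y"
        then show "x = y" using rec[of x] rec[of y] by simp
      qed
      show "?f ` R \<subseteq> (SIGMA g:?G. N' g)"
      proof
        fix z assume "z \<in> ?f ` R"
        then obtain \<phi> where \<phi>: "\<phi> \<in> R" "z = ?f \<phi>" by auto
        then have "\<phi> \<in> {..<Suc m} \<rightarrow>\<^sub>E V" using R by blast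
        then have "restrict \<phi> {..<m} \<in> ?G" "\<phi> m \<in> V" by (simp_all add: PiE_def Pi_def)
        then show "z \<in> (SIGMA g:?G. N' g)" using rec[OF \<phi>(1)] \<phi> by (simp add: N'_def)
      qed
      show "finite (SIGMA g:?G. N' g)" using fG fN by auto
    qed
    also have "\<dots> = (\<Sum>g\<in>?G. card (N' g))" using fG fN by simp
    finally have "real (card R) \<le> (\<Sum>g\<in>?G. real (card (N' g)))" by (simp only: of_nat_sum[symmetric] of_nat_le_iff)
    also have "\<dots> \<le> (\<Sum>g\<in>?G. (if g \<in> L then ?n else 0) + \<xi>/2 * ?n)"
    proof (rule sum_mono)
      fix g assume "g \<in> ?G"
      then show "real (card (N' g)) \<le> (if g \<in> L then ?n else 0) + \<xi>/2 * ?n"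
        using cN[of g] Suc.prems n0 by (cases "g \<in> L") (simp_all add: L_def add_increasing2)
    qed
    also have "\<dots> = real (card L) * ?n + real (card ?G) * (\<xi>/2 * ?n)"
    proof -
      have "?G \<inter> {x. x \<in> L} = L" by (auto simp: L_def)
      then show ?thesis using fG by (simp add: sum.distrib sum.If_cases)
    qed
    finally have "\<xi> * ?n ^ Suc m \<le> real (card L) * ?n + ?n ^ m * (\<xi>/2 * ?n)" using dens cG by simp
    then have "\<xi>/2 * ?n ^ m * ?n \<le> real (card L) * ?n" by (simp add: algebra_simps)
    then have L: "\<xi>/2 * ?n ^ m \<le> real (card L)" using n0 by simp
    define W where "W w = {g \<in> ?G. \<forall>i<t. w i \<in> N' g}" for w :: "nat \<Rightarrow> 'a"
    have fW: "finite (W w)" for w using fG by (auto simp: W_def)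
    have cW: "real (card (W w)) \<le> ?n ^ m" for w
      proof -
      have "card (W w) \<le> card ?G" by (rule card_mono[OF fG]) (auto simp: W_def)
      then show ?thesis using cG by (simp flip: of_nat_power)
    qed
    have swap: "(\<Sum>w\<in>?T. card (W w)) = (\<Sum>g\<in>?G. card (N' g) ^ t)"
    proof -
      have "(\<Sum>w\<in>?T. card (W w)) = (\<Sum>w\<in>?T. \<Sum>g\<in>?G. if \<forall>i<t. w i \<in> N' g then 1 else 0)"
        by (rule sum.cong) (auto simp: W_def sum.If_cases[OF fG] Int_def conj_commute)
      also have "\<dots> = (\<Sum>g\<in>?G. \<Sum>w\<in>?T. if \<forall>i<t. w i \<in> N' g then 1 else 0)" by (rule sum.swap)
      also have "\<dots> = (\<Sum>g\<in>?G. card (N' g) ^ t)"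
      proof (rule sum.cong)
        fix g
        have "{w. w \<in> ?T \<and> (\<forall>i<t. w i \<in> N' g)} = {..<t} \<rightarrow>\<^sub>E N' g"
          by (auto simp: N'_def PiE_def Pi_def)
        then show "(\<Sum>w\<in>?T. if \<forall>i<t. w i \<in> N' g then 1 else 0) = card (N' g) ^ t"
          by (simp add: sum.If_cases[OF fT] Int_def card_PiE)
      qed simp
      finally show ?thesis .
    qed
    have "\<zeta> * ?n ^ (m + t) = \<xi>/2 * ?n ^ m * (\<xi>/2 * ?n) ^ t"
      unfolding \<zeta>_def power_add power_mult_distrib by (simp only: mult_ac)
    also have "\<dots> \<le> real (card L) * (\<xi>/2 * ?n) ^ t" using L Suc.prems by (intro mult_right_mono) auto
    also have "\<dots> = (\<Sum>g\<in>L. (\<xi>/2 * ?n) ^ t)" by simp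
    also have "\<dots> \<le> (\<Sum>g\<in>L. real (card (N' g)) ^ t)"
    proof (rule sum_mono)
      fix g assume "g \<in> L"
      then show "(\<xi>/2 * ?n) ^ t \<le> real (card (N' g)) ^ t"
        using Suc.prems n0 by (intro power_mono) (simp_all add: L_def)
    qed
    also have "\<dots> \<le> (\<Sum>g\<in>?G. real (card (N' g)) ^ t)"
      by (rule sum_mono2[OF fG]) (simp_all add: L_def)
    also have "\<dots> = (\<Sum>w\<in>?T. real (card (W w)))" using swap by (simp only: of_nat_sum[symmetric] of_nat_power[symmetric])
    finally have tot: "\<zeta> * ?n ^ (m + t) \<le> (\<Sum>w\<in>?T. real (card (W w)))" .
    \<comment> \<open>Averaging alone could return a \<open>w\<close> with repeated entries, whose
      image has fewer than \<open>t\<close> elements. There are only \<open>O(n^(t-1))\<close> such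
      \<open>w\<close>, which is less than half of the average once \<open>n\<close> exceeds
      \<open>N1\<close>.\<close>
    have "\<exists>w\<in>?T. inj_on w {..<t} \<and> real (card (W w)) \<ge> \<zeta>/2 * ?n ^ m"
    proof (rule ccontr)
      assume neg: "\<not> ?thesis"
      define D where "D = {w\<in>?T. \<not> inj_on w {..<t}}"
      let ?P = "{(i, j) \<in> {..<t} \<times> {..<t}. i \<noteq> j}"
      let ?diag = "(\<lambda>x. (x, x)) ` V"
      have fP: "finite ?P" by (rule finite_subset[of _ "{..<t} \<times> {..<t}"]) auto
      have "D \<subseteq> (\<Union>ij\<in>?P. {w\<in>?T. (w (fst ij), w (snd ij)) \<in> ?diag})"
      proof
        fix w assume "w \<in> D"
        then obtain i j where "w \<in> ?T" "i < t" "j < t" "w i = w j" "i \<noteq> j" by (auto simp: D_def inj_on_def)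
        moreover have "w i \<in> V" using PiE_mem[OF \<open>w \<in> ?T\<close>, of i] \<open>i < t\<close> by simp
        ultimately show "w \<in> (\<Union>ij\<in>?P. {w\<in>?T. (w (fst ij), w (snd ij)) \<in> ?diag})"
          by (intro UN_I[of "(i, j)"]) simp_all
      qed
      then have "real (card D) \<le> real (card (\<Union>ij\<in>?P. {w\<in>?T. (w (fst ij), w (snd ij)) \<in> ?diag}))"
        by (intro of_nat_mono card_mono finite_UN_I[OF fP]) (use fT in simp_all)
      also have "\<dots> \<le> real (card ?P) * (?n ^ t / ?n)"
      proof (rule card_UN_le_real[OF fP])
        fix x assume x: "x \<in> ?P"
        then have x': "fst x \<in> {..<t}" "snd x \<in> {..<t}" "fst x \<noteq> snd x" by (simp_all add: case_prod_unfold)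
        then have t2: "t \<ge> 2" by simp
        then obtain s where s: "t = 2 + s" using le_Suc_ex by blast
        have "card {w\<in>?T. (w (fst x), w (snd x)) \<in> ?diag} \<le> card ?diag * card V ^ (card {..<t} - 2)"
          by (rule card_pair_fixed_le) (use x' V in simp_all)
        also have "card ?diag = card V" by (rule card_image) (auto simp: inj_on_def)
        also have "card V * card V ^ (card {..<t} - 2) = card V ^ (t - 1)"
          by (simp add: s)
        finally have nat: "card {w\<in>?T. (w (fst x), w (snd x)) \<in> ?diag} \<le> card V ^ (t - 1)" .
        have "real (card {w\<in>?T. (w (fst x), w (snd x)) \<in> ?diag}) \<le> real (card V ^ (t - 1))"
          by (rule of_nat_mono[OF nat])
        also have "\<dots> = ?n ^ t / ?n" using n0 by (simp add: s)
        finally show "real (card {w\<in>?T. (w (fst x), w (snd x)) \<in> ?diag}) \<le> ?n ^ t / ?n" .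
      qed
      also have "\<dots> \<le> real t ^ 2 * (?n ^ t / ?n)"
      proof (rule mult_right_mono)
        have "card ?P \<le> card ({..<t} \<times> {..<t})" by (rule card_mono) auto
        then have "card ?P \<le> t ^ 2" by (simp only: card_cartesian_product card_lessThan power2_eq_square)
        then have "real (card ?P) \<le> real (t ^ 2)" by (rule of_nat_mono)
        then show "real (card ?P) \<le> real t ^ 2" by (simp only: of_nat_power)
      qed simp
      finally have D: "real (card D) \<le> real t ^ 2 * (?n ^ t / ?n)" .
      have "(\<Sum>w\<in>?T. real (card (W w))) \<le> (\<Sum>w\<in>?T. (if w \<in> D then ?n ^ m else 0) + \<zeta>/2 * ?n ^ m)"
      proof (rule sum_mono)
        fix w assume "w \<in> ?T"
        then show "real (card (W w)) \<le> (if w \<in> D then ?n ^ m else 0) + \<zeta>/2 * ?n ^ m"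
        proof (cases "w \<in> D")
          case True
          then show ?thesis using cW[of w] \<zeta> by (simp add: add_increasing2)
        next
          case False
          then have "inj_on w {..<t}" using \<open>w \<in> ?T\<close> by (simp add: D_def)
          then have "\<not> real (card (W w)) \<ge> \<zeta>/2 * ?n ^ m" using neg \<open>w \<in> ?T\<close> by blast
          then show ?thesis using False by simp
        qed
      qed
      also have "\<dots> = real (card D) * ?n ^ m + ?n ^ t * (\<zeta>/2 * ?n ^ m)"
      proof -
        have "?T \<inter> {x. x \<in> D} = D" by (auto simp: D_def)
        then show ?thesis using fT by (simp add: sum.distrib sum.If_cases cT)
      qed
      also have "\<dots> \<le> real t ^ 2 * (?n ^ t / ?n) * ?n ^ m + ?n ^ t * (\<zeta>/2 * ?n ^ m)"
        using D by (intro add_right_mono mult_right_mono) auto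
      finally have "\<zeta> * ?n ^ (m + t) \<le> real t ^ 2 * (?n ^ t / ?n) * ?n ^ m + ?n ^ t * (\<zeta>/2 * ?n ^ m)"
        using tot by simp
      then have "(\<zeta>/2) * ?n ^ (m + t) \<le> (real t ^ 2 / ?n) * ?n ^ (m + t)" by (simp add: power_add algebra_simps)
      then have "\<zeta>/2 \<le> real t ^ 2 / ?n" by (rule mult_right_le_imp_le) (use n0 in simp)
      then have "\<zeta> * ?n \<le> 2 * real t ^ 2" using n0 by (simp add: field_simps)
      moreover have "2 * real t ^ 2 < \<zeta> * real N1" using N1 \<zeta> by (simp add: field_simps)
      moreover have "\<zeta> * real N1 \<le> \<zeta> * ?n" by (rule mult_left_mono) (use nN \<zeta> in auto)
      ultimately show False by linarith
    qed
    then obtain w where w: "w \<in> ?T" "inj_on w {..<t}" and dw: "real (card (W w)) \<ge> \<zeta>/2 * ?n ^ m" by auto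
    obtain A where A: "\<And>i. i < m \<Longrightarrow> A i \<subseteq> V \<and> card (A i) = t" "Pi\<^sub>E {..<m} A \<subseteq> W w"
      proof -
      have "W w \<subseteq> {..<m} \<rightarrow>\<^sub>E V" unfolding W_def by blast
      moreover have "card V \<ge> N" using nN by simp
      ultimately show ?thesis using N[OF V _ _ dw] that by blast
    qed
    let ?A = "A(m := w ` {..<t})"
    have "Pi\<^sub>E {..<Suc m} ?A \<subseteq> R"
    proof
      fix f assume f: "f \<in> Pi\<^sub>E {..<Suc m} ?A"
      let ?g = "restrict f {..<m}"
      have "f i \<in> A i" if "i < m" for i using PiE_mem[OF f, of i] that by auto
      then have "?g \<in> Pi\<^sub>E {..<m} A" by simp
      then have g: "?g \<in> W w" using A(2) by blast
      have "f m \<in> w ` {..<t}" using PiE_mem[OF f, of m] by auto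
      then obtain i where i: "i < t" "f m = w i" by auto
      have eq: "?g(m := f m) = f"
      proof
        fix x show "(?g(m := f m)) x = f x"
          using PiE_arb[OF f, of x] by (cases "x < Suc m") (auto simp: restrict_def less_Suc_eq)
      qed
      have "w i \<in> N' ?g" using g i(1) unfolding W_def by blast
      then have "?g(m := w i) \<in> R" unfolding N'_def by blast
      then show "f \<in> R" unfolding i(2)[symmetric] eq .
    qed
    moreover have "\<forall>i<Suc m. ?A i \<subseteq> V \<and> card (?A i) = t"
      using A w by (auto simp: card_image less_Suc_eq)
    ultimately show "\<exists>A. (\<forall>i<Suc m. A i \<subseteq> V \<and> card (A i) = t) \<and> Pi\<^sub>E {..<Suc m} A \<subseteq> R" by blast
  qed
qed

section \<open>Zykov symmetrization\<close>

definition graph_on :: "'a set \<Rightarrow> ('a \<Rightarrow> 'a \<Rightarrow> bool) \<Rightarrow> bool" where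
  "graph_on V E \<longleftrightarrow> (\<forall>x\<in>V. \<forall>y\<in>V. E x y \<longrightarrow> E y x) \<and> (\<forall>x\<in>V. \<not> E x x)"

lemma graph_onD: "graph_on V E \<Longrightarrow> x \<in> V \<Longrightarrow> y \<in> V \<Longrightarrow> E x y \<Longrightarrow> E y x"
  and graph_on_irrefl: "graph_on V E \<Longrightarrow> x \<in> V \<Longrightarrow> \<not> E x x"
  by (auto simp: graph_on_def)

text \<open>For \<open>x = y = u\<close> the value is \<open>E v u\<close>, so the result is
  irreflexive only because vertices are cloned onto non-neighbours.\<close>

definition clone :: "'a \<Rightarrow> 'a \<Rightarrow> ('a \<Rightarrow> 'a \<Rightarrow> bool) \<Rightarrow> 'a \<Rightarrow> 'a \<Rightarrow> bool" where
  "clone u v E x y = (if x = u then E v y else if y = u then E x v else E x y)"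

lemma graph_on_clone:
  assumes "graph_on V E" "u \<in> V" "v \<in> V" "\<not> E u v"
  shows "graph_on V (clone u v E)"
  using assms unfolding graph_on_def clone_def by (metis (full_types))

lemma homs_replace:
  assumes "\<phi> \<in> I \<rightarrow>\<^sub>E V" "w \<in> V"
  shows "(\<lambda>i\<in>I. if \<phi> i = z then w else \<phi> i) \<in> I \<rightarrow>\<^sub>E V"
  using assms by (auto simp: PiE_def Pi_def)

lemma homsI: "\<phi> \<in> I \<rightarrow>\<^sub>E V \<Longrightarrow> (\<And>a b. a \<in> I \<Longrightarrow> b \<in> I \<Longrightarrow> p a \<noteq> p b \<Longrightarrow> E (\<phi> a) (\<phi> b)) \<Longrightarrow> \<phi> \<in> homs I p V E"
  by (simp add: homs_def)

lemma homsD: "\<phi> \<in> homs I p V E \<Longrightarrow> a \<in> I \<Longrightarrow> b \<in> I \<Longrightarrow> p a \<noteq> p b \<Longrightarrow> E (\<phi> a) (\<phi> b)"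
  and homs_PiE: "\<phi> \<in> homs I p V E \<Longrightarrow> \<phi> \<in> I \<rightarrow>\<^sub>E V"
  and homs_in: "\<phi> \<in> homs I p V E \<Longrightarrow> a \<in> I \<Longrightarrow> \<phi> a \<in> V"
  by (auto simp: homs_def)

lemma card_split_3:
  assumes "finite A"
  shows "card A = card {x\<in>A. \<not> P x} + card {x\<in>A. P x \<and> \<not> R x} + card {x\<in>A. P x \<and> R x}"
proof -
  have "A = {x\<in>A. \<not> P x} \<union> ({x\<in>A. P x \<and> \<not> R x} \<union> {x\<in>A. P x \<and> R x})" by auto
  then have "card A = card ({x\<in>A. \<not> P x} \<union> ({x\<in>A. P x \<and> \<not> R x} \<union> {x\<in>A. P x \<and> R x}))" by simp
  also have "\<dots> = card {x\<in>A. \<not> P x} + card ({x\<in>A. P x \<and> \<not> R x} \<union> {x\<in>A. P x \<and> R x})"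
    by (rule card_Un_disjoint) (use assms in auto)
  also have "card ({x\<in>A. P x \<and> \<not> R x} \<union> {x\<in>A. P x \<and> R x}) = card {x\<in>A. P x \<and> \<not> R x} + card {x\<in>A. P x \<and> R x}"
    by (rule card_Un_disjoint) (use assms in auto)
  finally show ?thesis by simp
qed

definition using_only :: "'a \<Rightarrow> 'a \<Rightarrow> 'i set \<Rightarrow> ('i \<Rightarrow> 'b) \<Rightarrow> 'a set \<Rightarrow> ('a \<Rightarrow> 'a \<Rightarrow> bool) \<Rightarrow> nat" where
  "using_only w z I p V E = card {\<phi> \<in> homs I p V E. w \<in> \<phi> ` I \<and> \<not> z \<in> \<phi> ` I}"

text \<open>Maps avoiding \<open>u\<close> are unaffected, and maps using \<open>u\<close> without
  \<open>v\<close> are replaced by copies of those using \<open>v\<close> without \<open>u\<close>.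
  A map using both survives: as \<open>u\<close> and \<open>v\<close> are nonadjacent, their
  preimages all have one colour, so whatever must be adjacent to \<open>u\<close> was already
  adjacent to \<open>v\<close>. New maps using both may appear, hence only an inequality. With
  injective \<open>p\<close> no map uses both vertices before or after, hence equality.\<close>

lemma card_homs_clone:
  assumes fin: "finite I" "finite V" and g: "graph_on V E" and uv: "u \<in> V" "v \<in> V" "u \<noteq> v" "\<not> E u v"
  shows "card (homs I p V (clone u v E)) + using_only u v I p V E \<ge> card (homs I p V E) + using_only v u I p V E"
    and "inj_on p I \<Longrightarrow>
      card (homs I p V (clone u v E)) + using_only u v I p V E = card (homs I p V E) + using_only v u I p V E"
proof -
  let ?E = "clone u v E"
  have nvu: "\<not> E v u" using graph_onD[OF g, of v u] uv by auto
  note irr = graph_on_irrefl[OF g]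
  have Z: "{\<phi> \<in> homs I p V ?E. \<not> u \<in> \<phi> ` I} = {\<phi> \<in> homs I p V E. \<not> u \<in> \<phi> ` I}"
  proof -
    have "(\<phi> \<in> homs I p V ?E) = (\<phi> \<in> homs I p V E)" if "\<not> u \<in> \<phi> ` I" for \<phi>
    proof -
      have "?E (\<phi> a) (\<phi> b) = E (\<phi> a) (\<phi> b)" if "a \<in> I" "b \<in> I" for a b
        using that \<open>\<not> u \<in> \<phi> ` I\<close> unfolding clone_def by auto
      then show ?thesis unfolding homs_def by auto
    qed
    then show ?thesis by blast
  qed
  let ?B = "{\<phi> \<in> homs I p V ?E. u \<in> \<phi> ` I \<and> \<not> v \<in> \<phi> ` I}"
  let ?A = "{\<phi> \<in> homs I p V E. v \<in> \<phi> ` I \<and> \<not> u \<in> \<phi> ` I}"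
  let ?f = "\<lambda>\<phi>. \<lambda>i\<in>I. if \<phi> i = v then u else \<phi> i"
  let ?h = "\<lambda>\<phi>. \<lambda>i\<in>I. if \<phi> i = u then v else \<phi> i"
  have "bij_betw ?f ?A ?B"
  proof (rule bij_betwI[where g = ?h])
    show "?f \<in> ?A \<rightarrow> ?B"
    proof
      fix \<phi> assume \<phi>: "\<phi> \<in> ?A"
      then have h: "\<phi> \<in> homs I p V E" and u: "\<And>i. i \<in> I \<Longrightarrow> \<phi> i \<noteq> u" by auto
      have "?f \<phi> \<in> homs I p V ?E"
      proof (rule homsI)
        show "?f \<phi> \<in> I \<rightarrow>\<^sub>E V" by (rule homs_replace[OF homs_PiE[OF h]]) (use uv in auto)
        fix a b assume ab: "a \<in> I" "b \<in> I" "p a \<noteq> p b"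
        have e: "E (\<phi> a) (\<phi> b)" by (rule homsD[OF h ab])
        have "\<not> (\<phi> a = v \<and> \<phi> b = v)" using e irr uv by auto
        then show "?E (?f \<phi> a) (?f \<phi> b)" using e ab u[OF ab(1)] u[OF ab(2)] uv(3)
          by (auto simp: clone_def)
      qed
      moreover have "u \<in> ?f \<phi> ` I" using \<phi> by (auto simp: image_iff)
      moreover have "v \<notin> ?f \<phi> ` I" using uv(3) by auto
      ultimately show "?f \<phi> \<in> ?B" by blast
    qed
    show "?h \<in> ?B \<rightarrow> ?A"
    proof
      fix \<phi> assume \<phi>: "\<phi> \<in> ?B"
      then have h: "\<phi> \<in> homs I p V ?E" and v: "\<And>i. i \<in> I \<Longrightarrow> \<phi> i \<noteq> v" by auto
      have "?h \<phi> \<in> homs I p V E"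
      proof (rule homsI)
        show "?h \<phi> \<in> I \<rightarrow>\<^sub>E V" by (rule homs_replace[OF homs_PiE[OF h]]) (use uv in auto)
        fix a b assume ab: "a \<in> I" "b \<in> I" "p a \<noteq> p b"
        have e: "?E (\<phi> a) (\<phi> b)" by (rule homsD[OF h ab])
        then show "E (?h \<phi> a) (?h \<phi> b)" using ab v[OF ab(1)] v[OF ab(2)] uv(3) nvu
          by (auto simp: clone_def split: if_splits)
      qed
      moreover have "v \<in> ?h \<phi> ` I" using \<phi> by (auto simp: image_iff)
      moreover have "u \<notin> ?h \<phi> ` I" using uv(3) by auto
      ultimately show "?h \<phi> \<in> ?A" by blast
    qed
    show "?h (?f \<phi>) = \<phi>" if "\<phi> \<in> ?A" for \<phi>
    proof
      fix i show "?h (?f \<phi>) i = \<phi> i"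
        using that homs_PiE[of \<phi> I p V E] by (cases "i \<in> I") (auto simp: PiE_def extensional_def)
    qed
    show "?f (?h \<phi>) = \<phi>" if "\<phi> \<in> ?B" for \<phi>
    proof
      fix i show "?f (?h \<phi>) i = \<phi> i"
        using that homs_PiE[of \<phi> I p V ?E] by (cases "i \<in> I") (auto simp: PiE_def extensional_def)
    qed
  qed
  then have AB: "card ?A = card ?B" by (rule bij_betw_same_card)
  let ?C = "{\<phi> \<in> homs I p V E. u \<in> \<phi> ` I \<and> v \<in> \<phi> ` I}"
  let ?C' = "{\<phi> \<in> homs I p V ?E. u \<in> \<phi> ` I \<and> v \<in> \<phi> ` I}"
  have CC: "?C \<subseteq> ?C'"
  proof
    fix \<phi> assume \<phi>: "\<phi> \<in> ?C"
    then have h: "\<phi> \<in> homs I p V E" by blast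
    obtain i j where ij: "i \<in> I" "j \<in> I" "u = \<phi> i" "v = \<phi> j" using \<phi> by blast
    have pj: "p a = p j" if "a \<in> I" "\<phi> a = u" for a
      using homsD[OF h that(1) ij(2)] that ij uv by metis
    have "\<phi> \<in> homs I p V ?E"
    proof (rule homsI)
      show "\<phi> \<in> I \<rightarrow>\<^sub>E V" by (rule homs_PiE[OF h])
      fix a b assume ab: "a \<in> I" "b \<in> I" "p a \<noteq> p b"
      consider "\<phi> a = u" | "\<phi> a \<noteq> u" "\<phi> b = u" | "\<phi> a \<noteq> u" "\<phi> b \<noteq> u" by blast
      then show "?E (\<phi> a) (\<phi> b)"
      proof cases
        case 1
        then have "E (\<phi> j) (\<phi> b)" using homsD[OF h ij(2) ab(2)] pj[OF ab(1)] ab by auto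
        then show ?thesis using 1 ij by (simp add: clone_def)
      next
        case 2
        then have "E (\<phi> a) (\<phi> j)" using homsD[OF h ab(1) ij(2)] pj[OF ab(2)] ab by auto
        then show ?thesis using 2 ij by (simp add: clone_def)
      next
        case 3
        then show ?thesis using homsD[OF h ab] by (simp add: clone_def)
      qed
    qed
    then show "\<phi> \<in> ?C'" using \<phi> by blast
  qed
  have fh: "finite (homs I p V E)" "finite (homs I p V ?E)" using fin by auto
  have fC: "finite ?C'" using fh by simp
  have 1: "card (homs I p V E) = card {\<phi> \<in> homs I p V E. \<not> u \<in> \<phi> ` I} + using_only u v I p V E + card ?C"
    unfolding using_only_def by (rule card_split_3[OF fh(1)])
  have 2: "card (homs I p V ?E) = card {\<phi> \<in> homs I p V ?E. \<not> u \<in> \<phi> ` I} + card ?B + card ?C'"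
    by (rule card_split_3[OF fh(2)])
  have 3: "using_only v u I p V E = card ?B" unfolding using_only_def by (rule AB)
  show "card (homs I p V ?E) + using_only u v I p V E \<ge> card (homs I p V E) + using_only v u I p V E"
    unfolding 1 2 3 Z using card_mono[OF fC CC] by linarith
  assume inj: "inj_on p I"
  have "?C' = {}"
  proof (rule ccontr)
    assume "?C' \<noteq> {}"
    then obtain \<phi> i j where h: "\<phi> \<in> homs I p V ?E" and ij: "i \<in> I" "j \<in> I" "u = \<phi> i" "v = \<phi> j" by blast
    have "p i \<noteq> p j" using inj ij uv(3) by (metis inj_onD)
    then have "?E u v" using homsD[OF h ij(1,2)] ij by auto
    then show False using irr[OF uv(2)] by (simp add: clone_def)
  qed
  then have "card ?C = card ?C'" using CC by (metis (no_types, lifting) subset_empty)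
  then show "card (homs I p V ?E) + using_only u v I p V E = card (homs I p V E) + using_only v u I p V E"
    unfolding 1 2 3 Z by linarith
qed

section \<open>Twin classes and termination of the symmetrization\<close>

definition twins :: "'a set \<Rightarrow> ('a \<Rightarrow> 'a \<Rightarrow> bool) \<Rightarrow> 'a \<Rightarrow> 'a set" where
  "twins V E x = {y\<in>V. \<forall>z\<in>V. E x z = E y z}"

text \<open>Its size is the sum of the squares of the sizes of the twin classes, which serves as the
  termination measure in case of ties.\<close>

definition twin_pairs :: "'a set \<Rightarrow> ('a \<Rightarrow> 'a \<Rightarrow> bool) \<Rightarrow> ('a \<times> 'a) set" where
  "twin_pairs V E = {(x, y) \<in> V \<times> V. \<forall>z\<in>V. E x z = E y z}"

lemma finite_twin_pairs: "finite V \<Longrightarrow> finite (twin_pairs V E)"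
  unfolding twin_pairs_def by (rule finite_subset[of _ "V \<times> V"]) auto

text \<open>Twins different from \<open>u\<close> stay twins, because their adjacency to
  \<open>u\<close> now copies their common adjacency to \<open>v\<close>. The vertex
  \<open>u\<close> leaves a class of size \<open>a\<close> and joins one of size
  \<open>b \<ge> a\<close>: at most \<open>2a - 1\<close> pairs are lost and \<open>2b + 1\<close>
  are gained.\<close>

lemma card_twin_pairs_clone:
  assumes V: "finite V" and g: "graph_on V E" and uv: "u \<in> V" "v \<in> V" "\<not> E u v" "u \<notin> twins V E v"
    and le: "card (twins V E u) \<le> card (twins V E v)"
  shows "card (twin_pairs V E) < card (twin_pairs V (clone u v E))"
proof -
  let ?S = "twin_pairs V E" and ?S' = "twin_pairs V (clone u v E)"
  let ?Z = "{(x, y) \<in> ?S. x \<noteq> u \<and> y \<noteq> u}"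
  let ?Tu = "twins V E u - {u}" and ?Tv = "twins V E v"
  have fT: "finite (twins V E x)" for x using V by (simp add: twins_def)
  have fS: "finite ?S" "finite ?S'" "finite ?Z"
    using finite_twin_pairs[OF V] finite_subset[of ?Z "twin_pairs V E"] by auto
  have uu: "u \<in> twins V E u" using uv by (simp add: twins_def)
  have "?S \<subseteq> ?Z \<union> (insert (u, u) (Pair u ` ?Tu \<union> (\<lambda>x. (x, u)) ` ?Tu))"
    unfolding twin_pairs_def twins_def by auto
  then have "card ?S \<le> card (?Z \<union> (insert (u, u) (Pair u ` ?Tu \<union> (\<lambda>x. (x, u)) ` ?Tu)))"
    by (rule card_mono[rotated]) (use fS fT in auto)
  also have "\<dots> \<le> card ?Z + card (insert (u, u) (Pair u ` ?Tu \<union> (\<lambda>x. (x, u)) ` ?Tu))" by (rule card_Un_le)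
  also have "\<dots> \<le> card ?Z + (Suc (card ?Tu + card ?Tu))"
    using card_Un_le[of "Pair u ` ?Tu" "(\<lambda>x. (x, u)) ` ?Tu"]
      card_image_le[of ?Tu "Pair u"] card_image_le[of ?Tu "\<lambda>x. (x, u)"] fT
      card_insert_le_m1[of "Suc (card ?Tu + card ?Tu)" "Pair u ` ?Tu \<union> (\<lambda>x. (x, u)) ` ?Tu" "(u, u)"]
    by simp
  also have "\<dots> \<le> card ?Z + (card ?Tv + card ?Tv)"
    using le card_Suc_Diff1[OF fT uu] by linarith
  also have "\<dots> = card (?Z \<union> (Pair u ` ?Tv \<union> (\<lambda>x. (x, u)) ` ?Tv))"
  proof -
    have "card (?Z \<union> (Pair u ` ?Tv \<union> (\<lambda>x. (x, u)) ` ?Tv)) = card ?Z + card (Pair u ` ?Tv \<union> (\<lambda>x. (x, u)) ` ?Tv)"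
      by (rule card_Un_disjoint) (use fS fT in auto)
    also have "card (Pair u ` ?Tv \<union> (\<lambda>x. (x, u)) ` ?Tv) = card (Pair u ` ?Tv) + card ((\<lambda>x. (x, u)) ` ?Tv)"
      by (rule card_Un_disjoint) (use fT uv(4) in auto)
    finally show ?thesis by (simp add: card_image inj_on_def)
  qed
  also have "\<dots> < card ?S'"
  proof (rule psubset_card_mono[OF fS(2)])
    have tw: "\<forall>z\<in>V. clone u v E u z = clone u v E w z" if "w \<in> ?Tv" for w
    proof
      fix z assume z: "z \<in> V"
      have w: "w \<in> V" "w \<noteq> u" "\<And>z. z \<in> V \<Longrightarrow> E v z = E w z" using that uv(4) by (auto simp: twins_def)
      have "\<not> E v u" using graph_onD[OF g uv(2) uv(1)] uv(3) by blast
      moreover have "\<not> E w v" using w(3)[OF uv(2)] graph_on_irrefl[OF g uv(2)] by simp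
      ultimately show "clone u v E u z = clone u v E w z" using w z by (auto simp: clone_def)
    qed
    have "?Z \<subseteq> ?S'" using uv(2) by (auto simp: twin_pairs_def clone_def)
    moreover have "Pair u ` ?Tv \<subseteq> ?S'" using tw uv(1) by (auto simp: twin_pairs_def twins_def)
    moreover have "(\<lambda>x. (x, u)) ` ?Tv \<subseteq> ?S'" using tw uv(1) by (auto simp: twin_pairs_def twins_def)
    moreover have "(u, u) \<in> ?S'" using uv by (simp add: twin_pairs_def)
    moreover have "(u, u) \<notin> ?Z \<union> (Pair u ` ?Tv \<union> (\<lambda>x. (x, u)) ` ?Tv)" using uv(4) by auto
    ultimately show "?Z \<union> (Pair u ` ?Tv \<union> (\<lambda>x. (x, u)) ` ?Tv) \<subset> ?S'" by blast
  qed
  finally show ?thesis .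
qed

text \<open>Zykov symmetrization for \<open>a * #homs(P) - b * #homs(K\<^sub>m)\<close>: of the two ways to clone one of two
  non-adjacent vertices onto the other, one does not decrease this quantity; in case of a tie the
  vertex of the smaller twin class is moved to the larger one, which makes the process terminate.\<close>

lemma zykov_induct:
  fixes I :: "'i set" and p :: "'i \<Rightarrow> 'b" and V :: "'a set" and a b :: real and m :: nat
  defines "\<Phi> \<equiv> \<lambda>E. a * real (card (homs I p V E)) - b * real (card (homs {..<m} id V E))"
  assumes fin: "finite I" "finite V" and ab: "0 \<le> a" "0 \<le> b"
    and base: "\<And>E. graph_on V E \<Longrightarrow> (\<And>x y z. x \<in> V \<Longrightarrow> y \<in> V \<Longrightarrow> z \<in> V \<Longrightarrow> \<not> E x y \<Longrightarrow> E x z = E y z) \<Longrightarrow> Q E"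
    and step: "\<And>E u v. graph_on V E \<Longrightarrow> u \<in> V \<Longrightarrow> v \<in> V \<Longrightarrow> \<Phi> (clone u v E) \<ge> \<Phi> E \<Longrightarrow> Q (clone u v E) \<Longrightarrow> Q E"
    and g0: "graph_on V E0"
  shows "Q E0"
proof (rule ccontr)
  assume "\<not> Q E0"
  \<comment> \<open>Failure of \<open>Q\<close> passes from a graph to each clone with at least the
    same value of \<open>\<Phi>\<close>. So take a counterexample with maximal
    \<open>\<Phi>\<close>, which exists because both counts are bounded naturals, and among these
    one with the most twin pairs; any further cloning contradicts one of the two choices.\<close>
  define C where "C = {E. graph_on V E \<and> \<not> Q E}"
  have C0: "E0 \<in> C" using g0 \<open>\<not> Q E0\<close> by (simp add: C_def)
  have "\<Phi> ` C \<subseteq> (\<lambda>(x, y). a * real x - b * real y) ` ({..card V ^ card I} \<times> {..card V ^ m})"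
  proof
    fix x assume "x \<in> \<Phi> ` C"
    then obtain E where "x = \<Phi> E" by blast
    moreover have "card (homs I p V E) \<le> card V ^ card I" "card (homs {..<m} id V E) \<le> card V ^ m"
      using card_homs_le[OF fin, of p E] card_homs_le[of "{..<m}" V id E] fin by simp_all
    ultimately show "x \<in> (\<lambda>(x, y). a * real x - b * real y) ` ({..card V ^ card I} \<times> {..card V ^ m})"
      by (auto simp: \<Phi>_def)
  qed
  then have fC: "finite (\<Phi> ` C)" by (rule finite_subset) simp
  define M where "M = Max (\<Phi> ` C)"
  have M: "\<Phi> E \<le> M" if "E \<in> C" for E unfolding M_def by (rule Max_ge) (use fC that in auto)
  have "M \<in> \<Phi> ` C" unfolding M_def by (rule Max_in) (use fC C0 in auto)
  then obtain E1 where E1: "E1 \<in> C" "\<Phi> E1 = M" by auto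
  have tb: "card (twin_pairs V E) \<le> card (V \<times> V)" for E
    by (rule card_mono) (use fin in \<open>auto simp: twin_pairs_def\<close>)
  have "\<exists>E. (E \<in> C \<and> \<Phi> E = M) \<and> (\<forall>E'. E' \<in> C \<and> \<Phi> E' = M \<longrightarrow> card (twin_pairs V E') \<le> card (twin_pairs V E))"
    by (rule ex_has_greatest_nat[where b = "Suc (card (V \<times> V))"]) (use E1 tb in \<open>auto simp: less_Suc_eq_le\<close>)
  then obtain E where E: "E \<in> C" "\<Phi> E = M"
    and mx: "\<And>E'. E' \<in> C \<Longrightarrow> \<Phi> E' = M \<Longrightarrow> card (twin_pairs V E') \<le> card (twin_pairs V E)" by blast
  have g: "graph_on V E" and nQ: "\<not> Q E" using E by (auto simp: C_def)
  obtain x y z where xyz: "x \<in> V" "y \<in> V" "z \<in> V" "\<not> E x y" "E x z \<noteq> E y z"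
    using base[OF g] nQ by blast
  \<comment> \<open>The contribution to \<open>\<Phi>\<close> of the maps that use \<open>u\<close>
    without \<open>v\<close>. Cloning \<open>u\<close> onto \<open>v\<close> changes
    \<open>\<Phi>\<close> by at least \<open>d v u - d u v\<close>, so one of the two directions
    does not decrease it.\<close>
  define d where "d u v = a * real (using_only u v I p V E) - b * real (using_only u v {..<m} id V E)" for u v
  have one: "\<Phi> (clone u v E) \<ge> \<Phi> E + d v u - d u v" if uv: "u \<in> V" "v \<in> V" "u \<noteq> v" "\<not> E u v" for u v
  proof -
    have "real (card (homs I p V E)) + real (using_only v u I p V E) - real (using_only u v I p V E) \<le> real (card (homs I p V (clone u v E)))"
      using card_homs_clone(1)[OF fin g uv, of p] by linarith
    then have 1: "a * (real (card (homs I p V E)) + real (using_only v u I p V E) - real (using_only u v I p V E)) \<le> a * real (card (homs I p V (clone u v E)))"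
      using ab(1) by (rule mult_left_mono)
    have 2: "real (card (homs {..<m} id V (clone u v E))) = real (card (homs {..<m} id V E)) + real (using_only v u {..<m} id V E) - real (using_only u v {..<m} id V E)"
      using card_homs_clone(2)[OF finite_lessThan fin(2) g uv, of id m] by simp
    show ?thesis using 1 unfolding \<Phi>_def d_def 2 by (simp add: algebra_simps)
  qed
  have lt: False if uv: "u \<in> V" "v \<in> V" "u \<noteq> v" "\<not> E u v" and d: "d u v < d v u" for u v
  proof -
    have "\<Phi> (clone u v E) > M" using one[OF uv] d E(2) by linarith
    moreover have "clone u v E \<in> C"
      using graph_on_clone[OF g uv(1,2,4)] step[OF g uv(1,2)] one[OF uv] d nQ by (auto simp: C_def)
    ultimately show False using M by fastforce
  qed
  have eq: False if uv: "u \<in> V" "v \<in> V" "u \<noteq> v" "\<not> E u v" and d: "d u v = d v u"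
    and t: "u \<notin> twins V E v" and le: "card (twins V E u) \<le> card (twins V E v)" for u v
  proof -
    have ge: "\<Phi> (clone u v E) \<ge> \<Phi> E" using one[OF uv] d by linarith
    have inC: "clone u v E \<in> C"
      using graph_on_clone[OF g uv(1,2,4)] step[OF g uv(1,2) ge] nQ by (auto simp: C_def)
    then have "\<Phi> (clone u v E) = M" using M[OF inC] ge E(2) by linarith
    then show False using mx[OF inC] card_twin_pairs_clone[OF fin(2) g uv(1,2,4) t le] by linarith
  qed
  have xy: "x \<noteq> y" "\<not> E y x" using xyz graph_onD[OF g, of y x] by auto
  have nt: "x \<notin> twins V E y" "y \<notin> twins V E x" using xyz by (auto simp: twins_def)
  consider "d x y < d y x" | "d y x < d x y" | "d x y = d y x" by linarith
  then show False
  proof cases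
    case 1 then show ?thesis using lt[of x y] xyz xy by blast
  next
    case 2 then show ?thesis using lt[of y x] xyz xy by blast
  next
    case 3 then show ?thesis using eq[of x y] eq[of y x] xyz xy nt by (metis nat_le_linear)
  qed
qed

section \<open>Patterns in complete multipartite graphs\<close>

definition cross :: "('a \<Rightarrow> 'b) \<Rightarrow> 'a \<Rightarrow> 'a \<Rightarrow> bool" where
  "cross c x y \<longleftrightarrow> c x \<noteq> c y"

lemma inj_prescribed:
  assumes fin: "finite A" "finite B" and a: "a1 \<in> A" "a2 \<in> A" "a1 \<noteq> a2" and b: "b1 \<in> B" "b2 \<in> B" "b1 \<noteq> b2"
    and le: "card A \<le> card B"
  shows "\<exists>f. inj_on f A \<and> f ` A \<subseteq> B \<and> f a1 = b1 \<and> f a2 = b2"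
proof -
  have "card (A - {a1, a2}) \<le> card (B - {b1, b2})"
    using a b le fin by (simp add: card_Diff_subset)
  then obtain g where g: "g ` (A - {a1, a2}) \<subseteq> B - {b1, b2}" "inj_on g (A - {a1, a2})"
    using card_le_inj[of "A - {a1, a2}" "B - {b1, b2}"] fin by auto
  let ?f = "g(a1 := b1, a2 := b2)"
  have fA: "?f x \<in> B - {b1, b2}" "?f x = g x" if "x \<in> A - {a1, a2}" for x using g(1) that by auto
  have "inj_on ?f A"
  proof (rule inj_onI)
    fix x y assume xy: "x \<in> A" "y \<in> A" "?f x = ?f y"
    show "x = y"
    proof (cases "x \<in> A - {a1, a2} \<and> y \<in> A - {a1, a2}")
      case True
      then have "g x = g y" using xy(3) fA(2) by metis
      then show ?thesis using True g(2) by (metis inj_onD)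
    next
      case False
      then show ?thesis using xy a b fA(1)[of x] fA(1)[of y] by (auto split: if_splits)
    qed
  qed
  moreover have "?f ` A \<subseteq> B" using g(1) b by auto
  ultimately show ?thesis using a by (intro exI[of _ ?f]) auto
qed

text \<open>The pattern is the complete multipartite graph whose parts are the fibres of
  \<open>pc\<close>. Two colours mean that it has an edge, and at most \<open>l\<close> colours that
  it maps into complete \<open>l\<close>-partite graphs.\<close>

locale colour_pattern =
  fixes VP :: "'q set" and pc :: "'q \<Rightarrow> nat" and l :: nat
  assumes fin: "finite VP" and two_colours: "2 \<le> card (pc ` VP)" and colours_le: "card (pc ` VP) \<le> l"
begin

abbreviation v where "v \<equiv> card VP"

lemma v_ge_2: "2 \<le> v" using card_image_le[OF fin, of pc] two_colours by linarith

lemma two_vertices: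
  obtains a b where "a \<in> VP" "b \<in> VP" "pc a \<noteq> pc b"
proof -
  obtain A where "A \<subseteq> pc ` VP" "card A = 2" using obtain_subset_with_card_n[OF two_colours] by metis
  then show thesis using that by (auto simp: card_2_iff)
qed

lemma l_ge_2: "2 \<le> l" using two_colours colours_le by linarith

section \<open>The limiting density and blow-ups\<close>

definition cnt :: "nat set \<Rightarrow> (nat \<Rightarrow> nat) \<Rightarrow> real" where
  "cnt V c = real (card (homs VP pc V (cross c)))"

lemma cnt_nonneg [simp]: "0 \<le> cnt V c" by (simp add: cnt_def)

lemma cnt_le_power: "finite V \<Longrightarrow> cnt V c \<le> real (card V) ^ v"
  unfolding cnt_def using card_homs_le[OF fin, of V pc "cross c"] by (simp flip: of_nat_power)

text \<open>The asymptotically optimal density of the pattern in complete \<open>l\<close>-partite graphs. It is not only a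
  limit but an upper bound for all sizes because homomorphisms, unlike injections, lift to blow-ups.\<close>

definition opt :: real where
  "opt = Sup {cnt V c / real (card V) ^ v |V c. finite V \<and> V \<noteq> {} \<and> c \<in> V \<rightarrow> {..<l}}"

lemma densities_bdd: "bdd_above {cnt V c / real (card V) ^ v |V c. finite V \<and> V \<noteq> {} \<and> c \<in> V \<rightarrow> {..<l}}"
proof (rule bdd_aboveI[of _ 1])
  fix x assume "x \<in> {cnt V c / real (card V) ^ v |V c. finite V \<and> V \<noteq> {} \<and> c \<in> V \<rightarrow> {..<l}}"
  then obtain V c where "x = cnt V c / real (card V) ^ v" "finite V" "V \<noteq> {}" by auto
  then show "x \<le> 1" using cnt_le_power[of V c] by (simp add: card_gt_0_iff)
qed

lemma cnt_le_opt:
  assumes "finite V" "c \<in> V \<rightarrow> {..<l}"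
  shows "cnt V c \<le> opt * real (card V) ^ v"
proof (cases "V = {}")
  case True
  then show ?thesis using cnt_le_power[of V c] v_ge_2 by (simp add: power_0_left split: if_splits)
next
  case False
  have "cnt V c / real (card V) ^ v \<le> opt"
    unfolding opt_def by (rule cSup_upper[OF _ densities_bdd]) (use assms False in auto)
  then show ?thesis using False assms by (simp add: field_simps card_gt_0_iff)
qed

lemma PiE_homs:
  assumes "inj_on \<sigma> (pc ` VP)" "\<And>a. a \<in> VP \<Longrightarrow> W a \<subseteq> {x\<in>V. c x = \<sigma> (pc a)}"
  shows "Pi\<^sub>E VP W \<subseteq> homs VP pc V (cross c)"
proof
  fix \<phi> assume \<phi>: "\<phi> \<in> Pi\<^sub>E VP W"
  have in_W: "\<phi> a \<in> V" "c (\<phi> a) = \<sigma> (pc a)" if "a \<in> VP" for a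
    using PiE_mem[OF \<phi> that] assms(2)[OF that] by auto
  show "\<phi> \<in> homs VP pc V (cross c)"
  proof (rule homsI)
    show "\<phi> \<in> VP \<rightarrow>\<^sub>E V" by (rule PiE_I) (use in_W PiE_arb[OF \<phi>] in auto)
    fix a b assume "a \<in> VP" "b \<in> VP" "pc a \<noteq> pc b"
    then show "cross c (\<phi> a) (\<phi> b)" using in_W assms(1) unfolding cross_def by (metis imageI inj_onD)
  qed
qed

lemma opt_pos: "opt > 0" and opt_le_1: "opt \<le> 1"
proof -
  obtain \<sigma> where \<sigma>: "\<sigma> ` pc ` VP \<subseteq> {..<l}" "inj_on \<sigma> (pc ` VP)"
    using card_le_inj[of "pc ` VP" "{..<l}"] fin colours_le by auto
  have "Pi\<^sub>E VP (\<lambda>a. {\<sigma> (pc a)}) \<subseteq> homs VP pc {..<l} (cross id)"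
    by (rule PiE_homs[OF \<sigma>(2)]) (use \<sigma> in auto)
  then have "card (Pi\<^sub>E VP (\<lambda>a. {\<sigma> (pc a)})) \<le> card (homs VP pc {..<l} (cross id))"
    by (rule card_mono[rotated]) (use fin in auto)
  then have "1 \<le> cnt {..<l} id" using fin unfolding cnt_def by (simp add: card_PiE)
  also have "\<dots> \<le> opt * real l ^ v" using cnt_le_opt[of "{..<l}" id] by auto
  finally show "opt > 0" by (metis less_le_trans of_nat_0_le_iff zero_le_power zero_less_mult_pos2 zero_less_one linorder_not_le mult_nonpos_nonneg)
  show "opt \<le> 1" unfolding opt_def
  proof (rule cSup_least)
    show "{cnt V c / real (card V) ^ v |V c. finite V \<and> V \<noteq> {} \<and> c \<in> V \<rightarrow> {..<l}} \<noteq> {}"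
      using l_ge_2 by (auto intro!: exI[of _ "{..<l}"] exI[of _ id] simp: lessThan_empty_iff)
  next
    fix x assume "x \<in> {cnt V c / real (card V) ^ v |V c. finite V \<and> V \<noteq> {} \<and> c \<in> V \<rightarrow> {..<l}}"
    then obtain V c where "x = cnt V c / real (card V) ^ v" "finite V" "V \<noteq> {}" by auto
    then show "x \<le> 1" using cnt_le_power[of V c] by (simp add: card_gt_0_iff)
  qed
qed

text \<open>Vertex \<open>i\<close> copies the vertex with index \<open>i mod m\<close>, where
  \<open>m = card V\<close>. A homomorphism is lifted by choosing one of \<open>q\<close> copies
  separately for every pattern vertex (the map \<open>\<rho>\<close>), also for those with a common
  image; this gives the full factor \<open>q^v\<close>. Surplus vertices do no harm.\<close>

lemma cnt_blowup:
  assumes V: "finite V" "V \<noteq> {}" and c: "c \<in> V \<rightarrow> {..<l}" and n: "q * card V \<le> n"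
  shows "\<exists>c'\<in>{..<n} \<rightarrow> {..<l}. cnt {..<n} c' \<ge> real q ^ v * cnt V c"
proof -
  let ?m = "card V"
  have m: "?m > 0" using V by (simp add: card_gt_0_iff)
  obtain e where e: "bij_betw e {0..<?m} V" using ex_bij_betw_nat_finite[OF V(1)] by blast
  define e' where "e' = the_inv_into {0..<?m} e"
  have e'1: "e' x < ?m" "e (e' x) = x" if "x \<in> V" for x
    using that e the_inv_into_into[of e "{0..<?m}" x "{0..<?m}"] f_the_inv_into_f[of e "{0..<?m}" x]
    unfolding e'_def bij_betw_def by auto
  define c' where "c' i = c (e (i mod ?m))" for i
  have c': "c' \<in> {..<n} \<rightarrow> {..<l}"
  proof
    fix i
    have "e (i mod ?m) \<in> V" using e m by (auto simp: bij_betw_def)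
    then show "c' i \<in> {..<l}" using c by (auto simp: c'_def)
  qed
  let ?X = "homs VP pc V (cross c) \<times> (VP \<rightarrow>\<^sub>E {..<q})"
  let ?f = "\<lambda>(\<phi>, \<rho>). \<lambda>a\<in>VP. \<rho> a * ?m + e' (\<phi> a)"
  have val: "(\<rho> a * ?m + e' (\<phi> a)) mod ?m = e' (\<phi> a)" "(\<rho> a * ?m + e' (\<phi> a)) div ?m = \<rho> a"
    if "\<phi> \<in> homs VP pc V (cross c)" "a \<in> VP" for \<phi> \<rho> a
    using e'1(1)[OF homs_in[OF that]] by auto
  have "inj_on ?f ?X"
  proof (rule inj_onI, clarify)
    fix \<phi> \<rho> \<phi>' \<rho>' assume h: "\<phi> \<in> homs VP pc V (cross c)" "\<phi>' \<in> homs VP pc V (cross c)"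
      and r: "\<rho> \<in> VP \<rightarrow>\<^sub>E {..<q}" "\<rho>' \<in> VP \<rightarrow>\<^sub>E {..<q}"
      and eq: "(\<lambda>a\<in>VP. \<rho> a * ?m + e' (\<phi> a)) = (\<lambda>a\<in>VP. \<rho>' a * ?m + e' (\<phi>' a))"
    have "\<rho> a = \<rho>' a \<and> \<phi> a = \<phi>' a" if a: "a \<in> VP" for a
    proof -
      have s: "\<rho> a * ?m + e' (\<phi> a) = \<rho>' a * ?m + e' (\<phi>' a)" using fun_cong[OF eq, of a] a by simp
      then have "e' (\<phi> a) = e' (\<phi>' a)" using val(1)[OF h(1) a, of \<rho>] val(1)[OF h(2) a, of \<rho>'] by simp
      then have "\<phi> a = \<phi>' a" using e'1(2)[OF homs_in[OF h(1) a]] e'1(2)[OF homs_in[OF h(2) a]] by metis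
      moreover have "\<rho> a = \<rho>' a" using s val(2)[OF h(1) a, of \<rho>] val(2)[OF h(2) a, of \<rho>'] by metis
      ultimately show ?thesis by blast
    qed
    then show "\<phi> = \<phi>' \<and> \<rho> = \<rho>'"
      using PiE_ext[OF homs_PiE[OF h(1)] homs_PiE[OF h(2)]] PiE_ext[OF r] by blast
  qed
  moreover have "?f ` ?X \<subseteq> homs VP pc {..<n} (cross c')"
  proof clarify
    fix \<phi> \<rho> assume h: "\<phi> \<in> homs VP pc V (cross c)" and r: "\<rho> \<in> VP \<rightarrow>\<^sub>E {..<q}"
    show "(\<lambda>a\<in>VP. \<rho> a * ?m + e' (\<phi> a)) \<in> homs VP pc {..<n} (cross c')"
    proof (rule homsI)
      have "\<rho> a * ?m + e' (\<phi> a) < n" if a: "a \<in> VP" for a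
      proof -
        have "\<rho> a < q" using r a by auto
        then have "\<rho> a * ?m + ?m \<le> q * ?m" by (metis Suc_leI add.commute mult_Suc mult_le_mono1)
        then show ?thesis using n e'1(1)[OF homs_in[OF h a]] by linarith
      qed
      then show "(\<lambda>a\<in>VP. \<rho> a * ?m + e' (\<phi> a)) \<in> VP \<rightarrow>\<^sub>E {..<n}" by simp
      fix a b assume ab: "a \<in> VP" "b \<in> VP" "pc a \<noteq> pc b"
      have "c' (\<rho> a * ?m + e' (\<phi> a)) = c (\<phi> a)" if "a \<in> VP" for a
        unfolding c'_def val(1)[OF h that] e'1(2)[OF homs_in[OF h that]] ..
      then show "cross c' ((\<lambda>a\<in>VP. \<rho> a * ?m + e' (\<phi> a)) a) ((\<lambda>a\<in>VP. \<rho> a * ?m + e' (\<phi> a)) b)"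
        using homsD[OF h ab] ab unfolding cross_def by simp
    qed
  qed
  ultimately have "card ?X \<le> card (homs VP pc {..<n} (cross c'))"
    by (rule card_inj_on_le) (use fin in simp)
  then have "real (card ?X) \<le> cnt {..<n} c'" unfolding cnt_def by (rule of_nat_mono)
  moreover have "real (card ?X) = real q ^ v * cnt V c"
    by (simp add: card_cartesian_product card_PiE_const[OF fin] cnt_def)
  ultimately show ?thesis using c' by auto
qed

text \<open>The supremum is approached for all large \<open>n\<close>, not only along some sequence:
  one good colouring of fixed size \<open>m\<close> is blown up by \<open>n div m\<close>, and the
  rounding costs a factor of at least \<open>(1 - m/n)^v\<close>, estimated by Bernoulli.\<close>

lemma cnt_near_opt:
  assumes "\<delta> > 0"
  shows "\<exists>N. \<forall>n\<ge>N. \<exists>c\<in>{..<n} \<rightarrow> {..<l}. cnt {..<n} c \<ge> (opt - \<delta>) * real n ^ v"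
proof -
  have "opt - \<delta>/2 < opt" using assms by simp
  then obtain x where x: "x \<in> {cnt V c / real (card V) ^ v |V c. finite V \<and> V \<noteq> {} \<and> c \<in> V \<rightarrow> {..<l}}" "opt - \<delta>/2 < x"
    unfolding opt_def by (rule less_cSupE) (use l_ge_2 in \<open>auto intro!: exI[of _ "{..<l}"] exI[of _ id] simp: lessThan_empty_iff\<close>)
  then obtain V c where V: "finite V" "V \<noteq> {}" "c \<in> V \<rightarrow> {..<l}" and d: "opt - \<delta>/2 < cnt V c / real (card V) ^ v" by auto
  let ?m = "card V"
  have m: "?m > 0" using V by (simp add: card_gt_0_iff)
  have d': "(opt - \<delta>/2) * real ?m ^ v \<le> cnt V c" using d m by (simp add: field_simps)
  obtain N1 :: nat where N1: "real N1 > 2 * real v * real ?m / \<delta>" using reals_Archimedean2 by blast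
  show ?thesis
  proof (intro exI[of _ "max N1 ?m"] allI impI)
    fix n assume n: "max N1 ?m \<le> n"
    then have n0: "real n > 0" using m by linarith
    obtain c' where c': "c' \<in> {..<n} \<rightarrow> {..<l}" "cnt {..<n} c' \<ge> real (n div ?m) ^ v * cnt V c"
      using cnt_blowup[OF V, of "n div ?m" n] by auto
    have "(opt - \<delta>) * real n ^ v \<le> cnt {..<n} c'"
    proof (cases "opt - \<delta> \<le> 0")
      case True
      then show ?thesis using mult_nonpos_nonneg[of "opt - \<delta>" "real n ^ v"] cnt_nonneg[of "{..<n}" c']
        by (meson order_trans zero_le_power of_nat_0_le_iff)
    next
      case False
      let ?y = "real ?m / real n"
      have y: "0 \<le> ?y" "?y \<le> 1" using n n0 by auto
      have "real v * ?y \<le> \<delta>/2"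
      proof -
        have "2 * real v * real ?m \<le> \<delta> * real N1" using N1 assms by (simp add: field_simps)
        also have "\<dots> \<le> \<delta> * real n" using n assms by simp
        finally show ?thesis using n0 by (simp add: field_simps)
      qed
      moreover have "1 - real v * ?y \<le> (1 - ?y) ^ v" using Bernoulli_inequality[of "- ?y" v] y by simp
      ultimately have b: "1 - \<delta>/2 \<le> (1 - ?y) ^ v" by linarith
      have "opt - \<delta> \<le> (opt - \<delta>/2) * (1 - \<delta>/2)"
      proof -
        have "(opt - \<delta>/2) * (\<delta>/2) \<le> 1 * (\<delta>/2)" by (rule mult_right_mono) (use opt_le_1 assms in auto)
        then show ?thesis by (simp add: algebra_simps)
      qed
      also have "\<dots> \<le> (opt - \<delta>/2) * (1 - ?y) ^ v" by (rule mult_left_mono[OF b]) (use False assms in auto)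
      finally have "(opt - \<delta>) * real n ^ v \<le> (opt - \<delta>/2) * (1 - ?y) ^ v * real n ^ v"
        by (rule mult_right_mono) simp
      also have "\<dots> = (opt - \<delta>/2) * (real n - real ?m) ^ v"
        using n0 by (simp add: mult.assoc left_diff_distrib flip: power_mult_distrib)
      also have "\<dots> \<le> (opt - \<delta>/2) * (real (n div ?m) * real ?m) ^ v"
      proof (intro mult_left_mono power_mono)
        have "n \<le> n div ?m * ?m + ?m" using m by (metis add_le_cancel_left div_mult_mod_eq less_imp_le_nat mod_less_divisor)
        then have "real n \<le> real (n div ?m * ?m + ?m)" by (rule of_nat_mono)
        then show "real n - real ?m \<le> real (n div ?m) * real ?m" by simp
      qed (use n False assms in auto)
      also have "\<dots> = real (n div ?m) ^ v * ((opt - \<delta>/2) * real ?m ^ v)" by (simp add: power_mult_distrib)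
      also have "\<dots> \<le> real (n div ?m) ^ v * cnt V c" by (rule mult_left_mono[OF d']) simp
      finally show ?thesis using c' by linarith
    qed
    then show "\<exists>c\<in>{..<n} \<rightarrow> {..<l}. cnt {..<n} c \<ge> (opt - \<delta>) * real n ^ v" using c' by blast
  qed
qed

lemma card_through:
  assumes "finite V" "finite S"
  shows "real (card {\<phi> \<in> VP \<rightarrow>\<^sub>E V. \<exists>a\<in>VP. \<phi> a \<in> S}) \<le> real v * real (card S) * real (card V) ^ (v - 1)"
proof -
  have "{\<phi> \<in> VP \<rightarrow>\<^sub>E V. \<exists>a\<in>VP. \<phi> a \<in> S} = (\<Union>a\<in>VP. {\<phi> \<in> VP \<rightarrow>\<^sub>E V. \<phi> a \<in> S})" by blast
  then have "real (card {\<phi> \<in> VP \<rightarrow>\<^sub>E V. \<exists>a\<in>VP. \<phi> a \<in> S}) = real (card (\<Union>a\<in>VP. {\<phi> \<in> VP \<rightarrow>\<^sub>E V. \<phi> a \<in> S}))" by (simp only:)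
  also have "\<dots> \<le> real v * (real (card S) * real (card V) ^ (v - 1))"
  proof (rule card_UN_le_real[OF fin])
    fix a assume "a \<in> VP"
    then have "card {\<phi> \<in> VP \<rightarrow>\<^sub>E V. \<phi> a \<in> S} \<le> card S * card V ^ (v - 1)"
      using card_coord_choice_le[OF fin assms(1), of a "\<lambda>_. S" "card S"] assms(2) by simp
    then have "real (card {\<phi> \<in> VP \<rightarrow>\<^sub>E V. \<phi> a \<in> S}) \<le> real (card S * card V ^ (v - 1))" by (rule of_nat_mono)
    then show "real (card {\<phi> \<in> VP \<rightarrow>\<^sub>E V. \<phi> a \<in> S}) \<le> real (card S) * real (card V) ^ (v - 1)" by (simp only: of_nat_mult of_nat_power)
  qed
  finally show ?thesis by (simp only: mult.assoc)
qed

lemma power_v: "x * x ^ (v - 1) = (x::real) ^ v" "x ^ 2 * x ^ (v - 2) = (x::real) ^ v"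
proof -
  obtain w where "v = 2 + w" using v_ge_2 le_Suc_ex by blast
  then show "x * x ^ (v - 1) = x ^ v" "x ^ 2 * x ^ (v - 2) = x ^ v" by (simp_all add: power2_eq_square)
qed

text \<open>As \<open>l\<close> colours suffice for the pattern, its colours can be assigned
  injectively to colours of the host so that those of \<open>a\<close> and \<open>b\<close> go to
  those of \<open>x\<close> and \<open>y\<close>. The remaining \<open>v - 2\<close> vertices are
  then placed freely in their classes.\<close>

lemma card_through_pair:
  assumes V: "finite V" and c: "c \<in> V \<rightarrow> {..<l}" and xy: "x \<in> V" "y \<in> V" "c x \<noteq> c y"
    and ab: "a \<in> VP" "b \<in> VP" "pc a \<noteq> pc b" and q: "0 \<le> q" "\<And>i. i < l \<Longrightarrow> q \<le> real (card {x\<in>V. c x = i})"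
  shows "real (card {\<phi> \<in> homs VP pc V (cross c). \<phi> a = x \<and> \<phi> b = y}) \<ge> q ^ (v - 2)"
proof -
  have cl: "c x < l" "c y < l" using c xy by auto
  obtain \<sigma> where \<sigma>: "inj_on \<sigma> (pc ` VP)" "\<sigma> ` pc ` VP \<subseteq> {..<l}" "\<sigma> (pc a) = c x" "\<sigma> (pc b) = c y"
    using inj_prescribed[of "pc ` VP" "{..<l}" "pc a" "pc b" "c x" "c y"] fin ab xy(3) cl colours_le by auto
  define W where "W d = (if d = a then {x} else if d = b then {y} else {x\<in>V. c x = \<sigma> (pc d)})" for d
  have "a \<noteq> b" using ab by auto
  have "Pi\<^sub>E VP W \<subseteq> homs VP pc V (cross c)"
    by (rule PiE_homs[OF \<sigma>(1)]) (use xy \<sigma> in \<open>auto simp: W_def\<close>)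
  moreover have "\<phi> a = x \<and> \<phi> b = y" if "\<phi> \<in> Pi\<^sub>E VP W" for \<phi>
    using PiE_mem[OF that ab(1)] PiE_mem[OF that ab(2)] \<open>a \<noteq> b\<close> by (simp add: W_def)
  ultimately have "Pi\<^sub>E VP W \<subseteq> {\<phi> \<in> homs VP pc V (cross c). \<phi> a = x \<and> \<phi> b = y}" by blast
  then have "card (Pi\<^sub>E VP W) \<le> card {\<phi> \<in> homs VP pc V (cross c). \<phi> a = x \<and> \<phi> b = y}"
    by (rule card_mono[rotated]) (use fin V in simp)
  moreover have "q ^ (v - 2) \<le> real (card (Pi\<^sub>E VP W))"
  proof -
    have "q ^ (v - 2) = (\<Prod>d\<in>VP - {a, b}. q)" using fin ab \<open>a \<noteq> b\<close> by (simp add: card_Diff_subset numeral_2_eq_2)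
    also have "\<dots> \<le> (\<Prod>d\<in>VP - {a, b}. real (card (W d)))"
    proof (rule prod_mono)
      fix d assume d: "d \<in> VP - {a, b}"
      then have "\<sigma> (pc d) < l" using \<sigma>(2) by auto
      then show "0 \<le> q \<and> q \<le> real (card (W d))" using q d by (simp add: W_def)
    qed
    also have "\<dots> = (\<Prod>d\<in>VP. real (card (W d)))"
      by (rule prod.mono_neutral_left) (use fin in \<open>auto simp: W_def\<close>)
    finally show ?thesis using fin by (simp add: card_PiE)
  qed
  ultimately show ?thesis by linarith
qed

text \<open>A map into \<open>E\<close> that is proper for \<open>c\<close> cannot send the fixed
  pair \<open>a\<close>, \<open>b\<close> to a missing pair. Every missing pair therefore destroys
  at least \<open>q^(v-2)\<close> proper maps, and different missing pairs destroy different ones. A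
  map that is not proper for \<open>c\<close> uses an inside pair, and each of these accounts for at
  most \<open>v^2 * n^(v-2)\<close> maps.\<close>

lemma card_homs_le_cnt:
  assumes V: "finite V" and c: "c \<in> V \<rightarrow> {..<l}"
    and q: "0 \<le> q" "\<And>i. i < l \<Longrightarrow> q \<le> real (card {x\<in>V. c x = i})"
  shows "real (card (homs VP pc V E)) \<le> cnt V c + real v ^ 2 * real (card (inside V c E)) * real (card V) ^ (v - 2)
     - q ^ (v - 2) * real (card (missing V c E))"
proof -
  obtain a b where ab: "a \<in> VP" "b \<in> VP" "pc a \<noteq> pc b" by (rule two_vertices)
  let ?H = "homs VP pc V (cross c)"
  let ?M = "{\<phi> \<in> ?H. (\<phi> a, \<phi> b) \<in> missing V c E}"
  let ?I = "\<Union>z\<in>VP \<times> VP - Id. {\<phi> \<in> VP \<rightarrow>\<^sub>E V. (\<phi> (fst z), \<phi> (snd z)) \<in> inside V c E}"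
  have fH: "finite ?H" and fM: "finite ?M" using fin V by auto
  have fI: "finite ?I" using fin V by (auto intro!: finite_UN_I finite_PiE)
  have sub: "homs VP pc V E \<subseteq> (?H - ?M) \<union> ?I"
  proof
    fix \<phi> assume h: "\<phi> \<in> homs VP pc V E"
    show "\<phi> \<in> (?H - ?M) \<union> ?I"
    proof (cases "\<phi> \<in> ?H")
      case True
      have "E (\<phi> a) (\<phi> b)" by (rule homsD[OF h ab])
      then have "\<phi> \<notin> ?M" by (simp add: missing_def)
      then show ?thesis using True by blast
    next
      case False
      then obtain d e where de: "d \<in> VP" "e \<in> VP" "pc d \<noteq> pc e" "c (\<phi> d) = c (\<phi> e)"
        using homs_PiE[OF h] unfolding homs_def cross_def by blast
      then have "(\<phi> d, \<phi> e) \<in> inside V c E" using homsD[OF h de(1-3)] homs_in[OF h] by (simp add: inside_def)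
      then have "\<phi> \<in> {\<phi> \<in> VP \<rightarrow>\<^sub>E V. (\<phi> (fst (d, e)), \<phi> (snd (d, e))) \<in> inside V c E}"
        using homs_PiE[OF h] by simp
      moreover have "(d, e) \<in> VP \<times> VP - Id" using de by auto
      ultimately show ?thesis by blast
    qed
  qed
  have "card (homs VP pc V E) \<le> card ((?H - ?M) \<union> ?I)" by (rule card_mono[OF _ sub]) (use fH fI in simp)
  also have "\<dots> \<le> card (?H - ?M) + card ?I" by (rule card_Un_le)
  also have "card (?H - ?M) = card ?H - card ?M" by (rule card_Diff_subset[OF fM]) blast
  finally have "card (homs VP pc V E) + card ?M \<le> card ?H + card ?I"
    using card_mono[OF fH, of ?M] by (simp add: Collect_subset)
  then have 1: "real (card (homs VP pc V E)) + real (card ?M) \<le> cnt V c + real (card ?I)"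
    unfolding cnt_def by (simp only: of_nat_add[symmetric] of_nat_le_iff)
  have "real (card ?I) \<le> real (card (VP \<times> VP - Id)) * (real (card (inside V c E)) * real (card V) ^ (v - 2))"
  proof (rule card_UN_le_real)
    show "finite (VP \<times> VP - Id)" using fin by simp
    fix z assume z: "z \<in> VP \<times> VP - Id"
    have "card {\<phi> \<in> VP \<rightarrow>\<^sub>E V. (\<phi> (fst z), \<phi> (snd z)) \<in> inside V c E} \<le> card (inside V c E) * card V ^ (v - 2)"
      by (rule card_pair_fixed_le[OF fin V]) (use z V in auto)
    then show "real (card {\<phi> \<in> VP \<rightarrow>\<^sub>E V. (\<phi> (fst z), \<phi> (snd z)) \<in> inside V c E}) \<le> real (card (inside V c E)) * real (card V) ^ (v - 2)"
      by (simp only: of_nat_mult[symmetric] of_nat_power[symmetric] of_nat_le_iff)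
  qed
  also have "\<dots> \<le> real v ^ 2 * (real (card (inside V c E)) * real (card V) ^ (v - 2))"
  proof (rule mult_right_mono)
    have "card (VP \<times> VP - Id) \<le> card (VP \<times> VP)" by (rule card_mono) (use fin in auto)
    then have "real (card (VP \<times> VP - Id)) \<le> real (v * v)" unfolding card_cartesian_product by (rule of_nat_mono)
    then show "real (card (VP \<times> VP - Id)) \<le> real v ^ 2" by (simp only: of_nat_mult power2_eq_square)
  qed simp
  finally have 2: "real (card ?I) \<le> real v ^ 2 * real (card (inside V c E)) * real (card V) ^ (v - 2)" by (simp only: mult.assoc)
  let ?S = "SIGMA z:missing V c E. {\<phi> \<in> ?H. \<phi> a = fst z \<and> \<phi> b = snd z}"
  have "real (card (missing V c E)) * q ^ (v - 2) \<le> real (card ?S)"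
  proof (rule card_SIGMA_ge_real)
    fix z assume "z \<in> missing V c E"
    then have z: "fst z \<in> V" "snd z \<in> V" "c (fst z) \<noteq> c (snd z)" by (auto simp: missing_def)
    show "q ^ (v - 2) \<le> real (card {\<phi> \<in> ?H. \<phi> a = fst z \<and> \<phi> b = snd z})"
      by (rule card_through_pair[OF V c z ab q])
  qed (use V fH in auto)
  also have "card ?S \<le> card ?M"
  proof (rule card_inj_on_le[OF _ _ fM])
    show "inj_on snd ?S" by (rule inj_onI) auto
    show "snd ` ?S \<subseteq> ?M" by auto
  qed
  then have "real (card ?S) \<le> real (card ?M)" by (rule of_nat_mono)
  finally have 3: "real (card (missing V c E)) * q ^ (v - 2) \<le> real (card ?M)" .
  show ?thesis using 1 2 3 by (simp only: mult.commute[of "q ^ (v - 2)"])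
qed

lemma card_subset_homs_le_cnt: "finite V \<Longrightarrow> S \<subseteq> homs VP pc V (cross c) \<Longrightarrow> real (card S) \<le> cnt V c"
  unfolding cnt_def using fin by (intro of_nat_mono card_mono) auto

text \<open>For a proper map the colour of the image determines the colour of the pattern
  vertex.\<close>

lemma colours_of_hom_le:
  assumes "\<phi> \<in> homs VP pc V (cross c)"
  shows "card (pc ` VP) \<le> card ((\<lambda>a. c (\<phi> a)) ` VP)"
proof -
  have "\<exists>g. \<forall>a\<in>VP. g (c (\<phi> a)) = pc a"
  proof (rule exI, rule ballI)
    fix a assume a: "a \<in> VP"
    let ?b = "SOME b. b \<in> VP \<and> c (\<phi> b) = c (\<phi> a)"
    have "?b \<in> VP \<and> c (\<phi> ?b) = c (\<phi> a)" by (rule someI) (use a in blast)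
    then show "(\<lambda>i. pc (SOME b. b \<in> VP \<and> c (\<phi> b) = i)) (c (\<phi> a)) = pc a"
      using homsD[OF assms _ a, of ?b] unfolding cross_def by blast
  qed
  then obtain g where g: "\<And>a. a \<in> VP \<Longrightarrow> g (c (\<phi> a)) = pc a" by blast
  then have "pc ` VP = g ` (\<lambda>a. c (\<phi> a)) ` VP" by (auto simp: image_iff)
  then show ?thesis using card_image_le[of "(\<lambda>a. c (\<phi> a)) ` VP" g] fin by simp
qed

text \<open>If some part were tiny, moving half of a large part into it would lose few homomorphisms and
  create many new ones.\<close>

lemma parts_large:
  "\<exists>c0 \<delta>. c0 > 0 \<and> c0 \<le> 1 \<and> \<delta> > 0 \<and> (\<exists>N. \<forall>V c. finite V \<longrightarrow> N \<le> card V \<longrightarrow> c \<in> V \<rightarrow> {..<l} \<longrightarrow>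
     cnt V c \<ge> (opt - \<delta>) * real (card V) ^ v \<longrightarrow> (\<forall>i<l. real (card {x\<in>V. c x = i}) \<ge> c0 * real (card V)))"
proof -
  \<comment> \<open>Vertices in parts below \<open>c1 * n\<close> meet at most
    \<open>opt/4 * n^v\<close> maps, so some map uses large parts only. \<open>X\<close> is the
    density of the maps created by splitting a large part, with \<open>c1/4 * n\<close> choices per
    vertex. Giving up all maps through a part below \<open>c0 * n\<close> costs at most
    \<open>X/4 * n^v\<close>, and \<open>\<delta> \<le> X/4\<close> keeps the balance
    positive.\<close>
  define c1 where "c1 = opt / (4 * real v * real l)"
  define X where "X = (c1/4) ^ v"
  define c0 where "c0 = X / (4 * real v)"
  define \<delta> where "\<delta> = min (opt/2) (X/4)"
  have v1: "real v \<ge> 1" and l1: "real l \<ge> 1" using v_ge_2 l_ge_2 by auto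
  have c1: "c1 > 0" using opt_pos v1 l1 by (auto simp: c1_def)
  have "opt \<le> 4 * real v * real l" using opt_le_1 mult_mono[of 1 "real v" 1 "real l"] v1 l1 by simp
  then have c1': "c1 \<le> 1" using v1 l1 by (simp add: c1_def divide_le_eq)
  have X: "X > 0" using c1 by (simp add: X_def)
  have "X \<le> c1/4" unfolding X_def using power_decreasing[of 1 v "c1/4"] v_ge_2 c1 c1' by simp
  then have X1: "X \<le> c1" using c1 by linarith
  have c0: "c0 > 0" using X v1 by (simp add: c0_def)
  have "c0 \<le> X" using X v1 by (simp add: c0_def divide_le_eq mult_le_cancel_left1)
  then have c01: "c0 \<le> c1" using X1 by linarith
  have \<delta>: "\<delta> > 0" using opt_pos X by (simp add: \<delta>_def)
  obtain N :: nat where N: "real N > 4 / c1" using reals_Archimedean2 by blast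
  have main: False
    if V: "finite V" and n: "N + 1 \<le> card V" and c: "c \<in> V \<rightarrow> {..<l}"
      and near: "cnt V c \<ge> (opt - \<delta>) * real (card V) ^ v"
      and i: "i < l" and small: "real (card {x\<in>V. c x = i}) < c0 * real (card V)" for V c i
  proof -
    let ?n = "real (card V)"
    let ?V = "\<lambda>i. {x\<in>V. c x = i}"
    have n0: "?n > 0" using n by simp
    have nN: "4 \<le> c1 * ?n"
    proof -
      have "4 \<le> c1 * real N" using N c1 by (simp add: field_simps)
      also have "\<dots> \<le> c1 * ?n" using n c1 by simp
      finally show ?thesis .
    qed
    define S where "S = (\<Union>i\<in>{i. i < l \<and> real (card (?V i)) < c1 * ?n}. ?V i)"
    have fS: "finite S" using V by (auto simp: S_def intro!: finite_subset[of _ "{..<l}"])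
    have cS: "real (card S) \<le> real l * (c1 * ?n)"
    proof -
      have f: "finite {i. i < l \<and> real (card (?V i)) < c1 * ?n}" by (rule finite_subset[of _ "{..<l}"]) auto
      have "real (card S) \<le> real (card {i. i < l \<and> real (card (?V i)) < c1 * ?n}) * (c1 * ?n)"
        unfolding S_def by (rule card_UN_le_real[OF f]) simp
      also have "card {i. i < l \<and> real (card (?V i)) < c1 * ?n} \<le> l"
        using card_mono[of "{..<l}" "{i. i < l \<and> real (card (?V i)) < c1 * ?n}"] by auto
      finally show ?thesis using c1 n0 by (simp add: mult_right_mono)
    qed
    obtain \<phi> where \<phi>: "\<phi> \<in> homs VP pc V (cross c)" "\<And>a. a \<in> VP \<Longrightarrow> \<phi> a \<notin> S"
    proof (rule ccontr)
      assume "\<not> thesis"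
      then have "homs VP pc V (cross c) \<subseteq> {\<phi> \<in> VP \<rightarrow>\<^sub>E V. \<exists>a\<in>VP. \<phi> a \<in> S}" using that homs_PiE by blast
      then have "card (homs VP pc V (cross c)) \<le> card {\<phi> \<in> VP \<rightarrow>\<^sub>E V. \<exists>a\<in>VP. \<phi> a \<in> S}"
        by (rule card_mono[rotated]) (simp add: fin V finite_PiE)
      then have "cnt V c \<le> real (card {\<phi> \<in> VP \<rightarrow>\<^sub>E V. \<exists>a\<in>VP. \<phi> a \<in> S})" unfolding cnt_def by (rule of_nat_mono)
      also have "\<dots> \<le> real v * real (card S) * ?n ^ (v - 1)" by (rule card_through[OF V fS])
      also have "\<dots> \<le> real v * (real l * (c1 * ?n)) * ?n ^ (v - 1)"
        by (intro mult_right_mono mult_left_mono cS) auto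
      also have "\<dots> = real v * real l * c1 * (?n * ?n ^ (v - 1))" by (simp only: mult_ac)
      also have "\<dots> = opt/4 * ?n ^ v" using v1 l1 by (simp only: power_v) (simp add: c1_def)
      finally have "(opt - \<delta>) * ?n ^ v \<le> opt/4 * ?n ^ v" using near by linarith
      moreover have "opt/4 < opt - \<delta>" using opt_pos by (simp add: \<delta>_def)
      then have "opt/4 * ?n ^ v < (opt - \<delta>) * ?n ^ v" using n0 by simp
      ultimately show False by linarith
    qed
    define L where "L = (\<lambda>a. c (\<phi> a)) ` VP"
    have fL: "finite L" using fin by (simp add: L_def)
    have L: "j < l" "c1 * ?n \<le> real (card (?V j))" if "j \<in> L" for j
    proof -
      obtain a where a: "a \<in> VP" "j = c (\<phi> a)" using \<open>j \<in> L\<close> by (auto simp: L_def)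
      have "\<phi> a \<in> V" by (rule homs_in[OF \<phi>(1) a(1)])
      then show "j < l" using c a by auto
      then show "c1 * ?n \<le> real (card (?V j))" using \<phi>(2)[OF a(1)] a(2) \<open>\<phi> a \<in> V\<close> by (force simp: S_def)
    qed
    have "c0 * ?n \<le> c1 * ?n" using c01 n0 by simp
    then have iL: "i \<notin> L" using L(2)[of i] small by linarith
    obtain a1 a2 where a12: "a1 \<in> VP" "a2 \<in> VP" "pc a1 \<noteq> pc a2" by (rule two_vertices)
    define p1 p2 where "p1 = pc a1" and "p2 = pc a2"
    have p: "p1 \<in> pc ` VP" "p2 \<in> pc ` VP" "p1 \<noteq> p2" using a12 by (auto simp: p1_def p2_def)
    have "VP \<noteq> {}" using p by auto
    then obtain j where j: "j \<in> L" by (auto simp: L_def)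
    \<comment> \<open>The large parts in \<open>L\<close> together with the tiny part
      \<open>i\<close> offer enough colours to use both \<open>i\<close> and \<open>j\<close>: one
      colour of the pattern goes to the half \<open>A\<close> moved from part \<open>j\<close> to
      part \<open>i\<close>, another to the rest of part \<open>j\<close>. Before the move both
      halves had colour \<open>j\<close>, so these maps are new.\<close>
    have "card (pc ` VP) \<le> card (insert i L)" using colours_of_hom_le[OF \<phi>(1)] iL fL by (simp add: L_def)
    then obtain \<sigma> where \<sigma>: "inj_on \<sigma> (pc ` VP)" "\<sigma> ` pc ` VP \<subseteq> insert i L" "\<sigma> p1 = i" "\<sigma> p2 = j"
    proof -
      assume le: "card (pc ` VP) \<le> card (insert i L)"
      have "\<exists>\<sigma>. inj_on \<sigma> (pc ` VP) \<and> \<sigma> ` pc ` VP \<subseteq> insert i L \<and> \<sigma> p1 = i \<and> \<sigma> p2 = j"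
        by (rule inj_prescribed[OF _ _ p _ _ _ le]) (use fin fL j iL in auto)
      then show thesis using that by blast
    qed
    obtain A where A: "A \<subseteq> ?V j" "card A = card (?V j) div 2" "finite A"
      using obtain_subset_with_card_n[of "card (?V j) div 2" "?V j"] by auto
    define c' where "c' x = (if x \<in> A then i else c x)" for x
    have c': "c' \<in> V \<rightarrow> {..<l}" using c i by (auto simp: c'_def)
    define W where "W a = (if pc a = p1 then A else if pc a = p2 then ?V j - A else ?V (\<sigma> (pc a)))" for a
    have ij: "i \<noteq> j" using iL j by blast
    have Wsub: "W a \<subseteq> {x\<in>V. c' x = \<sigma> (pc a)}" if a: "a \<in> VP" for a
    proof -
      consider "pc a = p1" | "pc a \<noteq> p1" "pc a = p2" | "pc a \<noteq> p1" "pc a \<noteq> p2" by blast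
      then show ?thesis
      proof cases
        case 3
        then have "\<sigma> (pc a) \<noteq> j" using \<sigma>(1,4) p(2) a by (metis imageI inj_onD)
        then show ?thesis using 3 A(1) by (auto simp: W_def c'_def)
      qed (use A(1) \<sigma> p in \<open>auto simp: W_def c'_def\<close>)
    qed
    have Whom: "Pi\<^sub>E VP W \<subseteq> homs VP pc V (cross c')" by (rule PiE_homs[OF \<sigma>(1) Wsub])
    have Vj: "c1 * ?n \<le> real (card (?V j))" "j < l" using L j by auto
    have halves: "c1/4 * ?n \<le> real (card A)" "c1/4 * ?n \<le> real (card (?V j - A))"
    proof -
      have "real (card (?V j)) \<le> 2 * real (card A) + 1" using A(2) by linarith
      then show "c1/4 * ?n \<le> real (card A)" using Vj nN by linarith
      have "card (?V j - A) = card (?V j) - card A" by (rule card_Diff_subset) (use A in auto)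
      then have "real (card (?V j)) \<le> 2 * real (card (?V j - A))" using A(2) by linarith
      then show "c1/4 * ?n \<le> real (card (?V j - A))" using Vj nN by linarith
    qed
    have new: "X * ?n ^ v \<le> real (card (Pi\<^sub>E VP W))"
    proof -
      have "X * ?n ^ v = (\<Prod>a\<in>VP. c1/4 * ?n)" unfolding X_def prod_constant power_mult_distrib ..
      also have "\<dots> \<le> (\<Prod>a\<in>VP. real (card (W a)))"
      proof (rule prod_mono)
        fix a assume a: "a \<in> VP"
        have "c1/4 * ?n \<le> real (card (W a))"
        proof (cases "pc a = p1 \<or> pc a = p2")
          case True then show ?thesis using halves by (auto simp: W_def)
        next
          case False
          then have "\<sigma> (pc a) \<noteq> i" using \<sigma>(1,3) p(1) a by (metis imageI inj_onD)
          then have "\<sigma> (pc a) \<in> L" using \<sigma>(2) a by blast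
          then have "c1 * ?n \<le> real (card (?V (\<sigma> (pc a))))" by (rule L(2))
          moreover have "c1/4 * ?n \<le> c1 * ?n" using c1 n0 by simp
          ultimately show ?thesis using False by (simp add: W_def)
        qed
        then show "0 \<le> c1/4 * ?n \<and> c1/4 * ?n \<le> real (card (W a))" using c1 by simp
      qed
      also have "\<dots> = real (card (Pi\<^sub>E VP W))" using fin by (simp add: card_PiE)
      finally show ?thesis .
    qed
    \<comment> \<open>Splitting part \<open>j\<close> does not hurt a proper map; a clash can only
      arise between \<open>A\<close> and the old vertices of part \<open>i\<close>. Hence only the
      maps in \<open>?T\<close> have to be given up.\<close>
    let ?T = "{\<phi> \<in> VP \<rightarrow>\<^sub>E V. \<exists>a\<in>VP. \<phi> a \<in> ?V i}"
    let ?O = "homs VP pc V (cross c) - ?T"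
    have fT: "finite ?T" by (simp add: fin V finite_PiE)
    have Ohom: "?O \<subseteq> homs VP pc V (cross c')"
    proof
      fix \<psi> assume \<psi>: "\<psi> \<in> ?O"
      then have h: "\<psi> \<in> homs VP pc V (cross c)" by blast
      have ni: "c (\<psi> a) \<noteq> i" if "a \<in> VP" for a
        using \<psi> homs_PiE[OF h] homs_in[OF h that] that by blast
      show "\<psi> \<in> homs VP pc V (cross c')"
      proof (rule homsI[OF homs_PiE[OF h]])
        fix a b assume ab: "a \<in> VP" "b \<in> VP" "pc a \<noteq> pc b"
        have "c (\<psi> a) \<noteq> c (\<psi> b)" using homsD[OF h ab] by (simp add: cross_def)
        then show "cross c' (\<psi> a) (\<psi> b)" using ni[OF ab(1)] ni[OF ab(2)] A(1) by (auto simp: cross_def c'_def)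
      qed
    qed
    have disj: "Pi\<^sub>E VP W \<inter> ?O = {}"
    proof (rule ccontr)
      assume "Pi\<^sub>E VP W \<inter> ?O \<noteq> {}"
      then obtain \<psi> where \<psi>: "\<psi> \<in> Pi\<^sub>E VP W" "\<psi> \<in> homs VP pc V (cross c)" by blast
      obtain a b where ab: "a \<in> VP" "b \<in> VP" "pc a = p1" "pc b = p2" using p by blast
      have "\<psi> a \<in> A" "\<psi> b \<in> ?V j" using PiE_mem[OF \<psi>(1) ab(1)] PiE_mem[OF \<psi>(1) ab(2)] ab p(3) by (auto simp: W_def)
      then have "c (\<psi> a) = c (\<psi> b)" using A(1) by auto
      then show False using homsD[OF \<psi>(2) ab(1,2)] ab p(3) by (simp add: cross_def)
    qed
    have fW: "finite (Pi\<^sub>E VP W)" using finite_subset[OF Whom] fin V by simp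
    have "real (card (Pi\<^sub>E VP W \<union> ?O)) \<le> cnt V c'" by (rule card_subset_homs_le_cnt[OF V]) (use Whom Ohom in blast)
    also have "card (Pi\<^sub>E VP W \<union> ?O) = card (Pi\<^sub>E VP W) + card ?O"
      by (rule card_Un_disjoint[OF fW _ disj]) (use fin V in simp)
    finally have 1: "real (card (Pi\<^sub>E VP W)) + real (card ?O) \<le> cnt V c'" by simp
    have "card (homs VP pc V (cross c)) \<le> card (?O \<union> ?T)" by (rule card_mono) (use fin V fT in auto)
    also have "\<dots> \<le> card ?O + card ?T" by (rule card_Un_le)
    finally have 2: "cnt V c \<le> real (card ?O) + real (card ?T)"
      unfolding cnt_def by (simp only: of_nat_add[symmetric] of_nat_le_iff)
    have "real (card ?T) \<le> real v * real (card (?V i)) * ?n ^ (v - 1)" by (rule card_through[OF V]) (use V in simp)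
    also have "\<dots> \<le> real v * (c0 * ?n) * ?n ^ (v - 1)"
      using small by (intro mult_right_mono mult_left_mono) auto
    also have "\<dots> = real v * c0 * (?n * ?n ^ (v - 1))" by (simp only: mult_ac)
    also have "\<dots> = X/4 * ?n ^ v" using v1 by (simp only: power_v) (simp add: c0_def)
    finally have 3: "real (card ?T) \<le> X/4 * ?n ^ v" .
    have "X * ?n ^ v + (opt - \<delta>) * ?n ^ v - X/4 * ?n ^ v \<le> opt * ?n ^ v"
      using 1 2 3 new near cnt_le_opt[OF V c'] by linarith
    then have "(3 * X/4) * ?n ^ v \<le> \<delta> * ?n ^ v" by (simp add: algebra_simps)
    then have "3 * X/4 \<le> \<delta>" by (rule mult_right_le_imp_le) (use n0 in simp)
    moreover have "\<delta> \<le> X/4" by (simp add: \<delta>_def)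
    ultimately show False using X by linarith
  qed
  have "\<forall>i<l. real (card {x\<in>V. c x = i}) \<ge> c0 * real (card V)"
    if "finite V" "N + 1 \<le> card V" "c \<in> V \<rightarrow> {..<l}" "cnt V c \<ge> (opt - \<delta>) * real (card V) ^ v" for V c
    using main[OF that] by (meson not_le)
  then show ?thesis using c0 c01 c1' \<delta> by (intro exI[of _ c0] exI[of _ \<delta>] conjI exI[of _ "N + 1"]) auto
qed

section \<open>Vertex degrees in near-optimal colourings\<close>

text \<open>The linear coefficient has to be exact, since it becomes the factor \<open>v\<close> in
  the degree bound \<open>opt * v\<close>; the quadratic coefficient only has to be some constant.
  With \<open>3 ^ m\<close> the induction closes because \<open>m \<le> 3 ^ m\<close>.\<close>

lemma one_plus_power_le:
  fixes y :: real assumes "0 \<le> y" "y \<le> 1"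
  shows "(1 + y) ^ m \<le> 1 + real m * y + 3 ^ m * y ^ 2"
proof (induction m)
  case 0 then show ?case using assms by simp
next
  case (Suc m)
  have m: "real m \<le> 3 ^ m" using Bernoulli_inequality[of 2 m] by simp
  have "(1 + y) ^ Suc m \<le> (1 + y) * (1 + real m * y + 3 ^ m * y ^ 2)"
    using mult_left_mono[OF Suc] assms by simp
  also have "\<dots> = 1 + real (Suc m) * y + (real m + 3 ^ m + 3 ^ m * y) * y ^ 2" by (simp add: algebra_simps power2_eq_square)
  also have "\<dots> \<le> 1 + real (Suc m) * y + (3 ^ m + 3 ^ m + 3 ^ m * 1) * y ^ 2"
    by (intro add_left_mono mult_right_mono add_mono mult_left_mono m) (use assms in auto)
  finally show ?case by simp
qed

text \<open>The partial derivative of the homomorphism count in the weight of \<open>x\<close>: a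
  map is counted once for every pattern vertex that it sends to \<open>x\<close>.\<close>

definition degsum :: "nat set \<Rightarrow> (nat \<Rightarrow> nat) \<Rightarrow> nat \<Rightarrow> real" where
  "degsum V c x = (\<Sum>a\<in>VP. real (card {\<phi> \<in> homs VP pc V (cross c). \<phi> a = x}))"

text \<open>Of the maps created by \<open>t\<close> copies of \<open>x\<close>, only those with
  exactly one vertex on a copy are counted: take a map with \<open>\<phi> a = x\<close> and redirect
  \<open>a\<close> to one of the copies. They are pairwise distinct because \<open>a\<close> is the
  only vertex outside \<open>V\<close>. The upper bound is \<open>opt\<close> for the enlarged
  set.\<close>

lemma cnt_add_clones:
  assumes V: "finite V" and c: "c \<in> V \<rightarrow> {..<l}" and x: "x \<in> V"
  shows "cnt V c + real t * degsum V c x \<le> opt * (real (card V) + real t) ^ v"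
proof -
  have "infinite (UNIV - V)" using V by (simp add: Diff_infinite_finite)
  then obtain X where X: "finite X" "card X = t" "X \<subseteq> UNIV - V" using infinite_arbitrarily_large by blast
  define c' where "c' y = (if y \<in> X then c x else c y)" for y
  have cV: "c' y = c y" if "y \<in> V" for y using that X(3) by (auto simp: c'_def)
  have c': "c' \<in> (V \<union> X) \<rightarrow> {..<l}" using c x by (auto simp: c'_def)
  let ?D = "\<lambda>a. {\<phi> \<in> homs VP pc V (cross c). \<phi> a = x}"
  let ?S = "SIGMA z:VP \<times> X. ?D (fst z)"
  let ?f = "\<lambda>(z, \<phi>). \<phi>(fst z := snd z)"
  have fD: "finite (?D a)" for a using fin V by simp
  have new: "?f ` ?S \<subseteq> homs VP pc (V \<union> X) (cross c') - homs VP pc V (cross c)"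
  proof
    fix \<psi> assume "\<psi> \<in> ?f ` ?S"
    then obtain a y \<phi> where z: "a \<in> VP" "y \<in> X" and h: "\<phi> \<in> homs VP pc V (cross c)" and ax: "x = \<phi> a"
      and \<psi>: "\<psi> = \<phi>(a := y)" by auto
    have "\<phi>(a := y) \<in> homs VP pc (V \<union> X) (cross c')"
    proof (rule homsI)
      show "\<phi>(a := y) \<in> VP \<rightarrow>\<^sub>E V \<union> X"
        using homs_PiE[OF h] z by (auto simp: PiE_def extensional_def)
      have cc: "c' ((\<phi>(a := y)) b) = c (\<phi> b)" if "b \<in> VP" for b
        using cV[OF homs_in[OF h that]] z ax by (auto simp: c'_def)
      fix b d assume bd: "b \<in> VP" "d \<in> VP" "pc b \<noteq> pc d"
      then show "cross c' ((\<phi>(a := y)) b) ((\<phi>(a := y)) d)"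
        unfolding cross_def cc[OF bd(1)] cc[OF bd(2)] using homsD[OF h bd] by (simp add: cross_def)
    qed
    moreover have "\<phi>(a := y) \<notin> homs VP pc V (cross c)"
      using homs_in[of "\<phi>(a := y)" VP pc V "cross c" a] z X(3) by auto
    ultimately show "\<psi> \<in> homs VP pc (V \<union> X) (cross c') - homs VP pc V (cross c)" unfolding \<psi> by blast
  qed
  have inj: "inj_on ?f ?S"
  proof (rule inj_onI)
    fix s s' assume s: "s \<in> ?S" "s' \<in> ?S" "?f s = ?f s'"
    obtain a y \<phi> where s1: "s = ((a, y), \<phi>)" by (metis prod.exhaust)
    obtain b y' \<psi> where s2: "s' = ((b, y'), \<psi>)" by (metis prod.exhaust)
    have z: "a \<in> VP" "y \<in> X" "b \<in> VP" "y' \<in> X" and h: "\<phi> \<in> homs VP pc V (cross c)" "\<psi> \<in> homs VP pc V (cross c)"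
      and fx: "\<phi> a = x" "\<psi> b = x" using s(1,2) by (auto simp: s1 s2)
    have e': "\<phi>(a := y) = \<psi>(b := y')" using s(3) by (simp add: s1 s2)
    have "a = b"
    proof (rule ccontr)
      assume "a \<noteq> b"
      then have "y = \<psi> a" using fun_cong[OF e', of a] by simp
      then show False using homs_in[OF h(2) z(1)] z(2) X(3) by auto
    qed
    moreover have "y = y'" using fun_cong[OF e', of a] calculation by simp
    moreover have "\<phi> = \<psi>"
    proof
      fix d show "\<phi> d = \<psi> d"
        using fun_cong[OF e', of d] fx calculation by (cases "d = a") auto
    qed
    ultimately show "s = s'" by (simp add: s1 s2)
  qed
  have old: "homs VP pc V (cross c) \<subseteq> homs VP pc (V \<union> X) (cross c')"
  proof
    fix \<phi> assume h: "\<phi> \<in> homs VP pc V (cross c)"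
    show "\<phi> \<in> homs VP pc (V \<union> X) (cross c')"
    proof (rule homsI)
      show "\<phi> \<in> VP \<rightarrow>\<^sub>E V \<union> X" using homs_PiE[OF h] by (auto simp: PiE_def Pi_def)
      fix b d assume bd: "b \<in> VP" "d \<in> VP" "pc b \<noteq> pc d"
      show "cross c' (\<phi> b) (\<phi> d)"
        unfolding cross_def cV[OF homs_in[OF h bd(1)]] cV[OF homs_in[OF h bd(2)]]
        using homsD[OF h bd] by (simp add: cross_def)
    qed
  qed
  have "card ?S = (\<Sum>z\<in>VP \<times> X. card (?D (fst z)))" using fin X fD by (intro card_SigmaI) auto
  also have "\<dots> = (\<Sum>a\<in>VP. \<Sum>y\<in>X. card (?D a))" unfolding sum.cartesian_product by (rule sum.cong) auto
  also have "\<dots> = t * (\<Sum>a\<in>VP. card (?D a))" using X by (simp add: sum_distrib_left)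
  finally have cS: "real (card ?S) = real t * degsum V c x" by (simp add: degsum_def)
  have "card (?f ` ?S \<union> homs VP pc V (cross c)) = card (?f ` ?S) + card (homs VP pc V (cross c))"
    by (rule card_Un_disjoint) (use new fin V X fD in auto)
  also have "card (?f ` ?S) = card ?S" by (rule card_image[OF inj])
  finally have "real (card (?f ` ?S \<union> homs VP pc V (cross c))) = real t * degsum V c x + cnt V c"
    using cS by (simp only: of_nat_add cnt_def)
  moreover have "real (card (?f ` ?S \<union> homs VP pc V (cross c))) \<le> cnt (V \<union> X) c'"
    by (rule card_subset_homs_le_cnt) (use V X new old in auto)
  moreover have "cnt (V \<union> X) c' \<le> opt * real (card (V \<union> X)) ^ v" by (rule cnt_le_opt) (use V X c' in auto)
  moreover have "card (V \<union> X) = card V + t" using V X by (subst card_Un_disjoint) auto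
  ultimately show ?thesis by simp
qed

text \<open>With \<open>t = y * n\<close> copies of \<open>x\<close> the count grows by at least
  \<open>y * n * degsum V c x\<close>, while the bound \<open>opt * ((1 + y) * n)^v\<close> grows
  only by \<open>opt * v * y * n^v\<close> up to second order. So a larger degree would push the
  density above \<open>opt\<close>.\<close>

lemma degsum_near_opt_le:
  assumes "\<nu> > 0"
  shows "\<exists>\<delta>>0. \<exists>N. \<forall>V c x. finite V \<longrightarrow> N \<le> card V \<longrightarrow> c \<in> V \<rightarrow> {..<l} \<longrightarrow>
     cnt V c \<ge> (opt - \<delta>) * real (card V) ^ v \<longrightarrow> x \<in> V \<longrightarrow>
     degsum V c x \<le> (opt * real v + \<nu>) * real (card V) ^ (v - 1)"
proof -
  \<comment> \<open>The cloned fraction \<open>y\<close> lies between \<open>\<tau>\<close> and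
    \<open>2 * \<tau>\<close>. It is small enough for the second-order term \<open>3^v * y^2\<close>
    to be at most \<open>y * \<nu>/2\<close>, and \<open>\<delta>\<close> is small against it, so
    that the deviation from \<open>opt\<close> also costs at most
    \<open>y * \<nu>/2\<close>.\<close>
  define \<tau> where "\<tau> = min (1/2) (\<nu> / (4 * 3 ^ v))"
  define \<delta> where "\<delta> = \<tau> * \<nu> / 2"
  have \<tau>: "\<tau> > 0" "\<tau> \<le> 1/2" using assms by (auto simp: \<tau>_def)
  have \<delta>: "\<delta> > 0" using \<tau> assms by (simp add: \<delta>_def)
  have \<tau>\<nu>: "3 ^ v * (2 * \<tau>) \<le> \<nu>/2"
  proof -
    have "\<tau> \<le> \<nu> / (4 * 3 ^ v)" by (simp add: \<tau>_def)
    then show ?thesis by (simp add: field_simps)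
  qed
  obtain N :: nat where N: "real N > 1 / \<tau>" using reals_Archimedean2 by blast
  have "degsum V c x \<le> (opt * real v + \<nu>) * real (card V) ^ (v - 1)"
    if V: "finite V" and n: "N + 1 \<le> card V" and c: "c \<in> V \<rightarrow> {..<l}"
      and near: "cnt V c \<ge> (opt - \<delta>) * real (card V) ^ v" and x: "x \<in> V" for V c x
  proof -
    let ?n = "real (card V)"
    have n0: "?n > 0" using n by simp
    define t where "t = nat \<lceil>\<tau> * ?n\<rceil>"
    have "0 \<le> \<tau> * ?n" using \<tau> n0 by simp
    then have t: "\<tau> * ?n \<le> real t" "real t \<le> \<tau> * ?n + 1" unfolding t_def by linarith+
    have "1 \<le> \<tau> * real N" using N \<tau> by (simp add: field_simps)
    also have "\<dots> \<le> \<tau> * ?n" using n \<tau> by simp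
    finally have t2: "real t \<le> 2 * \<tau> * ?n" and tpos: "1 \<le> real t" using t by linarith+
    define y where "y = real t / ?n"
    have y: "\<tau> \<le> y" "y \<le> 2 * \<tau>" using t t2 n0 by (simp_all add: y_def field_simps)
    have y01: "0 \<le> y" "y \<le> 1" "y > 0" using y \<tau> by auto
    have ty: "real t = y * ?n" using n0 by (simp add: y_def)
    have "(opt - \<delta>) * ?n ^ v + y * ?n * degsum V c x \<le> opt * (?n + y * ?n) ^ v"
      using cnt_add_clones[OF V c x, of t] near unfolding ty by linarith
    also have "?n + y * ?n = (1 + y) * ?n" by (simp add: algebra_simps)
    also have "opt * ((1 + y) * ?n) ^ v = opt * (1 + y) ^ v * ?n ^ v" by (simp add: power_mult_distrib)
    also have "\<dots> \<le> (opt + opt * real v * y + 3 ^ v * y ^ 2) * ?n ^ v"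
    proof (rule mult_right_mono)
      have "opt * (1 + y) ^ v \<le> opt * (1 + real v * y + 3 ^ v * y ^ 2)"
        using one_plus_power_le[OF y01(1,2), of v] opt_pos by simp
      also have "\<dots> = opt + opt * real v * y + opt * (3 ^ v * y ^ 2)" by (simp add: algebra_simps)
      also have "opt * (3 ^ v * y ^ 2) \<le> 1 * (3 ^ v * y ^ 2)" by (rule mult_right_mono[OF opt_le_1]) simp
      finally show "opt * (1 + y) ^ v \<le> opt + opt * real v * y + 3 ^ v * y ^ 2" by simp
    qed simp
    finally have "y * ?n * degsum V c x \<le> (\<delta> + opt * real v * y + 3 ^ v * y ^ 2) * ?n ^ v" by (simp add: algebra_simps)
    also have "\<dots> \<le> (y * (\<nu>/2) + opt * real v * y + y * (\<nu>/2)) * ?n ^ v"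
    proof (intro mult_right_mono add_mono order_refl)
      show "\<delta> \<le> y * (\<nu>/2)" using y(1) assms mult_right_mono[OF y(1), of "\<nu>/2"] by (simp add: \<delta>_def)
      have "3 ^ v * y \<le> 3 ^ v * (2 * \<tau>)" using y(2) by simp
      then have "3 ^ v * y \<le> \<nu>/2" using \<tau>\<nu> by linarith
      then have "y * (3 ^ v * y) \<le> y * (\<nu>/2)" by (rule mult_left_mono) (use y01 in simp)
      then show "3 ^ v * y ^ 2 \<le> y * (\<nu>/2)" by (simp only: power2_eq_square mult_ac)
    qed (use y01 in auto)
    also have "\<dots> = y * ((opt * real v + \<nu>) * ?n ^ v)" by (simp add: algebra_simps)
    also have "?n ^ v = ?n * ?n ^ (v - 1)" by (simp only: power_v)
    finally have "(y * ?n) * degsum V c x \<le> (y * ?n) * ((opt * real v + \<nu>) * ?n ^ (v - 1))" by (simp only: mult_ac)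
    then show ?thesis by (rule mult_left_le_imp_le) (use y01 n0 in simp)
  qed
  then show ?thesis using \<delta> by blast
qed

end

section \<open>A penalized density bound\<close>

lemma sum_card_SIGMA_le_real:
  assumes "finite X" "\<And>x. x \<in> X \<Longrightarrow> finite (A x)" "\<And>x. x \<in> X \<Longrightarrow> real (card (A x)) \<le> q"
  shows "real (card (SIGMA x:X. A x)) \<le> real (card X) * q"
proof -
  have "real (card (SIGMA x:X. A x)) = (\<Sum>x\<in>X. real (card (A x)))" using assms by simp
  also have "\<dots> \<le> real (card X) * q" by (rule sum_bounded_above) (use assms in auto)
  finally show ?thesis .
qed

text \<open>Each of at most \<open>m^2\<close> pairs of coordinates is nonadjacent in at most
  \<open>card S * d * card S ^ (m - 2)\<close> tuples; the assumption on \<open>d\<close> makes this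
  at most half of all tuples.\<close>

lemma card_cliques_sparse_nonadjacency:
  assumes S: "finite S" and d: "\<And>x. x \<in> S \<Longrightarrow> real (card {y\<in>S. \<not> E x y}) \<le> d"
    and d': "2 * real m ^ 2 * d \<le> real (card S)" and m: "2 \<le> m"
  shows "real (card (homs {..<m} id S E)) \<ge> real (card S) ^ m / 2"
proof -
  let ?s = "real (card S)"
  define R where "R = {(x, y) \<in> S \<times> S. \<not> E x y}"
  have "R = (SIGMA x:S. {y\<in>S. \<not> E x y})" by (auto simp: R_def)
  then have cR: "real (card R) \<le> ?s * d" using sum_card_SIGMA_le_real[OF S _ d] S by simp
  have fR: "finite R" unfolding R_def by (rule finite_subset[of _ "S \<times> S"]) (use S in auto)
  let ?P = "{..<m} \<times> {..<m} - Id"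
  let ?B = "\<Union>z\<in>?P. {f \<in> {..<m} \<rightarrow>\<^sub>E S. (f (fst z), f (snd z)) \<in> R}"
  have fB: "finite ?B" using S by (auto intro!: finite_UN_I finite_PiE)
  have cB: "real (card ?B) \<le> real (card ?P) * (?s * d * ?s ^ (m - 2))"
  proof (rule card_UN_le_real)
    fix z assume z: "z \<in> ?P"
    have "card {f \<in> {..<m} \<rightarrow>\<^sub>E S. (f (fst z), f (snd z)) \<in> R} \<le> card R * card S ^ (card {..<m} - 2)"
      by (rule card_pair_fixed_le) (use z S fR in auto)
    then have "real (card {f \<in> {..<m} \<rightarrow>\<^sub>E S. (f (fst z), f (snd z)) \<in> R}) \<le> real (card R * card S ^ (card {..<m} - 2))"
      by (rule of_nat_mono)
    also have "\<dots> \<le> ?s * d * ?s ^ (m - 2)" using cR by (simp add: mult_right_mono)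
    finally show "real (card {f \<in> {..<m} \<rightarrow>\<^sub>E S. (f (fst z), f (snd z)) \<in> R}) \<le> ?s * d * ?s ^ (m - 2)" .
  qed simp
  have "0 \<le> ?s * d" using cR by linarith
  have "card ?P \<le> card ({..<m} \<times> {..<m})" by (rule card_mono) auto
  then have "real (card ?P) \<le> real (m * m)" unfolding card_cartesian_product card_lessThan by (rule of_nat_mono)
  then have "real (card ?P) * (?s * d * ?s ^ (m - 2)) \<le> real m ^ 2 * (?s * d * ?s ^ (m - 2))"
    using \<open>0 \<le> ?s * d\<close> by (intro mult_right_mono) (simp_all add: power2_eq_square)
  also have "\<dots> = (real m ^ 2 * d) * (?s * ?s ^ (m - 2))" by (simp only: mult_ac)
  also have "\<dots> \<le> (?s / 2) * (?s * ?s ^ (m - 2))" by (rule mult_right_mono) (use d' in auto)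
  also have "\<dots> = ?s ^ m / 2"
  proof -
    obtain k where "m = 2 + k" using m le_Suc_ex by blast
    then show ?thesis by simp
  qed
  finally have cB': "real (card ?B) \<le> ?s ^ m / 2" using cB by linarith
  have sub: "{..<m} \<rightarrow>\<^sub>E S \<subseteq> homs {..<m} id S E \<union> ?B"
  proof
    fix f assume f: "f \<in> {..<m} \<rightarrow>\<^sub>E S"
    show "f \<in> homs {..<m} id S E \<union> ?B"
    proof (cases "f \<in> homs {..<m} id S E")
      case False
      then obtain i j where ij: "i < m" "j < m" "i \<noteq> j" "\<not> E (f i) (f j)" using f by (auto simp: homs_def)
      have "f i \<in> S" "f j \<in> S" using f ij by auto
      then have "f \<in> {f \<in> {..<m} \<rightarrow>\<^sub>E S. (f (fst (i, j)), f (snd (i, j))) \<in> R}" using f ij(4) by (simp add: R_def)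
      moreover have "(i, j) \<in> ?P" using ij by auto
      ultimately show ?thesis by blast
    qed blast
  qed
  have "card ({..<m} \<rightarrow>\<^sub>E S) \<le> card (homs {..<m} id S E \<union> ?B)" by (rule card_mono[OF _ sub]) (use S fB in simp)
  also have "\<dots> \<le> card (homs {..<m} id S E) + card ?B" by (rule card_Un_le)
  finally have "card S ^ m \<le> card (homs {..<m} id S E) + card ?B" by (simp only: card_PiE_const finite_lessThan card_lessThan)
  then have "?s ^ m \<le> real (card (homs {..<m} id S E)) + real (card ?B)"
    by (simp only: of_nat_add[symmetric] of_nat_power[symmetric] of_nat_le_iff)
  then show ?thesis using cB' by linarith
qed

lemma homs_mono: "V \<subseteq> V' \<Longrightarrow> homs I p V E \<subseteq> homs I p V' E"
  by (auto simp: homs_def PiE_def Pi_def)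

context colour_pattern
begin

abbreviation hP :: "nat set \<Rightarrow> (nat \<Rightarrow> nat \<Rightarrow> bool) \<Rightarrow> real" where "hP V E \<equiv> real (card (homs VP pc V E))"
abbreviation hK :: "nat set \<Rightarrow> (nat \<Rightarrow> nat \<Rightarrow> bool) \<Rightarrow> real" where "hK V E \<equiv> real (card (homs {..<l + 1} (id :: nat \<Rightarrow> nat) V E))"

text \<open>Here nonadjacency is an equivalence. If small classes cover \<open>w * n\<close>
  vertices, almost all tuples in them are cliques; if there are \<open>l + 1\<close> large classes,
  their transversals are cliques. Otherwise the large classes serve as colours, and only maps
  through the few remaining vertices are not controlled.\<close>

lemma complete_multipartite_cases:
  assumes w: "w > 0"
  shows "\<exists>\<kappa>>0. \<forall>V E. finite V \<longrightarrow> V \<noteq> {} \<longrightarrow> graph_on V E \<longrightarrow>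
    (\<forall>x\<in>V. \<forall>y\<in>V. \<forall>z\<in>V. \<not> E x y \<longrightarrow> E x z = E y z) \<longrightarrow>
    hK V E \<ge> \<kappa> * real (card V) ^ (l + 1) \<or>
    (\<exists>c \<in> V \<rightarrow> {..<l}. missing V c E = {} \<and> hP V E \<le> cnt V c + real v * w * real (card V) ^ v)"
proof -
  \<comment> \<open>Chosen so that classes below \<open>c2 * n\<close> meet the sparsity condition
    of \<open>card_cliques_sparse_nonadjacency\<close> inside a set of \<open>w * n\<close>
    vertices.\<close>
  define c2 where "c2 = w / (2 * real (l + 1) ^ 2)"
  have c2: "c2 > 0" using w by (simp add: c2_def)
  have c2': "2 * real (l + 1) ^ 2 * c2 = w" by (simp add: c2_def)
  define \<kappa> where "\<kappa> = min (c2 ^ (l + 1)) (w ^ (l + 1) / 2)"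
  have \<kappa>: "\<kappa> > 0" using c2 w by (simp add: \<kappa>_def)
  have main: "hK V E \<ge> \<kappa> * real (card V) ^ (l + 1) \<or>
    (\<exists>c \<in> V \<rightarrow> {..<l}. missing V c E = {} \<and> hP V E \<le> cnt V c + real v * w * real (card V) ^ v)"
    if V: "finite V" "V \<noteq> {}" and g: "graph_on V E"
      and eqv: "\<And>x y z. x \<in> V \<Longrightarrow> y \<in> V \<Longrightarrow> z \<in> V \<Longrightarrow> \<not> E x y \<Longrightarrow> E x z = E y z" for V :: "nat set" and E
  proof -
    let ?n = "real (card V)"
    have n0: "?n > 0" using V by (simp add: card_gt_0_iff)
    define C where "C x = {y\<in>V. \<not> E x y}" for x
    have self: "x \<in> C x" if "x \<in> V" for x using that graph_on_irrefl[OF g that] by (simp add: C_def)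
    have Ceq: "C x = C y" if "x \<in> V" "y \<in> V" "\<not> E x y" for x y
      using eqv[OF that(1,2) _ that(3)] by (auto simp: C_def)
    have Cne: "C x \<noteq> C y" if "x \<in> V" "y \<in> V" "E x y" for x y
      using self[OF that(2)] that by (auto simp: C_def)
    define S where "S = {x\<in>V. real (card (C x)) < c2 * ?n}"
    have fS: "finite S" "S \<subseteq> V" using V by (auto simp: S_def)
    show ?thesis
    proof (cases "real (card S) \<ge> w * ?n")
      case True
      have "real (card S) ^ (l + 1) / 2 \<le> real (card (homs {..<l + 1} id S E))"
      proof (rule card_cliques_sparse_nonadjacency[OF fS(1), where d = "c2 * ?n"])
        fix x assume x: "x \<in> S"
        have "card {y\<in>S. \<not> E x y} \<le> card (C x)" by (rule card_mono) (use V fS in \<open>auto simp: C_def\<close>)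
        then show "real (card {y\<in>S. \<not> E x y}) \<le> c2 * ?n" using x by (simp add: S_def)
      next
        have "2 * real (l + 1) ^ 2 * (c2 * ?n) = w * ?n" using c2' by (simp only: mult.assoc[symmetric])
        then show "2 * real (l + 1) ^ 2 * (c2 * ?n) \<le> real (card S)" using True by linarith
      qed (use l_ge_2 in simp)
      also have "card (homs {..<l + 1} (id :: nat \<Rightarrow> nat) S E) \<le> card (homs {..<l + 1} (id :: nat \<Rightarrow> nat) V E)"
        by (rule card_mono[OF _ homs_mono[OF fS(2)]]) (use V in simp)
      finally have 1: "real (card S) ^ (l + 1) / 2 \<le> hK V E" by simp
      have "\<kappa> * ?n ^ (l + 1) \<le> w ^ (l + 1) / 2 * ?n ^ (l + 1)" by (rule mult_right_mono) (auto simp: \<kappa>_def)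
      also have "\<dots> = (w * ?n) ^ (l + 1) / 2" by (simp only: power_mult_distrib times_divide_eq_left)
      also have "\<dots> \<le> real (card S) ^ (l + 1) / 2" by (intro divide_right_mono power_mono True) (use w n0 in auto)
      finally show ?thesis using 1 by linarith
    next
      case False
      define D where "D = C ` (V - S)"
      have fD: "finite D" using V by (simp add: D_def)
      show ?thesis
      proof (cases "l + 1 \<le> card D")
        case True
        obtain f where f: "f ` {..<l + 1} \<subseteq> D" "inj_on f {..<l + 1}"
          using card_le_inj[of "{..<l + 1}" D] fD True by auto
        have fi: "c2 * ?n \<le> real (card (f i))" if i: "i < l + 1" for i
        proof -
          have "f i \<in> D" using f(1) i by blast
          then obtain x where x: "x \<in> V - S" "f i = C x" unfolding D_def by blast
          then show ?thesis by (auto simp: S_def)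
        qed
        have "Pi\<^sub>E {..<l + 1} f \<subseteq> homs {..<l + 1} id V E"
        proof
          fix h assume h: "h \<in> Pi\<^sub>E {..<l + 1} f"
          have hi: "h i \<in> V \<and> f i = C (h i)" if i: "i < l + 1" for i
          proof -
            have "f i \<in> D" using f(1) i by blast
            then obtain x where x: "x \<in> V" "f i = C x" unfolding D_def by blast
            have "h i \<in> C x" using PiE_mem[OF h, of i] i x by simp
            then have "h i \<in> V" "\<not> E x (h i)" by (auto simp: C_def)
            then show ?thesis using Ceq[OF x(1)] x(2) by blast
          qed
          show "h \<in> homs {..<l + 1} id V E"
          proof (rule homsI)
            show "h \<in> {..<l + 1} \<rightarrow>\<^sub>E V" by (rule PiE_I) (use hi PiE_arb[OF h] in auto)
            fix i j assume ij: "i \<in> {..<l + 1}" "j \<in> {..<l + 1}" "id i \<noteq> id j"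
            have "f i \<noteq> f j" using inj_onD[OF f(2) _ ij(1,2)] ij(3) by auto
            then show "E (h i) (h j)" using Ceq[of "h i" "h j"] hi[of i] hi[of j] ij by fastforce
          qed
        qed
        then have "card (Pi\<^sub>E {..<l + 1} f) \<le> card (homs {..<l + 1} (id :: nat \<Rightarrow> nat) V E)"
          by (rule card_mono[rotated]) (use V in simp)
        then have 1: "real (card (Pi\<^sub>E {..<l + 1} f)) \<le> hK V E" by (rule of_nat_mono)
        have "\<kappa> * ?n ^ (l + 1) \<le> c2 ^ (l + 1) * ?n ^ (l + 1)" by (rule mult_right_mono) (auto simp: \<kappa>_def)
        also have "\<dots> = (\<Prod>i<l + 1. c2 * ?n)" by (simp only: power_mult_distrib prod_constant card_lessThan)
        also have "\<dots> \<le> (\<Prod>i<l + 1. real (card (f i)))" by (rule prod_mono) (use fi c2 in auto)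
        also have "\<dots> = real (card (Pi\<^sub>E {..<l + 1} f))" by (simp add: card_PiE)
        finally show ?thesis using 1 by linarith
      next
        case False': False
        obtain f where f: "f ` D \<subseteq> {..<l}" "inj_on f D"
          using card_le_inj[of D "{..<l}"] fD False' by auto
        \<comment> \<open>All small classes are merged into colour \<open>0\<close>, possibly
          together with a large one. Colours are still constant on classes, so no pair is missing;
          the maps lost by the merging pass through \<open>S\<close>.\<close>
        define c where "c x = (if x \<in> S then 0 else f (C x))" for x
        have c: "c \<in> V \<rightarrow> {..<l}" proof
          fix x assume "x \<in> V"
          then have "f (C x) \<in> {..<l}" if "x \<notin> S" using f(1) that unfolding D_def by blast
          then show "c x \<in> {..<l}" using l_ge_2 by (simp add: c_def)
        qed
        have "missing V c E = {}"
        proof (rule ccontr)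
          assume "missing V c E \<noteq> {}"
          then obtain x y where xy: "x \<in> V" "y \<in> V" "c x \<noteq> c y" "\<not> E x y" unfolding missing_def by blast
          then have e: "C x = C y" using Ceq by blast
          then have "x \<in> S \<longleftrightarrow> y \<in> S" using xy by (simp add: S_def)
          then show False using xy(3) e unfolding c_def by (metis (full_types))
        qed
        moreover have "hP V E \<le> cnt V c + real v * w * ?n ^ v"
        proof -
          let ?T = "{\<phi> \<in> VP \<rightarrow>\<^sub>E V. \<exists>a\<in>VP. \<phi> a \<in> S}"
          have "finite (VP \<rightarrow>\<^sub>E V)" by (rule finite_PiE[OF fin]) (rule V(1))
          then have fT: "finite ?T" by (rule finite_subset[rotated]) blast
          have sub: "homs VP pc V E \<subseteq> homs VP pc V (cross c) \<union> ?T"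
          proof
            fix \<phi> assume h: "\<phi> \<in> homs VP pc V E"
            show "\<phi> \<in> homs VP pc V (cross c) \<union> ?T"
            proof (cases "\<exists>a\<in>VP. \<phi> a \<in> S")
              case True then show ?thesis using homs_PiE[OF h] by blast
            next
              case False
              have "\<phi> \<in> homs VP pc V (cross c)"
              proof (rule homsI[OF homs_PiE[OF h]])
                fix a b assume ab: "a \<in> VP" "b \<in> VP" "pc a \<noteq> pc b"
                have ne: "C (\<phi> a) \<noteq> C (\<phi> b)"
                  by (rule Cne[OF homs_in[OF h ab(1)] homs_in[OF h ab(2)] homsD[OF h ab]])
                have "C (\<phi> a) \<in> D" "C (\<phi> b) \<in> D" using False ab homs_in[OF h] by (auto simp: D_def)
                then have "f (C (\<phi> a)) \<noteq> f (C (\<phi> b))" using inj_onD[OF f(2)] ne by blast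
                then show "cross c (\<phi> a) (\<phi> b)" using False ab by (simp add: cross_def c_def)
              qed
              then show ?thesis by blast
            qed
          qed
          have "card (homs VP pc V E) \<le> card (homs VP pc V (cross c) \<union> ?T)"
            by (rule card_mono[OF finite_UnI[OF finite_homs[OF fin V(1)] fT] sub])
          also have "\<dots> \<le> card (homs VP pc V (cross c)) + card ?T" by (rule card_Un_le)
          finally have "hP V E \<le> cnt V c + real (card ?T)"
            unfolding cnt_def by (simp only: of_nat_add[symmetric] of_nat_le_iff)
          also have "real (card ?T) \<le> real v * real (card S) * ?n ^ (v - 1)" by (rule card_through[OF V(1) fS(1)])
          also have "\<dots> \<le> real v * (w * ?n) * ?n ^ (v - 1)"
            using False by (intro mult_right_mono mult_left_mono) auto
          also have "\<dots> = real v * w * (?n * ?n ^ (v - 1))" by (simp only: mult_ac)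
          also have "\<dots> = real v * w * ?n ^ v" by (simp only: power_v)
          finally show ?thesis by simp
        qed
        ultimately show ?thesis using c by blast
      qed
    qed
  qed
  show ?thesis
  proof (intro exI[of _ \<kappa>] conjI allI impI \<kappa>)
    fix V :: "nat set" and E assume V: "finite V" "V \<noteq> {}" and g: "graph_on V E"
      and eqv: "\<forall>x\<in>V. \<forall>y\<in>V. \<forall>z\<in>V. \<not> E x y \<longrightarrow> E x z = E y z"
    show "hK V E \<ge> \<kappa> * real (card V) ^ (l + 1) \<or>
      (\<exists>c \<in> V \<rightarrow> {..<l}. missing V c E = {} \<and> hP V E \<le> cnt V c + real v * w * real (card V) ^ v)"
      by (rule main[OF V g eqv[rule_format]])
  qed
qed

text \<open>By symmetrization it suffices to treat complete multipartite graphs. If such a graph has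
  many cliques, \<open>M * \<kappa> \<ge> 1\<close> makes the penalty exceed every possible density;
  otherwise the graph is compared with an \<open>l\<close>-colouring, whose density is at most
  \<open>opt\<close>.\<close>

lemma penalized_density_le:
  assumes w: "w > 0"
  shows "\<exists>M\<ge>1. \<forall>V E. finite V \<longrightarrow> V \<noteq> {} \<longrightarrow> graph_on V E \<longrightarrow>
    hP V E / real (card V) ^ v \<le> opt + w + M * (hK V E / real (card V) ^ (l + 1))"
proof -
  have v0: "real v > 0" using v_ge_2 by simp
  have "w / real v > 0" using w v0 by simp
  from complete_multipartite_cases[OF this] obtain \<kappa> where \<kappa>: "\<kappa> > 0"
    and cm: "\<forall>V E. finite V \<longrightarrow> V \<noteq> {} \<longrightarrow> graph_on V E \<longrightarrow>
    (\<forall>x\<in>V. \<forall>y\<in>V. \<forall>z\<in>V. \<not> E x y \<longrightarrow> E x z = E y z) \<longrightarrow>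
    hK V E \<ge> \<kappa> * real (card V) ^ (l + 1) \<or>
    (\<exists>c \<in> V \<rightarrow> {..<l}. missing V c E = {} \<and> hP V E \<le> cnt V c + real v * (w / real v) * real (card V) ^ v)"
    by (elim exE conjE) (rule that)
  define M where "M = max 1 (1 / \<kappa>)"
  have M: "M \<ge> 1" "M * \<kappa> \<ge> 1" using \<kappa> by (auto simp: M_def max_def field_simps)
  have "hP V E0 / real (card V) ^ v \<le> opt + w + M * (hK V E0 / real (card V) ^ (l + 1))"
    if V: "finite V" "V \<noteq> {}" and g0: "graph_on V E0" for V E0
  proof -
    let ?n = "real (card V)"
    have n0: "?n > 0" using V by (simp add: card_gt_0_iff)
    have "1 / ?n ^ v * hP V E0 - M / ?n ^ (l + 1) * hK V E0 \<le> opt + w"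
    proof (rule zykov_induct[where I = VP and p = pc and V = V and m = "l + 1" and a = "1 / ?n ^ v" and b = "M / ?n ^ (l + 1)"
          and Q = "\<lambda>E. 1 / ?n ^ v * hP V E - M / ?n ^ (l + 1) * hK V E \<le> opt + w", OF fin V(1) _ _ _ _ g0])
      fix E assume g: "graph_on V E" and eqv: "\<And>x y z. x \<in> V \<Longrightarrow> y \<in> V \<Longrightarrow> z \<in> V \<Longrightarrow> \<not> E x y \<Longrightarrow> E x z = E y z"
      consider "hK V E \<ge> \<kappa> * ?n ^ (l + 1)"
        | c where "c \<in> V \<rightarrow> {..<l}" "hP V E \<le> cnt V c + real v * (w / real v) * ?n ^ v"
      proof -
        have "hK V E \<ge> \<kappa> * ?n ^ (l + 1) \<or>
            (\<exists>c \<in> V \<rightarrow> {..<l}. missing V c E = {} \<and> hP V E \<le> cnt V c + real v * (w / real v) * ?n ^ v)"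
          by (rule cm[rule_format, OF V g eqv])
        then show thesis using that by blast
      qed
      then show "1 / ?n ^ v * hP V E - M / ?n ^ (l + 1) * hK V E \<le> opt + w"
      proof cases
        case 1
        have "M / ?n ^ (l + 1) * (\<kappa> * ?n ^ (l + 1)) \<le> M / ?n ^ (l + 1) * hK V E"
          by (rule mult_left_mono[OF 1]) (use M n0 in auto)
        moreover have "M / ?n ^ (l + 1) * (\<kappa> * ?n ^ (l + 1)) = M * \<kappa>" using n0 by simp
        moreover have "hP V E \<le> ?n ^ v" using card_homs_le[OF fin V(1), of pc E] by (simp flip: of_nat_power)
        then have "1 / ?n ^ v * hP V E \<le> 1" using n0 by (simp add: divide_le_eq)
        ultimately show ?thesis using M opt_pos w by linarith
      next
        case 2
        have "hP V E \<le> (opt + w) * ?n ^ v" using 2(2) cnt_le_opt[OF V(1) 2(1)] v0 by (simp add: algebra_simps)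
        then have "1 / ?n ^ v * hP V E \<le> opt + w" using n0 by (simp add: divide_le_eq)
        moreover have "0 \<le> M / ?n ^ (l + 1) * hK V E" using M n0 by simp
        ultimately show ?thesis by linarith
      qed
    next
      fix E u z
      assume "1 / ?n ^ v * hP V E - M / ?n ^ (l + 1) * hK V E \<le> 1 / ?n ^ v * hP V (clone u z E) - M / ?n ^ (l + 1) * hK V (clone u z E)"
        and "1 / ?n ^ v * hP V (clone u z E) - M / ?n ^ (l + 1) * hK V (clone u z E) \<le> opt + w"
      then show "1 / ?n ^ v * hP V E - M / ?n ^ (l + 1) * hK V E \<le> opt + w" by linarith
    qed (use M n0 in auto)
    then show ?thesis by simp
  qed
  then show ?thesis using M(1) by (intro exI[of _ M] conjI allI impI)
qed

end

section \<open>Stability\<close>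

lemma card_le_of_weighted:
  fixes N :: real
  assumes "N * (\<beta> * n ^ a) \<le> \<xi> * n ^ (a + b)" "n > 0" "\<beta> > 0"
  shows "N \<le> \<xi> / \<beta> * n ^ b"
proof -
  have "(N * \<beta>) * n ^ a \<le> (\<xi> * n ^ b) * n ^ a" using assms(1) by (simp only: power_add mult_ac)
  then have "N * \<beta> \<le> \<xi> * n ^ b" by (rule mult_right_le_imp_le) (use assms(2) in simp)
  then show ?thesis using assms(3) by (simp add: field_simps)
qed

context colour_pattern
begin

text \<open>Edges inside parts are few for three reasons. An inside edge between vertices with few
  missing pairs extends to \<open>\<beta> * n^(l-1)\<close> transversal cliques, and a vertex with
  \<open>\<gamma> * n\<close> neighbours in every part extends to \<open>\<beta> * n^l\<close>; the
  clique bound limits both (the sets \<open>X\<close> and \<open>VB\<close>). Every other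
  exceptional vertex is moved to a part where it has fewer than \<open>\<gamma> * n\<close>
  neighbours. The set \<open>B\<close> of exceptional vertices has size
  \<open>O(\<eta> * n)\<close>, so its contribution is \<open>\<eta>\<close> times a small factor,
  and this factor is the source of the self-improvement.\<close>

lemma inside_after_reassignment:
  assumes V: "finite V" "V \<noteq> {}" and g: "graph_on V E" and c: "c \<in> V \<rightarrow> {..<l}"
    and parts: "\<And>i. i < l \<Longrightarrow> c0 * real (card V) \<le> real (card {x\<in>V. c x = i})" and c0: "c0 > 0"
    and \<eta>: "\<eta> \<ge> 0" and \<gamma>: "\<gamma> > 0" and miss: "real (card (missing V c E)) \<le> (2 * \<eta>) * real (card V) ^ 2"
    and hK: "hK V E \<le> \<xi> * real (card V) ^ (l + 1)"
    and \<beta>: "\<beta> > 0" "\<beta> \<le> (c0/2) ^ (l - 1) - real l ^ 2 * (2 * \<eta>)" "\<beta> \<le> \<gamma> ^ l - real l ^ 2 * (2 * \<eta>)"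
  shows "\<exists>c' \<in> V \<rightarrow> {..<l}. real (card (inside V c' E)) \<le>
    (3 * (\<xi>/\<beta>) + 2 * (8 * \<eta> / c0) * (8 * \<eta> / c0 + \<gamma>)) * real (card V) ^ 2"
proof -
  define n where "n = real (card V)"
  have n0: "n > 0" using V by (simp add: n_def card_gt_0_iff)
  define Mi where "Mi x = {y\<in>V. c x \<noteq> c y \<and> \<not> E x y}" for x
  define B where "B = {x\<in>V. real (card (Mi x)) \<ge> c0/4 * n}"
  define N where "N x i = {y\<in>V. c y = i \<and> E x y}" for x i
  define VB where "VB = {x\<in>B. \<forall>i<l. real (card (N x i)) \<ge> \<gamma> * n}"
  have fB: "finite B" "B \<subseteq> V" using V by (auto simp: B_def)
  have fVB: "finite VB" "VB \<subseteq> V" using fB by (auto simp: VB_def)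
  have fMi: "finite (Mi x)" for x using V by (simp add: Mi_def)
  have cB: "real (card B) \<le> 8 * \<eta> / c0 * n"
  proof -
    have "real (card B) * (c0/4 * n) \<le> real (card (SIGMA x:B. Mi x))"
      by (rule card_SIGMA_ge_real[OF fB(1) fMi]) (simp add: B_def)
    also have "card (SIGMA x:B. Mi x) \<le> card (missing V c E)"
      by (rule card_mono[OF finite_missing[OF V(1)]]) (use fB in \<open>auto simp: missing_def Mi_def\<close>)
    finally have "real (card B) * (c0/4 * n) \<le> (2 * \<eta>) * n ^ 2" using miss by (simp add: n_def)
    then have "(real (card B) * c0) * n \<le> (8 * \<eta> * n) * n" by (simp add: power2_eq_square algebra_simps)
    then have "real (card B) * c0 \<le> 8 * \<eta> * n" by (rule mult_right_le_imp_le) (rule n0)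
    then show ?thesis using c0 by (simp add: field_simps)
  qed
  define X where "X = {(x, y) \<in> (V - B) \<times> (V - B). c x = c y \<and> E x y}"
  have fX: "finite X" unfolding X_def by (rule finite_subset[of _ "V \<times> V"]) (use V in auto)
  have fK: "finite (homs {..<l + 1} id V E)" using V by simp
  have card_le_hK: "real (card S) \<le> \<xi> * n ^ (l + 1)" if "inj_on f S" "f ` S \<subseteq> homs {..<l + 1} id V E"
    for f :: "'x \<Rightarrow> nat \<Rightarrow> nat" and S
    using of_nat_mono[OF card_inj_on_le[OF that fK]] hK by (auto simp: n_def intro: order_trans)
  have cX: "real (card X) \<le> \<xi>/\<beta> * n ^ 2"
  proof -
    define J where "J z = {..<l} - {c (fst z)}" for z :: "nat \<times> nat"
    define A where "A z j = {w\<in>V. c w = j \<and> E (fst z) w \<and> E (snd z) w}" for z j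
    define T where "T z = {f \<in> Pi\<^sub>E (J z) (A z). \<forall>i\<in>J z. \<forall>j\<in>J z. i \<noteq> j \<longrightarrow> E (f i) (f j)}" for z
    have cT: "\<beta> * n ^ (l - 1) \<le> real (card (T z))" and fT: "finite (T z)" if z: "z \<in> X" for z
    proof -
      have xy: "fst z \<in> V" "snd z \<in> V" "fst z \<notin> B" "snd z \<notin> B" "c (fst z) = c (snd z)"
        using z by (auto simp: X_def)
      have cl: "c (fst z) < l" using c xy by auto
      have cJ: "card (J z) = l - 1" using cl by (simp add: J_def)
      have "(((c0/2)) ^ card (J z) - real (card (J z)) ^ 2 * (2 * \<eta>)) * real (card V) ^ card (J z) \<le> real (card (T z))"
        unfolding T_def
      proof (rule card_transversal_cliques[OF _ V(1)])
        show "finite (J z)" by (simp add: J_def)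
        show "A z j \<subseteq> {x\<in>V. c x = j}" for j by (auto simp: A_def)
        show "0 \<le> c0/2" using c0 by simp
        show "real (card (missing V c E)) \<le> (2 * \<eta>) * real (card V) ^ 2" by (rule miss)
        fix j assume j: "j \<in> J z"
        have "{x\<in>V. c x = j} \<subseteq> A z j \<union> (Mi (fst z) \<union> Mi (snd z))"
          using j xy by (auto simp: A_def Mi_def J_def)
        then have "card {x\<in>V. c x = j} \<le> card (A z j \<union> (Mi (fst z) \<union> Mi (snd z)))"
          by (rule card_mono[rotated]) (use V fMi in \<open>simp add: A_def\<close>)
        also have "\<dots> \<le> card (A z j) + (card (Mi (fst z)) + card (Mi (snd z)))"
          using card_Un_le[of "A z j" "Mi (fst z) \<union> Mi (snd z)"] card_Un_le[of "Mi (fst z)" "Mi (snd z)"] by linarith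
        finally have "real (card {x\<in>V. c x = j}) \<le> real (card (A z j)) + (real (card (Mi (fst z))) + real (card (Mi (snd z))))"
          by (simp only: of_nat_add[symmetric] of_nat_le_iff)
        moreover have "real (card (Mi (fst z))) \<le> c0/4 * n" "real (card (Mi (snd z))) \<le> c0/4 * n"
          using xy by (auto simp: B_def)
        moreover have "c0 * n \<le> real (card {x\<in>V. c x = j})" using parts[of j] j by (simp add: J_def n_def)
        ultimately show "c0/2 * real (card V) \<le> real (card (A z j))" unfolding n_def by linarith
      qed
      moreover have "\<beta> \<le> (c0/2) ^ card (J z) - real (card (J z)) ^ 2 * (2 * \<eta>)"
      proof -
        have "real (l - 1) ^ 2 * (2 * \<eta>) \<le> real l ^ 2 * (2 * \<eta>)"
          by (intro mult_right_mono power_mono) (use \<eta> in auto)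
        then show ?thesis using \<beta>(2) unfolding cJ by linarith
      qed
      then have "\<beta> * real (card V) ^ card (J z) \<le> ((c0/2) ^ card (J z) - real (card (J z)) ^ 2 * (2 * \<eta>)) * real (card V) ^ card (J z)"
        by (rule mult_right_mono) simp
      ultimately show "\<beta> * n ^ (l - 1) \<le> real (card (T z))" unfolding n_def cJ by linarith
      have "finite (Pi\<^sub>E (J z) (A z))" by (intro finite_PiE) (use V in \<open>auto simp: J_def A_def\<close>)
      then show "finite (T z)" by (simp add: T_def)
    qed
    \<comment> \<open>The edge \<open>(x, y)\<close> is stored in the clique with \<open>x\<close>
      at its own colour and \<open>y\<close> at the additional index \<open>l\<close>. Decoding is
      possible because \<open>y\<close> reveals the common colour and thereby the position of
      \<open>x\<close>.\<close>
    let ?f = "\<lambda>(z, f). (f(c (fst z) := fst z))(l := snd z)"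
    have "real (card X) * (\<beta> * n ^ (l - 1)) \<le> real (card (SIGMA z:X. T z))"
      by (rule card_SIGMA_ge_real[OF fX fT cT])
    also have "\<dots> \<le> \<xi> * n ^ (l + 1)"
    proof (rule card_le_hK[of ?f])
      have rec: "x \<in> V" "y \<in> V" "c x = c y" "E x y" "c x < l" if "(x, y) \<in> X" for x y
        using that c by (auto simp: X_def)
      show "inj_on ?f (SIGMA z:X. T z)"
      proof (rule inj_onI)
        fix s s' assume s: "s \<in> (SIGMA z:X. T z)" "s' \<in> (SIGMA z:X. T z)" "?f s = ?f s'"
        obtain x y f where s1: "s = ((x, y), f)" by (metis prod.exhaust)
        obtain x' y' f' where s2: "s' = ((x', y'), f')" by (metis prod.exhaust)
        have X1: "(x, y) \<in> X" "(x', y') \<in> X" and T1: "f \<in> T (x, y)" "f' \<in> T (x', y')" using s(1,2) by (auto simp: s1 s2)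
        have e: "(f(c x := x))(l := y) = (f'(c x' := x'))(l := y')" using s(3) by (simp add: s1 s2)
        have y: "y = y'" using fun_cong[OF e, of l] by simp
        then have cx: "c x = c x'" using rec(3)[OF X1(1)] rec(3)[OF X1(2)] by simp
        have x: "x = x'" using fun_cong[OF e, of "c x"] rec(5)[OF X1(1)] cx by simp
        have ext: "f (c x) = undefined" "f l = undefined" "f' (c x) = undefined" "f' l = undefined"
        proof -
          have F: "f \<in> Pi\<^sub>E (J (x, y)) (A (x, y))" "f' \<in> Pi\<^sub>E (J (x', y')) (A (x', y'))" using T1 by (simp_all add: T_def)
          show "f (c x) = undefined" "f l = undefined" "f' (c x) = undefined" "f' l = undefined"
            by (rule PiE_arb[OF F(1)], simp add: J_def)+ (rule PiE_arb[OF F(2)], simp add: J_def cx)+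
        qed
        have "f = f'"
        proof
          fix d show "f d = f' d" using fun_cong[OF e, of d] ext cx by (cases "d = l"; cases "d = c x") auto
        qed
        then show "s = s'" using x y by (simp add: s1 s2)
      qed
      show "?f ` (SIGMA z:X. T z) \<subseteq> homs {..<l + 1} id V E"
      proof
        fix h assume "h \<in> ?f ` (SIGMA z:X. T z)"
        then obtain x y f where X1: "(x, y) \<in> X" and T1: "f \<in> T (x, y)" and h: "h = (f(c x := x))(l := y)" by auto
        note r = rec[OF X1]
        have fj: "f j \<in> V" "E x (f j)" "E y (f j)" if "j < l" "j \<noteq> c x" for j
          using T1 that by (auto simp: T_def J_def A_def dest!: PiE_mem[of f _ _ j])
        have fij: "E (f i) (f j)" if "i < l" "i \<noteq> c x" "j < l" "j \<noteq> c x" "i \<noteq> j" for i j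
          using T1 that by (auto simp: T_def J_def)
        have sym: "E a b" if "E b a" "a \<in> V" "b \<in> V" for a b using graph_onD[OF g that(3,2,1)] .
        show "h \<in> homs {..<l + 1} id V E"
        proof (rule homsI)
          show "h \<in> {..<l + 1} \<rightarrow>\<^sub>E V"
          proof (rule PiE_I)
            show "h i \<in> V" if "i \<in> {..<l + 1}" for i
              using that fj(1)[of i] r by (cases "i = l"; cases "i = c x") (auto simp: h)
            show "h i = undefined" if "i \<notin> {..<l + 1}" for i
            proof -
              have i: "i \<notin> J (x, y)" "i \<noteq> l" "i \<noteq> c x" using that r(5) by (simp_all add: J_def)
              have "f \<in> Pi\<^sub>E (J (x, y)) (A (x, y))" using T1 by (simp add: T_def)
              from PiE_arb[OF this i(1)] show ?thesis using i by (simp add: h)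
            qed
          qed
          fix i j assume ij: "i \<in> {..<l + 1}" "j \<in> {..<l + 1}" "id i \<noteq> id j"
          consider "i = l" | "j = l" "i \<noteq> l" | "i = c x" "j \<noteq> l" "i \<noteq> l" | "j = c x" "i \<noteq> c x" "i \<noteq> l" "j \<noteq> l"
            | "i \<noteq> c x" "j \<noteq> c x" "i \<noteq> l" "j \<noteq> l" by argo
          then show "E (h i) (h j)"
          proof cases
            case 1
            then show ?thesis using ij fj[of j] r sym by (cases "j = c x") (auto simp: h)
          next
            case 2
            then show ?thesis using ij fj[of i] r sym by (cases "i = c x") (auto simp: h)
          next
            case 3
            then show ?thesis using ij fj[of j] r by (auto simp: h)
          next
            case 4
            then show ?thesis using ij fj[of i] r sym by (auto simp: h)
          next
            case 5
            then show ?thesis using ij fij[of i j] by (auto simp: h)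
          qed
        qed
      qed
    qed
    also have "l + 1 = (l - 1) + 2" using l_ge_2 by simp
    finally show ?thesis by (rule card_le_of_weighted[OF _ n0 \<beta>(1)])
  qed
  have cVB: "real (card VB) \<le> \<xi>/\<beta> * n ^ 1"
  proof -
    define T where "T x = {f \<in> Pi\<^sub>E {..<l} (N x). \<forall>i\<in>{..<l}. \<forall>j\<in>{..<l}. i \<noteq> j \<longrightarrow> E (f i) (f j)}" for x
    have fT: "finite (T x)" for x
    proof -
      have "finite (Pi\<^sub>E {..<l} (N x))" by (intro finite_PiE) (use V in \<open>auto simp: N_def\<close>)
      then show ?thesis by (simp add: T_def)
    qed
    have cT: "\<beta> * n ^ l \<le> real (card (T x))" if x: "x \<in> VB" for x
    proof -
      have "(\<gamma> ^ card {..<l} - real (card {..<l}) ^ 2 * (2 * \<eta>)) * real (card V) ^ card {..<l} \<le> real (card (T x))"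
        unfolding T_def
        by (rule card_transversal_cliques[OF _ V(1) _ _ _ miss]) (use x \<gamma> in \<open>auto simp: N_def VB_def n_def\<close>)
      moreover have "\<beta> * real (card V) ^ l \<le> (\<gamma> ^ l - real l ^ 2 * (2 * \<eta>)) * real (card V) ^ l"
        by (rule mult_right_mono[OF \<beta>(3)]) simp
      ultimately show ?thesis unfolding n_def card_lessThan by linarith
    qed
    let ?f = "\<lambda>(x, f). f(l := x)"
    have "real (card VB) * (\<beta> * n ^ l) \<le> real (card (SIGMA x:VB. T x))"
      by (rule card_SIGMA_ge_real[OF fVB(1) fT cT])
    also have "\<dots> \<le> \<xi> * n ^ (l + 1)"
    proof (rule card_le_hK[of ?f])
      show "inj_on ?f (SIGMA x:VB. T x)"
      proof (rule inj_onI)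
        fix s s' assume s: "s \<in> (SIGMA x:VB. T x)" "s' \<in> (SIGMA x:VB. T x)" "?f s = ?f s'"
        obtain x f where s1: "s = (x, f)" by (metis prod.exhaust)
        obtain x' f' where s2: "s' = (x', f')" by (metis prod.exhaust)
        have T1: "f \<in> T x" "f' \<in> T x'" using s(1,2) by (auto simp: s1 s2)
        have e: "f(l := x) = f'(l := x')" using s(3) by (simp add: s1 s2)
        have x: "x = x'" using fun_cong[OF e, of l] by simp
        have ext: "f l = undefined" "f' l = undefined"
        proof -
          have F: "f \<in> Pi\<^sub>E {..<l} (N x)" "f' \<in> Pi\<^sub>E {..<l} (N x')" using T1 by (simp_all add: T_def)
          show "f l = undefined" "f' l = undefined" by (rule PiE_arb[OF F(1)], simp) (rule PiE_arb[OF F(2)], simp)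
        qed
        have "f = f'"
        proof
          fix d show "f d = f' d" using fun_cong[OF e, of d] ext by (cases "d = l") auto
        qed
        then show "s = s'" using x by (simp add: s1 s2)
      qed
      show "?f ` (SIGMA x:VB. T x) \<subseteq> homs {..<l + 1} id V E"
      proof
        fix h assume "h \<in> ?f ` (SIGMA x:VB. T x)"
        then obtain x f where X1: "x \<in> VB" and T1: "f \<in> T x" and h: "h = f(l := x)" by auto
        have xV: "x \<in> V" using X1 fVB by blast
        have fj: "f j \<in> V" "E x (f j)" if "j < l" for j
          using T1 that by (auto simp: T_def N_def dest!: PiE_mem[of f _ _ j])
        have fij: "E (f i) (f j)" if "i < l" "j < l" "i \<noteq> j" for i j
          using T1 that by (auto simp: T_def)
        show "h \<in> homs {..<l + 1} id V E"
        proof (rule homsI)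
          show "h \<in> {..<l + 1} \<rightarrow>\<^sub>E V"
          proof (rule PiE_I)
            show "h i \<in> V" if "i \<in> {..<l + 1}" for i
              using that fj(1)[of i] xV by (cases "i = l") (auto simp: h)
            show "h i = undefined" if "i \<notin> {..<l + 1}" for i
            proof -
              have i: "i \<notin> {..<l}" "i \<noteq> l" using that by simp_all
              have "f \<in> Pi\<^sub>E {..<l} (N x)" using T1 by (simp add: T_def)
              from PiE_arb[OF this i(1)] show ?thesis using i by (simp add: h)
            qed
          qed
          fix i j assume ij: "i \<in> {..<l + 1}" "j \<in> {..<l + 1}" "id i \<noteq> id j"
          consider "i = l" | "j = l" "i \<noteq> l" | "i \<noteq> l" "j \<noteq> l" by blast
          then show "E (h i) (h j)"
          proof cases
            case 1
            then show ?thesis using ij fj[of j] by (auto simp: h)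
          next
            case 2
            then have "E x (f i)" "f i \<in> V" using ij fj[of i] by auto
            then show ?thesis using 2 graph_onD[OF g xV] by (simp add: h)
          next
            case 3
            then show ?thesis using ij fij[of i j] by (auto simp: h)
          qed
        qed
      qed
    qed
    finally show ?thesis by (rule card_le_of_weighted[OF _ n0 \<beta>(1)])
  qed
  \<comment> \<open>Vertices of \<open>VB\<close> keep their colours; they are so few that all their
    edges may count as inside.\<close>
  define c' where "c' x = (if x \<in> B - VB then SOME i. i < l \<and> real (card (N x i)) < \<gamma> * n else c x)" for x
  have c'B: "c' x < l" "real (card (N x (c' x))) < \<gamma> * n" if "x \<in> B - VB" for x
  proof -
    have "\<exists>i. i < l \<and> real (card (N x i)) < \<gamma> * n" using that unfolding VB_def by (auto simp: not_le)
    from someI_ex[OF this] show "c' x < l" "real (card (N x (c' x))) < \<gamma> * n" using that by (simp_all add: c'_def)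
  qed
  have c': "c' \<in> V \<rightarrow> {..<l}"
  proof
    fix x assume "x \<in> V"
    then show "c' x \<in> {..<l}" using c c'B[of x] by (cases "x \<in> B - VB") (auto simp: c'_def)
  qed
  define D where "D x = {y\<in>V. c' x = c' y \<and> E x y}" for x
  have fD: "finite (D x)" for x using V by (simp add: D_def)
  have sub: "inside V c' E \<subseteq> X \<union> ((SIGMA x:B. D x) \<union> (\<lambda>(x, y). (y, x)) ` (SIGMA x:B. D x))"
  proof
    fix z assume "z \<in> inside V c' E"
    then obtain x y where z: "z = (x, y)" "x \<in> V" "y \<in> V" "c' x = c' y" "E x y" by (auto simp: inside_def)
    consider "x \<in> B" | "y \<in> B" | "x \<notin> B" "y \<notin> B" by blast
    then show "z \<in> X \<union> ((SIGMA x:B. D x) \<union> (\<lambda>(x, y). (y, x)) ` (SIGMA x:B. D x))"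
    proof cases
      case 1 then show ?thesis using z by (auto simp: D_def)
    next
      case 2
      then have "(y, x) \<in> (SIGMA x:B. D x)" using z graph_onD[OF g z(2,3,5)] by (auto simp: D_def)
      then have "(\<lambda>(x, y). (y, x)) (y, x) \<in> (\<lambda>(x, y). (y, x)) ` (SIGMA x:B. D x)" by (rule imageI)
      then show ?thesis using z(1) by simp
    next
      case 3 then show ?thesis using z by (auto simp: X_def c'_def)
    qed
  qed
  let ?S = "SIGMA x:B. D x"
  have fS: "finite ?S" using fB fD by auto
  have "card (inside V c' E) \<le> card (X \<union> (?S \<union> (\<lambda>(x, y). (y, x)) ` ?S))"
    by (rule card_mono[OF _ sub]) (use fX fS in auto)
  also have "\<dots> \<le> card X + (card ?S + card ((\<lambda>(x, y). (y, x)) ` ?S))"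
    using card_Un_le[of X "?S \<union> (\<lambda>(x, y). (y, x)) ` ?S"] card_Un_le[of ?S "(\<lambda>(x, y). (y, x)) ` ?S"] by linarith
  also have "\<dots> \<le> card X + (card ?S + card ?S)" using card_image_le[OF fS, of "\<lambda>(x, y). (y, x)"] by linarith
  finally have 1: "real (card (inside V c' E)) \<le> real (card X) + 2 * real (card ?S)" by linarith
  have "?S \<subseteq> (SIGMA x:VB. D x) \<union> (SIGMA x:B - VB. D x)" by auto
  then have "card ?S \<le> card ((SIGMA x:VB. D x) \<union> (SIGMA x:B - VB. D x))"
    by (rule card_mono[rotated]) (use fB fVB fD in auto)
  also have "\<dots> \<le> card (SIGMA x:VB. D x) + card (SIGMA x:B - VB. D x)" by (rule card_Un_le)
  finally have 2: "real (card ?S) \<le> real (card (SIGMA x:VB. D x)) + real (card (SIGMA x:B - VB. D x))" by linarith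
  have 3: "real (card (SIGMA x:VB. D x)) \<le> real (card VB) * n"
  proof (rule sum_card_SIGMA_le_real[OF fVB(1) fD])
    fix x show "real (card (D x)) \<le> n" unfolding n_def D_def by (intro of_nat_mono card_mono) (use V in auto)
  qed
  have 4: "real (card (SIGMA x:B - VB. D x)) \<le> real (card (B - VB)) * (real (card B) + \<gamma> * n)"
  proof (rule sum_card_SIGMA_le_real[OF _ fD])
    fix x assume x: "x \<in> B - VB"
    have "D x \<subseteq> B \<union> N x (c' x)"
    proof
      fix y assume "y \<in> D x"
      then have "y \<in> V" "c' x = c' y" "E x y" by (auto simp: D_def)
      then show "y \<in> B \<union> N x (c' x)" by (cases "y \<in> B") (auto simp: N_def c'_def)
    qed
    then have "card (D x) \<le> card (B \<union> N x (c' x))" by (rule card_mono[rotated]) (use fB V in \<open>simp add: N_def\<close>)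
    also have "\<dots> \<le> card B + card (N x (c' x))" by (rule card_Un_le)
    finally have "real (card (D x)) \<le> real (card B) + real (card (N x (c' x)))" by linarith
    then show "real (card (D x)) \<le> real (card B) + \<gamma> * n" using c'B(2)[OF x] by linarith
  qed (use fB in simp)
  have "card (B - VB) \<le> card B" by (rule card_mono) (use fB in auto)
  then have "real (card (B - VB)) * (real (card B) + \<gamma> * n) \<le> real (card B) * (real (card B) + \<gamma> * n)"
    by (intro mult_right_mono) (use \<gamma> n0 in auto)
  also have "\<dots> \<le> (8 * \<eta> / c0 * n) * (8 * \<eta> / c0 * n + \<gamma> * n)"
    by (intro mult_mono add_mono cB order_refl) (use \<gamma> n0 \<eta> c0 in auto)
  also have "\<dots> = (8 * \<eta> / c0) * (8 * \<eta> / c0 + \<gamma>) * n ^ 2" by (simp add: power2_eq_square algebra_simps)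
  finally have 5: "real (card (SIGMA x:B - VB. D x)) \<le> (8 * \<eta> / c0) * (8 * \<eta> / c0 + \<gamma>) * n ^ 2" using 4 by linarith
  have "real (card VB) * n \<le> (\<xi>/\<beta> * n ^ 1) * n" by (rule mult_right_mono[OF cVB]) (use n0 in simp)
  also have "\<dots> = \<xi>/\<beta> * n ^ 2" by (simp add: power2_eq_square)
  finally have 6: "real (card VB) * n \<le> \<xi>/\<beta> * n ^ 2" .
  have "real (card (inside V c' E)) \<le> 3 * (\<xi>/\<beta> * n ^ 2) + 2 * ((8 * \<eta> / c0) * (8 * \<eta> / c0 + \<gamma>) * n ^ 2)"
    using 1 2 3 5 6 cX by linarith
  also have "\<dots> = (3 * (\<xi>/\<beta>) + 2 * (8 * \<eta> / c0) * (8 * \<eta> / c0 + \<gamma>)) * n ^ 2" by (simp add: algebra_simps)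
  finally show ?thesis using c' unfolding n_def by blast
qed

text \<open>Edges inside the parts are left free. Where they have to be controlled, this is done
  through the number of cliques.\<close>

definition near_multipartite :: "real \<Rightarrow> nat set \<Rightarrow> (nat \<Rightarrow> nat \<Rightarrow> bool) \<Rightarrow> bool" where
  "near_multipartite \<eta> V E \<longleftrightarrow> (\<exists>c \<in> V \<rightarrow> {..<l}.
     real (card (missing V c E)) \<le> \<eta> * real (card V) ^ 2 \<and> cnt V c \<ge> (opt - \<eta>) * real (card V) ^ v)"

text \<open>A self-improvement: the constant \<open>2 * \<eta>\<close> in the hypothesis leaves room for changing the
  neighbourhood of one vertex, so this closes the induction along the symmetrization process.\<close>

lemma near_multipartite_improve:
  "\<exists>\<eta>0>0. \<forall>\<eta>. 0 < \<eta> \<longrightarrow> \<eta> \<le> \<eta>0 \<longrightarrow> (\<exists>w>0. \<exists>N. \<forall>V E c. finite V \<longrightarrow> N \<le> card V \<longrightarrow> V \<noteq> {} \<longrightarrow> graph_on V E \<longrightarrow>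
     hP V E \<ge> (opt - w) * real (card V) ^ v \<longrightarrow> hK V E \<le> (2 * w) * real (card V) ^ (l + 1) \<longrightarrow>
     c \<in> V \<rightarrow> {..<l} \<longrightarrow> real (card (missing V c E)) \<le> (2 * \<eta>) * real (card V) ^ 2 \<longrightarrow>
     cnt V c \<ge> (opt - \<eta>) * real (card V) ^ v \<longrightarrow> near_multipartite \<eta> V E)"
proof -
  obtain c0 \<delta> N where c0: "c0 > 0" "c0 \<le> 1" and \<delta>: "\<delta> > 0" and large: "\<forall>V c. finite V \<longrightarrow> N \<le> card V \<longrightarrow> c \<in> V \<rightarrow> {..<l} \<longrightarrow>
     cnt V c \<ge> (opt - \<delta>) * real (card V) ^ v \<longrightarrow> (\<forall>i<l. real (card {x\<in>V. c x = i}) \<ge> c0 * real (card V))"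
    using parts_large by (elim exE conjE) (rule that)
  have v1: "real v \<ge> 1" and l1: "real l \<ge> 1" using v_ge_2 l_ge_2 by auto
  define e where "e = c0 ^ (v - 2)"
  have e: "e > 0" "e \<le> 1" using c0 by (auto simp: e_def power_le_one)
  \<comment> \<open>With \<open>8 * \<eta> / c0 \<le> \<gamma>\<close>, the share of exceptional
    vertices in the inside pairs creates at most \<open>e * \<eta> / 2 * n^v\<close> maps. The
    quantity to beat is \<open>e * \<eta> * n^v\<close>, the loss caused by
    \<open>\<eta> * n^2\<close> missing pairs.\<close>
  define \<gamma> where "\<gamma> = e * c0 / (64 * real v ^ 2)"
  have \<gamma>: "\<gamma> > 0" using e c0 v1 by (simp add: \<gamma>_def)
  define \<beta> where "\<beta> = min ((c0/2) ^ (l - 1)) (\<gamma> ^ l) / 2"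
  have \<beta>: "\<beta> > 0" using c0 \<gamma> by (simp add: \<beta>_def)
  \<comment> \<open>The three bounds guarantee, in this order, that near-optimality to within
    \<open>\<eta>\<close> makes all parts linear, that
    \<open>8 * \<eta> / c0 \<le> \<gamma>\<close>, and that missing pairs leave transversal cliques
    with density at least \<open>\<beta>\<close>.\<close>
  define \<eta>0 where "\<eta>0 = min \<delta> (min (c0 * \<gamma> / 8) (\<beta> / (2 * real l ^ 2)))"
  have \<eta>0: "\<eta>0 > 0" using \<delta> c0 \<gamma> \<beta> l1 by (simp add: \<eta>0_def)
  show ?thesis
  proof (rule exI[of _ \<eta>0], intro conjI allI impI \<eta>0)
    fix \<eta> :: real assume \<eta>: "0 < \<eta>" "\<eta> \<le> \<eta>0"
    \<comment> \<open>Chosen so that the deficit \<open>w\<close> of the pattern count and the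
      inside pairs stemming from \<open>2 * w * n^(l+1)\<close> cliques together cost exactly
      \<open>e * \<eta> / 4\<close>.\<close>
    define d where "d = 1 + 6 * real v ^ 2 / \<beta>"
    define w where "w = e * \<eta> / 4 / d"
    have d1: "d \<ge> 1" using \<beta> by (simp add: d_def)
    have w: "w > 0" unfolding w_def using e \<eta> d1 by (intro divide_pos_pos mult_pos_pos) linarith+
    have wsum: "w + real v ^ 2 * (3 * (2 * w / \<beta>)) = e * \<eta> / 4"
    proof -
      have "w * d = e * \<eta> / 4" unfolding w_def using d1 by simp
      then show ?thesis by (simp add: d_def algebra_simps)
    qed
    define \<sigma> where "\<sigma> = 3 * (2 * w / \<beta>) + 2 * (8 * \<eta> / c0) * (8 * \<eta> / c0 + \<gamma>)"
    have \<eta>\<gamma>: "8 * \<eta> / c0 \<le> \<gamma>"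
    proof -
      have "\<eta> \<le> c0 * \<gamma> / 8" using \<eta>(2) by (simp add: \<eta>0_def)
      then show ?thesis using c0 by (simp add: field_simps)
    qed
    have "2 * (8 * \<eta> / c0) * (8 * \<eta> / c0 + \<gamma>) \<le> 2 * (8 * \<eta> / c0) * (\<gamma> + \<gamma>)"
      by (rule mult_left_mono) (use \<eta>\<gamma> \<eta> c0 in auto)
    also have "\<dots> = e * \<eta> / (2 * real v ^ 2)" using c0 by (simp add: \<gamma>_def)
    finally have "real v ^ 2 * (2 * (8 * \<eta> / c0) * (8 * \<eta> / c0 + \<gamma>)) \<le> real v ^ 2 * (e * \<eta> / (2 * real v ^ 2))"
      by (rule mult_left_mono) simp
    also have "\<dots> = e * \<eta> / 2" using v1 by simp
    finally have "w + real v ^ 2 * \<sigma> \<le> e * \<eta> / 4 + e * \<eta> / 2" unfolding \<sigma>_def distrib_left using wsum by linarith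
    moreover have "0 < e * \<eta>" using e \<eta> by simp
    ultimately have ws: "w + real v ^ 2 * \<sigma> \<le> e * \<eta>" by linarith
    have e\<eta>: "e * \<eta> \<le> \<eta>" using e \<eta> by (simp add: mult_le_cancel_right1)
    have l2\<eta>: "real l ^ 2 * (2 * \<eta>) \<le> \<beta>"
    proof -
      have "\<eta> \<le> \<beta> / (2 * real l ^ 2)" using \<eta>(2) by (simp add: \<eta>0_def)
      then show ?thesis using l1 by (simp add: field_simps)
    qed
    have \<beta>': "\<beta> \<le> (c0/2) ^ (l - 1) - real l ^ 2 * (2 * \<eta>)" "\<beta> \<le> \<gamma> ^ l - real l ^ 2 * (2 * \<eta>)"
    proof -
      have "2 * \<beta> \<le> (c0/2) ^ (l - 1)" "2 * \<beta> \<le> \<gamma> ^ l" by (simp_all add: \<beta>_def)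
      then show "\<beta> \<le> (c0/2) ^ (l - 1) - real l ^ 2 * (2 * \<eta>)" "\<beta> \<le> \<gamma> ^ l - real l ^ 2 * (2 * \<eta>)" using l2\<eta> by linarith+
    qed
    have main: "near_multipartite \<eta> V E"
      if V: "finite V" "N \<le> card V" "V \<noteq> {}" and g: "graph_on V E" and hP: "hP V E \<ge> (opt - w) * real (card V) ^ v"
        and hK: "hK V E \<le> (2 * w) * real (card V) ^ (l + 1)" and c: "c \<in> V \<rightarrow> {..<l}"
        and miss: "real (card (missing V c E)) \<le> (2 * \<eta>) * real (card V) ^ 2"
        and near: "cnt V c \<ge> (opt - \<eta>) * real (card V) ^ v" for V E c
    proof -
      let ?n = "real (card V)"
      have n0: "?n > 0" using V by (simp add: card_gt_0_iff)
      have near_parts: "c0 * ?n \<le> real (card {x\<in>V. c x = i})" if "c \<in> V \<rightarrow> {..<l}" "cnt V c \<ge> (opt - \<eta>) * ?n ^ v" "i < l" for c i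
      proof -
        have "(opt - \<delta>) * ?n ^ v \<le> (opt - \<eta>) * ?n ^ v" using \<eta>(2) by (intro mult_right_mono) (auto simp: \<eta>0_def)
        then have "(opt - \<delta>) * ?n ^ v \<le> cnt V c" using that(2) by linarith
        then show ?thesis using large[rule_format, OF V(1,2) that(1) _ that(3)] by blast
      qed
      obtain c' where c': "c' \<in> V \<rightarrow> {..<l}" and ins: "real (card (inside V c' E)) \<le> \<sigma> * ?n ^ 2"
        using inside_after_reassignment[OF V(1,3) g c near_parts[OF c near] c0(1) less_imp_le[OF \<eta>(1)] \<gamma> miss hK \<beta> \<beta>']
        unfolding \<sigma>_def by blast
      have ins': "real v ^ 2 * real (card (inside V c' E)) * ?n ^ (v - 2) \<le> real v ^ 2 * \<sigma> * ?n ^ v"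
      proof -
        have "real v ^ 2 * real (card (inside V c' E)) * ?n ^ (v - 2) \<le> real v ^ 2 * (\<sigma> * ?n ^ 2) * ?n ^ (v - 2)"
          by (intro mult_right_mono mult_left_mono ins) auto
        also have "\<dots> = real v ^ 2 * \<sigma> * (?n ^ 2 * ?n ^ (v - 2))" by (simp only: mult_ac)
        also have "\<dots> = real v ^ 2 * \<sigma> * ?n ^ v" by (simp only: power_v)
        finally show ?thesis .
      qed
      \<comment> \<open>The comparison is used twice. The lower bound \<open>0\<close> for the parts
        of \<open>c'\<close> already shows that \<open>c'\<close> is near-optimal; then its parts
        are linear, and the second use with \<open>c0 * n\<close> bounds its missing pairs.\<close>
      have "hP V E \<le> cnt V c' + real v ^ 2 * real (card (inside V c' E)) * ?n ^ (v - 2) - 0 ^ (v - 2) * real (card (missing V c' E))"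
        by (rule card_homs_le_cnt[OF V(1) c']) auto
      moreover have "0 \<le> 0 ^ (v - 2) * real (card (missing V c' E))" by simp
      ultimately have "(opt - w) * ?n ^ v - real v ^ 2 * \<sigma> * ?n ^ v \<le> cnt V c'" using hP ins' by linarith
      moreover have "(opt - \<eta>) * ?n ^ v \<le> (opt - w - real v ^ 2 * \<sigma>) * ?n ^ v"
        by (rule mult_right_mono) (use ws e\<eta> in auto)
      ultimately have near': "(opt - \<eta>) * ?n ^ v \<le> cnt V c'" by (simp add: algebra_simps)
      have "hP V E \<le> cnt V c' + real v ^ 2 * real (card (inside V c' E)) * ?n ^ (v - 2) - (c0 * ?n) ^ (v - 2) * real (card (missing V c' E))"
        by (rule card_homs_le_cnt[OF V(1) c' _ near_parts[OF c' near']]) (use c0 in auto)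
      then have "(c0 * ?n) ^ (v - 2) * real (card (missing V c' E)) \<le> (w + real v ^ 2 * \<sigma>) * ?n ^ v"
        using hP ins' cnt_le_opt[OF V(1) c'] by (simp add: algebra_simps)
      also have "\<dots> \<le> (e * \<eta>) * ?n ^ v" by (rule mult_right_mono[OF ws]) simp
      also have "\<dots> = (e * \<eta>) * (?n ^ 2 * ?n ^ (v - 2))" by (simp only: power_v)
      also have "\<dots> = (c0 * ?n) ^ (v - 2) * (\<eta> * ?n ^ 2)" by (simp only: e_def power_mult_distrib mult_ac)
      finally have "real (card (missing V c' E)) \<le> \<eta> * ?n ^ 2"
        by (rule mult_left_le_imp_le) (use c0 n0 in simp)
      then show ?thesis using c' near' unfolding near_multipartite_def by blast
    qed
    show "\<exists>w>0. \<exists>N. \<forall>V E c. finite V \<longrightarrow> N \<le> card V \<longrightarrow> V \<noteq> {} \<longrightarrow> graph_on V E \<longrightarrow>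
     hP V E \<ge> (opt - w) * real (card V) ^ v \<longrightarrow> hK V E \<le> (2 * w) * real (card V) ^ (l + 1) \<longrightarrow>
     c \<in> V \<rightarrow> {..<l} \<longrightarrow> real (card (missing V c E)) \<le> (2 * \<eta>) * real (card V) ^ 2 \<longrightarrow>
     cnt V c \<ge> (opt - \<eta>) * real (card V) ^ v \<longrightarrow> near_multipartite \<eta> V E"
      by (intro exI[of _ w] exI[of _ N] conjI allI impI w main)
  qed
qed

lemma near_multipartite_mono:
  assumes "near_multipartite \<eta> V E" "\<eta> \<le> \<eta>'"
  shows "near_multipartite \<eta>' V E"
proof -
  have "\<eta> * real (card V) ^ 2 \<le> \<eta>' * real (card V) ^ 2" "(opt - \<eta>') * real (card V) ^ v \<le> (opt - \<eta>) * real (card V) ^ v"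
    using assms(2) by (auto intro!: mult_right_mono)
  then show ?thesis using assms(1) unfolding near_multipartite_def by (meson order_trans)
qed

lemma missing_clone:
  "missing V c E \<subseteq> missing V c (clone u z E) \<union> ({u} \<times> V \<union> V \<times> {u})"
  by (auto simp: missing_def clone_def)

text \<open>The property carried back along the symmetrization is conditional: a graph whose
  penalized density is at least \<open>opt - w\<close> is close to multipartite. Cloning does not
  decrease the penalized density, so the condition passes to the clone. The colouring obtained for
  the clone is then reused for the graph itself: only pairs at one vertex differ, at most
  \<open>2 * n\<close> of them, and the doubled constant absorbs these.\<close>

theorem stability:
  assumes "\<eta> > 0"
  shows "\<exists>\<zeta>>0. \<exists>N. \<forall>V E. finite V \<longrightarrow> N \<le> card V \<longrightarrow> graph_on V E \<longrightarrow>
     hP V E \<ge> (opt - \<zeta>) * real (card V) ^ v \<longrightarrow> hK V E \<le> \<zeta> * real (card V) ^ (l + 1) \<longrightarrow> near_multipartite \<eta> V E"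
proof -
  have v1: "real v \<ge> 1" using v_ge_2 by auto
  obtain \<eta>0 where \<eta>0: "\<eta>0 > 0" and imp: "\<forall>\<eta>. 0 < \<eta> \<longrightarrow> \<eta> \<le> \<eta>0 \<longrightarrow> (\<exists>w>0. \<exists>N. \<forall>V E c. finite V \<longrightarrow> N \<le> card V \<longrightarrow> V \<noteq> {} \<longrightarrow> graph_on V E \<longrightarrow>
     hP V E \<ge> (opt - w) * real (card V) ^ v \<longrightarrow> hK V E \<le> (2 * w) * real (card V) ^ (l + 1) \<longrightarrow>
     c \<in> V \<rightarrow> {..<l} \<longrightarrow> real (card (missing V c E)) \<le> (2 * \<eta>) * real (card V) ^ 2 \<longrightarrow>
     cnt V c \<ge> (opt - \<eta>) * real (card V) ^ v \<longrightarrow> near_multipartite \<eta> V E)"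
    using near_multipartite_improve by (elim exE conjE) (rule that)
  define \<theta> where "\<theta> = min \<eta> \<eta>0"
  have \<theta>: "0 < \<theta>" "\<theta> \<le> \<eta>0" "\<theta> \<le> \<eta>" using assms \<eta>0 by (auto simp: \<theta>_def)
  obtain w1 N1 where w1: "w1 > 0" and imp1: "\<forall>V E c. finite V \<longrightarrow> N1 \<le> card V \<longrightarrow> V \<noteq> {} \<longrightarrow> graph_on V E \<longrightarrow>
     hP V E \<ge> (opt - w1) * real (card V) ^ v \<longrightarrow> hK V E \<le> (2 * w1) * real (card V) ^ (l + 1) \<longrightarrow>
     c \<in> V \<rightarrow> {..<l} \<longrightarrow> real (card (missing V c E)) \<le> (2 * \<theta>) * real (card V) ^ 2 \<longrightarrow>
     cnt V c \<ge> (opt - \<theta>) * real (card V) ^ v \<longrightarrow> near_multipartite \<theta> V E"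
    using imp[rule_format, OF \<theta>(1,2)] by (elim exE conjE) (rule that)
  have "\<theta> / (2 * real v) > 0" using \<theta> v1 by simp
  from complete_multipartite_cases[OF this] obtain \<kappa> where \<kappa>: "\<kappa> > 0"
    and cm: "\<forall>V E. finite V \<longrightarrow> V \<noteq> {} \<longrightarrow> graph_on V E \<longrightarrow>
    (\<forall>x\<in>V. \<forall>y\<in>V. \<forall>z\<in>V. \<not> E x y \<longrightarrow> E x z = E y z) \<longrightarrow>
    hK V E \<ge> \<kappa> * real (card V) ^ (l + 1) \<or>
    (\<exists>c \<in> V \<rightarrow> {..<l}. missing V c E = {} \<and> hP V E \<le> cnt V c + real v * (\<theta> / (2 * real v)) * real (card V) ^ v)"
    by (elim exE conjE) (rule that)
  \<comment> \<open>\<open>\<kappa>/3\<close> rules out the case of many cliques, since then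
    \<open>2 * w < \<kappa>\<close>. The bound \<open>\<theta>/2\<close> adds up to
    \<open>\<theta>\<close> with the \<open>\<theta>/2\<close> lost when small classes are
    merged.\<close>
  define w where "w = min w1 (min (\<kappa>/3) (\<theta>/2))"
  have w: "w > 0" "w \<le> w1" "w \<le> \<kappa>/3" "w \<le> \<theta>/2" using w1 \<kappa> \<theta> by (auto simp: w_def)
  from penalized_density_le[OF w(1)] obtain M where M: "M \<ge> 1" and pen: "\<forall>V E. finite V \<longrightarrow> V \<noteq> {} \<longrightarrow> graph_on V E \<longrightarrow>
    hP V E / real (card V) ^ v \<le> opt + w + M * (hK V E / real (card V) ^ (l + 1))"
    by (elim exE conjE) (rule that)
  define \<zeta> where "\<zeta> = w / (1 + 2 * M)"
  have \<zeta>: "\<zeta> > 0" "\<zeta> + 2 * M * \<zeta> = w" proof -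
    have d: "1 + 2 * M > 0" using M by simp
    then show "\<zeta> > 0" using w by (simp add: \<zeta>_def)
    have "\<zeta> * (1 + 2 * M) = w" unfolding \<zeta>_def using d by simp
    then show "\<zeta> + 2 * M * \<zeta> = w" by (simp add: algebra_simps)
  qed
  obtain N2 :: nat where N2: "real N2 > 2 / \<theta>" using reals_Archimedean2 by blast
  have main: "near_multipartite \<eta> V E0"
    if V: "finite V" "max N1 (N2 + 1) \<le> card V" and g0: "graph_on V E0"
      and hP0: "hP V E0 \<ge> (opt - \<zeta>) * real (card V) ^ v" and hK0: "hK V E0 \<le> \<zeta> * real (card V) ^ (l + 1)" for V E0
  proof -
    define n where "n = real (card V)"
    have n0: "n > 0" using V(2) by (simp add: n_def)
    have Vne: "V \<noteq> {}" using V(2) by auto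
    \<comment> \<open>The penalty is twice the one in the density bound. The excess makes
      \<open>\<Phi> E \<ge> opt - w\<close> equivalent to nothing less than both wishes at once: the
      pattern density is at least \<open>opt - w\<close>, and comparison with the bound for
      \<open>M\<close> leaves at most \<open>2 * w\<close> for the clique density.\<close>
    define \<Phi> where "\<Phi> E = 1 / n ^ v * hP V E - 2 * M / n ^ (l + 1) * hK V E" for E
    have \<Phi>alt: "\<Phi> E = hP V E / n ^ v - 2 * M * (hK V E / n ^ (l + 1))" for E by (simp add: \<Phi>_def)
    have bounds: "hP V E \<ge> (opt - w) * n ^ v" "hK V E \<le> (2 * w) * n ^ (l + 1)"
      if g: "graph_on V E" and ge: "opt - w \<le> \<Phi> E" for E
    proof -
      have K0: "0 \<le> hK V E / n ^ (l + 1)" using n0 by simp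
      then have "0 \<le> M * (hK V E / n ^ (l + 1))" by (intro mult_nonneg_nonneg) (use M in auto)
      then have "opt - w \<le> hP V E / n ^ v" using ge unfolding \<Phi>alt by linarith
      then show "hP V E \<ge> (opt - w) * n ^ v" using n0 by (simp add: pos_le_divide_eq)
      have "hP V E / n ^ v \<le> opt + w + M * (hK V E / n ^ (l + 1))"
        unfolding n_def by (rule pen[rule_format, OF V(1) Vne g])
      then have "M * (hK V E / n ^ (l + 1)) \<le> 2 * w" using ge unfolding \<Phi>alt by linarith
      moreover have "1 * (hK V E / n ^ (l + 1)) \<le> M * (hK V E / n ^ (l + 1))" by (rule mult_right_mono[OF M K0])
      ultimately have "hK V E / n ^ (l + 1) \<le> 2 * w" by linarith
      then show "hK V E \<le> (2 * w) * n ^ (l + 1)" using n0 by (simp only: pos_divide_le_eq zero_less_power)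
    qed
    have "opt - w \<le> \<Phi> E0 \<longrightarrow> near_multipartite \<theta> V E0"
    proof (rule zykov_induct[where I = VP and p = pc and V = V and m = "l + 1" and a = "1 / n ^ v" and b = "2 * M / n ^ (l + 1)"
          and Q = "\<lambda>E. opt - w \<le> \<Phi> E \<longrightarrow> near_multipartite \<theta> V E", OF fin V(1) _ _ _ _ g0])
      fix E assume g: "graph_on V E" and eqv: "\<And>x y z. x \<in> V \<Longrightarrow> y \<in> V \<Longrightarrow> z \<in> V \<Longrightarrow> \<not> E x y \<Longrightarrow> E x z = E y z"
      show "opt - w \<le> \<Phi> E \<longrightarrow> near_multipartite \<theta> V E"
      proof
        assume ge: "opt - w \<le> \<Phi> E"
        have "hK V E \<ge> \<kappa> * n ^ (l + 1) \<or>
            (\<exists>c \<in> V \<rightarrow> {..<l}. missing V c E = {} \<and> hP V E \<le> cnt V c + real v * (\<theta> / (2 * real v)) * n ^ v)"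
          unfolding n_def by (rule cm[rule_format, OF V(1) Vne g eqv])
        moreover have "\<not> hK V E \<ge> \<kappa> * n ^ (l + 1)"
        proof
          assume "hK V E \<ge> \<kappa> * n ^ (l + 1)"
          then have "\<kappa> * n ^ (l + 1) \<le> (2 * w) * n ^ (l + 1)" using bounds(2)[OF g ge] by linarith
          then have "\<kappa> \<le> 2 * w" by (rule mult_right_le_imp_le) (use n0 in simp)
          then show False using w(3) \<kappa> by linarith
        qed
        ultimately obtain c where c: "c \<in> V \<rightarrow> {..<l}" "missing V c E = {}" "hP V E \<le> cnt V c + real v * (\<theta> / (2 * real v)) * n ^ v" by blast
        have "(opt - \<theta>) * n ^ v \<le> (opt - w - \<theta>/2) * n ^ v" by (rule mult_right_mono) (use w n0 in auto)
        also have "\<dots> = (opt - w) * n ^ v - \<theta>/2 * n ^ v" by (simp only: left_diff_distrib)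
        also have "\<theta>/2 = real v * (\<theta> / (2 * real v))" using v1 by simp
        finally have "(opt - \<theta>) * n ^ v \<le> cnt V c" using c(3) bounds(1)[OF g ge] by linarith
        moreover have "real (card (missing V c E)) \<le> \<theta> * n ^ 2" using c(2) \<theta> by simp
        ultimately show "near_multipartite \<theta> V E" using c(1) unfolding near_multipartite_def n_def by blast
      qed
    next
      fix E u z assume g: "graph_on V E" and u: "u \<in> V" and mono0: "1 / n ^ v * hP V E - 2 * M / n ^ (l + 1) * hK V E \<le> 1 / n ^ v * hP V (clone u z E) - 2 * M / n ^ (l + 1) * hK V (clone u z E)"
        and IH: "opt - w \<le> \<Phi> (clone u z E) \<longrightarrow> near_multipartite \<theta> V (clone u z E)"
      show "opt - w \<le> \<Phi> E \<longrightarrow> near_multipartite \<theta> V E"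
      proof
        assume ge: "opt - w \<le> \<Phi> E"
        then have "near_multipartite \<theta> V (clone u z E)" using IH mono0 unfolding \<Phi>_def by linarith
        then obtain c where c: "c \<in> V \<rightarrow> {..<l}" and miss: "real (card (missing V c (clone u z E))) \<le> \<theta> * n ^ 2"
          and near: "cnt V c \<ge> (opt - \<theta>) * n ^ v" unfolding near_multipartite_def n_def by blast
        have "card (missing V c E) \<le> card (missing V c (clone u z E) \<union> ({u} \<times> V \<union> V \<times> {u}))"
          by (rule card_mono[OF _ missing_clone]) (use V(1) in simp)
        also have "\<dots> \<le> card (missing V c (clone u z E)) + (card ({u} \<times> V) + card (V \<times> {u}))"
          using card_Un_le[of "missing V c (clone u z E)" "{u} \<times> V \<union> V \<times> {u}"] card_Un_le[of "{u} \<times> V" "V \<times> {u}"] by linarith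
        finally have "card (missing V c E) \<le> card (missing V c (clone u z E)) + (card V + card V)"
          by (simp only: card_cartesian_product card.insert finite.emptyI card.empty) simp
        then have "real (card (missing V c E)) \<le> real (card (missing V c (clone u z E))) + 2 * n" unfolding n_def by linarith
        moreover have "2 * n \<le> \<theta> * n ^ 2"
        proof -
          have "2 \<le> \<theta> * real N2" using N2 \<theta>(1) by (simp add: field_simps)
          also have "\<dots> \<le> \<theta> * n" using V(2) \<theta>(1) by (simp add: n_def)
          finally have "2 * n \<le> \<theta> * n * n" by (rule mult_right_mono) (use n0 in simp)
          then show ?thesis by (simp only: power2_eq_square mult.assoc)
        qed
        ultimately have miss2: "real (card (missing V c E)) \<le> (2 * \<theta>) * n ^ 2" using miss by linarith
        have "(opt - w1) * n ^ v \<le> (opt - w) * n ^ v" "(2 * w) * n ^ (l + 1) \<le> (2 * w1) * n ^ (l + 1)"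
          by (intro mult_right_mono; use w n0 in simp)+
        then have hP: "(opt - w1) * n ^ v \<le> hP V E" and hK: "hK V E \<le> (2 * w1) * n ^ (l + 1)"
          using bounds[OF g ge] by linarith+
        show "near_multipartite \<theta> V E"
          by (rule imp1[rule_format, OF V(1) _ Vne g hP[unfolded n_def] hK[unfolded n_def] c miss2[unfolded n_def] near[unfolded n_def]])
            (use V(2) in simp)
      qed
    qed (use M n0 in auto)
    moreover have "opt - w \<le> \<Phi> E0"
    proof -
      have "opt - \<zeta> \<le> hP V E0 / n ^ v" using hP0 n0 by (simp add: pos_le_divide_eq n_def)
      moreover have "hK V E0 / n ^ (l + 1) \<le> \<zeta>" using hK0 n0 by (simp only: pos_divide_le_eq zero_less_power n_def)
      then have "2 * M * (hK V E0 / n ^ (l + 1)) \<le> 2 * M * \<zeta>" by (rule mult_left_mono) (use M in simp)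
      ultimately show ?thesis unfolding \<Phi>alt using \<zeta>(2) by linarith
    qed
    ultimately show ?thesis using near_multipartite_mono \<theta>(3) by blast
  qed
  show ?thesis by (intro exI[of _ \<zeta>] exI[of _ "max N1 (N2 + 1)"] conjI allI impI \<zeta>(1) main)
qed

end

section \<open>Thick pairs and expansions\<close>

lemma inj_homsD:
  assumes "\<phi> \<in> inj_homs Q H"
  shows "\<phi> \<in> verts Q \<rightarrow>\<^sub>E verts H" "inj_on \<phi> (verts Q)" "\<And>e. e \<in> edges Q \<Longrightarrow> \<phi> ` e \<in> edges H"
  using assms by (auto simp: inj_homs_def)

lemma finite_inj_homs: "finite (verts Q) \<Longrightarrow> finite (verts H) \<Longrightarrow> finite (inj_homs Q H)"
  unfolding inj_homs_def by (rule finite_subset[of _ "verts Q \<rightarrow>\<^sub>E verts H"]) (auto intro: finite_PiE)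

lemma r_graphD:
  assumes "r_graph r H"
  shows "finite (verts H)" "\<And>e. e \<in> edges H \<Longrightarrow> e \<subseteq> verts H" "\<And>e. e \<in> edges H \<Longrightarrow> card e = r" "\<And>e. e \<in> edges H \<Longrightarrow> finite e"
  using assms by (auto simp: r_graph_def intro: finite_subset)

lemma r_graph_finite_edges: "r_graph r H \<Longrightarrow> finite (edges H)"
  by (rule finite_subset[of _ "Pow (verts H)"]) (auto simp: r_graph_def)

text \<open>A thick pair can be expanded greedily while avoiding \<open>s\<close> vertices already in use.\<close>

definition thick :: "nat \<Rightarrow> 'a hypergraph \<Rightarrow> 'a \<Rightarrow> 'a \<Rightarrow> bool" where
  "thick s H y z \<longleftrightarrow> y \<noteq> z \<and> (\<forall>S. finite S \<longrightarrow> card S \<le> s \<longrightarrow> y \<notin> S \<longrightarrow> z \<notin> S \<longrightarrow>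
     (\<exists>e\<in>edges H. y \<in> e \<and> z \<in> e \<and> e \<inter> S = {}))"

lemma thick_sym: "thick s H y z \<Longrightarrow> thick s H z y"
  unfolding thick_def by blast

lemma graph_on_thick: "graph_on V (thick s H)"
  unfolding graph_on_def using thick_sym by (auto simp: thick_def)

lemma card_2_obtain: "card f = 2 \<Longrightarrow> \<exists>a b. a \<noteq> b \<and> f = {a, b}"
  by (auto simp: card_2_iff)

text \<open>The edge \<open>h f\<close> meets the core exactly in the image of \<open>f\<close>, so
  it has \<open>r - 2\<close> further vertices. These are numbered by a bijection
  \<open>\<beta> f\<close> and serve as the new vertices of \<open>f\<close>; disjointness makes the
  whole map injective.\<close>

lemma contains_expansionI_edges:
  assumes H: "r_graph r H" and r: "2 \<le> r" and F: "r_graph 2 F"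
    and g: "inj_on g (verts F)" "g ` verts F \<subseteq> verts H"
    and h: "\<And>f. f \<in> edges F \<Longrightarrow> h f \<in> edges H" "\<And>f. f \<in> edges F \<Longrightarrow> h f \<inter> g ` verts F = g ` f"
    and disj: "\<And>f f'. f \<in> edges F \<Longrightarrow> f' \<in> edges F \<Longrightarrow> f \<noteq> f' \<Longrightarrow> (h f - g ` verts F) \<inter> (h f' - g ` verts F) = {}"
  shows "contains H (expansion r F)"
proof -
  have rest: "card (h f - g ` verts F) = r - 2 \<and> finite (h f)" if f: "f \<in> edges F" for f
  proof -
    have fin: "finite (h f)" "card (h f) = r" using r_graphD[OF H] h(1)[OF f] by auto
    have "card (g ` f) = 2"
      using card_image[OF inj_on_subset[OF g(1)]] r_graphD(2,3)[OF F f] by simp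
    moreover have "h f - g ` verts F = h f - g ` f" using h(2)[OF f] by blast
    moreover have "g ` f \<subseteq> h f" using h(2)[OF f] by blast
    ultimately show ?thesis using fin card_Diff_subset[of "g ` f" "h f"] finite_subset[of "g ` f" "h f"] by simp
  qed
  have "\<exists>\<beta>. \<forall>f\<in>edges F. bij_betw (\<beta> f) {..<r - 2} (h f - g ` verts F)"
  proof (rule bchoice, rule ballI)
    fix f assume "f \<in> edges F"
    then show "\<exists>b. bij_betw b {..<r - 2} (h f - g ` verts F)"
      using rest ex_bij_betw_nat_finite[of "h f - g ` verts F"] by (auto simp: atLeast0LessThan)
  qed
  then obtain \<beta> where \<beta>: "\<And>f. f \<in> edges F \<Longrightarrow> bij_betw (\<beta> f) {..<r - 2} (h f - g ` verts F)" by blast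
  define \<phi> where "\<phi> = (\<lambda>x\<in>verts (expansion r F). case x of Inl u \<Rightarrow> g u | Inr (f, i) \<Rightarrow> \<beta> f i)"
  have vx: "verts (expansion r F) = Inl ` verts F \<union> Inr ` (edges F \<times> {..<r - 2})"
    by (simp add: expansion_def)
  have \<phi>l: "\<phi> (Inl u) = g u" if "u \<in> verts F" for u using that by (simp add: \<phi>_def vx)
  have \<phi>r: "\<phi> (Inr (f, i)) = \<beta> f i" if "f \<in> edges F" "i < r - 2" for f i
    using that by (simp add: \<phi>_def vx image_iff)
  have \<beta>in: "\<beta> f i \<in> h f - g ` verts F" if "f \<in> edges F" "i < r - 2" for f i
    using bij_betwE[OF \<beta>[OF that(1)]] that(2) by blast
  have inj: "inj_on \<phi> (verts (expansion r F))"
  proof (rule inj_onI)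
    fix x y assume x: "x \<in> verts (expansion r F)" and y: "y \<in> verts (expansion r F)" and e: "\<phi> x = \<phi> y"
    from x consider u where "u \<in> verts F" "x = Inl u" | f i where "f \<in> edges F" "i < r - 2" "x = Inr (f, i)" by (auto simp: vx)
    note cx = this
    from y consider u where "u \<in> verts F" "y = Inl u" | f i where "f \<in> edges F" "i < r - 2" "y = Inr (f, i)" by (auto simp: vx)
    note cy = this
    show "x = y"
    proof (rule cx)
      fix u assume u: "u \<in> verts F" "x = Inl u"
      show ?thesis
      proof (rule cy)
        fix w assume w: "w \<in> verts F" "y = Inl w"
        then show ?thesis using e u \<phi>l g(1) by (auto dest: inj_onD)
      next
        fix f i assume w: "f \<in> edges F" "i < r - 2" "y = Inr (f, i)"
        have "g u = \<beta> f i" using e u w \<phi>l[OF u(1)] \<phi>r[OF w(1,2)] by simp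
        then show ?thesis using \<beta>in[OF w(1,2)] u(1) by (metis DiffD2 imageI)
      qed
    next
      fix f i assume u: "f \<in> edges F" "i < r - 2" "x = Inr (f, i)"
      show ?thesis
      proof (rule cy)
        fix w assume w: "w \<in> verts F" "y = Inl w"
        have "g w = \<beta> f i" using e u w \<phi>l[OF w(1)] \<phi>r[OF u(1,2)] by simp
        then show ?thesis using \<beta>in[OF u(1,2)] w(1) by (metis DiffD2 imageI)
      next
        fix f' j assume w: "f' \<in> edges F" "j < r - 2" "y = Inr (f', j)"
        have e': "\<beta> f i = \<beta> f' j" using e u(3) w(3) \<phi>r[OF u(1,2)] \<phi>r[OF w(1,2)] by simp
        then have "f = f'" using disj[OF u(1) w(1)] \<beta>in[OF u(1,2)] \<beta>in[OF w(1,2)] by (metis IntI empty_iff)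
        moreover have "i = j" using e' calculation \<beta>[OF u(1)] u(2) w(2) by (metis bij_betw_imp_inj_on inj_onD lessThan_iff)
        ultimately show ?thesis using u w by simp
      qed
    qed
  qed
  have into: "\<phi> \<in> verts (expansion r F) \<rightarrow>\<^sub>E verts H"
  proof (rule PiE_I)
    fix x assume "x \<in> verts (expansion r F)"
    then consider u where "u \<in> verts F" "x = Inl u" | f i where "f \<in> edges F" "i < r - 2" "x = Inr (f, i)" by (auto simp: vx)
    then show "\<phi> x \<in> verts H"
    proof cases
      case 1 then show ?thesis using \<phi>l g(2) by auto
    next
      case 2 then show ?thesis using \<phi>r[OF 2(1,2)] \<beta>in[OF 2(1,2)] r_graphD(2)[OF H h(1)[OF 2(1)]] by auto
    qed
  qed (simp add: \<phi>_def)
  have edge: "\<phi> ` E \<in> edges H" if E: "E \<in> edges (expansion r F)" for E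
  proof -
    obtain f where f: "f \<in> edges F" "E = Inl ` f \<union> Inr ` ({f} \<times> {..<r - 2})" using E by (auto simp: expansion_def)
    have "\<phi> ` (Inl ` f) = g ` f" using r_graphD(2)[OF F f(1)] \<phi>l by (force simp: image_iff)
    moreover have "\<phi> ` (Inr ` ({f} \<times> {..<r - 2})) = \<beta> f ` {..<r - 2}" using \<phi>r[OF f(1)] by (force simp: image_iff)
    moreover have "\<beta> f ` {..<r - 2} = h f - g ` verts F" using \<beta>[OF f(1)] by (simp add: bij_betw_def)
    ultimately have "\<phi> ` E = g ` f \<union> (h f - g ` verts F)" using f(2) by (simp add: image_Un)
    also have "\<dots> = h f" using h(2)[OF f(1)] by blast
    finally show ?thesis using h(1)[OF f(1)] by simp
  qed
  have "\<phi> \<in> inj_homs (expansion r F) H" using inj into edge by (simp add: inj_homs_def)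
  then show ?thesis by (auto simp: contains_def)
qed

text \<open>Greedy embedding of the edges over a given core. \<open>D\<close> is empty or consists
  of one edge of \<open>F\<close> that is already realized by the edge \<open>e0\<close> of
  \<open>H\<close>; the pair under it does not have to be thick.\<close>

lemma contains_expansionI:
  assumes H: "r_graph r H" and r: "2 \<le> r" and F: "r_graph 2 F"
    and g: "inj_on g (verts F)" "g ` verts F \<subseteq> verts H"
    and D: "D \<subseteq> {f0}" "D \<subseteq> edges F"
    and h0: "f0 \<in> D \<Longrightarrow> e0 \<in> edges H \<and> e0 \<inter> g ` verts F = g ` f0"
    and th: "\<And>a b. {a, b} \<in> edges F \<Longrightarrow> {a, b} \<notin> D \<Longrightarrow> thick (card (verts F) + r * card (edges F)) H (g a) (g b)"
  shows "contains H (expansion r F)"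
proof -
  let ?G = "g ` verts F"
  have fF: "finite (verts F)" "finite (edges F)" using r_graphD(1)[OF F] r_graph_finite_edges[OF F] by auto
  define good where "good h X \<longleftrightarrow> (\<forall>f\<in>X. h f \<in> edges H \<and> h f \<inter> ?G = g ` f) \<and>
      (\<forall>f\<in>X. \<forall>f'\<in>X. f \<noteq> f' \<longrightarrow> (h f - ?G) \<inter> (h f' - ?G) = {})" for h X
  have ext: "\<exists>h. good h (D \<union> X)" if "finite X" "X \<subseteq> edges F - D" for X
    using that
  proof (induction X rule: finite_induct)
    case empty
    have "good (\<lambda>_. e0) D" unfolding good_def using D(1) h0 by (metis singletonD subsetD)
    then show ?case by auto
  next
    case (insert f X)
    then obtain h where h: "good h (D \<union> X)" by auto
    have f: "f \<in> edges F" "f \<notin> D" "f \<notin> D \<union> X" using insert by auto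
    obtain a b where ab: "a \<noteq> b" "f = {a, b}" using card_2_obtain[OF r_graphD(3)[OF F f(1)]] by blast
    have fv: "f \<subseteq> verts F" by (rule r_graphD(2)[OF F f(1)])
    have DX: "D \<union> X \<subseteq> edges F" "finite (D \<union> X)" using D(2) insert(4) fF(2) by (auto intro: finite_subset)
    \<comment> \<open>Everything in use except the two ends of the current pair: the core and the
      edges chosen so far. Its size is what determines the thickness required.\<close>
    let ?S = "(?G \<union> (\<Union>f'\<in>D \<union> X. h f')) - {g a, g b}"
    have hf: "finite (h f')" "card (h f') = r" if "f' \<in> D \<union> X" for f'
    proof -
      have "h f' \<in> edges H" using h that unfolding good_def by simp
      then show "finite (h f')" "card (h f') = r" using r_graphD(3,4)[OF H] by simp_all
    qed
    have fS: "finite (?G \<union> (\<Union>f'\<in>D \<union> X. h f'))" by (intro finite_UnI finite_imageI fF(1) finite_UN_I[OF DX(2)] hf(1))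
    have "card ?S \<le> card (?G \<union> (\<Union>f'\<in>D \<union> X. h f'))" by (rule card_mono[OF fS]) blast
    also have "\<dots> \<le> card ?G + card (\<Union>f'\<in>D \<union> X. h f')" by (rule card_Un_le)
    also have "\<dots> \<le> card (verts F) + r * card (edges F)"
    proof (rule add_mono)
      show "card ?G \<le> card (verts F)" by (rule card_image_le[OF fF(1)])
      have "card (\<Union>f'\<in>D \<union> X. h f') \<le> (\<Sum>f'\<in>D \<union> X. card (h f'))" by (rule card_UN_le[OF DX(2)])
      also have "\<dots> = r * card (D \<union> X)" using hf(2) by simp
      also have "\<dots> \<le> r * card (edges F)" by (intro mult_le_mono2 card_mono fF(2) DX(1))
      finally show "card (\<Union>f'\<in>D \<union> X. h f') \<le> r * card (edges F)" .
    qed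
    finally have cS: "card ?S \<le> card (verts F) + r * card (edges F)" .
    have th': "thick (card (verts F) + r * card (edges F)) H (g a) (g b)" using th f(1,2) ab(2) by simp
    have S: "finite ?S" "g a \<notin> ?S" "g b \<notin> ?S" using fS by simp_all
    have "\<exists>e\<in>edges H. g a \<in> e \<and> g b \<in> e \<and> e \<inter> ?S = {}"
      using th' unfolding thick_def by (elim conjE allE[of _ ?S]) (simp only: S cS simp_thms)
    then obtain e where e: "e \<in> edges H" "g a \<in> e" "g b \<in> e" "e \<inter> ?S = {}" by (elim bexE conjE) (rule that)
    let ?h = "h(f := e)"
    have gf: "g ` f = {g a, g b}" using ab by auto
    have ge: "e \<inter> ?G = g ` f" using e fv unfolding gf ab(2) by blast
    have dj: "(e - ?G) \<inter> (h f' - ?G) = {}" if "f' \<in> D \<union> X" for f'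
    proof -
      have "h f' \<subseteq> ?S \<union> {g a, g b}" using that by auto
      moreover have "{g a, g b} \<subseteq> ?G" using ab fv by auto
      ultimately show ?thesis using e(4) by blast
    qed
    have hh: "?h f' = h f'" if "f' \<in> D \<union> X" for f' using that f(3) by auto
    have hg: "h f' \<in> edges H" "h f' \<inter> ?G = g ` f'" if "f' \<in> D \<union> X" for f'
      using h that unfolding good_def by simp_all
    have hd: "(h f' - ?G) \<inter> (h f'' - ?G) = {}" if "f' \<in> D \<union> X" "f'' \<in> D \<union> X" "f' \<noteq> f''" for f' f''
      using h that unfolding good_def by simp
    have "good ?h (insert f (D \<union> X))"
      unfolding good_def
    proof (intro conjI ballI impI)
      fix f' assume f': "f' \<in> insert f (D \<union> X)"
      show "?h f' \<in> edges H" "?h f' \<inter> ?G = g ` f'"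
      proof -
        have "?h f' \<in> edges H \<and> ?h f' \<inter> ?G = g ` f'"
        proof (cases "f' = f")
          case True
          then show ?thesis using e(1) ge by simp
        next
          case False
          then have "f' \<in> D \<union> X" using f' by blast
          then show ?thesis using hg hh by simp
        qed
        then show "?h f' \<in> edges H" "?h f' \<inter> ?G = g ` f'" by blast+
      qed
      fix f'' assume f'': "f'' \<in> insert f (D \<union> X)" "f' \<noteq> f''"
      consider "f' = f" "f'' \<in> D \<union> X" | "f' \<in> D \<union> X" "f'' = f" | "f' \<in> D \<union> X" "f'' \<in> D \<union> X"
        using f' f'' by blast
      then show "(?h f' - ?G) \<inter> (?h f'' - ?G) = {}"
      proof cases
        case 1
        show ?thesis unfolding hh[OF 1(2)] using dj[OF 1(2)] 1(1) by (simp only: fun_upd_same)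
      next
        case 2
        show ?thesis unfolding hh[OF 2(1)] using dj[OF 2(1)] 2(2) by (simp only: fun_upd_same Int_commute)
      next
        case 3
        show ?thesis unfolding hh[OF 3(1)] hh[OF 3(2)] by (rule hd[OF 3 f''(2)])
      qed
    qed
    then show ?case unfolding Un_insert_right by (rule exI[of _ ?h])
  qed
  have "D \<union> (edges F - D) = edges F" using D(2) by blast
  moreover have "finite (edges F - D)" using fF(2) by (rule finite_Diff)
  ultimately obtain h where h: "good h (edges F)" using ext[of "edges F - D"] by (metis order_refl)
  show ?thesis
  proof (rule contains_expansionI_edges[OF H r F g, of h])
    show "h f \<in> edges H" "h f \<inter> ?G = g ` f" if "f \<in> edges F" for f using h that unfolding good_def by simp_all
    show "(h f - ?G) \<inter> (h f' - ?G) = {}" if "f \<in> edges F" "f' \<in> edges F" "f \<noteq> f'" for f f'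
      using h that unfolding good_def by simp
  qed
qed

section \<open>Colourings and edge-critical graphs\<close>

text \<open>A colouring of the host with rainbow edges restricts to a proper colouring of
  \<open>F\<close> along the core of an expansion.\<close>

lemma not_contains_expansion:
  assumes F: "r_graph 2 F" and nc: "\<not> colorable F l" and c: "c \<in> verts H \<rightarrow> {..<l}"
    and rainbow: "\<And>e. e \<in> edges H \<Longrightarrow> inj_on c e"
  shows "\<not> contains H (expansion r F)"
proof
  assume "contains H (expansion r F)"
  then obtain \<phi> where \<phi>: "\<phi> \<in> inj_homs (expansion r F) H" by (auto simp: contains_def)
  note \<phi> = inj_homsD[OF \<phi>]
  have vx: "Inl u \<in> verts (expansion r F)" if "u \<in> verts F" for u using that by (simp add: expansion_def)
  have "colorable F l" unfolding colorable_def
  proof (intro exI[of _ "\<lambda>u. c (\<phi> (Inl u))"] conjI allI impI)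
    show "(\<lambda>u. c (\<phi> (Inl u))) \<in> verts F \<rightarrow> {..<l}" using \<phi>(1) vx c by (auto simp: PiE_def Pi_def)
    fix u w assume e: "{u, w} \<in> edges F"
    have uw: "u \<in> verts F" "w \<in> verts F" "u \<noteq> w" using r_graphD(2,3)[OF F e] by (auto simp: card_2_iff doubleton_eq_iff)
    have "Inl ` {u, w} \<union> Inr ` ({{u, w}} \<times> {..<r - 2}) \<in> edges (expansion r F)"
      unfolding expansion_def hypergraph.sel using e by (rule imageI)
    then have "\<phi> ` (Inl ` {u, w} \<union> Inr ` ({{u, w}} \<times> {..<r - 2})) \<in> edges H" by (rule \<phi>(3))
    from rainbow[OF this] have "inj_on c (\<phi> ` (Inl ` {u, w} \<union> Inr ` ({{u, w}} \<times> {..<r - 2})))" .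
    moreover have "\<phi> (Inl u) \<noteq> \<phi> (Inl w)" using \<phi>(2) vx uw by (metis Inl_inject inj_onD)
    ultimately show "c (\<phi> (Inl u)) \<noteq> c (\<phi> (Inl w))" by (auto simp: inj_on_def)
  qed
  then show False using nc by blast
qed

lemma colorable_card:
  assumes "r_graph 2 F"
  shows "colorable F (card (verts F))"
proof -
  obtain f where f: "bij_betw f (verts F) {0..<card (verts F)}"
    using ex_bij_betw_finite_nat[OF r_graphD(1)[OF assms]] by blast
  have "f u \<noteq> f w" if "{u, w} \<in> edges F" for u w
  proof -
    have "u \<in> verts F" "w \<in> verts F" "u \<noteq> w" using r_graphD(2,3)[OF assms that] by (auto simp: card_2_iff doubleton_eq_iff)
    then show ?thesis using f by (metis bij_betw_imp_inj_on inj_onD)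
  qed
  moreover have "f \<in> verts F \<rightarrow> {..<card (verts F)}" using f by (auto simp: bij_betw_def)
  ultimately show ?thesis unfolding colorable_def by blast
qed

lemma colorable_mono:
  assumes "colorable F k" "k \<le> m"
  shows "colorable F m"
proof -
  obtain c where c: "c \<in> verts F \<rightarrow> {..<k}" "\<forall>u v. {u, v} \<in> edges F \<longrightarrow> c u \<noteq> c v"
    using assms(1) unfolding colorable_def by blast
  have "c \<in> verts F \<rightarrow> {..<m}" using c(1) assms(2) by (auto simp: Pi_def)
  then show ?thesis using c(2) unfolding colorable_def by blast
qed

lemma colorable_chromatic_number: "r_graph 2 F \<Longrightarrow> colorable F (chromatic_number F)"
  unfolding chromatic_number_def by (rule LeastI[of "colorable F"]) (rule colorable_card)

lemma not_colorable_less: "k < chromatic_number F \<Longrightarrow> \<not> colorable F k"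
  unfolding chromatic_number_def by (rule not_less_Least)

text \<open>Without its critical edge \<open>F\<close> is \<open>l\<close>-colourable, and the ends
  of that edge must get the same colour, as otherwise \<open>F\<close> itself would be
  \<open>l\<close>-colourable. Permuting the colours makes this common colour arbitrary.\<close>

lemma edge_critical_colouring:
  assumes F: "r_graph 2 F" and crit: "edge_critical F" and chi: "chromatic_number F = l + 1"
  obtains a b where "{a, b} \<in> edges F" "a \<noteq> b"
    "\<And>i. i < l \<Longrightarrow> \<exists>\<chi> \<in> verts F \<rightarrow> {..<l}. \<chi> a = i \<and> \<chi> b = i \<and> (\<forall>u w. {u, w} \<in> edges F \<longrightarrow> {u, w} \<noteq> {a, b} \<longrightarrow> \<chi> u \<noteq> \<chi> w)"
proof -
  obtain e where e: "e \<in> edges F" "chromatic_number (delete_edge F e) < l + 1"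
    using crit chi by (auto simp: edge_critical_def)
  obtain a b where ab: "a \<noteq> b" "e = {a, b}" using r_graphD(3)[OF F e(1)] by (auto simp: card_2_iff)
  have "r_graph 2 (delete_edge F e)" using F by (auto simp: r_graph_def delete_edge_def)
  then have "colorable (delete_edge F e) l"
    using colorable_mono[OF colorable_chromatic_number] e(2) by (metis Suc_eq_plus1 less_Suc_eq_le)
  then obtain \<chi> where \<chi>: "\<chi> \<in> verts F \<rightarrow> {..<l}" "\<And>u w. {u, w} \<in> edges F \<Longrightarrow> {u, w} \<noteq> e \<Longrightarrow> \<chi> u \<noteq> \<chi> w"
    by (auto simp: colorable_def delete_edge_def)
  have nc: "\<not> colorable F l" using not_colorable_less[of l F] chi by simp
  have same: "\<chi> a = \<chi> b"
  proof (rule ccontr)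
    assume ne: "\<chi> a \<noteq> \<chi> b"
    have "\<chi> u \<noteq> \<chi> w" if "{u, w} \<in> edges F" for u w
    proof (cases "{u, w} = e")
      case True
      then show ?thesis using ne ab by (metis doubleton_eq_iff)
    qed (use \<chi>(2) that in blast)
    then show False using nc \<chi>(1) unfolding colorable_def by blast
  qed
  have av: "a \<in> verts F" using r_graphD(2)[OF F e(1)] ab by blast
  have "\<exists>\<chi>' \<in> verts F \<rightarrow> {..<l}. \<chi>' a = i \<and> \<chi>' b = i \<and> (\<forall>u w. {u, w} \<in> edges F \<longrightarrow> {u, w} \<noteq> {a, b} \<longrightarrow> \<chi>' u \<noteq> \<chi>' w)" if i: "i < l" for i
  proof -
    \<comment> \<open>The transposition of \<open>i\<close> and the common colour of
      \<open>a\<close> and \<open>b\<close>.\<close>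
    let ?s = "\<lambda>x. if x = i then \<chi> a else if x = \<chi> a then i else x"
    have inj: "?s x = ?s y \<Longrightarrow> x = y" for x y by (auto split: if_splits)
    have al: "\<chi> a < l" using \<chi>(1) av by auto
    have "(\<lambda>u. ?s (\<chi> u)) \<in> verts F \<rightarrow> {..<l}" using \<chi>(1) al i by auto
    moreover have "?s (\<chi> a) = i" "?s (\<chi> b) = i" using same by auto
    moreover have "?s (\<chi> u) \<noteq> ?s (\<chi> w)" if "{u, w} \<in> edges F" "{u, w} \<noteq> {a, b}" for u w
      using \<chi>(2)[OF that(1)] that(2) ab(2) inj by metis
    ultimately show ?thesis by (intro bexI[of _ "\<lambda>u. ?s (\<chi> u)"]) blast+
  qed
  then show thesis using that e(1) ab by blast
qed

lemma coloured_injection: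
  assumes fin: "finite X" and \<chi>: "\<chi> \<in> X \<rightarrow> {..<m}"
    and A: "\<And>i. i < m \<Longrightarrow> finite (A i) \<and> card X \<le> card (A i)"
    and disj: "\<And>i j. i < m \<Longrightarrow> j < m \<Longrightarrow> i \<noteq> j \<Longrightarrow> A i \<inter> A j = {}"
  shows "\<exists>g. inj_on g X \<and> (\<forall>u\<in>X. g u \<in> A (\<chi> u))"
proof -
  have "\<exists>\<iota>. \<forall>i\<in>{..<m}. inj_on (\<iota> i) X \<and> \<iota> i ` X \<subseteq> A i"
    by (rule bchoice) (use card_le_inj[OF fin] A in \<open>metis lessThan_iff\<close>)
  then obtain \<iota> where \<iota>: "\<And>i. i < m \<Longrightarrow> inj_on (\<iota> i) X \<and> \<iota> i ` X \<subseteq> A i" by blast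
  have in_A: "\<iota> (\<chi> u) u \<in> A (\<chi> u)" "\<chi> u < m" if "u \<in> X" for u using \<iota>[of "\<chi> u"] \<chi> that by auto
  have "inj_on (\<lambda>u. \<iota> (\<chi> u) u) X"
  proof (rule inj_onI)
    fix u w assume uw: "u \<in> X" "w \<in> X" "\<iota> (\<chi> u) u = \<iota> (\<chi> w) w"
    have "\<chi> u = \<chi> w" using disj[of "\<chi> u" "\<chi> w"] in_A[OF uw(1)] in_A[OF uw(2)] uw(3) by fastforce
    then show "u = w" using uw \<iota>[of "\<chi> u"] in_A(2)[OF uw(1)] by (metis inj_onD)
  qed
  then show ?thesis using in_A(1) by blast
qed

section \<open>Finding an expansion near a multipartite graph\<close>

text \<open>Any two elements of different sides occur together in some tuple of the box, provided
  that the other sides can be filled.\<close>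

lemma box_adjacent:
  assumes sub: "Pi\<^sub>E J A \<subseteq> {f. \<forall>i\<in>J. \<forall>j\<in>J. i \<noteq> j \<longrightarrow> E (f i) (f j)}" and ne: "\<And>k. k \<in> J \<Longrightarrow> A k \<noteq> {}"
    and ij: "i \<in> J" "j \<in> J" "i \<noteq> j" and xy: "x \<in> A i" "y \<in> A j"
  shows "E x y"
proof -
  let ?f = "\<lambda>k\<in>J. if k = i then x else if k = j then y else SOME z. z \<in> A k"
  have "?f \<in> Pi\<^sub>E J A" using xy some_in_eq[of "A _"] ne by auto
  then have "E (?f i) (?f j)" using sub ij by blast
  then show ?thesis using ij by simp
qed

text \<open>Transversal cliques have positive density, so they contain a box. Its sides are pairwise
  completely adjacent, that is, they form a complete \<open>m\<close>-partite subgraph with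
  \<open>t\<close> vertices in each of the prescribed sets \<open>A j\<close>.\<close>

lemma transversal_box:
  assumes \<beta>: "0 < \<beta>" "\<beta> \<le> \<alpha> ^ m - real m ^ 2 * \<eta>" and \<alpha>: "0 \<le> \<alpha>" and t: "0 < t"
  shows "\<exists>N. \<forall>V c E A. finite (V :: 'a set) \<longrightarrow> N \<le> card V \<longrightarrow>
     real (card (missing V c E)) \<le> \<eta> * real (card V) ^ 2 \<longrightarrow>
     (\<forall>j<m. A j \<subseteq> {x\<in>V. c x = j} \<and> \<alpha> * real (card V) \<le> real (card (A j))) \<longrightarrow>
     (\<exists>B. (\<forall>j<m. B j \<subseteq> A j \<and> card (B j) = t) \<and> (\<forall>i<m. \<forall>j<m. i \<noteq> j \<longrightarrow> (\<forall>x\<in>B i. \<forall>y\<in>B j. E x y)))"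
proof -
  obtain N where N: "\<forall>V R. finite (V :: 'a set) \<longrightarrow> card V \<ge> N \<longrightarrow> R \<subseteq> {..<m} \<rightarrow>\<^sub>E V \<longrightarrow>
     real (card R) \<ge> \<beta> * real (card V) ^ m \<longrightarrow> (\<exists>A. (\<forall>i<m. A i \<subseteq> V \<and> card (A i) = t) \<and> Pi\<^sub>E {..<m} A \<subseteq> R)"
    using dense_tuples_contain_box[OF \<beta>(1), where m = m and t = t] by (elim exE) (rule that)
  show ?thesis
  proof (intro exI[of _ N] allI impI)
    fix V :: "'a set" and c :: "'a \<Rightarrow> nat" and E A
    assume V: "finite V" "N \<le> card V" and miss: "real (card (missing V c E)) \<le> \<eta> * real (card V) ^ 2"
      and A: "\<forall>j<m. A j \<subseteq> {x\<in>V. c x = j} \<and> \<alpha> * real (card V) \<le> real (card (A j))"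
    let ?R = "{f \<in> Pi\<^sub>E {..<m} A. \<forall>i\<in>{..<m}. \<forall>j\<in>{..<m}. i \<noteq> j \<longrightarrow> E (f i) (f j)}"
    have "(\<alpha> ^ card {..<m} - real (card {..<m}) ^ 2 * \<eta>) * real (card V) ^ card {..<m} \<le> real (card ?R)"
      by (rule card_transversal_cliques[OF _ V(1) _ _ \<alpha> miss]) (use A in simp_all)
    moreover have "\<beta> * real (card V) ^ m \<le> (\<alpha> ^ m - real m ^ 2 * \<eta>) * real (card V) ^ m"
      by (rule mult_right_mono[OF \<beta>(2)]) simp
    ultimately have d: "\<beta> * real (card V) ^ m \<le> real (card ?R)" unfolding card_lessThan by linarith
    have RV: "?R \<subseteq> {..<m} \<rightarrow>\<^sub>E V"
    proof
      fix f assume "f \<in> ?R"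
      then have f: "f \<in> Pi\<^sub>E {..<m} A" by blast
      show "f \<in> {..<m} \<rightarrow>\<^sub>E V"
      proof (rule PiE_I)
        show "f j \<in> V" if "j \<in> {..<m}" for j using PiE_mem[OF f that] A that by blast
        show "f j = undefined" if "j \<notin> {..<m}" for j by (rule PiE_arb[OF f that])
      qed
    qed
    obtain B where B: "\<forall>i<m. B i \<subseteq> V \<and> card (B i) = t" "Pi\<^sub>E {..<m} B \<subseteq> ?R"
      using N[rule_format, OF V RV d] by (elim exE conjE) (rule that)
    \<comment> \<open>Nonempty sides allow both \<open>B j \<subseteq> A j\<close> and pairwise
      adjacency to be read off from the inclusion of a product.\<close>
    have ne: "B k \<noteq> {}" if "k \<in> {..<m}" for k using B(1) t that by (metis card.empty lessThan_iff not_gr_zero)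
    have "Pi\<^sub>E {..<m} B \<subseteq> Pi\<^sub>E {..<m} A" using B(2) by blast
    then have BA: "B j \<subseteq> A j" if "j < m" for j using ne that unfolding subset_PiE PiE_eq_empty_iff by blast
    have cl: "Pi\<^sub>E {..<m} B \<subseteq> {f. \<forall>i\<in>{..<m}. \<forall>j\<in>{..<m}. i \<noteq> j \<longrightarrow> E (f i) (f j)}" using B(2) by blast
    have adj: "E x y" if "i < m" "j < m" "i \<noteq> j" "x \<in> B i" "y \<in> B j" for i j x y
      by (rule box_adjacent[where E = E, OF cl ne]) (use that in auto)
    show "\<exists>B. (\<forall>j<m. B j \<subseteq> A j \<and> card (B j) = t) \<and> (\<forall>i<m. \<forall>j<m. i \<noteq> j \<longrightarrow> (\<forall>x\<in>B i. \<forall>y\<in>B j. E x y))"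
      by (intro exI[of _ B] conjI allI impI ballI BA adj) (use B(1) in auto)
  qed
qed

text \<open>The axiom \<open>pc_adj\<close> says that the shadow of \<open>Q\<close> is complete
  multipartite with the fibres of \<open>pc\<close> as parts, in the form in which it is applied:
  differently coloured vertices share an edge.\<close>

locale expansion_problem = colour_pattern "verts Q" pc l
  for Q :: "'q hypergraph" and pc :: "'q \<Rightarrow> nat" and l :: nat +
  fixes r :: nat and F :: "'f hypergraph"
  assumes r_ge_2: "2 \<le> r" and Q: "r_graph r Q"
    and pc_adj: "\<And>a b. a \<in> verts Q \<Longrightarrow> b \<in> verts Q \<Longrightarrow> pc a \<noteq> pc b \<longleftrightarrow> a \<noteq> b \<and> (\<exists>e\<in>edges Q. a \<in> e \<and> b \<in> e)"
    and F: "r_graph 2 F" and crit: "edge_critical F" and chi: "chromatic_number F = l + 1"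
begin

abbreviation s :: nat where "s \<equiv> card (verts F) + r * card (edges F)"
abbreviation T :: "nat hypergraph \<Rightarrow> nat \<Rightarrow> nat \<Rightarrow> bool" where "T H \<equiv> thick s H"

lemma finite_verts_F: "finite (verts F)" by (rule r_graphD(1)[OF F])

lemma verts_F_pos: "0 < card (verts F)"
proof -
  obtain e where "e \<in> edges F" using crit by (auto simp: edge_critical_def)
  then have "e \<subseteq> verts F" "card e = 2" using r_graphD(2,3)[OF F] by blast+
  then show ?thesis using card_mono[OF finite_verts_F, of e] by simp
qed

lemma edge_F: "{u, w} \<in> edges F \<Longrightarrow> u \<in> verts F \<and> w \<in> verts F \<and> u \<noteq> w"
  using r_graphD(2,3)[OF F] by (fastforce simp: card_2_iff doubleton_eq_iff)

text \<open>Positive density of ordered \<open>(l + 1)\<close>-cliques would give a complete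
  \<open>(l + 1)\<close>-partite graph of thick pairs with \<open>card (verts F)\<close> vertices in
  each part. It contains \<open>F\<close>, as \<open>F\<close> is \<open>(l + 1)\<close>-colourable,
  and thick pairs expand.\<close>

lemma cliques_few:
  assumes "\<zeta> > 0"
  shows "\<exists>N. \<forall>H. r_graph r H \<longrightarrow> N \<le> card (verts H) \<longrightarrow> \<not> contains H (expansion r F) \<longrightarrow>
    hK (verts H) (T H) \<le> \<zeta> * real (card (verts H)) ^ (l + 1)"
proof -
  obtain N where N: "\<forall>V R. finite (V :: nat set) \<longrightarrow> card V \<ge> N \<longrightarrow> R \<subseteq> {..<l + 1} \<rightarrow>\<^sub>E V \<longrightarrow>
     real (card R) \<ge> \<zeta> * real (card V) ^ (l + 1) \<longrightarrow>
     (\<exists>A. (\<forall>i<l + 1. A i \<subseteq> V \<and> card (A i) = card (verts F)) \<and> Pi\<^sub>E {..<l + 1} A \<subseteq> R)"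
    using dense_tuples_contain_box[OF assms, where m = "l + 1" and t = "card (verts F)"] by (elim exE) (rule that)
  show ?thesis
  proof (intro exI[of _ N] allI impI, rule ccontr)
    fix H :: "nat hypergraph" assume H: "r_graph r H" and n: "N \<le> card (verts H)" and nc: "\<not> contains H (expansion r F)"
      and big: "\<not> hK (verts H) (T H) \<le> \<zeta> * real (card (verts H)) ^ (l + 1)"
    let ?R = "homs {..<l + 1} (id :: nat \<Rightarrow> nat) (verts H) (T H)"
    have R: "?R \<subseteq> {..<l + 1} \<rightarrow>\<^sub>E verts H" using homs_PiE by blast
    have "\<zeta> * real (card (verts H)) ^ (l + 1) \<le> real (card ?R)" using big by linarith
    from N[rule_format, OF r_graphD(1)[OF H] n R this]
    obtain A where A: "\<forall>i<l + 1. A i \<subseteq> verts H \<and> card (A i) = card (verts F)" "Pi\<^sub>E {..<l + 1} A \<subseteq> ?R"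
      by (elim exE conjE) (rule that)
    have ne: "A k \<noteq> {}" if "k \<in> {..<l + 1}" for k using A(1) verts_F_pos that by (metis card.empty lessThan_iff not_gr_zero)
    have cl: "Pi\<^sub>E {..<l + 1} A \<subseteq> {f. \<forall>i\<in>{..<l + 1}. \<forall>j\<in>{..<l + 1}. i \<noteq> j \<longrightarrow> T H (f i) (f j)}"
      using A(2) by (auto simp: homs_def)
    have adj: "T H x y" if "i < l + 1" "j < l + 1" "i \<noteq> j" "x \<in> A i" "y \<in> A j" for i j x y
      by (rule box_adjacent[where E = "T H", OF cl ne]) (use that in auto)
    obtain \<chi> where \<chi>: "\<chi> \<in> verts F \<rightarrow> {..<l + 1}" "\<And>u w. {u, w} \<in> edges F \<Longrightarrow> \<chi> u \<noteq> \<chi> w"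
      using colorable_chromatic_number[OF F] unfolding chi colorable_def by blast
    have "\<exists>g. inj_on g (verts F) \<and> (\<forall>u\<in>verts F. g u \<in> A (\<chi> u))"
    proof (rule coloured_injection[OF finite_verts_F \<chi>(1)])
      show "finite (A i) \<and> card (verts F) \<le> card (A i)" if "i < l + 1" for i
        using A(1) that r_graphD(1)[OF H] by (auto intro: finite_subset)
      show "A i \<inter> A j = {}" if "i < l + 1" "j < l + 1" "i \<noteq> j" for i j
        using adj[OF that] by (auto simp: thick_def)
    qed
    then obtain g where g: "inj_on g (verts F)" "\<And>u. u \<in> verts F \<Longrightarrow> g u \<in> A (\<chi> u)" by blast
    have \<chi>l: "\<chi> u < l + 1" if "u \<in> verts F" for u using \<chi>(1) that by auto
    have "contains H (expansion r F)"
    proof (rule contains_expansionI[OF H r_ge_2 F g(1), of "{}"])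
      show "g ` verts F \<subseteq> verts H" using g(2) A(1) \<chi>l by blast
      fix u w assume "{u, w} \<in> edges F"
      then show "T H (g u) (g w)" using edge_F adj[OF \<chi>l \<chi>l \<chi>(2) g(2) g(2)] by blast
    qed auto
    then show False using nc by blast
  qed
qed

text \<open>The vertex \<open>x\<close> takes the place of one end \<open>a\<close> of the critical
  edge. All remaining edges of \<open>F\<close> are properly coloured with \<open>l\<close> colours,
  so the other vertices fit into a complete \<open>l\<close>-partite graph of thick pairs within the
  thick neighbourhood of \<open>x\<close>, where every vertex is thickly adjacent to
  \<open>x\<close>.\<close>

lemma contains_of_wide_vertex:
  assumes \<beta>: "0 < \<beta>" "\<beta> \<le> \<gamma> ^ l - real l ^ 2 * \<eta>" and \<gamma>: "0 \<le> \<gamma>"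
  shows "\<exists>N. \<forall>H c x. r_graph r H \<longrightarrow> N \<le> card (verts H) \<longrightarrow>
     real (card (missing (verts H) c (T H))) \<le> \<eta> * real (card (verts H)) ^ 2 \<longrightarrow> x \<in> verts H \<longrightarrow>
     (\<forall>i<l. \<gamma> * real (card (verts H)) \<le> real (card {y\<in>verts H. c y = i \<and> T H x y})) \<longrightarrow> contains H (expansion r F)"
proof -
  obtain N where N: "\<forall>V c E A. finite (V :: nat set) \<longrightarrow> N \<le> card V \<longrightarrow>
     real (card (missing V c E)) \<le> \<eta> * real (card V) ^ 2 \<longrightarrow>
     (\<forall>j<l. A j \<subseteq> {x\<in>V. c x = j} \<and> \<gamma> * real (card V) \<le> real (card (A j))) \<longrightarrow>
     (\<exists>B. (\<forall>j<l. B j \<subseteq> A j \<and> card (B j) = card (verts F)) \<and> (\<forall>i<l. \<forall>j<l. i \<noteq> j \<longrightarrow> (\<forall>x\<in>B i. \<forall>y\<in>B j. E x y)))"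
    using transversal_box[OF \<beta> \<gamma> verts_F_pos] by (elim exE) (rule that)
  show ?thesis
  proof (intro exI[of _ N] allI impI)
    fix H :: "nat hypergraph" and c x assume H: "r_graph r H" and n: "N \<le> card (verts H)"
      and miss: "real (card (missing (verts H) c (T H))) \<le> \<eta> * real (card (verts H)) ^ 2" and x: "x \<in> verts H"
      and wide: "\<forall>i<l. \<gamma> * real (card (verts H)) \<le> real (card {y\<in>verts H. c y = i \<and> T H x y})"
    let ?A = "\<lambda>i. {y\<in>verts H. c y = i \<and> T H x y}"
    have A: "\<forall>j<l. ?A j \<subseteq> {x\<in>verts H. c x = j} \<and> \<gamma> * real (card (verts H)) \<le> real (card (?A j))"
      using wide by auto
    have "\<exists>B. (\<forall>j<l. B j \<subseteq> ?A j \<and> card (B j) = card (verts F)) \<and> (\<forall>i<l. \<forall>j<l. i \<noteq> j \<longrightarrow> (\<forall>x\<in>B i. \<forall>y\<in>B j. T H x y))"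
      by (rule N[rule_format, OF r_graphD(1)[OF H] n miss]) (rule A[rule_format])
    then obtain B where B: "\<forall>j<l. B j \<subseteq> ?A j \<and> card (B j) = card (verts F)"
      "\<forall>i<l. \<forall>j<l. i \<noteq> j \<longrightarrow> (\<forall>x\<in>B i. \<forall>y\<in>B j. T H x y)" by (elim exE conjE) (rule that)
    have Badj: "T H x y" if "i < l" "j < l" "i \<noteq> j" "x \<in> B i" "y \<in> B j" for i j x y using B(2) that by blast
    obtain a b where ab: "{a, b} \<in> edges F" "a \<noteq> b"
      and col: "\<And>i. i < l \<Longrightarrow> \<exists>\<chi> \<in> verts F \<rightarrow> {..<l}. \<chi> a = i \<and> \<chi> b = i \<and> (\<forall>u w. {u, w} \<in> edges F \<longrightarrow> {u, w} \<noteq> {a, b} \<longrightarrow> \<chi> u \<noteq> \<chi> w)"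
      by (rule edge_critical_colouring[OF F crit chi]) (rule that)
    have "0 < l" using l_ge_2 by simp
    from col[OF this] obtain \<chi> where \<chi>: "\<chi> \<in> verts F \<rightarrow> {..<l}" "\<And>u w. {u, w} \<in> edges F \<Longrightarrow> {u, w} \<noteq> {a, b} \<Longrightarrow> \<chi> u \<noteq> \<chi> w" by blast
    have "\<exists>g. inj_on g (verts F) \<and> (\<forall>u\<in>verts F. g u \<in> B (\<chi> u))"
    proof (rule coloured_injection[OF finite_verts_F \<chi>(1)])
      show "finite (B i) \<and> card (verts F) \<le> card (B i)" if "i < l" for i
      proof -
        have "B i \<subseteq> verts H" "card (B i) = card (verts F)" using B(1) that by blast+
        then show ?thesis using r_graphD(1)[OF H] by (auto intro: finite_subset)
      qed
      show "B i \<inter> B j = {}" if "i < l" "j < l" "i \<noteq> j" for i j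
      proof -
        have "\<not> T H y y" for y by (simp add: thick_def)
        then show ?thesis using Badj[OF that] by blast
      qed
    qed
    then obtain g where g: "inj_on g (verts F)" "\<And>u. u \<in> verts F \<Longrightarrow> g u \<in> B (\<chi> u)" by blast
    have \<chi>l: "\<chi> u < l" if "u \<in> verts F" for u using \<chi>(1) that by auto
    have gx: "T H x (g u)" "g u \<in> verts H" if "u \<in> verts F" for u using g(2)[OF that] B(1) \<chi>l[OF that] by blast+
    have gne: "g u \<noteq> x" if "u \<in> verts F" for u using gx(1)[OF that] by (auto simp: thick_def)
    let ?g = "g(a := x)"
    show "contains H (expansion r F)"
    proof (rule contains_expansionI[OF H r_ge_2 F, of ?g "{}"])
      show "inj_on ?g (verts F)" using g(1) gne by (intro inj_on_fun_updI) auto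
      show "?g ` verts F \<subseteq> verts H" using gx(2) x by auto
      fix u w assume uw: "{u, w} \<in> edges F"
      then have uw': "u \<in> verts F" "w \<in> verts F" "u \<noteq> w" using edge_F by blast+
      consider "u = a" | "w = a" "u \<noteq> a" | "u \<noteq> a" "w \<noteq> a" by blast
      then show "T H (?g u) (?g w)"
      proof cases
        case 1 then show ?thesis using gx(1)[OF uw'(2)] uw'(3) by simp
      next
        case 2 then show ?thesis using thick_sym[OF gx(1)[OF uw'(1)]] by simp
      next
        case 3
        then have "{u, w} \<noteq> {a, b}" by (metis doubleton_eq_iff)
        then have "\<chi> u \<noteq> \<chi> w" using \<chi>(2) uw by blast
        then have "T H (g u) (g w)" by (rule Badj[OF \<chi>l[OF uw'(1)] \<chi>l[OF uw'(2)] _ g(2)[OF uw'(1)] g(2)[OF uw'(2)]])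
        then show ?thesis using 3 by simp
      qed
    qed auto
  qed
qed

text \<open>The vertices \<open>y\<close> and \<open>z\<close> become the ends of the critical edge,
  and \<open>e\<close> itself is its expansion, so \<open>y\<close> and \<open>z\<close> do not have
  to form a thick pair. The ends have colour \<open>i\<close>, hence their other neighbours in
  \<open>F\<close> have different colours, and thick adjacency of \<open>y\<close> and
  \<open>z\<close> is only required towards the parts other than \<open>i\<close>.\<close>

lemma contains_of_monochromatic_pair:
  assumes \<beta>: "0 < \<beta>" "\<beta> \<le> (c0/4) ^ l - real l ^ 2 * \<eta>" and c0: "0 < c0"
  shows "\<exists>N. \<forall>H c e y z i. r_graph r H \<longrightarrow> N \<le> card (verts H) \<longrightarrow>
     real (card (missing (verts H) c (T H))) \<le> \<eta> * real (card (verts H)) ^ 2 \<longrightarrow>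
     (\<forall>i<l. c0 * real (card (verts H)) \<le> real (card {x\<in>verts H. c x = i})) \<longrightarrow>
     e \<in> edges H \<longrightarrow> y \<in> e \<longrightarrow> z \<in> e \<longrightarrow> y \<noteq> z \<longrightarrow> i < l \<longrightarrow>
     real (card {w\<in>verts H. c w \<noteq> i \<and> \<not> T H y w}) \<le> c0/4 * real (card (verts H)) + 1 \<longrightarrow>
     real (card {w\<in>verts H. c w \<noteq> i \<and> \<not> T H z w}) \<le> c0/4 * real (card (verts H)) + 1 \<longrightarrow>
     contains H (expansion r F)"
proof -
  have c04: "0 \<le> c0/4" using c0 by simp
  obtain N where N: "\<forall>V c E A. finite (V :: nat set) \<longrightarrow> N \<le> card V \<longrightarrow>
     real (card (missing V c E)) \<le> \<eta> * real (card V) ^ 2 \<longrightarrow>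
     (\<forall>j<l. A j \<subseteq> {x\<in>V. c x = j} \<and> c0/4 * real (card V) \<le> real (card (A j))) \<longrightarrow>
     (\<exists>B. (\<forall>j<l. B j \<subseteq> A j \<and> card (B j) = card (verts F)) \<and> (\<forall>i<l. \<forall>j<l. i \<noteq> j \<longrightarrow> (\<forall>x\<in>B i. \<forall>y\<in>B j. E x y)))"
    using transversal_box[OF \<beta> c04 verts_F_pos] by (elim exE) (rule that)
  \<comment> \<open>From a part of size \<open>c0 * n\<close>, two exceptional sets of size at most
    \<open>c0/4 * n + 1\<close> and the \<open>r\<close> vertices of \<open>e\<close> are removed;
    this leaves \<open>c0/4 * n\<close> when \<open>c0/4 * n \<ge> r + 2\<close>.\<close>
  obtain N' :: nat where N': "real N' > (real r + 2) * 4 / c0" using reals_Archimedean2 by blast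
  show ?thesis
  proof (intro exI[of _ "max N N'"] allI impI)
    fix H :: "nat hypergraph" and c e y z i assume H: "r_graph r H" and n: "max N N' \<le> card (verts H)"
      and miss: "real (card (missing (verts H) c (T H))) \<le> \<eta> * real (card (verts H)) ^ 2"
      and parts: "\<forall>i<l. c0 * real (card (verts H)) \<le> real (card {x\<in>verts H. c x = i})"
      and e: "e \<in> edges H" "y \<in> e" "z \<in> e" "y \<noteq> z" and i: "i < l"
      and my: "real (card {w\<in>verts H. c w \<noteq> i \<and> \<not> T H y w}) \<le> c0/4 * real (card (verts H)) + 1"
      and mz: "real (card {w\<in>verts H. c w \<noteq> i \<and> \<not> T H z w}) \<le> c0/4 * real (card (verts H)) + 1"
    let ?n = "real (card (verts H))"
    have fV: "finite (verts H)" by (rule r_graphD(1)[OF H])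
    have fe: "finite e" "card e = r" "e \<subseteq> verts H" using r_graphD(2-4)[OF H e(1)] by auto
    have rn: "real r + 2 \<le> c0/4 * ?n"
    proof -
      have "real r + 2 \<le> c0/4 * real N'" using N' c0 by (simp add: field_simps)
      also have "\<dots> \<le> c0/4 * ?n" using n c0 by simp
      finally show ?thesis .
    qed
    \<comment> \<open>Part \<open>i\<close> carries no adjacency condition because it hosts no
      neighbour of \<open>a\<close> or \<open>b\<close> apart from these two. Removing
      \<open>e\<close> ensures that \<open>e\<close> meets the core only in \<open>y\<close> and
      \<open>z\<close>.\<close>
    define A where "A j = {w\<in>verts H. c w = j \<and> (j \<noteq> i \<longrightarrow> T H y w \<and> T H z w)} - e" for j
    have A: "\<forall>j<l. A j \<subseteq> {x\<in>verts H. c x = j} \<and> c0/4 * ?n \<le> real (card (A j))"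
    proof (intro allI impI conjI)
      fix j assume j: "j < l"
      show "A j \<subseteq> {x\<in>verts H. c x = j}" by (auto simp: A_def)
      let ?My = "{w\<in>verts H. c w \<noteq> i \<and> \<not> T H y w}" and ?Mz = "{w\<in>verts H. c w \<noteq> i \<and> \<not> T H z w}"
      have "{x\<in>verts H. c x = j} \<subseteq> A j \<union> (e \<union> (?My \<union> ?Mz))" by (auto simp: A_def)
      then have "card {x\<in>verts H. c x = j} \<le> card (A j \<union> (e \<union> (?My \<union> ?Mz)))"
        by (rule card_mono[rotated]) (use fV fe in \<open>simp add: A_def\<close>)
      also have "\<dots> \<le> card (A j) + (card e + (card ?My + card ?Mz))"
        using card_Un_le[of "A j" "e \<union> (?My \<union> ?Mz)"] card_Un_le[of e "?My \<union> ?Mz"] card_Un_le[of ?My ?Mz] by linarith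
      finally have "real (card {x\<in>verts H. c x = j}) \<le> real (card (A j)) + (real r + (real (card ?My) + real (card ?Mz)))"
        unfolding fe(2) by (simp only: of_nat_add[symmetric] of_nat_le_iff)
      moreover have "c0 * ?n \<le> real (card {x\<in>verts H. c x = j})" using parts j by blast
      ultimately show "c0/4 * ?n \<le> real (card (A j))" using my mz rn by linarith
    qed
    have nN: "N \<le> card (verts H)" using n by simp
    have "\<exists>B. (\<forall>j<l. B j \<subseteq> A j \<and> card (B j) = card (verts F)) \<and> (\<forall>i<l. \<forall>j<l. i \<noteq> j \<longrightarrow> (\<forall>x\<in>B i. \<forall>y\<in>B j. T H x y))"
      by (rule N[rule_format, OF fV nN miss]) (rule A[rule_format])
    then obtain B where B: "\<forall>j<l. B j \<subseteq> A j \<and> card (B j) = card (verts F)"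
      "\<forall>i<l. \<forall>j<l. i \<noteq> j \<longrightarrow> (\<forall>x\<in>B i. \<forall>y\<in>B j. T H x y)" by (elim exE conjE) (rule that)
    have Badj: "T H x y" if "i < l" "j < l" "i \<noteq> j" "x \<in> B i" "y \<in> B j" for i j x y using B(2) that by blast
    obtain a b where ab: "{a, b} \<in> edges F" "a \<noteq> b"
      and col: "\<And>i. i < l \<Longrightarrow> \<exists>\<chi> \<in> verts F \<rightarrow> {..<l}. \<chi> a = i \<and> \<chi> b = i \<and> (\<forall>u w. {u, w} \<in> edges F \<longrightarrow> {u, w} \<noteq> {a, b} \<longrightarrow> \<chi> u \<noteq> \<chi> w)"
      by (rule edge_critical_colouring[OF F crit chi]) (rule that)
    obtain \<chi> where \<chi>: "\<chi> \<in> verts F \<rightarrow> {..<l}" "\<chi> a = i" "\<chi> b = i" "\<And>u w. {u, w} \<in> edges F \<Longrightarrow> {u, w} \<noteq> {a, b} \<Longrightarrow> \<chi> u \<noteq> \<chi> w"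
      using col[OF i] by blast
    have "\<exists>g. inj_on g (verts F) \<and> (\<forall>u\<in>verts F. g u \<in> B (\<chi> u))"
    proof (rule coloured_injection[OF finite_verts_F \<chi>(1)])
      show "finite (B i) \<and> card (verts F) \<le> card (B i)" if "i < l" for i
      proof -
        have "B i \<subseteq> A i" "card (B i) = card (verts F)" using B(1) that by blast+
        moreover have "A i \<subseteq> verts H" by (auto simp: A_def)
        ultimately show ?thesis using finite_subset[OF _ fV, of "B i"] by simp
      qed
      show "B i \<inter> B j = {}" if "i < l" "j < l" "i \<noteq> j" for i j
      proof -
        have "\<not> T H y y" for y by (simp add: thick_def)
        then show ?thesis using Badj[OF that] by blast
      qed
    qed
    then obtain g where g: "inj_on g (verts F)" "\<And>u. u \<in> verts F \<Longrightarrow> g u \<in> B (\<chi> u)" by blast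
    have \<chi>l: "\<chi> u < l" if "u \<in> verts F" for u using \<chi>(1) that by auto
    have gA: "g u \<in> A (\<chi> u)" if "u \<in> verts F" for u using g(2)[OF that] B(1) \<chi>l[OF that] by blast
    have ge: "g u \<notin> e" "g u \<in> verts H" if "u \<in> verts F" for u using gA[OF that] by (auto simp: A_def)
    have gyz: "T H y (g u)" "T H z (g u)" if "u \<in> verts F" "\<chi> u \<noteq> i" for u using gA[OF that(1)] that(2) by (auto simp: A_def)
    define g' where "g' = g(a := y, b := z)"
    have av: "a \<in> verts F" "b \<in> verts F" using edge_F[OF ab(1)] by auto
    have goff: "g' u = g u" if "u \<notin> {a, b}" for u using that by (simp add: g'_def)
    have gab: "g' a = y" "g' b = z" using ab(2) by (auto simp: g'_def)
    have gin: "g' u \<in> e" if "u \<in> {a, b}" for u using that gab e(2,3) by blast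
    show "contains H (expansion r F)"
    proof (rule contains_expansionI[OF H r_ge_2 F, of g' "{{a, b}}" "{a, b}" e])
      show "inj_on g' (verts F)"
      proof (rule inj_onI)
        fix u w assume uw: "u \<in> verts F" "w \<in> verts F" "g' u = g' w"
        consider "u \<in> {a, b}" "w \<in> {a, b}" | "u \<in> {a, b}" "w \<notin> {a, b}" | "u \<notin> {a, b}" "w \<in> {a, b}" | "u \<notin> {a, b}" "w \<notin> {a, b}" by blast
        then show "u = w"
        proof cases
          case 1 then show ?thesis using uw(3) e(4) gab by auto
        next
          case 2 then show ?thesis using uw(3) ge(1)[OF uw(2)] goff[OF 2(2)] gin[OF 2(1)] by simp
        next
          case 3 then show ?thesis using uw(3) ge(1)[OF uw(1)] goff[OF 3(1)] gin[OF 3(2)] by simp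
        next
          case 4
          then have "g u = g w" using uw(3) goff[OF 4(1)] goff[OF 4(2)] by simp
          then show ?thesis using inj_onD[OF g(1) _ uw(1,2)] by blast
        qed
      qed
      show "g' ` verts F \<subseteq> verts H"
      proof
        fix w assume "w \<in> g' ` verts F"
        then obtain u where u: "u \<in> verts F" "w = g' u" by blast
        show "w \<in> verts H" using ge(2)[OF u(1)] gin[of u] goff[of u] fe(3) u(2) by (cases "u \<in> {a, b}") auto
      qed
      show "{{a, b}} \<subseteq> edges F" using ab by simp
      show "e \<in> edges H \<and> e \<inter> g' ` verts F = g' ` {a, b}"
      proof
        show "e \<inter> g' ` verts F = g' ` {a, b}"
        proof
          show "e \<inter> g' ` verts F \<subseteq> g' ` {a, b}"
          proof
            fix w assume "w \<in> e \<inter> g' ` verts F"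
            then obtain u where u: "u \<in> verts F" "w = g' u" "w \<in> e" by blast
            then have "u \<in> {a, b}" using ge(1)[OF u(1)] goff[of u] by (metis (no_types))
            then show "w \<in> g' ` {a, b}" using u(2) by blast
          qed
          show "g' ` {a, b} \<subseteq> e \<inter> g' ` verts F" using gin av by blast
        qed
      qed (rule e(1))
      fix u w assume uw: "{u, w} \<in> edges F" "{u, w} \<notin> {{a, b}}"
      then have uw': "u \<in> verts F" "w \<in> verts F" "u \<noteq> w" using edge_F by blast+
      have ne: "\<chi> u \<noteq> \<chi> w" using \<chi>(4) uw by blast
      have out: "\<not> (u \<in> {a, b} \<and> w \<in> {a, b})" using ne \<chi>(2,3) by auto
      consider "u \<in> {a, b}" "w \<notin> {a, b}" | "u \<notin> {a, b}" "w \<in> {a, b}" | "u \<notin> {a, b}" "w \<notin> {a, b}" using out by blast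
      then show "T H (g' u) (g' w)"
      proof cases
        case 1
        then have "\<chi> w \<noteq> i" using ne \<chi>(2,3) by auto
        then have "T H y (g w)" "T H z (g w)" using gyz uw'(2) by blast+
        moreover have "g' w = g w" "g' u = y \<or> g' u = z" using goff[OF 1(2)] 1(1) gab by auto
        ultimately show ?thesis by auto
      next
        case 2
        then have "\<chi> u \<noteq> i" using ne \<chi>(2,3) by auto
        from gyz[OF uw'(1) this] have "T H (g u) y" "T H (g u) z" by (auto intro: thick_sym)
        moreover have "g' u = g u" "g' w = y \<or> g' w = z" using goff[OF 2(1)] 2(2) gab by auto
        ultimately show ?thesis by auto
      next
        case 3
        have "g' u = g u" "g' w = g w" by (rule goff[OF 3(1)]) (rule goff[OF 3(2)])
        moreover have "T H (g u) (g w)" by (rule Badj[OF \<chi>l[OF uw'(1)] \<chi>l[OF uw'(2)] ne g(2)[OF uw'(1)] g(2)[OF uw'(2)]])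
        ultimately show ?thesis by simp
      qed
    qed auto
  qed
qed

end

section \<open>Copies of \<open>Q\<close> through thin pairs\<close>

text \<open>A chosen witness that the pair is thin: at most \<open>s\<close> vertices that meet
  every edge through the pair. The default value is empty, so that finiteness and the size bound
  hold for all pairs, as the counting lemmas demand.\<close>

definition blocker :: "nat \<Rightarrow> 'a hypergraph \<Rightarrow> 'a \<Rightarrow> 'a \<Rightarrow> 'a set" where
  "blocker s H y z = (if y \<noteq> z \<and> \<not> thick s H y z
     then SOME S. finite S \<and> card S \<le> s \<and> y \<notin> S \<and> z \<notin> S \<and> (\<forall>e\<in>edges H. y \<in> e \<longrightarrow> z \<in> e \<longrightarrow> e \<inter> S \<noteq> {})
     else {})"

lemma blocker_props:
  assumes "y \<noteq> z" "\<not> thick s H y z"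
  shows "finite (blocker s H y z) \<and> card (blocker s H y z) \<le> s \<and> y \<notin> blocker s H y z \<and> z \<notin> blocker s H y z \<and>
    (\<forall>e\<in>edges H. y \<in> e \<longrightarrow> z \<in> e \<longrightarrow> e \<inter> blocker s H y z \<noteq> {})"
proof -
  have "\<exists>S. finite S \<and> card S \<le> s \<and> y \<notin> S \<and> z \<notin> S \<and> (\<forall>e\<in>edges H. y \<in> e \<longrightarrow> z \<in> e \<longrightarrow> e \<inter> S \<noteq> {})"
    using assms unfolding thick_def by blast
  from someI_ex[OF this] show ?thesis using assms unfolding blocker_def by simp
qed

lemma finite_blocker: "finite (blocker s H y z)" and card_blocker: "card (blocker s H y z) \<le> s"
  using blocker_props[of y z s H] by (auto simp: blocker_def)

context colour_pattern
begin

lemma cnt_recolour: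
  assumes V: "finite V" and S: "finite S" and eq: "\<And>x. x \<in> V \<Longrightarrow> x \<notin> S \<Longrightarrow> c' x = c x"
  shows "cnt V c \<le> cnt V c' + real v * real (card S) * real (card V) ^ (v - 1)"
proof -
  let ?T = "{\<phi> \<in> VP \<rightarrow>\<^sub>E V. \<exists>a\<in>VP. \<phi> a \<in> S}"
  have "finite (VP \<rightarrow>\<^sub>E V)" by (rule finite_PiE[OF fin]) (rule V)
  then have fT: "finite ?T" by (rule finite_subset[rotated]) blast
  have sub: "homs VP pc V (cross c) \<subseteq> homs VP pc V (cross c') \<union> ?T"
  proof
    fix \<phi> assume h: "\<phi> \<in> homs VP pc V (cross c)"
    show "\<phi> \<in> homs VP pc V (cross c') \<union> ?T"
    proof (cases "\<exists>a\<in>VP. \<phi> a \<in> S")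
      case True then show ?thesis using homs_PiE[OF h] by blast
    next
      case False
      then have e: "c' (\<phi> a) = c (\<phi> a)" if "a \<in> VP" for a using eq homs_in[OF h that] that by blast
      have "\<phi> \<in> homs VP pc V (cross c')"
        by (rule homsI[OF homs_PiE[OF h]]) (use homsD[OF h] e in \<open>simp add: cross_def\<close>)
      then show ?thesis by blast
    qed
  qed
  have "card (homs VP pc V (cross c)) \<le> card (homs VP pc V (cross c') \<union> ?T)"
    by (rule card_mono[OF finite_UnI[OF finite_homs[OF fin V] fT] sub])
  also have "\<dots> \<le> card (homs VP pc V (cross c')) + card ?T" by (rule card_Un_le)
  finally have "cnt V c \<le> cnt V c' + real (card ?T)"
    unfolding cnt_def by (simp only: of_nat_add[symmetric] of_nat_le_iff)
  then show ?thesis using card_through[OF V S] by linarith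
qed

end

context expansion_problem
begin

text \<open>Differently coloured vertices lie in a common edge of \<open>Q\<close>. Its image is an
  edge through the thin pair and therefore meets the blocker, which avoids the pair itself; so a
  third vertex of \<open>Q\<close> is sent into the blocker.\<close>

lemma thin_pair_blocked:
  assumes \<phi>: "\<phi> \<in> inj_homs Q H" and ab: "a \<in> verts Q" "b \<in> verts Q" "pc a \<noteq> pc b" and thin: "\<not> T H (\<phi> a) (\<phi> b)"
  shows "\<exists>d\<in>verts Q - {a, b}. \<phi> d \<in> blocker s H (\<phi> a) (\<phi> b)"
proof -
  note \<phi>' = inj_homsD[OF \<phi>]
  obtain e where e: "e \<in> edges Q" "a \<in> e" "b \<in> e" and "a \<noteq> b" using pc_adj[OF ab(1,2)] ab(3) by blast
  have "\<phi> a \<noteq> \<phi> b" using inj_onD[OF \<phi>'(2) _ ab(1,2)] \<open>a \<noteq> b\<close> by blast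
  note bl = blocker_props[OF this thin]
  have "\<phi> ` e \<in> edges H" by (rule \<phi>'(3)[OF e(1)])
  then have "\<phi> ` e \<inter> blocker s H (\<phi> a) (\<phi> b) \<noteq> {}" using bl e by blast
  then obtain d where "d \<in> e" "\<phi> d \<in> blocker s H (\<phi> a) (\<phi> b)" by blast
  then show ?thesis using bl r_graphD(2)[OF Q e(1)] by blast
qed

text \<open>A copy that is not a map into the thick graph has a triple \<open>a\<close>,
  \<open>b\<close>, \<open>d\<close> where the images of \<open>a\<close> and \<open>b\<close> leave
  only \<open>s\<close> possible images for \<open>d\<close>. There are at most \<open>v^3\<close>
  triples, so such copies are of order \<open>n^(v-1)\<close>.\<close>

lemma inj_num_le_hP:
  assumes H: "r_graph r H"
  shows "real (inj_num Q H) \<le> hP (verts H) (T H) + real v ^ 3 * real s * real (card (verts H)) ^ (v - 1)"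
proof -
  let ?V = "verts H"
  let ?I = "{z \<in> verts Q \<times> verts Q \<times> verts Q. snd (snd z) \<noteq> fst z \<and> snd (snd z) \<noteq> fst (snd z)}"
  let ?X = "\<lambda>z. {\<phi> \<in> verts Q \<rightarrow>\<^sub>E ?V. \<phi> (snd (snd z)) \<in> blocker s H (\<phi> (fst z)) (\<phi> (fst (snd z)))}"
  have fV: "finite ?V" by (rule r_graphD(1)[OF H])
  have fI: "finite ?I" using fin by simp
  have fX: "finite (?X z)" for z
    by (rule finite_subset[of _ "verts Q \<rightarrow>\<^sub>E ?V"]) (blast, rule finite_PiE[OF fin fV])
  have sub: "inj_homs Q H \<subseteq> homs (verts Q) pc ?V (T H) \<union> (\<Union>z\<in>?I. ?X z)"
  proof
    fix \<phi> assume \<phi>: "\<phi> \<in> inj_homs Q H"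
    show "\<phi> \<in> homs (verts Q) pc ?V (T H) \<union> (\<Union>z\<in>?I. ?X z)"
    proof (cases "\<phi> \<in> homs (verts Q) pc ?V (T H)")
      case False
      then obtain a b where ab: "a \<in> verts Q" "b \<in> verts Q" "pc a \<noteq> pc b" "\<not> T H (\<phi> a) (\<phi> b)"
        using inj_homsD(1)[OF \<phi>] unfolding homs_def by blast
      obtain d where d: "d \<in> verts Q - {a, b}" "\<phi> d \<in> blocker s H (\<phi> a) (\<phi> b)"
        using thin_pair_blocked[OF \<phi> ab] by blast
      have "(a, b, d) \<in> ?I" using ab d(1) by simp
      moreover have "\<phi> \<in> ?X (a, b, d)" using d(2) inj_homsD(1)[OF \<phi>] by simp
      ultimately show ?thesis by blast
    qed blast
  qed
  have "card (inj_homs Q H) \<le> card (homs (verts Q) pc ?V (T H) \<union> (\<Union>z\<in>?I. ?X z))"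
    by (rule card_mono[OF finite_UnI[OF finite_homs[OF fin fV] finite_UN_I[OF fI fX]] sub])
  also have "\<dots> \<le> card (homs (verts Q) pc ?V (T H)) + card (\<Union>z\<in>?I. ?X z)" by (rule card_Un_le)
  finally have 1: "real (inj_num Q H) \<le> hP ?V (T H) + real (card (\<Union>z\<in>?I. ?X z))"
    unfolding inj_num_def by (simp only: of_nat_add[symmetric] of_nat_le_iff)
  have "real (card (\<Union>z\<in>?I. ?X z)) \<le> real (card ?I) * (real s * real (card ?V) ^ (v - 1))"
  proof (rule card_UN_le_real[OF fI])
    fix z assume z: "z \<in> ?I"
    let ?W = "\<lambda>g. blocker s H (g (fst z)) (g (fst (snd z)))"
    have eq: "?X z = {\<phi> \<in> verts Q \<rightarrow>\<^sub>E ?V. \<phi> (snd (snd z)) \<in> ?W (restrict \<phi> (verts Q - {snd (snd z)}))}"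
      using z by (auto simp: restrict_def)
    have "card (?X z) \<le> s * card ?V ^ (v - 1)" unfolding eq
      by (rule card_coord_choice_le[OF fin fV _ finite_blocker card_blocker]) (use z in auto)
    then have "real (card (?X z)) \<le> real (s * card ?V ^ (v - 1))" by (rule of_nat_mono)
    then show "real (card (?X z)) \<le> real s * real (card ?V) ^ (v - 1)" by (simp only: of_nat_mult of_nat_power)
  qed
  also have "\<dots> \<le> real v ^ 3 * (real s * real (card ?V) ^ (v - 1))"
  proof (rule mult_right_mono)
    have "card ?I \<le> card (verts Q \<times> verts Q \<times> verts Q)"
      by (rule card_mono) (intro finite_cartesian_product fin, blast)
    also have "\<dots> = v ^ 3" by (simp add: card_cartesian_product power3_eq_cube)
    finally have "real (card ?I) \<le> real (v ^ 3)" by (rule of_nat_mono)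
    then show "real (card ?I) \<le> real v ^ 3" by (simp only: of_nat_power)
  qed simp
  finally show ?thesis using 1 by (simp only: mult.assoc)
qed

lemma sum_Q_degree:
  assumes H: "finite (verts H)"
  shows "(\<Sum>x\<in>verts H. Q_degree Q H x) = v * inj_num Q H"
proof -
  let ?A = "inj_homs Q H"
  have fA: "finite ?A" by (rule finite_inj_homs[OF fin H])
  have "(\<Sum>x\<in>verts H. Q_degree Q H x) = (\<Sum>x\<in>verts H. \<Sum>\<phi>\<in>?A. if x \<in> \<phi> ` verts Q then 1 else 0)"
    unfolding Q_degree_def by (rule sum.cong) (auto simp: sum.If_cases[OF fA] Int_def)
  also have "\<dots> = (\<Sum>\<phi>\<in>?A. \<Sum>x\<in>verts H. if x \<in> \<phi> ` verts Q then 1 else 0)" by (rule sum.swap)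
  also have "\<dots> = (\<Sum>\<phi>\<in>?A. v)"
  proof (rule sum.cong[OF refl])
    fix \<phi> assume \<phi>: "\<phi> \<in> ?A"
    have "verts H \<inter> \<phi> ` verts Q = \<phi> ` verts Q" using inj_homsD(1)[OF \<phi>] by (auto simp: PiE_def Pi_def)
    then show "(\<Sum>x\<in>verts H. if x \<in> \<phi> ` verts Q then 1 else 0) = v"
      using card_image[OF inj_homsD(2)[OF \<phi>]] by (simp add: sum.If_cases[OF H] Collect_mem_eq)
  qed
  finally show ?thesis by (simp add: inj_num_def)
qed

lemma Q_degree_le_sum:
  "Q_degree Q H x \<le> (\<Sum>a\<in>verts Q. card {\<phi> \<in> inj_homs Q H. \<phi> a = x})"
proof -
  have eq: "{\<phi> \<in> inj_homs Q H. x \<in> \<phi> ` verts Q} = (\<Union>a\<in>verts Q. {\<phi> \<in> inj_homs Q H. \<phi> a = x})" by auto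
  show ?thesis unfolding Q_degree_def eq by (rule card_UN_le[OF fin])
qed

text \<open>The vertex \<open>x\<close> is given a colour \<open>i\<close> in which it has few thick
  neighbours. Apart from negligible ones, copies through \<open>x\<close> are then proper for the
  new colouring: pairs away from \<open>x\<close> and \<open>B\<close> lie in rainbow edges, and a
  thick pair at \<open>x\<close> leads out of part \<open>i\<close>. Every vertex outside part
  \<open>i\<close> that is thin towards \<open>x\<close> wastes \<open>q^(v-2)\<close> proper maps,
  and this is the negative term.\<close>

lemma Q_degree_le:
  assumes H: "r_graph r H" and n: "card (verts H) > 0" and c: "c \<in> verts H \<rightarrow> {..<l}"
    and x: "x \<in> verts H" and i: "i < l"
    and few: "real (card {y\<in>verts H. c y = i \<and> T H x y}) \<le> \<gamma> * real (card (verts H))"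
    and B: "finite B"
    and rainbow: "\<And>e y z. e \<in> edges H \<Longrightarrow> y \<in> e \<Longrightarrow> z \<in> e \<Longrightarrow> y \<noteq> z \<Longrightarrow> y \<notin> B \<Longrightarrow> z \<notin> B \<Longrightarrow> c y \<noteq> c z"
    and q: "0 \<le> q" "\<And>j. j < l \<Longrightarrow> q \<le> real (card {y\<in>verts H. (c(x := i)) y = j})"
  shows "real (Q_degree Q H x) \<le> degsum (verts H) (c(x := i)) x
      - q ^ (v - 2) * real (card {y\<in>verts H. c y \<noteq> i \<and> y \<noteq> x \<and> \<not> T H x y})
      + real v ^ 2 * (real (card B) + real v * real s + \<gamma> * real (card (verts H))) * real (card (verts H)) ^ (v - 2)"
proof -
  let ?V = "verts H" and ?P = "verts Q"
  let ?n = "real (card ?V)"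
  define c1 where "c1 = c(x := i)"
  have c1V: "c1 \<in> ?V \<rightarrow> {..<l}" using c i by (auto simp: c1_def)
  have fV: "finite ?V" by (rule r_graphD(1)[OF H])
  define Nx where "Nx = {y\<in>?V. c y = i \<and> T H x y}"
  define M where "M = {y\<in>?V. c y \<noteq> i \<and> y \<noteq> x \<and> \<not> T H x y}"
  have fNx: "finite Nx" and fM: "finite M" using fV by (auto simp: Nx_def M_def)
  \<comment> \<open>The regular copies with \<open>a\<close> sent to \<open>x\<close>. The
    exceptions are collected in \<open>U1\<close> (another image in \<open>B\<close>),
    \<open>U2\<close> (a thin pair at \<open>x\<close>, hence an image in its blocker) and
    \<open>U3\<close> (another image among the thick neighbours of \<open>x\<close> in part
    \<open>i\<close>). Each of them has two constrained coordinates, so its order is governed by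
    \<open>n^(v-2)\<close>.\<close>
  define G where "G a = {\<phi> \<in> homs ?P pc ?V (cross c1). \<phi> a = x \<and> (\<forall>b\<in>?P. pc b \<noteq> pc a \<longrightarrow> T H x (\<phi> b))}" for a
  let ?X1 = "\<lambda>a b. {\<phi> \<in> ?P \<rightarrow>\<^sub>E ?V. \<phi> a = x \<and> \<phi> b \<in> B}"
  let ?X2 = "\<lambda>a z. {\<phi> \<in> ?P \<rightarrow>\<^sub>E ?V. \<phi> a = x \<and> \<phi> (snd z) \<in> blocker s H x (\<phi> (fst z))}"
  let ?X3 = "\<lambda>a b. {\<phi> \<in> ?P \<rightarrow>\<^sub>E ?V. \<phi> a = x \<and> \<phi> b \<in> Nx}"
  let ?J = "\<lambda>a. {z \<in> ?P \<times> ?P. snd z \<noteq> a \<and> snd z \<noteq> fst z}"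
  have fPE: "finite (?P \<rightarrow>\<^sub>E ?V)" by (rule finite_PiE[OF fin]) (rule fV)
  have fG: "finite (G a)" for a
    by (rule finite_subset[OF _ finite_homs[OF fin fV, of pc "cross c1"]]) (simp add: G_def Collect_subset)
  have fX: "finite (?X1 a b)" "finite (?X2 a z)" "finite (?X3 a b)" for a b z
    using fPE by (auto intro: finite_subset[OF _ fPE])
  define U1 where "U1 a = (\<Union>b\<in>?P - {a}. ?X1 a b)" for a
  define U2 where "U2 a = (\<Union>z\<in>?J a. ?X2 a z)" for a
  define U3 where "U3 a = (\<Union>b\<in>?P - {a}. ?X3 a b)" for a
  have fU: "finite (U1 a)" "finite (U2 a)" "finite (U3 a)" for a
    unfolding U1_def U2_def U3_def by (intro finite_UN_I fX; use fin in simp)+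
  have sub: "\<phi> \<in> G a \<union> (U1 a \<union> (U2 a \<union> U3 a))"
    if a: "a \<in> ?P" and \<phi>: "\<phi> \<in> inj_homs Q H" and ax: "\<phi> a = x" for a \<phi>
  proof -
    note \<phi>' = inj_homsD[OF \<phi>]
    show ?thesis
    proof (rule ccontr)
      assume no': "\<not> ?thesis"
      then have no: "\<phi> \<notin> G a" "\<phi> \<notin> U1 a" "\<phi> \<notin> U2 a" "\<phi> \<notin> U3 a" by simp_all
      have nB: "\<phi> b \<notin> B" if "b \<in> ?P" "b \<noteq> a" for b
      proof
        assume "\<phi> b \<in> B"
        then have "\<phi> \<in> ?X1 a b" using \<phi>'(1) ax by simp
        then show False using no(2) that unfolding U1_def by blast
      qed
      have nN: "\<phi> b \<notin> Nx" if "b \<in> ?P" "b \<noteq> a" for b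
      proof
        assume "\<phi> b \<in> Nx"
        then have "\<phi> \<in> ?X3 a b" using \<phi>'(1) ax by simp
        then show False using no(4) that unfolding U3_def by blast
      qed
      have nx: "\<phi> b \<noteq> x" if "b \<in> ?P" "b \<noteq> a" for b using inj_onD[OF \<phi>'(2) _ that(1) a] that(2) ax by metis
      have th: "T H x (\<phi> b)" if b: "b \<in> ?P" "pc b \<noteq> pc a" for b
      proof (rule ccontr)
        assume "\<not> T H x (\<phi> b)"
        then have "\<not> T H (\<phi> a) (\<phi> b)" using ax by simp
        from thin_pair_blocked[OF \<phi> a b(1) b(2)[symmetric] this]
        obtain d where d: "d \<in> ?P - {a, b}" and "\<phi> d \<in> blocker s H (\<phi> a) (\<phi> b)" by (elim bexE) (rule that)
        then have d': "\<phi> d \<in> blocker s H x (\<phi> b)" by (simp only: ax)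
        have "(b, d) \<in> ?J a" using d b by simp
        moreover have "\<phi> \<in> ?X2 a (b, d)" using d' \<phi>'(1) ax by simp
        ultimately have "\<phi> \<in> U2 a" unfolding U2_def by (rule UN_I)
        then show False using no(3) by simp
      qed
      have V: "\<phi> b \<in> ?V" if "b \<in> ?P" for b by (rule PiE_mem[OF \<phi>'(1) that])
      have ci: "c (\<phi> b) \<noteq> i" if b: "b \<in> ?P" "pc b \<noteq> pc a" for b
      proof -
        have "b \<noteq> a" using b by blast
        then show ?thesis using nN[OF b(1)] th[OF b] V[OF b(1)] by (simp add: Nx_def)
      qed
      have c1e: "c1 (\<phi> b) = c (\<phi> b)" if "b \<in> ?P" "b \<noteq> a" for b using nx[OF that] by (simp add: c1_def)
      have c1x: "c1 (\<phi> a) = i" using ax by (simp add: c1_def)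
      have "\<phi> \<in> homs ?P pc ?V (cross c1)"
      proof (rule homsI[OF \<phi>'(1)])
        fix b d assume bd: "b \<in> ?P" "d \<in> ?P" "pc b \<noteq> pc d"
        consider "b = a" | "d = a" "b \<noteq> a" | "b \<noteq> a" "d \<noteq> a" by blast
        then show "cross c1 (\<phi> b) (\<phi> d)"
        proof cases
          case 1
          then have "d \<noteq> a" "pc d \<noteq> pc a" using bd by auto
          then show ?thesis using 1 c1x c1e[OF bd(2)] ci[OF bd(2)] by (simp add: cross_def)
        next
          case 2
          then have "pc b \<noteq> pc a" using bd by auto
          then show ?thesis using 2 c1x c1e[OF bd(1)] ci[OF bd(1)] by (simp add: cross_def)
        next
          case 3
          obtain e where e: "e \<in> edges Q" "b \<in> e" "d \<in> e" and "b \<noteq> d" using pc_adj[OF bd(1,2)] bd(3) by blast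
          have "\<phi> b \<noteq> \<phi> d" using inj_onD[OF \<phi>'(2) _ bd(1,2)] \<open>b \<noteq> d\<close> by blast
          then have "c (\<phi> b) \<noteq> c (\<phi> d)"
            using rainbow[OF \<phi>'(3)[OF e(1)]] e(2,3) nB[OF bd(1) 3(1)] nB[OF bd(2) 3(2)] by blast
          then show ?thesis using c1e[OF bd(1) 3(1)] c1e[OF bd(2) 3(2)] by (simp add: cross_def)
        qed
      qed
      then have "\<phi> \<in> G a" using ax th by (simp add: G_def)
      then show False using no(1) by blast
    qed
  qed
  have b1: "real (card (U1 a)) \<le> real v * (real (card B) * ?n ^ (v - 2))" if a: "a \<in> ?P" for a
  proof -
    have "real (card (U1 a)) \<le> real (card (?P - {a})) * (real (card B) * ?n ^ (v - 2))"
    unfolding U1_def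
    proof (rule card_UN_le_real)
      fix b assume b: "b \<in> ?P - {a}"
      have "card (?X1 a b) \<le> card B * card ?V ^ (v - 2)"
        by (rule card_coord_choice_fixed_le[OF fin fV, where W = "\<lambda>_. B"]) (use a b B in auto)
      then have "real (card (?X1 a b)) \<le> real (card B * card ?V ^ (v - 2))" by (rule of_nat_mono)
      then show "real (card (?X1 a b)) \<le> real (card B) * ?n ^ (v - 2)" by (simp only: of_nat_mult of_nat_power)
    qed (use fin in simp)
    also have "\<dots> \<le> real v * (real (card B) * ?n ^ (v - 2))"
      by (intro mult_right_mono of_nat_mono card_mono fin) auto
    finally show ?thesis .
  qed
  have b3: "real (card (U3 a)) \<le> real v * (\<gamma> * ?n * ?n ^ (v - 2))" if a: "a \<in> ?P" for a
  proof -
    have "real (card (U3 a)) \<le> real (card (?P - {a})) * (real (card Nx) * ?n ^ (v - 2))"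
    unfolding U3_def
    proof (rule card_UN_le_real)
      fix b assume b: "b \<in> ?P - {a}"
      have "card (?X3 a b) \<le> card Nx * card ?V ^ (v - 2)"
        by (rule card_coord_choice_fixed_le[OF fin fV, where W = "\<lambda>_. Nx"]) (use a b fNx in auto)
      then have "real (card (?X3 a b)) \<le> real (card Nx * card ?V ^ (v - 2))" by (rule of_nat_mono)
      then show "real (card (?X3 a b)) \<le> real (card Nx) * ?n ^ (v - 2)" by (simp only: of_nat_mult of_nat_power)
    qed (use fin in simp)
    also have "\<dots> \<le> real v * (real (card Nx) * ?n ^ (v - 2))"
      by (intro mult_right_mono of_nat_mono card_mono fin) auto
    also have "\<dots> \<le> real v * (\<gamma> * ?n * ?n ^ (v - 2))"
      by (intro mult_left_mono mult_right_mono) (use few in \<open>auto simp: Nx_def\<close>)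
    finally show ?thesis .
  qed
  have b2: "real (card (U2 a)) \<le> real v ^ 2 * (real s * ?n ^ (v - 2))" if a: "a \<in> ?P" for a
  proof -
    have "real (card (U2 a)) \<le> real (card (?J a)) * (real s * ?n ^ (v - 2))"
    unfolding U2_def
    proof (rule card_UN_le_real)
      fix z assume z: "z \<in> ?J a"
      let ?W = "\<lambda>g. blocker s H x (g (fst z))"
      have eq: "?X2 a z = {\<phi> \<in> ?P \<rightarrow>\<^sub>E ?V. \<phi> a = x \<and> \<phi> (snd z) \<in> ?W (restrict \<phi> (?P - {snd z}))}"
        using z by (auto simp: restrict_def)
      have "card (?X2 a z) \<le> s * card ?V ^ (v - 2)" unfolding eq
        by (rule card_coord_choice_fixed_le[OF fin fV _ a _ finite_blocker card_blocker]) (use z in auto)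
      then have "real (card (?X2 a z)) \<le> real (s * card ?V ^ (v - 2))" by (rule of_nat_mono)
      then show "real (card (?X2 a z)) \<le> real s * ?n ^ (v - 2)" by (simp only: of_nat_mult of_nat_power)
    qed (use fin in simp)
    also have "\<dots> \<le> real v ^ 2 * (real s * ?n ^ (v - 2))"
    proof (rule mult_right_mono)
      have "card (?J a) \<le> card (?P \<times> ?P)" by (rule card_mono) (intro finite_cartesian_product fin, blast)
      then have "real (card (?J a)) \<le> real (v * v)" unfolding card_cartesian_product by (rule of_nat_mono)
      then show "real (card (?J a)) \<le> real v ^ 2" by (simp only: of_nat_mult power2_eq_square)
    qed simp
    finally show ?thesis .
  qed
  define R where "R = real v * (real (card B) * ?n ^ (v - 2)) + (real v ^ 2 * (real s * ?n ^ (v - 2)) + real v * (\<gamma> * ?n * ?n ^ (v - 2)))"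
  have one: "real (card {\<phi> \<in> inj_homs Q H. \<phi> a = x}) \<le> real (card (G a)) + R" if a: "a \<in> ?P" for a
  proof -
    have "card {\<phi> \<in> inj_homs Q H. \<phi> a = x} \<le> card (G a \<union> (U1 a \<union> (U2 a \<union> U3 a)))"
      by (rule card_mono) (intro finite_UnI fG fU, use sub[OF a] in blast)
    also have "\<dots> \<le> card (G a) + (card (U1 a) + (card (U2 a) + card (U3 a)))"
      using card_Un_le[of "G a" "U1 a \<union> (U2 a \<union> U3 a)"] card_Un_le[of "U1 a" "U2 a \<union> U3 a"] card_Un_le[of "U2 a" "U3 a"]
      by linarith
    finally have "real (card {\<phi> \<in> inj_homs Q H. \<phi> a = x}) \<le>
        real (card (G a)) + (real (card (U1 a)) + (real (card (U2 a)) + real (card (U3 a))))"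
      by (simp only: of_nat_add[symmetric] of_nat_le_iff)
    then show ?thesis using b1[OF a] b2[OF a] b3[OF a] unfolding R_def by linarith
  qed
  let ?D = "\<lambda>a. {\<phi> \<in> homs ?P pc ?V (cross c1). \<phi> a = x}"
  have fD: "finite (?D a)" for a
    by (rule finite_subset[OF _ finite_homs[OF fin fV, of pc "cross c1"]]) (simp add: Collect_subset)
  \<comment> \<open>The loss is claimed at a single pair of pattern vertices; for all other choices
    of the vertex sent to \<open>x\<close> the trivial bound suffices.\<close>
  obtain a0 b0 where ab0: "a0 \<in> ?P" "b0 \<in> ?P" "pc a0 \<noteq> pc b0" by (rule two_vertices)
  have GD: "real (card (G a)) \<le> real (card (?D a))" for a
    by (intro of_nat_mono card_mono fD) (auto simp: G_def)
  have GD0: "real (card (G a0)) + q ^ (v - 2) * real (card M) \<le> real (card (?D a0))"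
  proof -
    let ?L = "\<lambda>y. {\<phi> \<in> homs ?P pc ?V (cross c1). \<phi> a0 = x \<and> \<phi> b0 = y}"
    have fL: "finite (?L y)" for y
      by (rule finite_subset[OF _ finite_homs[OF fin fV, of pc "cross c1"]]) (simp add: Collect_subset)
    have "real (card M) * q ^ (v - 2) \<le> real (card (SIGMA y:M. ?L y))"
    proof (rule card_SIGMA_ge_real[OF fM fL])
      fix y assume "y \<in> M"
      then have y: "y \<in> ?V" "c1 x \<noteq> c1 y" by (auto simp: M_def c1_def)
      show "q ^ (v - 2) \<le> real (card (?L y))"
        by (rule card_through_pair[OF fV c1V x y ab0 q(1)]) (rule q(2)[folded c1_def])
    qed
    also have "card (SIGMA y:M. ?L y) = card (snd ` (SIGMA y:M. ?L y))"
      by (rule card_image[symmetric]) (auto simp: inj_on_def)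
    finally have 1: "real (card M) * q ^ (v - 2) \<le> real (card (snd ` (SIGMA y:M. ?L y)))" .
    have "card (G a0) + card (snd ` (SIGMA y:M. ?L y)) = card (G a0 \<union> snd ` (SIGMA y:M. ?L y))"
    proof (rule card_Un_disjoint[symmetric])
      show "finite (snd ` (SIGMA y:M. ?L y))" using fM fL by auto
      have "False" if "\<phi> \<in> G a0" "\<phi> \<in> snd ` (SIGMA y:M. ?L y)" for \<phi>
      proof -
        have "\<phi> b0 \<in> M" using that(2) by auto
        moreover have "T H x (\<phi> b0)" using that(1) ab0 by (simp add: G_def)
        ultimately show False by (simp add: M_def)
      qed
      then show "G a0 \<inter> snd ` (SIGMA y:M. ?L y) = {}" by blast
    qed (rule fG)
    also have "\<dots> \<le> card (?D a0)" by (rule card_mono[OF fD]) (auto simp: G_def)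
    finally show ?thesis using 1 by (simp only: mult.commute[of "q ^ (v - 2)"])
  qed
  define g where "g a = real (card (G a))" for a
  define d where "d a = real (card (?D a))" for a
  have "real (Q_degree Q H x) \<le> real (\<Sum>a\<in>?P. card {\<phi> \<in> inj_homs Q H. \<phi> a = x})"
    by (rule of_nat_mono[OF Q_degree_le_sum])
  also have "\<dots> = (\<Sum>a\<in>?P. real (card {\<phi> \<in> inj_homs Q H. \<phi> a = x}))" by (rule of_nat_sum)
  also have "\<dots> \<le> (\<Sum>a\<in>?P. g a + R)" unfolding g_def by (rule sum_mono) (rule one)
  also have "\<dots> = (\<Sum>a\<in>?P. g a) + real v * R" by (simp only: sum.distrib sum_constant)
  also have "(\<Sum>a\<in>?P. g a) = g a0 + (\<Sum>a\<in>?P - {a0}. g a)" by (rule sum.remove[OF fin ab0(1)])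
  also have "\<dots> + real v * R \<le> (d a0 - q ^ (v - 2) * real (card M)) + (\<Sum>a\<in>?P - {a0}. d a) + real v * R"
  proof (intro add_mono order_refl)
    show "g a0 \<le> d a0 - q ^ (v - 2) * real (card M)" using GD0 unfolding g_def d_def by linarith
    show "(\<Sum>a\<in>?P - {a0}. g a) \<le> (\<Sum>a\<in>?P - {a0}. d a)" unfolding g_def d_def by (rule sum_mono) (rule GD)
  qed
  also have "\<dots> = (d a0 + (\<Sum>a\<in>?P - {a0}. d a)) - q ^ (v - 2) * real (card M) + real v * R" by linarith
  also have "d a0 + (\<Sum>a\<in>?P - {a0}. d a) = (\<Sum>a\<in>?P. d a)" by (rule sum.remove[OF fin ab0(1), symmetric])
  also have "\<dots> = degsum ?V c1 x" unfolding degsum_def d_def ..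
  also have "real v * R = real v ^ 2 * (real (card B) + real v * real s + \<gamma> * ?n) * ?n ^ (v - 2)"
    unfolding R_def by (simp add: power2_eq_square algebra_simps)
  finally show ?thesis unfolding M_def c1_def .
qed

end

section \<open>Degree stability\<close>

context expansion_problem
begin

text \<open>The thick graph has so few cliques that the penalty in the density bound is negligible,
  and copies through thin pairs are of lower order.\<close>

lemma inj_num_upper:
  assumes "\<delta> > 0"
  shows "\<exists>N. \<forall>H :: nat hypergraph. r_graph r H \<longrightarrow> N \<le> card (verts H) \<longrightarrow> \<not> contains H (expansion r F) \<longrightarrow>
    real (inj_num Q H) \<le> (opt + \<delta>) * real (card (verts H)) ^ v"
proof -
  have "\<delta>/3 > 0" using assms by simp
  from penalized_density_le[OF this] obtain M where M: "M \<ge> 1" and pen: "\<forall>V E. finite V \<longrightarrow> V \<noteq> {} \<longrightarrow> graph_on V E \<longrightarrow>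
    hP V E / real (card V) ^ v \<le> opt + \<delta>/3 + M * (hK V E / real (card V) ^ (l + 1))"
    by (elim exE conjE) (rule that)
  have "\<delta>/(3 * M) > 0" using assms M by simp
  from cliques_few[OF this] obtain N1 where N1: "\<forall>H. r_graph r H \<longrightarrow> N1 \<le> card (verts H) \<longrightarrow> \<not> contains H (expansion r F) \<longrightarrow>
    hK (verts H) (T H) \<le> \<delta>/(3 * M) * real (card (verts H)) ^ (l + 1)"
    by (elim exE) (rule that)
  obtain N2 :: nat where N2: "real N2 > real v ^ 3 * real s * 3 / \<delta>" using reals_Archimedean2 by blast
  show ?thesis
  proof (intro exI[of _ "max N1 (N2 + 1)"] allI impI)
    fix H :: "nat hypergraph" assume H: "r_graph r H" and n: "max N1 (N2 + 1) \<le> card (verts H)" and free: "\<not> contains H (expansion r F)"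
    define n' where "n' = real (card (verts H))"
    have n0: "n' > 0" using n by (simp add: n'_def)
    have ne: "verts H \<noteq> {}" using n by auto
    define d where "d = hP (verts H) (T H)"
    have "hK (verts H) (T H) \<le> \<delta>/(3 * M) * n' ^ (l + 1)"
      unfolding n'_def by (rule N1[rule_format, OF H _ free]) (use n in simp)
    then have K: "hK (verts H) (T H) / n' ^ (l + 1) \<le> \<delta>/(3 * M)" using n0 by (simp only: pos_divide_le_eq zero_less_power)
    have "d / n' ^ v \<le> opt + \<delta>/3 + M * (hK (verts H) (T H) / n' ^ (l + 1))"
      unfolding n'_def d_def by (rule pen[rule_format, OF r_graphD(1)[OF H] ne graph_on_thick])
    also have "\<dots> \<le> opt + \<delta>/3 + M * (\<delta>/(3 * M))" by (intro add_left_mono mult_left_mono K) (use M in simp)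
    also have "\<dots> = opt + 2 * \<delta>/3" using M by (simp add: field_simps)
    finally have d: "d \<le> (opt + 2 * \<delta>/3) * n' ^ v" using n0 by (simp only: pos_divide_le_eq zero_less_power)
    have "real v ^ 3 * real s * n' ^ (v - 1) \<le> \<delta>/3 * n' * n' ^ (v - 1)"
    proof (rule mult_right_mono)
      have "real v ^ 3 * real s \<le> \<delta>/3 * real N2" using N2 assms by (simp add: field_simps)
      also have "\<dots> \<le> \<delta>/3 * n'" using n assms by (simp add: n'_def)
      finally show "real v ^ 3 * real s \<le> \<delta>/3 * n'" .
    qed (use n0 in simp)
    also have "\<dots> = \<delta>/3 * n' ^ v" by (simp only: mult.assoc power_v)
    finally have "real (inj_num Q H) \<le> (opt + 2 * \<delta>/3) * n' ^ v + \<delta>/3 * n' ^ v"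
      using inj_num_le_hP[OF H] d unfolding d_def n'_def by linarith
    also have "\<dots> = (opt + \<delta>) * n' ^ v" by (simp add: algebra_simps)
    finally show "real (inj_num Q H) \<le> (opt + \<delta>) * real (card (verts H)) ^ v" unfolding n'_def .
  qed
qed

lemma power_v_2: "x * x ^ (v - 2) = (x :: real) ^ (v - 1)"
proof -
  obtain w where "v = 2 + w" using v_ge_2 le_Suc_ex by blast
  then show ?thesis by simp
qed

lemma partiteI:
  assumes H: "r_graph r H" and c: "c \<in> verts H \<rightarrow> {..<l}"
    and rb: "\<And>e y z. e \<in> edges H \<Longrightarrow> y \<in> e \<Longrightarrow> z \<in> e \<Longrightarrow> y \<noteq> z \<Longrightarrow> c y \<noteq> c z"
  shows "partite l H"
  unfolding partite_def
proof (intro exI[of _ "\<lambda>i. {x\<in>verts H. c x = i}"] conjI ballI allI impI)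
  show "parts_of l (\<lambda>i. {x\<in>verts H. c x = i}) (verts H)"
    using c by (auto simp: parts_of_def disjoint_family_on_def)
  fix e i assume e: "e \<in> edges H"
  have "x = y" if "x \<in> e \<inter> {x\<in>verts H. c x = i}" "y \<in> e \<inter> {x\<in>verts H. c x = i}" for x y
    using rb[OF e, of x y] that by auto
  then have "\<exists>x. e \<inter> {x\<in>verts H. c x = i} \<subseteq> {x}" by blast
  then show "card (e \<inter> {x\<in>verts H. c x = i}) \<le> 1"
    by (metis card.empty card_insert_le_m1 card_mono finite.emptyI finite.insertI is_singletonI is_singleton_altdef)
qed

text \<open>Stability provides a colouring \<open>c\<close> of the thick graph. Edges of
  \<open>H\<close> avoiding the small set \<open>B\<close> of vertices with many missing pairs are
  already rainbow, and this is just what the degree estimate needs in order to find a suitable part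
  for every vertex, including those in \<open>B\<close>.\<close>

theorem degree_stability:
  "\<exists>\<epsilon>>0. \<exists>N. \<forall>H :: nat hypergraph. r_graph r H \<longrightarrow> N \<le> card (verts H) \<longrightarrow> \<not> contains H (expansion r F) \<longrightarrow>
     (\<forall>x\<in>verts H. real (Q_degree Q H x) \<ge> (real v * opt - \<epsilon>) * real (card (verts H)) ^ (v - 1)) \<longrightarrow> partite l H"
proof -
  have v1: "real v \<ge> 1" and l1: "real l \<ge> 1" using v_ge_2 l_ge_2 by auto
  obtain c0 \<delta> N0 where c0: "c0 > 0" "c0 \<le> 1" and \<delta>: "\<delta> > 0" and large: "\<forall>V c. finite V \<longrightarrow> N0 \<le> card V \<longrightarrow> c \<in> V \<rightarrow> {..<l} \<longrightarrow>
     cnt V c \<ge> (opt - \<delta>) * real (card V) ^ v \<longrightarrow> (\<forall>i<l. real (card {x\<in>V. c x = i}) \<ge> c0 * real (card V))"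
    using parts_large by (elim exE conjE) (rule that)
  \<comment> \<open>The degree, in units of \<open>n^(v-1)\<close>, lost by a vertex with
    \<open>c0/4 * n\<close> thin pairs to other parts. Against it stand \<open>g/8\<close> for the
    deviation of the degree bound from \<open>opt * v\<close>, three times \<open>g/8\<close> for
    exceptional copies, and at most \<open>g/8\<close> for \<open>\<epsilon>\<close>, which leaves a
    contradiction.\<close>
  define g where "g = c0 ^ (v - 2) * (c0/4)"
  have g: "g > 0" using c0 by (simp add: g_def)
  have "g/8 > 0" using g by simp
  from degsum_near_opt_le[OF this] obtain \<delta>' N1 where \<delta>': "\<delta>' > 0" and ds: "\<forall>V c x. finite V \<longrightarrow> N1 \<le> card V \<longrightarrow> c \<in> V \<rightarrow> {..<l} \<longrightarrow>
     cnt V c \<ge> (opt - \<delta>') * real (card V) ^ v \<longrightarrow> x \<in> V \<longrightarrow>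
     degsum V c x \<le> (opt * real v + g/8) * real (card V) ^ (v - 1)"
    by (elim exE conjE) (rule that)
  define \<gamma> where "\<gamma> = g / (8 * real v ^ 2)"
  have \<gamma>: "\<gamma> > 0" "real v ^ 2 * \<gamma> = g/8" using g v1 by (auto simp: \<gamma>_def)
  \<comment> \<open>The first two bounds leave the other halves of \<open>\<delta>\<close> and
    \<open>\<delta>'\<close> for recolouring one vertex. The next two keep the clique densities for
    both expansion lemmas positive, and the last one makes \<open>B\<close> smaller than
    \<open>\<gamma> * n\<close>.\<close>
  define \<eta> where "\<eta> = min (min (\<delta>/2) (\<delta>'/2)) (min (min (\<gamma> ^ l / (2 * real l ^ 2)) ((c0/4) ^ l / (2 * real l ^ 2))) (c0/4 * \<gamma>))"
  have \<eta>: "\<eta> > 0" using \<delta> \<delta>' \<gamma> c0 l1 by (simp add: \<eta>_def)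
  have \<eta>le: "\<eta> \<le> \<delta>/2" "\<eta> \<le> \<delta>'/2" "\<eta> \<le> \<gamma> ^ l / (2 * real l ^ 2)" "\<eta> \<le> (c0/4) ^ l / (2 * real l ^ 2)" "\<eta> \<le> c0/4 * \<gamma>"
    by (simp_all only: \<eta>_def min.coboundedI1 min.coboundedI2 order_refl)
  have \<beta>2: "0 < \<gamma> ^ l / 2" "\<gamma> ^ l / 2 \<le> \<gamma> ^ l - real l ^ 2 * \<eta>"
    using \<gamma> \<eta>le(3) l1 by (simp_all add: field_simps)
  have \<beta>3: "0 < (c0/4) ^ l / 2" "(c0/4) ^ l / 2 \<le> (c0/4) ^ l - real l ^ 2 * \<eta>"
  proof -
    define B where "B = (c0/4) ^ l"
    have "B > 0" using c0 by (simp add: B_def)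
    moreover have "\<eta> \<le> B / (2 * real l ^ 2)" using \<eta>le(4) by (simp only: B_def)
    ultimately show "0 < (c0/4) ^ l / 2" "(c0/4) ^ l / 2 \<le> (c0/4) ^ l - real l ^ 2 * \<eta>"
      unfolding B_def[symmetric] using l1 by (simp_all add: field_simps)
  qed
  from stability[OF \<eta>] obtain \<zeta> N2 where \<zeta>: "\<zeta> > 0" and st: "\<forall>V E. finite V \<longrightarrow> N2 \<le> card V \<longrightarrow> graph_on V E \<longrightarrow>
     hP V E \<ge> (opt - \<zeta>) * real (card V) ^ v \<longrightarrow> hK V E \<le> \<zeta> * real (card V) ^ (l + 1) \<longrightarrow> near_multipartite \<eta> V E"
    by (elim exE conjE) (rule that)
  from cliques_few[OF \<zeta>] obtain N3 where N3: "\<forall>H. r_graph r H \<longrightarrow> N3 \<le> card (verts H) \<longrightarrow> \<not> contains H (expansion r F) \<longrightarrow>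
    hK (verts H) (T H) \<le> \<zeta> * real (card (verts H)) ^ (l + 1)"
    by (elim exE) (rule that)
  from contains_of_wide_vertex[OF \<beta>2 less_imp_le[OF \<gamma>(1)]] obtain N4 where wide: "\<forall>H c x. r_graph r H \<longrightarrow> N4 \<le> card (verts H) \<longrightarrow>
     real (card (missing (verts H) c (T H))) \<le> \<eta> * real (card (verts H)) ^ 2 \<longrightarrow> x \<in> verts H \<longrightarrow>
     (\<forall>i<l. \<gamma> * real (card (verts H)) \<le> real (card {y\<in>verts H. c y = i \<and> T H x y})) \<longrightarrow> contains H (expansion r F)"
    by (elim exE) (rule that)
  from contains_of_monochromatic_pair[OF \<beta>3 c0(1)] obtain N5 where mono: "\<forall>H c e y z i. r_graph r H \<longrightarrow> N5 \<le> card (verts H) \<longrightarrow>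
     real (card (missing (verts H) c (T H))) \<le> \<eta> * real (card (verts H)) ^ 2 \<longrightarrow>
     (\<forall>i<l. c0 * real (card (verts H)) \<le> real (card {x\<in>verts H. c x = i})) \<longrightarrow>
     e \<in> edges H \<longrightarrow> y \<in> e \<longrightarrow> z \<in> e \<longrightarrow> y \<noteq> z \<longrightarrow> i < l \<longrightarrow>
     real (card {w\<in>verts H. c w \<noteq> i \<and> \<not> T H y w}) \<le> c0/4 * real (card (verts H)) + 1 \<longrightarrow>
     real (card {w\<in>verts H. c w \<noteq> i \<and> \<not> T H z w}) \<le> c0/4 * real (card (verts H)) + 1 \<longrightarrow>
     contains H (expansion r F)"
    by (elim exE) (rule that)
  define \<kappa> where "\<kappa> = min (min (\<zeta>/2) (g/8)) (min (\<delta>/2) (\<delta>'/2))"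
  have \<kappa>: "\<kappa> > 0" using \<zeta> g \<delta> \<delta>' by (simp add: \<kappa>_def)
  have \<kappa>le: "\<kappa> \<le> \<zeta>/2" "\<kappa> \<le> g/8" "\<kappa> \<le> \<delta>/2" "\<kappa> \<le> \<delta>'/2"
    by (simp_all only: \<kappa>_def min.coboundedI1 min.coboundedI2 order_refl)
  define \<epsilon> where "\<epsilon> = min (g/8) (\<zeta>/2)"
  have \<epsilon>: "\<epsilon> > 0" "\<epsilon> \<le> g/8" "\<epsilon> \<le> \<zeta>/2" using g \<zeta> by (auto simp: \<epsilon>_def)
  obtain N6 :: nat where N6: "real N6 > (real v ^ 3 * real s + real v) / \<kappa>" using reals_Archimedean2 by blast
  define N where "N = Max {N0, N1, N2, N3, N4, N5, N6 + 1}"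
  have Nge: "N0 \<le> N" "N1 \<le> N" "N2 \<le> N" "N3 \<le> N" "N4 \<le> N" "N5 \<le> N" "N6 + 1 \<le> N"
    unfolding N_def by (rule Max_ge; simp)+
  have main: "partite l H" if H: "r_graph r H" and nN: "N \<le> card (verts H)" and free: "\<not> contains H (expansion r F)"
    and deg: "\<forall>x\<in>verts H. real (Q_degree Q H x) \<ge> (real v * opt - \<epsilon>) * real (card (verts H)) ^ (v - 1)" for H :: "nat hypergraph"
  proof -
    let ?V = "verts H"
    define n where "n = real (card ?V)"
    have fV: "finite ?V" by (rule r_graphD(1)[OF H])
    have n0: "n > 0" using nN Nge(7) by (simp add: n_def)
    have big: "real v ^ 3 * real s + real v \<le> \<kappa> * n"
    proof -
      have "real v ^ 3 * real s + real v \<le> \<kappa> * real N6" using N6 \<kappa> by (simp add: field_simps)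
      also have "\<dots> \<le> \<kappa> * n" using nN Nge(7) \<kappa> by (simp add: n_def)
      finally show ?thesis .
    qed
    have vs: "real v ^ 3 * real s \<le> \<kappa> * n" and vn: "real v \<le> \<kappa> * n" using big v1 by (auto intro: order_trans[rotated])
    have hP: "hP ?V (T H) \<ge> (opt - \<zeta>) * n ^ v"
    proof -
      have "n * ((real v * opt - \<epsilon>) * n ^ (v - 1)) \<le> (\<Sum>x\<in>?V. real (Q_degree Q H x))"
        using sum_bounded_below[of ?V "(real v * opt - \<epsilon>) * n ^ (v - 1)" "\<lambda>x. real (Q_degree Q H x)"] deg by (simp add: n_def)
      also have "\<dots> = real (v * inj_num Q H)" using sum_Q_degree[OF fV] by (simp only: of_nat_sum[symmetric])
      finally have "(real v * opt - \<epsilon>) * (n * n ^ (v - 1)) \<le> real v * real (inj_num Q H)" by (simp only: of_nat_mult mult_ac)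
      then have 1: "(real v * opt - \<epsilon>) * n ^ v \<le> real v * real (inj_num Q H)" by (simp only: power_v)
      have "real v * ((opt - \<epsilon>) * n ^ v) = (real v * opt - real v * \<epsilon>) * n ^ v" by (simp add: algebra_simps)
      also have "\<dots> \<le> (real v * opt - \<epsilon>) * n ^ v"
        by (rule mult_right_mono) (use v1 \<epsilon>(1) n0 in \<open>auto simp: mult_le_cancel_right1\<close>)
      finally have "real v * ((opt - \<epsilon>) * n ^ v) \<le> real v * real (inj_num Q H)" using 1 by linarith
      then have 2: "(opt - \<epsilon>) * n ^ v \<le> real (inj_num Q H)" by (rule mult_left_le_imp_le) (use v1 in simp)
      have "real v ^ 3 * real s * n ^ (v - 1) \<le> (\<kappa> * n) * n ^ (v - 1)" by (rule mult_right_mono[OF vs]) (use n0 in simp)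
      also have "\<dots> = \<kappa> * n ^ v" by (simp only: mult.assoc power_v)
      finally have "(opt - \<epsilon>) * n ^ v - \<kappa> * n ^ v \<le> hP ?V (T H)"
        using 2 inj_num_le_hP[OF H] unfolding n_def by linarith
      moreover have "(opt - \<zeta>) * n ^ v \<le> (opt - \<epsilon> - \<kappa>) * n ^ v"
        by (rule mult_right_mono) (use \<epsilon> \<kappa>le n0 in auto)
      ultimately show ?thesis by (simp add: algebra_simps)
    qed
    have hK: "hK ?V (T H) \<le> \<zeta> * n ^ (l + 1)"
      unfolding n_def by (rule N3[rule_format, OF H _ free]) (use nN Nge in linarith)
    have "near_multipartite \<eta> ?V (T H)"
      by (rule st[rule_format, OF fV _ graph_on_thick hP[unfolded n_def] hK[unfolded n_def]]) (use nN Nge in linarith)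
    then obtain c where c: "c \<in> ?V \<rightarrow> {..<l}" and miss: "real (card (missing ?V c (T H))) \<le> \<eta> * n ^ 2"
      and near: "cnt ?V c \<ge> (opt - \<eta>) * n ^ v" unfolding near_multipartite_def n_def by blast
    have parts: "c0 * n \<le> real (card {x\<in>?V. c x = i})" if "i < l" for i
    proof -
      have "(opt - \<delta>) * n ^ v \<le> (opt - \<eta>) * n ^ v" using \<eta>le(1) \<delta> n0 by (intro mult_right_mono) auto
      then have "(opt - \<delta>) * n ^ v \<le> cnt ?V c" using near by linarith
      then show ?thesis unfolding n_def using large[rule_format, OF fV _ c _ that] nN Nge by (meson order_trans)
    qed
    have monoH: "False" if "e \<in> edges H" "y \<in> e" "z \<in> e" "y \<noteq> z" "i < l"
      "real (card {w\<in>?V. c w \<noteq> i \<and> \<not> T H y w}) \<le> c0/4 * n + 1" "real (card {w\<in>?V. c w \<noteq> i \<and> \<not> T H z w}) \<le> c0/4 * n + 1" for e y z i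
    proof -
      have "N5 \<le> card ?V" using nN Nge by linarith
      from mono[rule_format, OF H this miss[unfolded n_def] parts[unfolded n_def] that(1-5) that(6,7)[unfolded n_def]] free
      show False by blast
    qed
    define Mi where "Mi x = {y\<in>?V. c y \<noteq> c x \<and> \<not> T H x y}" for x
    define B where "B = {x\<in>?V. real (card (Mi x)) > c0/4 * n}"
    have fB: "finite B" using fV by (simp add: B_def)
    have fMi: "finite (Mi x)" for x using fV by (simp add: Mi_def)
    have cB: "real (card B) \<le> \<gamma> * n"
    proof -
      have "real (card B) * (c0/4 * n) \<le> real (card (SIGMA x:B. Mi x))"
        by (rule card_SIGMA_ge_real[OF fB fMi]) (simp add: B_def)
      also have "card (SIGMA x:B. Mi x) \<le> card (missing ?V c (T H))"
        by (rule card_mono[OF finite_missing[OF fV]]) (auto simp: missing_def Mi_def B_def)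
      finally have "real (card B) * (c0/4 * n) \<le> \<eta> * n ^ 2" using miss by linarith
      also have "\<dots> \<le> (c0/4 * \<gamma>) * n ^ 2" by (rule mult_right_mono[OF \<eta>le(5)]) simp
      also have "\<dots> = (\<gamma> * n) * (c0/4 * n)" by (simp add: power2_eq_square)
      finally show ?thesis by (rule mult_right_le_imp_le) (use c0 n0 in simp)
    qed
    have rainbow: "c y \<noteq> c z" if e: "e \<in> edges H" "y \<in> e" "z \<in> e" "y \<noteq> z" and nB: "y \<notin> B" "z \<notin> B" for e y z
    proof
      assume eq: "c y = c z"
      have yz: "y \<in> ?V" "z \<in> ?V" using r_graphD(2)[OF H e(1)] e by auto
      have "real (card (Mi y)) \<le> c0/4 * n + 1" "real (card (Mi z)) \<le> c0/4 * n + 1" using nB yz by (auto simp: B_def)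
      then show False using monoH[OF e, of "c y"] c yz eq by (auto simp: Mi_def)
    qed
    \<comment> \<open>By freeness \<open>x\<close> is not wide, so in some part \<open>i\<close> it
      has few thick neighbours. Moving \<open>x\<close> alone to part \<open>i\<close> changes the
      count by \<open>O(n^(v-1))\<close>, hence the new colouring is still near-optimal and the
      degree bounds apply to it. The additional \<open>1\<close> in the claim is for
      \<open>x\<close> itself.\<close>
    have ex: "\<exists>i. i < l \<and> real (card {w\<in>?V. c w \<noteq> i \<and> \<not> T H x w}) \<le> c0/4 * n + 1" if x: "x \<in> ?V" for x
    proof -
      have "\<not> (\<forall>i<l. \<gamma> * n \<le> real (card {y\<in>?V. c y = i \<and> T H x y}))"
      proof
        assume w: "\<forall>i<l. \<gamma> * n \<le> real (card {y\<in>?V. c y = i \<and> T H x y})"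
        have "N4 \<le> card ?V" using nN Nge by linarith
        from wide[rule_format, OF H this miss[unfolded n_def] x w[rule_format, unfolded n_def]] free show False by blast
      qed
      then obtain i where i: "i < l" and few: "real (card {y\<in>?V. c y = i \<and> T H x y}) \<le> \<gamma> * n" by (auto simp: not_le)
      let ?c1 = "c(x := i)"
      let ?M = "{y\<in>?V. c y \<noteq> i \<and> y \<noteq> x \<and> \<not> T H x y}"
      have c1: "?c1 \<in> ?V \<rightarrow> {..<l}" using c i by auto
      have near1: "cnt ?V ?c1 \<ge> (opt - \<eta> - \<kappa>) * n ^ v"
      proof -
        have "cnt ?V c \<le> cnt ?V ?c1 + real v * real (card {x}) * n ^ (v - 1)"
          unfolding n_def by (rule cnt_recolour[OF fV]) auto
        then have "cnt ?V c \<le> cnt ?V ?c1 + real v * n ^ (v - 1)" by simp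
        moreover have "real v * n ^ (v - 1) \<le> (\<kappa> * n) * n ^ (v - 1)" by (rule mult_right_mono[OF vn]) (use n0 in simp)
        moreover have "(\<kappa> * n) * n ^ (v - 1) = \<kappa> * n ^ v" by (simp only: mult.assoc power_v)
        ultimately show ?thesis using near unfolding left_diff_distrib by linarith
      qed
      have parts1: "c0 * n \<le> real (card {y\<in>?V. ?c1 y = j})" if "j < l" for j
      proof -
        have "(opt - \<delta>) * n ^ v \<le> (opt - \<eta> - \<kappa>) * n ^ v" using \<eta>le(1) \<kappa>le n0 by (intro mult_right_mono) auto
        then have "(opt - \<delta>) * n ^ v \<le> cnt ?V ?c1" using near1 by linarith
        then show ?thesis unfolding n_def using large[rule_format, OF fV _ c1 _ that] nN Nge by (meson order_trans)
      qed
      have ds1: "degsum ?V ?c1 x \<le> (opt * real v + g/8) * n ^ (v - 1)"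
      proof -
        have "(opt - \<delta>') * n ^ v \<le> (opt - \<eta> - \<kappa>) * n ^ v" using \<eta>le(2) \<kappa>le n0 by (intro mult_right_mono) auto
        then have "(opt - \<delta>') * n ^ v \<le> cnt ?V ?c1" using near1 by linarith
        then show ?thesis unfolding n_def using ds[rule_format, OF fV _ c1 _ x] nN Nge by (meson order_trans)
      qed
      have "real (card ?M) \<le> c0/4 * n"
      proof (rule ccontr)
        assume "\<not> real (card ?M) \<le> c0/4 * n"
        then have bigM: "c0/4 * n \<le> real (card ?M)" by linarith
        have "card ?V > 0" using n0 by (simp add: n_def)
        from Q_degree_le[OF H this c x i few[unfolded n_def] fB rainbow _ parts1[unfolded n_def]]
        have "real (Q_degree Q H x) \<le> degsum ?V ?c1 x - (c0 * n) ^ (v - 2) * real (card ?M)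
            + real v ^ 2 * (real (card B) + real v * real s + \<gamma> * n) * n ^ (v - 2)"
          using c0 by (simp add: n_def)
        also have "\<dots> \<le> (opt * real v + g/8) * n ^ (v - 1) - g * n ^ (v - 1) + (3 * (g/8)) * n ^ (v - 1)"
        proof (intro add_mono diff_mono ds1)
          have "g * n ^ (v - 1) = (c0 * n) ^ (v - 2) * (c0/4 * n)"
            unfolding g_def power_mult_distrib power_v_2[symmetric] by (simp only: mult_ac)
          also have "\<dots> \<le> (c0 * n) ^ (v - 2) * real (card ?M)" by (rule mult_left_mono[OF bigM]) (use c0 n0 in simp)
          finally show "g * n ^ (v - 1) \<le> (c0 * n) ^ (v - 2) * real (card ?M)" .
          have "real v ^ 2 * (real (card B) + real v * real s + \<gamma> * n) \<le> 3 * (g/8) * n"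
          proof -
            have "real v ^ 2 * real (card B) \<le> real v ^ 2 * (\<gamma> * n)" by (rule mult_left_mono[OF cB]) simp
            moreover have "real v ^ 2 * (\<gamma> * n) = g/8 * n" using \<gamma>(2) by (simp only: mult.assoc[symmetric])
            moreover have "real v ^ 2 * (real v * real s) = real v ^ 3 * real s" by (simp add: power2_eq_square power3_eq_cube)
            moreover have "\<kappa> * n \<le> g/8 * n" by (rule mult_right_mono[OF \<kappa>le(2)]) (use n0 in simp)
            ultimately show ?thesis using vs unfolding distrib_left by linarith
          qed
          then have "real v ^ 2 * (real (card B) + real v * real s + \<gamma> * n) * n ^ (v - 2) \<le> (3 * (g/8) * n) * n ^ (v - 2)"
            by (rule mult_right_mono) (use n0 in simp)
          then show "real v ^ 2 * (real (card B) + real v * real s + \<gamma> * n) * n ^ (v - 2) \<le> (3 * (g/8)) * n ^ (v - 1)"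
            by (simp only: mult.assoc power_v_2)
        qed
        also have "\<dots> = (opt * real v - g/2) * n ^ (v - 1)" by (simp add: algebra_simps)
        finally have "(real v * opt - \<epsilon>) * n ^ (v - 1) \<le> (opt * real v - g/2) * n ^ (v - 1)"
          using deg[rule_format, OF x] unfolding n_def by linarith
        then have "real v * opt - \<epsilon> \<le> opt * real v - g/2" by (rule mult_right_le_imp_le) (use n0 in simp)
        then show False using \<epsilon>(2) g by (simp only: mult.commute[of opt])
      qed
      moreover have "{w\<in>?V. c w \<noteq> i \<and> \<not> T H x w} \<subseteq> insert x ?M" by blast
      then have "card {w\<in>?V. c w \<noteq> i \<and> \<not> T H x w} \<le> card (insert x ?M)" by (rule card_mono[rotated]) (use fV in simp)
      then have "card {w\<in>?V. c w \<noteq> i \<and> \<not> T H x w} \<le> card ?M + 1" using card_insert_le_m1[of "card ?M + 1" ?M x] by simp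
      ultimately have "real (card {w\<in>?V. c w \<noteq> i \<and> \<not> T H x w}) \<le> c0/4 * n + 1" by linarith
      then show ?thesis using i by blast
    qed
    \<comment> \<open>The final colouring \<open>c'\<close> is always measured against the parts of
      \<open>c\<close>. Two vertices of an edge with the same value of \<open>c'\<close> thus
      satisfy the hypotheses of \<open>monoH\<close>, which refer to \<open>c\<close> only.\<close>
    have "\<exists>c'. \<forall>x\<in>?V. c' x < l \<and> real (card {w\<in>?V. c w \<noteq> c' x \<and> \<not> T H x w}) \<le> c0/4 * n + 1"
      by (rule bchoice) (use ex in simp)
    then obtain c' where c'0: "\<forall>x\<in>?V. c' x < l \<and> real (card {w\<in>?V. c w \<noteq> c' x \<and> \<not> T H x w}) \<le> c0/4 * n + 1"
      by (elim exE) (rule that)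
    have c': "c' x < l" "real (card {w\<in>?V. c w \<noteq> c' x \<and> \<not> T H x w}) \<le> c0/4 * n + 1" if "x \<in> ?V" for x
      using c'0[rule_format, OF that] by simp_all
    show "partite l H"
    proof (rule partiteI[OF H, of c'])
      show "c' \<in> ?V \<rightarrow> {..<l}" using c' by auto
      fix e y z assume e: "e \<in> edges H" "y \<in> e" "z \<in> e" "y \<noteq> z"
      have yz: "y \<in> ?V" "z \<in> ?V" using r_graphD(2)[OF H e(1)] e by auto
      show "c' y \<noteq> c' z"
      proof
        assume eq: "c' y = c' z"
        show False by (rule monoH[OF e c'(1)[OF yz(1)] c'(2)[OF yz(1)] c'(2)[OF yz(2), folded eq]])
      qed
    qed
  qed
  show ?thesis by (rule exI[of _ \<epsilon>], intro conjI exI[of _ N] allI impI \<epsilon>(1) main)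
qed

end

section \<open>Extremal numbers\<close>

text \<open>The complete partite \<open>r\<close>-graph whose parts are the colour classes. Encoding
  the partition by a colouring links copies of \<open>Q\<close> directly to \<open>homs\<close> with
  \<open>cross c\<close>.\<close>

definition rainbow_graph :: "nat \<Rightarrow> 'a set \<Rightarrow> ('a \<Rightarrow> nat) \<Rightarrow> 'a hypergraph" where
  "rainbow_graph r V c = Hypergraph V {e. e \<subseteq> V \<and> card e = r \<and> inj_on c e}"

lemma verts_rainbow_graph [simp]: "verts (rainbow_graph r V c) = V"
  by (simp add: rainbow_graph_def)

lemma r_graph_rainbow_graph: "finite V \<Longrightarrow> r_graph r (rainbow_graph r V c)"
  by (auto simp: r_graph_def rainbow_graph_def)

lemma inj_on_colour_classes:
  assumes "finite e" "e \<subseteq> V" "c \<in> V \<rightarrow> {..<l}"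
  shows "inj_on c e \<longleftrightarrow> (\<forall>i<l. card (e \<inter> {x\<in>V. c x = i}) \<le> 1)"
proof
  assume inj: "inj_on c e"
  show "\<forall>i<l. card (e \<inter> {x\<in>V. c x = i}) \<le> 1"
  proof (intro allI impI)
    fix i
    have "x = y" if "x \<in> e \<inter> {x\<in>V. c x = i}" "y \<in> e \<inter> {x\<in>V. c x = i}" for x y
      using inj_onD[OF inj, of x y] that by auto
    then show "card (e \<inter> {x\<in>V. c x = i}) \<le> 1" using assms(1) by (auto simp: card_le_Suc0_iff_eq)
  qed
next
  assume r: "\<forall>i<l. card (e \<inter> {x\<in>V. c x = i}) \<le> 1"
  show "inj_on c e"
  proof (rule inj_onI)
    fix x y assume xy: "x \<in> e" "y \<in> e" "c x = c y"
    have "c x < l" using assms(2,3) xy by auto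
    then have "card (e \<inter> {z\<in>V. c z = c x}) \<le> 1" using r by blast
    then have "\<forall>a\<in>e \<inter> {z\<in>V. c z = c x}. \<forall>b\<in>e \<inter> {z\<in>V. c z = c x}. a = b"
      using card_le_Suc0_iff_eq[of "e \<inter> {z\<in>V. c z = c x}"] assms(1) by simp
    then show "x = y" using xy assms(2) by auto
  qed
qed

lemma complete_partite_rainbow_graph:
  assumes "finite V" "c \<in> V \<rightarrow> {..<l}"
  shows "complete_partite r l (rainbow_graph r V c)"
  unfolding complete_partite_def
proof (intro exI[of _ "\<lambda>i. {x\<in>V. c x = i}"] conjI)
  show "parts_of l (\<lambda>i. {x\<in>V. c x = i}) (verts (rainbow_graph r V c))"
    using assms(2) by (auto simp: parts_of_def disjoint_family_on_def)
  have "inj_on c e \<longleftrightarrow> (\<forall>i<l. card (e \<inter> {x\<in>V. c x = i}) \<le> 1)" if "e \<subseteq> V" for e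
    by (rule inj_on_colour_classes[OF finite_subset[OF that assms(1)] that assms(2)])
  then show "edges (rainbow_graph r V c) = {e. e \<subseteq> verts (rainbow_graph r V c) \<and> card e = r \<and> (\<forall>i<l. card (e \<inter> {x\<in>V. c x = i}) \<le> 1)}"
    by (auto simp: rainbow_graph_def)
qed

lemma parts_of_colouring:
  assumes "parts_of l V X"
  obtains c where "c \<in> X \<rightarrow> {..<l}" "\<And>i. i < l \<Longrightarrow> V i = {x\<in>X. c x = i}"
proof -
  let ?c = "\<lambda>x. SOME i. i < l \<and> x \<in> V i"
  have c: "?c x < l \<and> x \<in> V (?c x)" if "x \<in> X" for x
  proof (rule someI_ex)
    show "\<exists>i. i < l \<and> x \<in> V i" using assms that by (auto simp: parts_of_def)
  qed
  have uniq: "i = j" if "x \<in> V i" "x \<in> V j" "i < l" "j < l" for x i j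
    using assms that by (auto simp: parts_of_def disjoint_family_on_def)
  have "V i = {x\<in>X. ?c x = i}" if i: "i < l" for i
  proof -
    have "V i \<subseteq> X" using assms i by (auto simp: parts_of_def)
    then show ?thesis using c uniq i by blast
  qed
  then show thesis using c by (intro that[of ?c]) auto
qed

lemma partite_subset_rainbow_graph:
  assumes H: "r_graph r H" and p: "partite l H"
  obtains c where "c \<in> verts H \<rightarrow> {..<l}" "edges H \<subseteq> edges (rainbow_graph r (verts H) c)"
proof -
  obtain V where V: "parts_of l V (verts H)" "\<forall>e\<in>edges H. \<forall>i<l. card (e \<inter> V i) \<le> 1"
    using p by (auto simp: partite_def)
  obtain c where c: "c \<in> verts H \<rightarrow> {..<l}" "\<And>i. i < l \<Longrightarrow> V i = {x\<in>verts H. c x = i}"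
    by (rule parts_of_colouring[OF V(1)]) (rule that)
  have "e \<in> edges (rainbow_graph r (verts H) c)" if e: "e \<in> edges H" for e
  proof -
    have e': "e \<subseteq> verts H" "card e = r" "finite e" using r_graphD(2-4)[OF H e] by auto
    have "card (e \<inter> {x\<in>verts H. c x = i}) \<le> 1" if "i < l" for i using V(2) e c(2)[OF that] that by force
    then have "inj_on c e" using inj_on_colour_classes[OF e'(3,1) c(1)] by blast
    then show ?thesis using e' by (simp add: rainbow_graph_def)
  qed
  then show thesis using that[OF c(1)] by blast
qed

lemma inj_num_mono:
  assumes "finite (verts Q)" "finite (verts G)" "verts H = verts G" "edges H \<subseteq> edges G"
  shows "inj_num Q H \<le> inj_num Q G"
  unfolding inj_num_def
proof (rule card_mono[OF finite_inj_homs[OF assms(1,2)]], rule subsetI)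
  fix \<phi> assume "\<phi> \<in> inj_homs Q H"
  then show "\<phi> \<in> inj_homs Q G" using assms(3,4) unfolding inj_homs_def by auto
qed

lemma inj_num_le_power:
  assumes "finite (verts Q)" "finite (verts H)"
  shows "inj_num Q H \<le> card (verts H) ^ card (verts Q)"
proof -
  have "inj_num Q H \<le> card (verts Q \<rightarrow>\<^sub>E verts H)" unfolding inj_num_def
    by (rule card_mono) (use assms in \<open>auto simp: inj_homs_def intro: finite_PiE\<close>)
  then show ?thesis using assms by (simp add: card_PiE_const)
qed

lemma finite_max_inj_set:
  assumes "finite (verts Q)"
  shows "finite {inj_num Q H |H :: nat hypergraph. r_graph r H \<and> card (verts H) = n \<and> free_of \<F> H}"
proof (rule finite_subset)
  show "{inj_num Q H |H :: nat hypergraph. r_graph r H \<and> card (verts H) = n \<and> free_of \<F> H} \<subseteq> {..n ^ card (verts Q)}"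
    using inj_num_le_power[OF assms] by (auto dest: r_graphD(1))
qed simp

context expansion_problem
begin

abbreviation free_max :: "nat \<Rightarrow> nat" where "free_max n \<equiv> max_inj r n Q {expansion r F}"

lemma free_iff: "free_of {expansion r F} H \<longleftrightarrow> \<not> contains H (expansion r F)"
  by (simp add: free_of_def)

lemma rainbow_graph_free:
  assumes "c \<in> V \<rightarrow> {..<l}"
  shows "\<not> contains (rainbow_graph r V c) (expansion r F)"
proof (rule not_contains_expansion[OF F])
  show "\<not> colorable F l" by (rule not_colorable_less) (simp add: chi)
  show "c \<in> verts (rainbow_graph r V c) \<rightarrow> {..<l}" using assms by simp
qed (simp add: rainbow_graph_def)

lemma inj_num_le_free_max:
  assumes "r_graph r (H :: nat hypergraph)" "\<not> contains H (expansion r F)"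
  shows "inj_num Q H \<le> free_max (card (verts H))"
  unfolding max_inj_def by (rule Max_ge[OF finite_max_inj_set[OF fin]]) (use assms free_iff in auto)

lemma free_max_attained:
  obtains H :: "nat hypergraph" where "r_graph r H" "card (verts H) = n" "\<not> contains H (expansion r F)" "inj_num Q H = free_max n"
proof -
  let ?S = "{inj_num Q H |H :: nat hypergraph. r_graph r H \<and> card (verts H) = n \<and> free_of {expansion r F} H}"
  have "r_graph r (rainbow_graph r {..<n} (\<lambda>_. 0))" "\<not> contains (rainbow_graph r {..<n} (\<lambda>_. 0)) (expansion r F)"
    using r_graph_rainbow_graph rainbow_graph_free[of "\<lambda>_. 0" "{..<n}"] l_ge_2 by auto
  then have "inj_num Q (rainbow_graph r {..<n} (\<lambda>_. 0)) \<in> ?S"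
    unfolding free_iff by (intro CollectI exI[of _ "rainbow_graph r {..<n} (\<lambda>_. 0)"]) simp
  then have "?S \<noteq> {}" by blast
  then have "Max ?S \<in> ?S" by (rule Max_in[OF finite_max_inj_set[OF fin]])
  then obtain H :: "nat hypergraph" where H: "Max ?S = inj_num Q H" "r_graph r H" "card (verts H) = n" "free_of {expansion r F} H"
    unfolding mem_Collect_eq by (elim exE conjE) (rule that)
  have "inj_num Q H = free_max n" unfolding max_inj_def using H(1) by (rule sym)
  then show thesis by (rule that[OF H(2,3) H(4)[unfolded free_iff]])
qed

text \<open>Both directions of \<open>pc_adj\<close> enter: differently coloured vertices of
  \<open>Q\<close> share an edge, whose image is rainbow; conversely, the vertices of an edge have
  different colours, so a proper map makes its image rainbow.\<close>

lemma inj_homs_rainbow_graph: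
  "inj_homs Q (rainbow_graph r V c) = {\<phi> \<in> homs (verts Q) pc V (cross c). inj_on \<phi> (verts Q)}"
proof (intro set_eqI iffI)
  fix \<phi> assume \<phi>: "\<phi> \<in> inj_homs Q (rainbow_graph r V c)"
  note \<phi>' = inj_homsD[OF \<phi>]
  have "\<phi> \<in> homs (verts Q) pc V (cross c)"
  proof (rule homsI)
    show "\<phi> \<in> verts Q \<rightarrow>\<^sub>E V" using \<phi>'(1) by simp
    fix a d assume ad: "a \<in> verts Q" "d \<in> verts Q" "pc a \<noteq> pc d"
    obtain e where e: "e \<in> edges Q" "a \<in> e" "d \<in> e" and "a \<noteq> d" using pc_adj[OF ad(1,2)] ad(3) by blast
    have "\<phi> a \<noteq> \<phi> d" using inj_onD[OF \<phi>'(2) _ ad(1,2)] \<open>a \<noteq> d\<close> by blast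
    moreover have "inj_on c (\<phi> ` e)" using \<phi>'(3)[OF e(1)] by (simp add: rainbow_graph_def)
    ultimately show "cross c (\<phi> a) (\<phi> d)" using inj_onD[of c "\<phi> ` e" "\<phi> a" "\<phi> d"] e by (auto simp: cross_def)
  qed
  then show "\<phi> \<in> {\<phi> \<in> homs (verts Q) pc V (cross c). inj_on \<phi> (verts Q)}" using \<phi>'(2) by simp
next
  fix \<phi> assume "\<phi> \<in> {\<phi> \<in> homs (verts Q) pc V (cross c). inj_on \<phi> (verts Q)}"
  then have h: "\<phi> \<in> homs (verts Q) pc V (cross c)" and inj: "inj_on \<phi> (verts Q)" by auto
  have "\<phi> ` e \<in> edges (rainbow_graph r V c)" if e: "e \<in> edges Q" for e
  proof -
    have ev: "e \<subseteq> verts Q" "card e = r" using r_graphD(2,3)[OF Q e] by auto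
    have "\<phi> ` e \<subseteq> V" using homs_in[OF h] ev by blast
    moreover have "card (\<phi> ` e) = r" using card_image[OF inj_on_subset[OF inj ev(1)]] ev(2) by simp
    moreover have "inj_on c (\<phi> ` e)"
    proof (rule inj_onI)
      fix x y assume "x \<in> \<phi> ` e" "y \<in> \<phi> ` e" and cxy: "c x = c y"
      then obtain a d where ad: "a \<in> e" "d \<in> e" "x = \<phi> a" "y = \<phi> d" by blast
      have ad': "a \<in> verts Q" "d \<in> verts Q" using ad ev by auto
      show "x = y"
      proof (rule ccontr)
        assume "x \<noteq> y"
        then have "a \<noteq> d" using ad by blast
        then have "pc a \<noteq> pc d" using pc_adj[OF ad'] e ad by blast
        then show False using homsD[OF h ad'] cxy ad by (simp add: cross_def)
      qed
    qed
    ultimately show ?thesis by (simp add: rainbow_graph_def)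
  qed
  then show "\<phi> \<in> inj_homs Q (rainbow_graph r V c)" using homs_PiE[OF h] inj by (simp add: inj_homs_def)
qed

text \<open>A map that is not injective identifies two of the pattern vertices, which leaves
  \<open>n^(v-1)\<close> possibilities for each of at most \<open>v^2\<close> pairs.\<close>

lemma inj_num_rainbow_graph_ge:
  assumes V: "finite V" "V \<noteq> {}"
  shows "cnt V c \<le> real (inj_num Q (rainbow_graph r V c)) + real v ^ 2 * real (card V) ^ (v - 1)"
proof -
  let ?n = "real (card V)"
  let ?I = "{\<phi> \<in> homs (verts Q) pc V (cross c). inj_on \<phi> (verts Q)}"
  let ?P = "verts Q \<times> verts Q - Id"
  let ?d = "(\<lambda>x. (x, x)) ` V"
  let ?X = "\<lambda>z. {\<phi> \<in> verts Q \<rightarrow>\<^sub>E V. (\<phi> (fst z), \<phi> (snd z)) \<in> ?d}"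
  have fI: "finite ?I" by (rule finite_subset[OF _ finite_homs[OF fin V(1), of pc "cross c"]]) (simp add: Collect_subset)
  have fX: "finite (?X z)" for z
    by (rule finite_subset[of _ "verts Q \<rightarrow>\<^sub>E V"]) (blast, rule finite_PiE[OF fin V(1)])
  have fP: "finite ?P" using fin by simp
  have sub: "\<phi> \<in> ?I \<union> (\<Union>z\<in>?P. ?X z)" if h: "\<phi> \<in> homs (verts Q) pc V (cross c)" for \<phi>
  proof (cases "inj_on \<phi> (verts Q)")
    case True then show ?thesis using h by simp
  next
    case False
    then obtain a d where ad: "a \<in> verts Q" "d \<in> verts Q" "\<phi> a = \<phi> d" "a \<noteq> d" by (auto simp: inj_on_def)
    have "(a, d) \<in> ?P" using ad by simp
    moreover have "\<phi> \<in> ?X (a, d)" using homs_PiE[OF h] homs_in[OF h ad(2)] ad(3) by simp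
    ultimately show ?thesis by blast
  qed
  have "card (homs (verts Q) pc V (cross c)) \<le> card (?I \<union> (\<Union>z\<in>?P. ?X z))"
    by (rule card_mono[OF finite_UnI[OF fI finite_UN_I[OF fP fX]] subsetI]) (rule sub)
  also have "\<dots> \<le> card ?I + card (\<Union>z\<in>?P. ?X z)" by (rule card_Un_le)
  finally have 1: "cnt V c \<le> real (card ?I) + real (card (\<Union>z\<in>?P. ?X z))"
    unfolding cnt_def by (simp only: of_nat_add[symmetric] of_nat_le_iff)
  have "real (card (\<Union>z\<in>?P. ?X z)) \<le> real (card ?P) * ?n ^ (v - 1)"
  proof (rule card_UN_le_real[OF fP])
    fix z assume z: "z \<in> ?P"
    have "card (?X z) \<le> card ?d * card V ^ (v - 2)" by (rule card_pair_fixed_le[OF fin V(1)]) (use z V in auto)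
    also have "card ?d = card V" by (rule card_image) (auto simp: inj_on_def)
    finally have "real (card (?X z)) \<le> real (card V * card V ^ (v - 2))" by (rule of_nat_mono)
    then show "real (card (?X z)) \<le> ?n ^ (v - 1)" by (simp only: of_nat_mult of_nat_power power_v_2)
  qed
  also have "\<dots> \<le> real v ^ 2 * ?n ^ (v - 1)"
  proof (rule mult_right_mono)
    have "card ?P \<le> card (verts Q \<times> verts Q)" by (rule card_mono) (use fin in auto)
    then have "real (card ?P) \<le> real (v * v)" unfolding card_cartesian_product by (rule of_nat_mono)
    then show "real (card ?P) \<le> real v ^ 2" by (simp only: of_nat_mult power2_eq_square)
  qed simp
  finally show ?thesis using 1 unfolding inj_num_def inj_homs_rainbow_graph by linarith
qed

section \<open>Optimal complete partite hypergraphs of given order\<close>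

definition partite_max :: "nat \<Rightarrow> nat" where
  "partite_max n = Max {inj_num Q (rainbow_graph r V c) |(V :: nat set) c. finite V \<and> card V = n \<and> c \<in> V \<rightarrow> {..<l}}"

lemma finite_partite_max_set: "finite {inj_num Q (rainbow_graph r V c) |(V :: nat set) c. finite V \<and> card V = n \<and> c \<in> V \<rightarrow> {..<l}}"
proof (rule finite_subset)
  show "{inj_num Q (rainbow_graph r V c) |(V :: nat set) c. finite V \<and> card V = n \<and> c \<in> V \<rightarrow> {..<l}} \<subseteq> {..n ^ v}"
  proof
    fix m assume "m \<in> {inj_num Q (rainbow_graph r V c) |(V :: nat set) c. finite V \<and> card V = n \<and> c \<in> V \<rightarrow> {..<l}}"
    then obtain V c where "m = inj_num Q (rainbow_graph r (V :: nat set) c)" "finite V" "card V = n" by blast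
    then show "m \<in> {..n ^ v}" using inj_num_le_power[OF fin, of "rainbow_graph r V c"] by simp
  qed
qed simp

lemma inj_num_le_partite_max: "finite (V :: nat set) \<Longrightarrow> c \<in> V \<rightarrow> {..<l} \<Longrightarrow> inj_num Q (rainbow_graph r V c) \<le> partite_max (card V)"
  unfolding partite_max_def by (rule Max_ge[OF finite_partite_max_set]) blast

lemma partite_max_attained:
  obtains V :: "nat set" and c where "finite V" "card V = n" "c \<in> V \<rightarrow> {..<l}" "inj_num Q (rainbow_graph r V c) = partite_max n"
proof -
  let ?S = "{inj_num Q (rainbow_graph r V c) |(V :: nat set) c. finite V \<and> card V = n \<and> c \<in> V \<rightarrow> {..<l}}"
  have "inj_num Q (rainbow_graph r {..<n} (\<lambda>_. 0)) \<in> ?S"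
    using l_ge_2 by (intro CollectI exI[of _ "{..<n}"] exI[of _ "\<lambda>_. 0"]) auto
  then have "?S \<noteq> {}" by blast
  then have "Max ?S \<in> ?S" by (rule Max_in[OF finite_partite_max_set])
  then obtain V :: "nat set" and c where V: "Max ?S = inj_num Q (rainbow_graph r V c)" "finite V" "card V = n" "c \<in> V \<rightarrow> {..<l}"
    unfolding mem_Collect_eq by (elim exE conjE) (rule that)
  have "inj_num Q (rainbow_graph r V c) = partite_max n" unfolding partite_max_def using V(1) by (rule sym)
  then show thesis by (rule that[OF V(2-4)])
qed

lemma partite_max_le_free_max: "partite_max n \<le> free_max n"
proof -
  obtain V :: "nat set" and c where V: "finite V" "card V = n" "c \<in> V \<rightarrow> {..<l}" "inj_num Q (rainbow_graph r V c) = partite_max n"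
    by (rule partite_max_attained)
  then show ?thesis using inj_num_le_free_max[OF r_graph_rainbow_graph[OF V(1)] rainbow_graph_free[OF V(3)]] by simp
qed

lemma partite_max_lower:
  assumes "\<delta> > 0"
  shows "\<exists>N. \<forall>n\<ge>N. real (partite_max n) \<ge> (opt - \<delta>) * real n ^ v"
proof -
  have "\<delta>/2 > 0" using assms by simp
  from cnt_near_opt[OF this] obtain N1 where N1: "\<forall>n\<ge>N1. \<exists>c\<in>{..<n} \<rightarrow> {..<l}. cnt {..<n} c \<ge> (opt - \<delta>/2) * real n ^ v"
    by (elim exE) (rule that)
  obtain N2 :: nat where N2: "real N2 > real v ^ 2 * 2 / \<delta>" using reals_Archimedean2 by blast
  show ?thesis
  proof (intro exI[of _ "max N1 (N2 + 1)"] allI impI)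
    fix n assume n: "max N1 (N2 + 1) \<le> n"
    obtain c where c: "c \<in> {..<n} \<rightarrow> {..<l}" "cnt {..<n} c \<ge> (opt - \<delta>/2) * real n ^ v" using N1 n by auto
    have "{..<n} \<noteq> {}" using n by (simp add: lessThan_empty_iff)
    from inj_num_rainbow_graph_ge[OF finite_lessThan this, of c] inj_num_le_partite_max[OF finite_lessThan c(1)]
    have 1: "cnt {..<n} c \<le> real (partite_max n) + real v ^ 2 * real n ^ (v - 1)" by simp
    have "real v ^ 2 * real n ^ (v - 1) \<le> (\<delta>/2 * real n) * real n ^ (v - 1)"
    proof (rule mult_right_mono)
      have "real v ^ 2 \<le> \<delta>/2 * real N2" using N2 assms by (simp add: field_simps)
      also have "\<dots> \<le> \<delta>/2 * real n" using n assms by simp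
      finally show "real v ^ 2 \<le> \<delta>/2 * real n" .
    qed simp
    also have "\<dots> = \<delta>/2 * real n ^ v" by (simp only: mult.assoc power_v)
    finally have "(opt - \<delta>/2) * real n ^ v - \<delta>/2 * real n ^ v \<le> real (partite_max n)" using 1 c(2) by linarith
    then show "(opt - \<delta>) * real n ^ v \<le> real (partite_max n)" by (simp add: algebra_simps)
  qed
qed

text \<open>Cloning a vertex of at least average degree.\<close>

lemma partite_max_growth:
  assumes "n > 0"
  shows "(n + v) * partite_max n \<le> n * partite_max (Suc n)"
proof -
  obtain V :: "nat set" and c where V: "finite V" "card V = n" "c \<in> V \<rightarrow> {..<l}" "inj_num Q (rainbow_graph r V c) = partite_max n"
    by (rule partite_max_attained)
  let ?G = "rainbow_graph r V c"
  have "\<exists>x\<in>V. v * partite_max n \<le> n * Q_degree Q ?G x"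
  proof (rule ccontr)
    assume "\<not> ?thesis"
    then have lt: "n * Q_degree Q ?G x < v * partite_max n" if "x \<in> V" for x using that by (auto simp: not_le)
    have "V \<noteq> {}" using V assms by auto
    then have "(\<Sum>x\<in>V. n * Q_degree Q ?G x) < (\<Sum>x\<in>V. v * partite_max n)" by (intro sum_strict_mono[OF V(1)] lt)
    then have "n * (\<Sum>x\<in>V. Q_degree Q ?G x) < n * (v * partite_max n)" using V(2) by (simp add: sum_distrib_left)
    moreover have "(\<Sum>x\<in>V. Q_degree Q ?G x) = v * partite_max n" using sum_Q_degree[of ?G] V by simp
    ultimately show False by simp
  qed
  then obtain x where x: "x \<in> V" "v * partite_max n \<le> n * Q_degree Q ?G x" by blast
  obtain y where y: "y \<notin> V" using ex_new_if_finite[OF infinite_UNIV_nat V(1)] by blast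
  define c' where "c' = c(y := c x)"
  have cV: "c' z = c z" if "z \<in> V" for z using that y by (auto simp: c'_def)
  have c'V: "c' \<in> insert y V \<rightarrow> {..<l}" using V(3) x by (auto simp: c'_def)
  let ?G' = "rainbow_graph r (insert y V) c'"
  let ?A = "inj_homs Q ?G" and ?D = "{\<phi> \<in> inj_homs Q ?G. x \<in> \<phi> ` verts Q}"
  let ?f = "\<lambda>\<phi>. \<lambda>u\<in>verts Q. if \<phi> u = x then y else \<phi> u"
  have fA: "finite ?A" "finite ?D" using finite_inj_homs[OF fin, of ?G] V(1) by simp_all
  have fA': "finite (inj_homs Q ?G')" using finite_inj_homs[OF fin, of ?G'] V(1) by simp
  have AI: "\<phi> \<in> homs (verts Q) pc V (cross c)" "inj_on \<phi> (verts Q)" if "\<phi> \<in> ?A" for \<phi>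
    using that unfolding inj_homs_rainbow_graph by auto
  have old: "?A \<subseteq> inj_homs Q ?G'"
  proof
    fix \<phi> assume \<phi>: "\<phi> \<in> ?A"
    note h = AI(1)[OF \<phi>]
    have "\<phi> \<in> homs (verts Q) pc (insert y V) (cross c')"
    proof (rule homsI)
      show "\<phi> \<in> verts Q \<rightarrow>\<^sub>E insert y V" using homs_PiE[OF h] by (auto simp: PiE_def Pi_def)
      fix u w assume uw: "u \<in> verts Q" "w \<in> verts Q" "pc u \<noteq> pc w"
      show "cross c' (\<phi> u) (\<phi> w)"
        unfolding cross_def cV[OF homs_in[OF h uw(1)]] cV[OF homs_in[OF h uw(2)]]
        using homsD[OF h uw] by (simp add: cross_def)
    qed
    then show "\<phi> \<in> inj_homs Q ?G'" using AI(2)[OF \<phi>] unfolding inj_homs_rainbow_graph by simp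
  qed
  have new: "?f \<phi> \<in> inj_homs Q ?G' - ?A" if \<phi>: "\<phi> \<in> ?D" for \<phi>
  proof -
    have \<phi>A: "\<phi> \<in> ?A" using \<phi> by simp
    note h = AI(1)[OF \<phi>A] and inj = AI(2)[OF \<phi>A]
    have fy: "\<phi> u \<noteq> y" if "u \<in> verts Q" for u using homs_in[OF h that] y by blast
    have cc: "c' (?f \<phi> u) = c (\<phi> u)" if "u \<in> verts Q" for u
      using cV[OF homs_in[OF h that]] that by (auto simp: c'_def)
    have "?f \<phi> \<in> homs (verts Q) pc (insert y V) (cross c')"
    proof (rule homsI)
      show "?f \<phi> \<in> verts Q \<rightarrow>\<^sub>E insert y V" using homs_in[OF h] by auto
      fix u w assume uw: "u \<in> verts Q" "w \<in> verts Q" "pc u \<noteq> pc w"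
      show "cross c' (?f \<phi> u) (?f \<phi> w)"
        unfolding cross_def cc[OF uw(1)] cc[OF uw(2)] using homsD[OF h uw] by (simp add: cross_def)
    qed
    moreover have "inj_on (?f \<phi>) (verts Q)"
    proof (rule inj_onI)
      fix u w assume uw: "u \<in> verts Q" "w \<in> verts Q" "?f \<phi> u = ?f \<phi> w"
      then have "\<phi> u = \<phi> w" using fy[OF uw(1)] fy[OF uw(2)] by (auto split: if_splits)
      then show "u = w" using inj_onD[OF inj _ uw(1,2)] by blast
    qed
    moreover have "?f \<phi> \<notin> ?A"
    proof
      assume fA: "?f \<phi> \<in> ?A"
      obtain u where u: "u \<in> verts Q" "\<phi> u = x" using \<phi> by auto
      have "?f \<phi> u = y" using u by simp
      then show False using homs_in[OF AI(1)[OF fA] u(1)] y by simp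
    qed
    ultimately show ?thesis unfolding inj_homs_rainbow_graph by simp
  qed
  have inj: "inj_on ?f ?D"
  proof (rule inj_onI)
    fix \<phi> \<psi> assume p: "\<phi> \<in> ?D" "\<psi> \<in> ?D" "?f \<phi> = ?f \<psi>"
    have h: "\<phi> \<in> homs (verts Q) pc V (cross c)" "\<psi> \<in> homs (verts Q) pc V (cross c)" using AI(1) p by simp_all
    have "\<phi> u = \<psi> u" if u: "u \<in> verts Q" for u
    proof -
      have "\<phi> u \<noteq> y" "\<psi> u \<noteq> y" using homs_in[OF h(1) u] homs_in[OF h(2) u] y by auto
      then show ?thesis using fun_cong[OF p(3), of u] u by (auto split: if_splits)
    qed
    then show "\<phi> = \<psi>" by (rule PiE_ext[OF homs_PiE[OF h(1)] homs_PiE[OF h(2)]])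
  qed
  have "card ?A + card ?D = card ?A + card (?f ` ?D)" using card_image[OF inj] by simp
  also have "\<dots> = card (?A \<union> ?f ` ?D)"
    by (rule card_Un_disjoint[symmetric]) (use fA new in \<open>auto simp del: mem_Collect_eq\<close>)
  also have "\<dots> \<le> card (inj_homs Q ?G')" by (rule card_mono[OF fA']) (use old new in blast)
  finally have "partite_max n + Q_degree Q ?G x \<le> inj_num Q ?G'" using V(4) by (simp add: inj_num_def Q_degree_def)
  also have "\<dots> \<le> partite_max (card (insert y V))" by (rule inj_num_le_partite_max) (use V(1) c'V in auto)
  also have "card (insert y V) = Suc n" using V y by simp
  finally have "n * (partite_max n + Q_degree Q ?G x) \<le> n * partite_max (Suc n)" by simp
  then show ?thesis using x(2) by (simp add: algebra_simps)
qed

lemma free_max_delete_vertex: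
  assumes H: "r_graph r (H :: nat hypergraph)" and free: "\<not> contains H (expansion r F)" and x: "x \<in> verts H"
  shows "inj_num Q H \<le> free_max (card (verts H) - 1) + Q_degree Q H x"
proof -
  let ?H = "Hypergraph (verts H - {x}) {e\<in>edges H. x \<notin> e}"
  have fV: "finite (verts H)" by (rule r_graphD(1)[OF H])
  have H': "r_graph r ?H" using H by (auto simp: r_graph_def)
  have sub: "inj_homs G ?H \<subseteq> inj_homs G H" for G :: "'c hypergraph"
  proof
    fix \<phi> assume "\<phi> \<in> inj_homs G ?H"
    then show "\<phi> \<in> inj_homs G H" unfolding inj_homs_def by (auto simp: PiE_def Pi_def)
  qed
  then have free': "\<not> contains ?H (expansion r F)" using free unfolding contains_def by blast
  have "inj_homs Q H \<subseteq> inj_homs Q ?H \<union> {\<phi> \<in> inj_homs Q H. x \<in> \<phi> ` verts Q}"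
  proof
    fix \<phi> assume \<phi>: "\<phi> \<in> inj_homs Q H"
    show "\<phi> \<in> inj_homs Q ?H \<union> {\<phi> \<in> inj_homs Q H. x \<in> \<phi> ` verts Q}"
    proof (cases "x \<in> \<phi> ` verts Q")
      case False
      note \<phi>' = inj_homsD[OF \<phi>]
      have "\<phi> \<in> verts Q \<rightarrow>\<^sub>E verts H - {x}" using \<phi>'(1) False by (auto simp: PiE_def Pi_def)
      moreover have "\<phi> ` e \<in> {e\<in>edges H. x \<notin> e}" if e: "e \<in> edges Q" for e
        using \<phi>'(3)[OF e] False r_graphD(2)[OF Q e] by auto
      ultimately show ?thesis using \<phi>'(2) by (simp add: inj_homs_def)
    qed (use \<phi> in simp)
  qed
  moreover have "finite (inj_homs Q H)" by (rule finite_inj_homs[OF fin fV])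
  moreover have "finite (inj_homs Q ?H)" by (rule finite_inj_homs[OF fin]) (use fV in simp)
  ultimately have "card (inj_homs Q H) \<le> card (inj_homs Q ?H \<union> {\<phi> \<in> inj_homs Q H. x \<in> \<phi> ` verts Q})"
    by (intro card_mono finite_UnI) simp_all
  also have "\<dots> \<le> card (inj_homs Q ?H) + card {\<phi> \<in> inj_homs Q H. x \<in> \<phi> ` verts Q}" by (rule card_Un_le)
  finally have "inj_num Q H \<le> inj_num Q ?H + Q_degree Q H x" by (simp add: inj_num_def Q_degree_def)
  moreover have "inj_num Q ?H \<le> free_max (card (verts ?H))" by (rule inj_num_le_free_max[OF H' free'])
  moreover have "card (verts ?H) = card (verts H) - 1" using x fV by simp
  ultimately show ?thesis by simp
qed

section \<open>Comparison of the two extremal numbers\<close>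

text \<open>The extremal number is at least \<open>(opt - \<epsilon>) * n^v\<close>, since complete
  partite hypergraphs are free. So a degree condition relative to the average degree in an extremal
  hypergraph implies one relative to \<open>opt\<close>.\<close>

lemma relative_degree_stability:
  "\<exists>\<epsilon>>0. \<epsilon> < 1 \<and> (\<exists>N. \<forall>H :: nat hypergraph. r_graph r H \<longrightarrow> N \<le> card (verts H) \<longrightarrow> \<not> contains H (expansion r F) \<longrightarrow>
     (\<forall>x\<in>verts H. real (Q_degree Q H x) \<ge> (1 - \<epsilon>) * (real v * real (free_max (card (verts H))) / real (card (verts H)))) \<longrightarrow> partite l H)"
proof -
  have v1: "real v \<ge> 1" using v_ge_2 by simp
  obtain \<epsilon>' N where \<epsilon>': "\<epsilon>' > 0" and st: "\<forall>H :: nat hypergraph. r_graph r H \<longrightarrow> N \<le> card (verts H) \<longrightarrow> \<not> contains H (expansion r F) \<longrightarrow>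
     (\<forall>x\<in>verts H. real (Q_degree Q H x) \<ge> (real v * opt - \<epsilon>') * real (card (verts H)) ^ (v - 1)) \<longrightarrow> partite l H"
    using degree_stability by (elim exE conjE) (rule that)
  \<comment> \<open>The product \<open>(1 - \<epsilon>) * v * (opt - \<epsilon>)\<close> falls short
    of \<open>v * opt\<close> by at most \<open>2 * v * \<epsilon>\<close>, because
    \<open>opt \<le> 1\<close>.\<close>
  define \<epsilon> where "\<epsilon> = min (1/2) (\<epsilon>' / (2 * real v))"
  have \<epsilon>: "\<epsilon> > 0" "\<epsilon> < 1" using \<epsilon>' v1 by (auto simp: \<epsilon>_def)
  have v\<epsilon>: "2 * (real v * \<epsilon>) \<le> \<epsilon>'"
  proof -
    have "\<epsilon> \<le> \<epsilon>' / (2 * real v)" by (simp add: \<epsilon>_def)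
    then show ?thesis using v1 by (simp add: field_simps)
  qed
  from partite_max_lower[OF \<epsilon>(1)] obtain N' where N': "\<forall>n\<ge>N'. real (partite_max n) \<ge> (opt - \<epsilon>) * real n ^ v" by (elim exE) (rule that)
  have "partite l H" if H: "r_graph r H" and n: "max N (max N' 1) \<le> card (verts H)" and free: "\<not> contains H (expansion r F)"
    and deg: "\<forall>x\<in>verts H. real (Q_degree Q H x) \<ge> (1 - \<epsilon>) * (real v * real (free_max (card (verts H))) / real (card (verts H)))" for H :: "nat hypergraph"
  proof (rule st[rule_format, OF H _ free])
    show "N \<le> card (verts H)" using n by simp
    fix x assume x: "x \<in> verts H"
    define m where "m = real (card (verts H))"
    have m0: "m > 0" using n by (simp add: m_def)
    have "N' \<le> card (verts H)" using n by simp
    with N' have "(opt - \<epsilon>) * m ^ v \<le> real (partite_max (card (verts H)))" by (simp add: m_def)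
    also have "\<dots> \<le> real (free_max (card (verts H)))" by (rule of_nat_mono[OF partite_max_le_free_max])
    finally have bm: "(opt - \<epsilon>) * m ^ v \<le> real (free_max (card (verts H)))" .
    have "(real v * opt - \<epsilon>') * m ^ (v - 1) \<le> ((1 - \<epsilon>) * real v * (opt - \<epsilon>)) * m ^ (v - 1)"
    proof (rule mult_right_mono)
      have "real v * \<epsilon> * opt \<le> real v * \<epsilon> * 1" by (rule mult_left_mono[OF opt_le_1]) (use \<epsilon> in simp)
      moreover have "0 \<le> real v * \<epsilon> * \<epsilon>" using \<epsilon> by simp
      moreover have "(1 - \<epsilon>) * real v * (opt - \<epsilon>) = real v * opt - real v * \<epsilon> - real v * \<epsilon> * opt + real v * \<epsilon> * \<epsilon>"
        by (simp add: algebra_simps)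
      ultimately show "real v * opt - \<epsilon>' \<le> (1 - \<epsilon>) * real v * (opt - \<epsilon>)" using v\<epsilon> by linarith
    qed (use m0 in simp)
    also have "\<dots> = (1 - \<epsilon>) * (real v * ((opt - \<epsilon>) * (m * m ^ (v - 1))) / m)" using m0 by simp
    also have "\<dots> = (1 - \<epsilon>) * (real v * ((opt - \<epsilon>) * m ^ v) / m)" by (simp only: power_v)
    also have "\<dots> \<le> (1 - \<epsilon>) * (real v * real (free_max (card (verts H))) / m)"
      by (intro mult_left_mono divide_right_mono bm) (use \<epsilon> m0 in auto)
    also have "\<dots> \<le> real (Q_degree Q H x)" using deg x by (simp only: m_def)
    finally show "(real v * opt - \<epsilon>') * real (card (verts H)) ^ (v - 1) \<le> real (Q_degree Q H x)" by (simp only: m_def)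
  qed
  then show ?thesis using \<epsilon> by (intro exI[of _ \<epsilon>] conjI exI[of _ "max N (max N' 1)"] allI impI) auto
qed

lemma inj_num_partite_le:
  assumes H: "r_graph r (H :: nat hypergraph)" and p: "partite l H"
  shows "inj_num Q H \<le> partite_max (card (verts H))"
proof -
  obtain c where c: "c \<in> verts H \<rightarrow> {..<l}" "edges H \<subseteq> edges (rainbow_graph r (verts H) c)"
    by (rule partite_subset_rainbow_graph[OF H p]) (rule that)
  have fV: "finite (verts H)" by (rule r_graphD(1)[OF H])
  have "inj_num Q H \<le> inj_num Q (rainbow_graph r (verts H) c)"
    by (rule inj_num_mono[OF fin _ _ c(2)]) (use fV in simp_all)
  also have "\<dots> \<le> partite_max (card (verts H))" by (rule inj_num_le_partite_max[OF fV c(1)])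
  finally show ?thesis .
qed

text \<open>If \<open>free_max n > partite_max n\<close>, an extremal hypergraph has a vertex of low degree, and deleting it
  makes the difference grow; this cannot go on since it is bounded at a fixed size.\<close>

lemma free_max_eq_partite_max: "\<exists>N. \<forall>n\<ge>N. free_max n = partite_max n"
proof -
  have v1: "real v \<ge> 1" using v_ge_2 by simp
  obtain \<epsilon> N1 where \<epsilon>: "\<epsilon> > 0" "\<epsilon> < 1" and st: "\<forall>H :: nat hypergraph. r_graph r H \<longrightarrow> N1 \<le> card (verts H) \<longrightarrow> \<not> contains H (expansion r F) \<longrightarrow>
     (\<forall>x\<in>verts H. real (Q_degree Q H x) \<ge> (1 - \<epsilon>) * (real v * real (free_max (card (verts H))) / real (card (verts H)))) \<longrightarrow> partite l H"
    using relative_degree_stability by (elim exE conjE) (rule that)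
  \<comment> \<open>Makes \<open>2 * \<delta>\<close> equal to \<open>\<epsilon> * opt / 2\<close>,
    so that \<open>(1 - \<epsilon>) * (opt + \<delta>) \<le> (opt - \<delta>) * (1 -
    \<epsilon>/2)\<close>. The remaining factor \<open>1 - \<epsilon>/2\<close> pays for the change
    from \<open>n\<close> to \<open>n - 1\<close>, and \<open>N4\<close> makes that change small
    enough.\<close>
  define \<delta> where "\<delta> = \<epsilon> * opt / 4"
  have \<delta>: "\<delta> > 0" using \<epsilon> opt_pos by (simp add: \<delta>_def)
  from partite_max_lower[OF \<delta>] obtain N2 where N2: "\<forall>n\<ge>N2. real (partite_max n) \<ge> (opt - \<delta>) * real n ^ v" by (elim exE) (rule that)
  from inj_num_upper[OF \<delta>] obtain N3 where N3: "\<forall>H :: nat hypergraph. r_graph r H \<longrightarrow> N3 \<le> card (verts H) \<longrightarrow> \<not> contains H (expansion r F) \<longrightarrow>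
    real (inj_num Q H) \<le> (opt + \<delta>) * real (card (verts H)) ^ v" by (elim exE) (rule that)
  obtain N4 :: nat where N4: "real N4 > 2 * real v / \<epsilon>" using reals_Archimedean2 by blast
  define n1 where "n1 = N1 + N2 + N3 + N4 + 1"
  \<comment> \<open>The difference of the two maxima increases when \<open>n\<close> is lowered by
    one, written without subtraction of naturals.\<close>
  have step: "free_max n + partite_max (n - 1) < free_max (n - 1) + partite_max n" if n: "n1 < n" and gap: "partite_max n < free_max n" for n
  proof -
    obtain H :: "nat hypergraph" where H: "r_graph r H" "card (verts H) = n" "\<not> contains H (expansion r F)" "inj_num Q H = free_max n"
      by (rule free_max_attained) (rule that)
    have "\<not> partite l H" using inj_num_partite_le[OF H(1)] H(2,4) gap by auto
    then have "\<not> (\<forall>x\<in>verts H. real (Q_degree Q H x) \<ge> (1 - \<epsilon>) * (real v * real (free_max n) / real n))"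
      using st[rule_format, OF H(1) _ H(3)] H(2) n by (auto simp: n1_def)
    then obtain x where x: "x \<in> verts H" "real (Q_degree Q H x) < (1 - \<epsilon>) * (real v * real (free_max n) / real n)" by (auto simp: not_le)
    define m where "m = n - 1"
    have nm: "n = Suc m" "m > 0" "N2 \<le> m" using n by (auto simp: m_def n1_def)
    have n0: "real n > 0" and m0: "real m > 0" using nm by auto
    have bn: "real (free_max n) \<le> (opt + \<delta>) * real n ^ v"
      using N3[rule_format, OF H(1) _ H(3)] H(2,4) n by (simp add: n1_def)
    have am: "(opt - \<delta>) * real m ^ v \<le> real (partite_max m)" using N2 nm(3) by blast
    \<comment> \<open>The degree of \<open>x\<close> has to fall below
      \<open>v * partite_max m / m\<close>, the increment from \<open>m\<close> to \<open>n\<close>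
      that \<open>partite_max_growth\<close> guarantees. Upper and lower density bounds differ by
      \<open>2 * \<delta>\<close> only, and this is outweighed by the factor
      \<open>1 - \<epsilon>\<close> in the choice of \<open>x\<close>.\<close>
    have "(1 - \<epsilon>) * (real v * real (free_max n) / real n) \<le> (1 - \<epsilon>) * (real v * ((opt + \<delta>) * (real n * real n ^ (v - 1))) / real n)"
      unfolding power_v by (intro mult_left_mono divide_right_mono bn) (use \<epsilon> in auto)
    also have "\<dots> = real v * (((1 - \<epsilon>) * (opt + \<delta>)) * real n ^ (v - 1))" using n0 by simp
    also have "\<dots> \<le> real v * (((opt - \<delta>) * (1 - \<epsilon>/2)) * real n ^ (v - 1))"
    proof (intro mult_left_mono mult_right_mono)
      have "(opt - \<delta>) * (1 - \<epsilon>/2) - (1 - \<epsilon>) * (opt + \<delta>) = \<epsilon> * opt / 2 - 2 * \<delta> + \<epsilon> * \<delta> * (3/2)"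
        by (simp add: algebra_simps)
      also have "\<epsilon> * opt / 2 = 2 * \<delta>" by (simp add: \<delta>_def)
      finally have "(opt - \<delta>) * (1 - \<epsilon>/2) - (1 - \<epsilon>) * (opt + \<delta>) = \<epsilon> * \<delta> * (3/2)" by simp
      moreover have "0 \<le> \<epsilon> * \<delta> * (3/2)" using \<epsilon> \<delta> by simp
      ultimately have "0 \<le> (opt - \<delta>) * (1 - \<epsilon>/2) - (1 - \<epsilon>) * (opt + \<delta>)" by (simp only:)
      then show "(1 - \<epsilon>) * (opt + \<delta>) \<le> (opt - \<delta>) * (1 - \<epsilon>/2)" by (simp only: diff_ge_0_iff_ge)
    qed auto
    also have "\<dots> = real v * ((opt - \<delta>) * ((1 - \<epsilon>/2) * real n ^ (v - 1)))" by (simp only: mult.assoc)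
    also have "\<dots> \<le> real v * ((opt - \<delta>) * real m ^ (v - 1))"
    proof (intro mult_left_mono)
      have "1 - \<epsilon>/2 \<le> (1 - 1 / real n) ^ (v - 1)"
      proof -
        have "1 - real (v - 1) * (1 / real n) \<le> (1 - 1 / real n) ^ (v - 1)"
          using Bernoulli_inequality[of "- (1 / real n)" "v - 1"] nm by simp
        moreover have "real (v - 1) * (1 / real n) \<le> \<epsilon>/2"
        proof -
          have "2 * real v \<le> \<epsilon> * real N4" using N4 \<epsilon> by (simp add: field_simps)
          also have "\<dots> \<le> \<epsilon> * real n" using n \<epsilon> by (simp add: n1_def)
          finally have "2 * real (v - 1) \<le> \<epsilon> * real n" by simp
          then show ?thesis using n0 by (simp add: field_simps)
        qed
        ultimately show ?thesis by linarith
      qed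
      then have "(1 - \<epsilon>/2) * real n ^ (v - 1) \<le> (1 - 1 / real n) ^ (v - 1) * real n ^ (v - 1)"
        by (rule mult_right_mono) simp
      also have "\<dots> = ((1 - 1 / real n) * real n) ^ (v - 1)" by (simp only: power_mult_distrib)
      also have "(1 - 1 / real n) * real n = real m" using nm by (simp add: field_simps)
      finally show "(1 - \<epsilon>/2) * real n ^ (v - 1) \<le> real m ^ (v - 1)" .
      have "\<delta> \<le> opt" using \<epsilon> opt_pos by (simp add: \<delta>_def)
      then show "0 \<le> opt - \<delta>" by simp
    qed simp
    finally have "(1 - \<epsilon>) * (real v * real (free_max n) / real n) \<le> real v * ((opt - \<delta>) * real m ^ (v - 1))" .
    then have "real m * real (Q_degree Q H x) < real m * (real v * ((opt - \<delta>) * real m ^ (v - 1)))"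
      by (intro mult_strict_left_mono[OF _ m0] less_le_trans[OF x(2)])
    also have "\<dots> = real v * ((opt - \<delta>) * (real m * real m ^ (v - 1)))" by (simp only: mult_ac)
    also have "\<dots> \<le> real v * real (partite_max m)" unfolding power_v by (rule mult_left_mono[OF am]) simp
    finally have "real (m * Q_degree Q H x) < real (v * partite_max m)" by simp
    then have "m * Q_degree Q H x < v * partite_max m" by (simp only: of_nat_less_iff)
    then have "m * (Q_degree Q H x + partite_max m) < (m + v) * partite_max m" by (simp add: algebra_simps)
    also have "\<dots> \<le> m * partite_max n" using partite_max_growth[OF nm(2)] by (simp only: nm(1))
    finally have "Q_degree Q H x + partite_max m < partite_max n" by simp
    moreover have "free_max n \<le> free_max m + Q_degree Q H x" using free_max_delete_vertex[OF H(1,3) x(1)] H(2,4) by (simp add: m_def)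
    ultimately show ?thesis unfolding m_def[symmetric] by linarith
  qed
  \<comment> \<open>Along the descent the difference grows by at least one in each step. A positive
    difference at \<open>n1 + k\<close> thus gives more than \<open>k\<close> at \<open>n1\<close>,
    which is impossible for \<open>k \<ge> n1 ^ v\<close>.\<close>
  have desc: "partite_max (n1 + k) < free_max (n1 + k) \<longrightarrow> free_max (n1 + k) + k + partite_max n1 \<le> free_max n1 + partite_max (n1 + k)" for k
  proof (induction k)
    case (Suc k)
    show ?case
    proof
      assume "partite_max (n1 + Suc k) < free_max (n1 + Suc k)"
      with step[of "n1 + Suc k"] have s: "free_max (n1 + Suc k) + partite_max (n1 + k) < free_max (n1 + k) + partite_max (n1 + Suc k)" by simp
      then have "partite_max (n1 + k) < free_max (n1 + k)" using \<open>partite_max (n1 + Suc k) < free_max (n1 + Suc k)\<close> by linarith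
      then show "free_max (n1 + Suc k) + Suc k + partite_max n1 \<le> free_max n1 + partite_max (n1 + Suc k)" using Suc s by linarith
    qed
  qed simp
  have bn1: "free_max n1 \<le> n1 ^ v"
  proof -
    obtain H :: "nat hypergraph" where H: "r_graph r H" "card (verts H) = n1" "inj_num Q H = free_max n1"
      by (rule free_max_attained) (rule that)
    then show ?thesis using inj_num_le_power[OF fin r_graphD(1)[OF H(1)]] by simp
  qed
  have "free_max n = partite_max n" if n: "n1 + n1 ^ v \<le> n" for n
  proof (rule ccontr)
    assume ne: "free_max n \<noteq> partite_max n"
    define k where "k = n - n1"
    have k: "n = n1 + k" "n1 ^ v \<le> k" using n by (auto simp: k_def)
    have "partite_max n < free_max n" using ne partite_max_le_free_max[of n] by simp
    then show False using desc[of k] bn1 k by simp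
  qed
  then show ?thesis by blast
qed

end

section \<open>From the hypotheses to a colour pattern\<close>

text \<open>The parts of the shadow become colours. Parts may be empty, so \<open>k\<close> is only
  an upper bound for the number of colours in use; an edge of \<open>Q\<close> provides two vertices
  with different colours.\<close>

lemma complete_partite_pattern:
  fixes Q :: "'q hypergraph"
  assumes Q: "r_graph r Q" and r: "2 \<le> r" and e: "edges Q \<noteq> {}" and k: "complete_partite 2 k (pair_shadow Q)"
  shows "\<exists>pc :: 'q \<Rightarrow> nat.
    (\<forall>u\<in>verts Q. \<forall>w\<in>verts Q. pc u \<noteq> pc w \<longleftrightarrow> u \<noteq> w \<and> (\<exists>e\<in>edges Q. u \<in> e \<and> w \<in> e)) \<and>
    2 \<le> card (pc ` verts Q) \<and> card (pc ` verts Q) \<le> k"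
proof -
  obtain V where V: "parts_of k V (verts Q)"
    "edges (pair_shadow Q) = {e. e \<subseteq> verts Q \<and> card e = 2 \<and> (\<forall>i<k. card (e \<inter> V i) \<le> 1)}"
    using k by (auto simp: complete_partite_def pair_shadow_def)
  obtain pc where pc: "pc \<in> verts Q \<rightarrow> {..<k}" "\<And>i. i < k \<Longrightarrow> V i = {x\<in>verts Q. pc x = i}"
    by (rule parts_of_colouring[OF V(1)]) (rule that)
  have adj: "pc u \<noteq> pc w \<longleftrightarrow> u \<noteq> w \<and> (\<exists>e\<in>edges Q. u \<in> e \<and> w \<in> e)" if uw: "u \<in> verts Q" "w \<in> verts Q" for u w
  proof (cases "u = w")
    case False
    have "(\<exists>e\<in>edges Q. u \<in> e \<and> w \<in> e) \<longleftrightarrow> {u, w} \<in> edges (pair_shadow Q)"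
      using False by (simp add: pair_shadow_def)
    also have "\<dots> \<longleftrightarrow> (\<forall>i<k. card ({u, w} \<inter> V i) \<le> 1)" using V(2) uw False by simp
    also have "\<dots> \<longleftrightarrow> (\<forall>i<k. card ({u, w} \<inter> {x\<in>verts Q. pc x = i}) \<le> 1)" using pc(2) by auto
    also have "\<dots> \<longleftrightarrow> inj_on pc {u, w}" by (rule inj_on_colour_classes[OF _ _ pc(1), symmetric]) (use uw in auto)
    also have "\<dots> \<longleftrightarrow> pc u \<noteq> pc w" using False by auto
    finally show ?thesis using False by blast
  qed simp
  have fin: "finite (verts Q)" by (rule r_graphD(1)[OF Q])
  have "2 \<le> card (pc ` verts Q)"
  proof -
    obtain f where f: "f \<in> edges Q" using e by blast
    have fQ: "f \<subseteq> verts Q" "card f = r" using r_graphD(2,3)[OF Q f] by auto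
    obtain A where "A \<subseteq> f" "card A = 2" using obtain_subset_with_card_n[of 2 f] r fQ(2) by metis
    then obtain u w where uw: "u \<in> f" "w \<in> f" "u \<noteq> w" by (auto simp: card_2_iff)
    then have "pc u \<noteq> pc w" using adj[of u w] f fQ(1) by blast
    moreover have "{pc u, pc w} \<subseteq> pc ` verts Q" using uw fQ(1) by blast
    then have "card {pc u, pc w} \<le> card (pc ` verts Q)" by (rule card_mono[rotated]) (use fin in simp)
    ultimately show ?thesis by simp
  qed
  moreover have "card (pc ` verts Q) \<le> card {..<k}" by (rule card_mono) (use pc(1) in auto)
  ultimately show ?thesis using adj by (intro exI[of _ pc]) simp
qed

theorem theorem2p5:
  fixes l k r :: nat
    and Q :: "'q hypergraph"
    and F :: "'f hypergraph"
  assumes "2 \<le> r" and "r \<le> k" and "k \<le> l"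
    and "r_graph r Q" and "edges Q \<noteq> {}"
    and "complete_partite 2 k (pair_shadow Q)"
    and "r_graph 2 F" and "edge_critical F" and "chromatic_number F = l + 1"
  shows "\<exists>\<epsilon>::real. \<epsilon> > 0 \<and> (\<exists>N0::nat. N0 > 0 \<and> (\<forall>n\<ge>N0.
    (\<forall>H :: nat hypergraph.
       r_graph r H \<and> card (verts H) = n \<and> free_of {expansion r F} H \<and>
       real (min_Q_degree Q H) \<ge>
         (1 - \<epsilon>) * (real (card (verts Q)) * real (max_inj r n Q {expansion r F}) / real n)
       \<longrightarrow> partite l H) \<and>
    (\<exists>G :: nat hypergraph.
       r_graph r G \<and> card (verts G) = n \<and> complete_partite r l G \<and>
       max_inj r n Q {expansion r F} = inj_num Q G)))"
proof -
  obtain pc :: "'q \<Rightarrow> nat" where pc: "\<forall>u\<in>verts Q. \<forall>w\<in>verts Q. pc u \<noteq> pc w \<longleftrightarrow> u \<noteq> w \<and> (\<exists>e\<in>edges Q. u \<in> e \<and> w \<in> e)"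
    "2 \<le> card (pc ` verts Q)" "card (pc ` verts Q) \<le> k"
    using complete_partite_pattern[OF assms(4,1,5,6)] by (elim exE conjE) (rule that)
  interpret expansion_problem Q pc l r F
    by unfold_locales (use assms pc r_graphD(1)[OF assms(4)] in auto)
  obtain \<epsilon> N1 where \<epsilon>: "\<epsilon> > 0" and st: "\<forall>H :: nat hypergraph. r_graph r H \<longrightarrow> N1 \<le> card (verts H) \<longrightarrow> \<not> contains H (expansion r F) \<longrightarrow>
     (\<forall>x\<in>verts H. real (Q_degree Q H x) \<ge> (1 - \<epsilon>) * (real v * real (free_max (card (verts H))) / real (card (verts H)))) \<longrightarrow> partite l H"
    using relative_degree_stability by (elim exE conjE) (rule that)
  obtain N2 where N2: "\<forall>n\<ge>N2. free_max n = partite_max n" using free_max_eq_partite_max by (elim exE) (rule that)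
  show ?thesis
  proof (intro exI[of _ \<epsilon>] conjI exI[of _ "max (max N1 N2) 1"] allI impI)
    fix n H assume n: "max (max N1 N2) 1 \<le> n"
      and H: "r_graph r (H :: nat hypergraph) \<and> card (verts H) = n \<and> free_of {expansion r F} H \<and>
       real (min_Q_degree Q H) \<ge> (1 - \<epsilon>) * (real v * real (free_max n) / real n)"
    have fV: "finite (verts H)" using H r_graphD(1) by blast
    show "partite l H"
    proof (rule st[rule_format])
      fix x assume "x \<in> verts H"
      then have "min_Q_degree Q H \<le> Q_degree Q H x" unfolding min_Q_degree_def using fV by simp
      then have "real (min_Q_degree Q H) \<le> real (Q_degree Q H x)" by (rule of_nat_mono)
      then show "real (Q_degree Q H x) \<ge> (1 - \<epsilon>) * (real v * real (free_max (card (verts H))) / real (card (verts H)))"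
        using H by simp
    qed (use H n free_iff in auto)
  next
    fix n assume n: "max (max N1 N2) 1 \<le> n"
    \<comment> \<open>For large \<open>n\<close> both maxima agree, so a colouring that attains
      \<open>partite_max n\<close> supplies the required complete partite hypergraph.\<close>
    obtain V :: "nat set" and c where V: "finite V" "card V = n" "c \<in> V \<rightarrow> {..<l}" "inj_num Q (rainbow_graph r V c) = partite_max n"
      by (rule partite_max_attained) (rule that)
    show "\<exists>G :: nat hypergraph. r_graph r G \<and> card (verts G) = n \<and> complete_partite r l G \<and> free_max n = inj_num Q G"
      using r_graph_rainbow_graph[OF V(1)] complete_partite_rainbow_graph[OF V(1,3)] V(2,4) N2 n
      by (intro exI[of _ "rainbow_graph r V c"]) simp
  qed (use \<epsilon> in auto)
qed

end
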